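(* Let $\Omega\subset\mathbf{R}^2$ be a bounded convex open set, let $N\ge1$ and let $S=(x_0,\dots,x_N)\in\Omega^{N+1}$ be $N+1$ distinct points. Let $\eta=\eta(\varepsilon)>0$ satisfy $\eta(\varepsilon)/\varepsilon\to\alpha$ as $\varepsilon\downarrow0$, and assume $\alpha>0$. Let $\mathcal{F}_\varepsilon$ be as in the context. For any family $(\sigma_\varepsilon,\phi_\varepsilon)_{\varepsilon\in(0,1]}$ of $\mathbf{R}^2$-valued measures and $L^1(\Omega)$ functions with $\sup_\varepsilon\mathcal{F}_\varepsilon(\sigma_\varepsilon,\phi_\varepsilon)<+\infty$, there exist a subsequence $\varepsilon_j\downarrow0$ and a measure $\sigma\in\mathcal{M}_S(\overline\Omega)$ such that $\sigma_{\varepsilon_j}\to\sigma$ weakly-$*$ as measures and $\phi_{\varepsilon_j}\to1$ in $L^1(\Omega)$. Moreover $\sigma$ is rectifiable, i.e. $\sigma=U(M,\theta,\xi)$ for some $M,\theta,\xi$.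
   Context: Let $\rho\in C^\infty_c(\mathbf{R}^2,\mathbf{R}_+)$ be a radial mollifier with $\operatorname{supp}\rho\subset B_1(0)$ and $\int\rho=1$; set $\rho_\varepsilon(x)=\varepsilon^{-2}\rho(x/\varepsilon)$. $V_\varepsilon(\Omega)$ is the set of vector fields $\sigma\in L^2(\Omega,\mathbf{R}^2)$ whose weak divergence satisfies $\nabla\cdot\sigma=\big(N\delta_{x_0}-\sum_{j=1}^N\delta_{x_j}\big)\ast\rho_\varepsilon$. $W_\varepsilon(\Omega)=\{\phi\in H^1(\Omega):\eta\le\phi\le1\text{ in }\Omega,\ \phi\equiv1\text{ on }\partial\Omega\}$. The functional $\mathcal{F}_\varepsilon$ on ($\mathbf{R}^2$-valued measures)$\times L^1(\Omega)$ is \[ \mathcal{F}_\varepsilon(\sigma,\phi)=\int_\Omega\frac{1}{2\varepsilon}\phi^2|\sigma|^2\,dx+\int_\Omega\Big(\frac{\varepsilon}{2}|\nabla\phi|^2+\frac{(1-\phi)^2}{2\varepsilon}\Big)dx \] if $(\sigma,\phi)\in V_\varepsilon(\Omega)\times W_\varepsilon(\Omega)$ (identifying $\sigma$ with its density), and $+\infty$ otherwise. A measure $\sigma$ is written $\sigma=U(M,\theta,\xi)$ if $\sigma=\theta\,\xi\,\mathcal{H}^1\llcorner M$ with $M$ a 1-dimensional rectifiable set, $\xi:M\to\mathbf{S}^1$ Borel and $\theta:M\to\mathbf{R}_+$ Borel. $\mathcal{M}_S(\overline\Omega)$ is the set of $\mathbf{R}^2$-valued measures on $\mathbf{R}^2$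 supported in $\overline\Omega$ with $\nabla\cdot\sigma=N\delta_{x_0}-\sum_{i=1}^N\delta_{x_i}$ in $\mathcal{D}'(\mathbf{R}^2)$. Weak-$*$ convergence of measures is against $C(\overline\Omega,\mathbf{R}^2)$. *)

theory Defs
  imports "HOL-Analysis.Analysis"
begin

type_synonym pt = "real^2"

fun Ck :: "nat \<Rightarrow> (pt \<Rightarrow> real) \<Rightarrow> bool" where
  "Ck 0 f = continuous_on UNIV f"
| "Ck (Suc n) f = (f differentiable_on UNIV \<and>
      (\<forall>i. Ck n (\<lambda>x. frechet_derivative f (at x) (axis i 1))))"

definition smooth_fn :: "(pt \<Rightarrow> real) \<Rightarrow> bool" where
  "smooth_fn f \<longleftrightarrow> (\<forall>n. Ck n f)"

definition tsupp :: "(pt \<Rightarrow> real) \<Rightarrow> pt set" where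
  "tsupp f = closure {x. f x \<noteq> 0}"

definition test_fn :: "pt set \<Rightarrow> (pt \<Rightarrow> real) \<Rightarrow> bool" where
  "test_fn U f \<longleftrightarrow> smooth_fn f \<and> compact (tsupp f) \<and> tsupp f \<subseteq> U"

definition grad :: "(pt \<Rightarrow> real) \<Rightarrow> pt \<Rightarrow> real^2" where
  "grad f x = (\<chi> i. frechet_derivative f (at x) (axis i 1))"

definition mollifier :: "(pt \<Rightarrow> real) \<Rightarrow> bool" where
  "mollifier \<rho> \<longleftrightarrow> smooth_fn \<rho> \<and> (\<forall>x. 0 \<le> \<rho> x) \<and> tsupp \<rho> \<subseteq> ball 0 1
     \<and> (\<forall>x y. norm x = norm y \<longrightarrow> \<rho> x = \<rho> y)
     \<and> integrable lborel \<rho> \<and> integral\<^sup>L lborel \<rho> = 1"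

definition moll :: "(pt \<Rightarrow> real) \<Rightarrow> real \<Rightarrow> pt \<Rightarrow> real" where
  "moll \<rho> \<epsilon> x = \<rho> (x /\<^sub>R \<epsilon>) / \<epsilon>\<^sup>2"

text \<open>(N delta_{x_0} - sum_{j=1}^N delta_{x_j}) * rho_eps, as a function.\<close>
definition src :: "(pt \<Rightarrow> real) \<Rightarrow> nat \<Rightarrow> (nat \<Rightarrow> pt) \<Rightarrow> real \<Rightarrow> pt \<Rightarrow> real" where
  "src \<rho> N xs \<epsilon> y = real N * moll \<rho> \<epsilon> (y - xs 0) - (\<Sum>j\<in>{1..N}. moll \<rho> \<epsilon> (y - xs j))"

definition L2_on :: "pt set \<Rightarrow> (pt \<Rightarrow> 'b::euclidean_space) \<Rightarrow> bool" where
  "L2_on U f \<longleftrightarrow> set_borel_measurable lborel U f \<and>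
     (\<integral>\<^sup>+ x. indicator U x * ennreal ((norm (f x))\<^sup>2) \<partial>lborel) < \<infinity>"

definition weak_grad :: "pt set \<Rightarrow> (pt \<Rightarrow> real) \<Rightarrow> (pt \<Rightarrow> real^2) \<Rightarrow> bool" where
  "weak_grad U u G \<longleftrightarrow> (\<forall>\<psi>. test_fn U \<psi> \<longrightarrow> (\<forall>i.
      set_lebesgue_integral lborel U (\<lambda>x. u x * (grad \<psi> x $ i))
      = - set_lebesgue_integral lborel U (\<lambda>x. (G x $ i) * \<psi> x)))"

definition H1_on :: "pt set \<Rightarrow> (pt \<Rightarrow> real) \<Rightarrow> bool" where
  "H1_on U u \<longleftrightarrow> L2_on U u \<and> (\<exists>G. L2_on U G \<and> weak_grad U u G)"

definition wgrad :: "pt set \<Rightarrow> (pt \<Rightarrow> real) \<Rightarrow> pt \<Rightarrow> real^2" where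
  "wgrad U u = (SOME G. L2_on U G \<and> weak_grad U u G)"

definition H10_on :: "pt set \<Rightarrow> (pt \<Rightarrow> real) \<Rightarrow> bool" where
  "H10_on U u \<longleftrightarrow> H1_on U u \<and> (\<exists>\<psi>s. (\<forall>n. test_fn U (\<psi>s n)) \<and>
      (\<lambda>n. \<integral>\<^sup>+ x. indicator U x * ennreal ((\<psi>s n x - u x)\<^sup>2 + (norm (grad (\<psi>s n) x - wgrad U u x))\<^sup>2)
             \<partial>lborel) \<longlonglongrightarrow> 0)"

text \<open>An R^2-valued (finite) Borel measure on R^2 is represented by a pair (mu, g) of a finite
  positive Borel measure mu and a mu-integrable density g; it is the set function
  A \<mapsto> int_A g dmu.  (Every R^2-valued measure has such a representation, e.g. the polar one.)\<close>
type_synonym vmeas = "pt measure \<times> (pt \<Rightarrow> real^2)"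

definition is_vmeasure :: "vmeas \<Rightarrow> bool" where
  "is_vmeasure \<sigma> \<longleftrightarrow> finite_measure (fst \<sigma>) \<and> sets (fst \<sigma>) = sets borel \<and> integrable (fst \<sigma>) (snd \<sigma>)"

definition vm_val :: "vmeas \<Rightarrow> pt set \<Rightarrow> real^2" where
  "vm_val \<sigma> A = set_lebesgue_integral (fst \<sigma>) A (snd \<sigma>)"

definition vm_int :: "vmeas \<Rightarrow> pt set \<Rightarrow> (pt \<Rightarrow> real^2) \<Rightarrow> real" where
  "vm_int \<sigma> A f = set_lebesgue_integral (fst \<sigma>) A (\<lambda>x. f x \<bullet> snd \<sigma> x)"

definition vm_supported_in :: "vmeas \<Rightarrow> pt set \<Rightarrow> bool" where
  "vm_supported_in \<sigma> K \<longleftrightarrow> (\<forall>A\<in>sets borel. A \<inter> K = {} \<longrightarrow> vm_val \<sigma> A = 0)"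

definition vm_density_on :: "vmeas \<Rightarrow> pt set \<Rightarrow> (pt \<Rightarrow> real^2) \<Rightarrow> bool" where
  "vm_density_on \<sigma> U s \<longleftrightarrow> (\<forall>A\<in>sets borel. vm_val \<sigma> A = set_lebesgue_integral lborel (A \<inter> U) s)"

text \<open>weak-* convergence against C(closure Omega, R^2) (all measures supported in closure Omega)\<close>
definition weak_star_conv :: "pt set \<Rightarrow> (nat \<Rightarrow> vmeas) \<Rightarrow> vmeas \<Rightarrow> bool" where
  "weak_star_conv \<Omega> \<sigma>s \<sigma> \<longleftrightarrow> (\<forall>f::pt \<Rightarrow> real^2. continuous_on (closure \<Omega>) f \<longrightarrow>
      (\<lambda>j. vm_int (\<sigma>s j) (closure \<Omega>) f) \<longlonglongrightarrow> vm_int \<sigma> (closure \<Omega>) f)"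

definition in_V :: "(pt \<Rightarrow> real) \<Rightarrow> nat \<Rightarrow> (nat \<Rightarrow> pt) \<Rightarrow> pt set \<Rightarrow> real \<Rightarrow> vmeas \<Rightarrow> bool" where
  "in_V \<rho> N xs \<Omega> \<epsilon> \<sigma> \<longleftrightarrow> is_vmeasure \<sigma> \<and> (\<exists>s. L2_on \<Omega> s \<and> vm_density_on \<sigma> \<Omega> s) \<and>
     (\<forall>\<psi>. test_fn UNIV \<psi> \<longrightarrow>
        - vm_int \<sigma> UNIV (grad \<psi>) = integral\<^sup>L lborel (\<lambda>y. src \<rho> N xs \<epsilon> y * \<psi> y))"

definition dens :: "vmeas \<Rightarrow> pt set \<Rightarrow> pt \<Rightarrow> real^2" where
  "dens \<sigma> \<Omega> = (SOME s. L2_on \<Omega> s \<and> vm_density_on \<sigma> \<Omega> s)"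

definition in_W :: "pt set \<Rightarrow> real \<Rightarrow> (pt \<Rightarrow> real) \<Rightarrow> bool" where
  "in_W \<Omega> \<eta> \<phi> \<longleftrightarrow> H1_on \<Omega> \<phi> \<and> (AE x in lborel. x \<in> \<Omega> \<longrightarrow> \<eta> \<le> \<phi> x \<and> \<phi> x \<le> 1)
     \<and> H10_on \<Omega> (\<lambda>x. \<phi> x - 1)"

definition Feps :: "(pt \<Rightarrow> real) \<Rightarrow> nat \<Rightarrow> (nat \<Rightarrow> pt) \<Rightarrow> pt set \<Rightarrow> real \<Rightarrow> real
     \<Rightarrow> vmeas \<Rightarrow> (pt \<Rightarrow> real) \<Rightarrow> ennreal" where
  "Feps \<rho> N xs \<Omega> \<eta> \<epsilon> \<sigma> \<phi> =
    (if in_V \<rho> N xs \<Omega> \<epsilon> \<sigma> \<and> in_W \<Omega> \<eta> \<phi> then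
       (\<integral>\<^sup>+ x. indicator \<Omega> x * ennreal (
           (\<phi> x)\<^sup>2 * (norm (dens \<sigma> \<Omega> x))\<^sup>2 / (2 * \<epsilon>)
         + \<epsilon> / 2 * (norm (wgrad \<Omega> \<phi> x))\<^sup>2 + (1 - \<phi> x)\<^sup>2 / (2 * \<epsilon>)) \<partial>lborel)
     else \<infinity>)"

definition in_MS :: "pt set \<Rightarrow> nat \<Rightarrow> (nat \<Rightarrow> pt) \<Rightarrow> vmeas \<Rightarrow> bool" where
  "in_MS \<Omega> N xs \<sigma> \<longleftrightarrow> is_vmeasure \<sigma> \<and> vm_supported_in \<sigma> (closure \<Omega>) \<and>
     (\<forall>\<psi>. test_fn UNIV \<psi> \<longrightarrow>
        - vm_int \<sigma> UNIV (grad \<psi>) = real N * \<psi> (xs 0) - (\<Sum>i\<in>{1..N}. \<psi> (xs i)))"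

text \<open>One-dimensional Hausdorff measure (normalized so that it agrees with length).\<close>
definition H1_delta :: "real \<Rightarrow> pt set \<Rightarrow> ennreal" where
  "H1_delta \<delta> A = (INF C \<in> {C :: nat \<Rightarrow> pt set. A \<subseteq> (\<Union>i. C i) \<and>
       (\<forall>i. bounded (C i) \<and> diameter (C i) \<le> \<delta>)}. (\<Sum>i. ennreal (diameter (C i))))"

definition H1 :: "pt set \<Rightarrow> ennreal" where
  "H1 A = (SUP \<delta>\<in>{0<..}. H1_delta \<delta> A)"

definition H1_meas :: "pt measure" where
  "H1_meas = measure_of UNIV (sets borel) H1"

definition rectifiable1 :: "pt set \<Rightarrow> bool" where
  "rectifiable1 M \<longleftrightarrow> (\<exists>N0 (f :: nat \<Rightarrow> real \<Rightarrow> pt). H1 N0 = 0 \<and>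
      (\<forall>i. \<exists>L. L-lipschitz_on UNIV (f i)) \<and> M \<subseteq> N0 \<union> (\<Union>i. range (f i)))"

definition is_U :: "vmeas \<Rightarrow> pt set \<Rightarrow> (pt \<Rightarrow> real) \<Rightarrow> (pt \<Rightarrow> real^2) \<Rightarrow> bool" where
  "is_U \<sigma> M \<theta> \<xi> \<longleftrightarrow> rectifiable1 M \<and> M \<in> sets borel \<and>
     \<theta> \<in> borel_measurable borel \<and> \<xi> \<in> borel_measurable borel \<and>
     (\<forall>x\<in>M. 0 \<le> \<theta> x \<and> norm (\<xi> x) = 1) \<and>
     set_integrable H1_meas M (\<lambda>x. \<theta> x *\<^sub>R \<xi> x) \<and>
     (\<forall>A\<in>sets borel. vm_val \<sigma> A = set_lebesgue_integral H1_meas (A \<inter> M) (\<lambda>x. \<theta> x *\<^sub>R \<xi> x))"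

end

theory Submission
  imports Defs "HOL-Probability.Probability"
begin

text \<open>
  Where \<open>\<phi> \<ge> 1/2\<close> the energy controls \<open>\<bar>\<sigma>\<bar>\<close> with a small factor \<open>\<surd>\<epsilon>\<close>, and elsewhere \<open>\<phi> \<ge> \<eta> \<ge> a\<epsilon>\<close> together
  with the well \<open>(1 - \<phi>)\<^sup>2 / 2\<epsilon>\<close> bounds \<open>\<bar>\<sigma>\<bar>\<close> by a multiple of the energy density; hence the masses are bounded
  and a subsequence converges. Compactness of measures on the plane is reduced to Helly's selection theorem
  on the line by a space filling curve.

  For rectifiability, cut the plane by the lines on which one coordinate equals \<open>t\<close>. For almost every \<open>t\<close> the
  one-dimensional Modica--Mortola energy of the slice of \<open>\<phi>\<close> is bounded along a subsequence, so \<open>\<phi> < 3/4\<close> only near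
  boundedly many points, and \<open>\<sigma>\<close> is small elsewhere: the limit flux through the line is a finite sum
  of atoms. The divergence constraint makes the slices Lipschitz in \<open>t\<close> after reparametrising by
  \<open>t\<close> plus the transported mass to the left of \<open>t\<close>. Isolating one atom by a bump function supported in a rational
  interval, its position is a quotient of such slices; so all atoms lie on countably many
  Lipschitz curves. The coordinate of \<open>\<sigma>\<close> normal to the lines then vanishes on every set whose
  intersection with these curves has null projection, in particular if that intersection
  is \<open>H1\<close>-null. Doing this for both coordinates, Radon--Nikodym with respect to
  \<open>H1\<close> on the curves gives the representation.
\<close>

section \<open>Weak compactness of measures\<close>

text \<open>Two obstacles shape the argument. As functions of \<open>t\<close> the limit slices are
  only of bounded variation, because \<open>mu\<close> may charge whole lines; therefore the
  parameter \<open>arc\<close> jumps wherever they may jump, and the curves are filled in over the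
  gaps of its range by Lipschitz extension. Moreover \<phi> is only an H1 function. The definition
  of \<open>H10_on\<close> supplies test functions \<psi> close to \<phi> - 1, and all slicing is
  done with 1 + \<psi>: its slices are C1 on entire lines, so neither absolute continuity on lines
  nor the boundary of \<Omega> enters. The threshold is 1/2 for \<phi> and 3/4 for 1 + \<psi>; in
  the gap of 1/4 the approximation error itself pays for the points where the two disagree. The
  mollified source runs through the compactness argument as a third density beside the two
  components of \<sigma>. In this way the divergence identity on a half plane survives in the limit
  whenever the bounding line is not charged. The lines on which one coordinate is constant see only
  that component of \<sigma>, hence two directions.\<close>

definition schoenberg_wave :: "real \<Rightarrow> real" where
  "schoenberg_wave u = max 0 (min 1 (1/2 - cos (pi * u)))"

lemma schoenberg_wave_bounds: "0 \<le> schoenberg_wave u" "schoenberg_wave u \<le> 1"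
  by (auto simp: schoenberg_wave_def)

text \<open>Since cos (pi u) is at least 1/2 for u within 1/3 of an even integer and at most -1/2
  within 1/3 of an odd one, clipping makes the wave exactly 0 or 1 there. \<open>e\<close> is half a
  ternary digit, \<open>r\<close> the tail of the expansion, and the even integer collects the
  earlier digits.\<close>

lemma schoenberg_wave_digit:
  fixes m :: int and e r :: real
  assumes e: "e = 0 \<or> e = 1" and r: "0 \<le> r" "r \<le> 1/3"
  shows "schoenberg_wave (2 * of_int m + 2 * e / 3 + r) = e"
proof -
  have per: "cos (pi * (2 * of_int m + 2 * e / 3 + r)) = cos (pi * (2 * e / 3 + r))"
  proof -
    have "pi * (2 * of_int m + 2 * e / 3 + r) = pi * (2 * e / 3 + r) + 2 * pi * of_int m"
      by (simp add: algebra_simps)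
    then show ?thesis
      by (metis cos.periodic_simps(1) cos_int_2pin cos_add sin_int_2pin mult_1_right mult_zero_right diff_zero)
  qed
  show ?thesis
  proof (cases "e = 0")
    case True
    have "cos (pi / 3) \<le> cos (pi * r)"
      using r by (intro cos_monotone_0_pi_le) (auto simp: field_simps)
    then show ?thesis using True per by (simp add: schoenberg_wave_def cos_60)
  next
    case False
    then have e1: "e = 1" using e by simp
    have "cos (pi * (2/3 + r)) = - cos (pi - pi * (2/3 + r))"
      by (simp add: cos_diff)
    moreover have "cos (pi/3) \<le> cos (pi - pi * (2/3 + r))"
      using r by (intro cos_monotone_0_pi_le) (auto simp: field_simps)
    ultimately show ?thesis using e1 per by (simp add: schoenberg_wave_def cos_60)
  qed
qed

text \<open>Schoenberg's plane filling curve: at a point of the Cantor set the wave reads every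
  second ternary digit, halved, and the series reuses these as binary digits. \<open>c\<close> is
  the parity of the positions read. Continuity comes from uniform convergence.\<close>

definition schoenberg_coord :: "nat \<Rightarrow> real \<Rightarrow> real" where
  "schoenberg_coord c t = (\<Sum>k. schoenberg_wave (3 ^ (2 * k + c) * t) / 2 ^ (Suc k))"

lemma continuous_schoenberg_coord: "continuous_on UNIV (schoenberg_coord c)"
proof -
  have "uniform_limit UNIV (\<lambda>n t. \<Sum>k<n. schoenberg_wave (3 ^ (2 * k + c) * t) / 2 ^ (Suc k))
     (\<lambda>t. \<Sum>k. schoenberg_wave (3 ^ (2 * k + c) * t) / 2 ^ (Suc k)) sequentially"
  proof (rule Weierstrass_m_test)
    show "norm (schoenberg_wave (3 ^ (2 * k + c) * t) / 2 ^ (Suc k)) \<le> (1/2) ^ k" for k t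
      using schoenberg_wave_bounds[of "3 ^ (2 * k + c) * t"] by (simp add: field_simps)
    show "summable (\<lambda>k. (1/2::real) ^ k)" by (rule summable_geometric) simp
  qed
  moreover have "\<forall>\<^sub>F n in sequentially. continuous_on UNIV
      (\<lambda>t. \<Sum>k<n. schoenberg_wave (3 ^ (2 * k + c) * t) / 2 ^ (Suc k))"
    unfolding schoenberg_wave_def by (intro always_eventually allI continuous_intros) auto
  ultimately show ?thesis
    unfolding schoenberg_coord_def [abs_def] by (intro uniform_limit_theorem) auto
qed

text \<open>The floor formula is visibly Borel in \<open>x\<close>, which makes the inverse of the
  curve measurable; at dyadic numbers it picks the terminating expansion.\<close>

definition binary_digit :: "real \<Rightarrow> nat \<Rightarrow> real" where
  "binary_digit x k = of_int (\<lfloor>2 ^ Suc k * x\<rfloor> - 2 * \<lfloor>2 ^ k * x\<rfloor>)"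

lemma binary_digit_cases: "binary_digit x k = 0 \<or> binary_digit x k = 1"
proof -
  define y where "y = 2 ^ k * x"
  have "\<lfloor>2 * y\<rfloor> - 2 * \<lfloor>y\<rfloor> = 0 \<or> \<lfloor>2 * y\<rfloor> - 2 * \<lfloor>y\<rfloor> = 1" by linarith
  then show ?thesis unfolding binary_digit_def y_def by (auto simp: mult.assoc)
qed

lemma binary_digit_measurable [measurable]: "(\<lambda>x. binary_digit x k) \<in> borel_measurable borel"
  unfolding binary_digit_def by measurable

lemma binary_digit_sums:
  assumes "0 \<le> x" "x < 1"
  shows "(\<lambda>k. binary_digit x k / 2 ^ Suc k) sums x"
proof -
  have part: "(\<Sum>k<n. binary_digit x k / 2 ^ Suc k) = of_int \<lfloor>2 ^ n * x\<rfloor> / 2 ^ n" for n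
  proof (induction n)
    case 0
    have "\<lfloor>x\<rfloor> = 0" using assms by linarith
    then show ?case by simp
  next
    case (Suc n)
    then show ?case by (simp add: binary_digit_def field_simps)
  qed
  have "(\<lambda>n. of_int \<lfloor>2 ^ n * x\<rfloor> / 2 ^ n) \<longlonglongrightarrow> x"
  proof (rule tendsto_sandwich)
    show "\<forall>\<^sub>F n in sequentially. x - (1/2) ^ n \<le> of_int \<lfloor>2 ^ n * x\<rfloor> / 2 ^ n"
    proof (intro always_eventually allI)
      fix n
      have "2 ^ n * x - 1 \<le> of_int \<lfloor>2 ^ n * x\<rfloor>" by linarith
      then have "(2 ^ n * x - 1) / 2 ^ n \<le> of_int \<lfloor>2 ^ n * x\<rfloor> / 2 ^ n"
        by (intro divide_right_mono) auto
      moreover have "(2 ^ n * x - 1) / 2 ^ n = x - (1/2) ^ n"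
        by (simp add: diff_divide_distrib power_one_over)
      ultimately show "x - (1/2) ^ n \<le> of_int \<lfloor>2 ^ n * x\<rfloor> / 2 ^ n" by simp
    qed
    show "\<forall>\<^sub>F n in sequentially. of_int \<lfloor>2 ^ n * x\<rfloor> / 2 ^ n \<le> x"
    proof (intro always_eventually allI)
      fix n
      have "of_int \<lfloor>2 ^ n * x\<rfloor> \<le> 2 ^ n * x" by linarith
      then show "of_int \<lfloor>2 ^ n * x\<rfloor> / 2 ^ n \<le> x"
        by (simp add: field_simps)
    qed
    have "(\<lambda>n. x - (1/2) ^ n) \<longlonglongrightarrow> x - 0"
      by (intro tendsto_intros LIMSEQ_power_zero) simp
    then show "(\<lambda>n. x - (1/2) ^ n) \<longlonglongrightarrow> x" by simp
  qed auto
  then show ?thesis unfolding sums_def part .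
qed

text \<open>For a sequence of zeros and ones, the point of the Cantor set with ternary digits 2 *
  \<open>e k\<close>.\<close>

definition ternary_code :: "(nat \<Rightarrow> real) \<Rightarrow> real" where
  "ternary_code e = (\<Sum>k. 2 * e k / 3 ^ Suc k)"

lemma ternary_geometric_sums: "(\<lambda>k. 2 / 3 ^ Suc k :: real) sums 1"
proof -
  have "(\<lambda>k. (2/3) * (1/3) ^ k :: real) sums ((2/3) * (1 / (1 - 1/3)))"
    by (intro sums_mult geometric_sums) simp
  then show ?thesis by (simp add: power_one_over field_simps)
qed

lemma ternary_code_summable:
  assumes "\<And>k. e k = 0 \<or> e k = 1"
  shows "summable (\<lambda>k. 2 * e k / 3 ^ Suc k :: real)"
proof (rule summable_comparison_test')
  show "summable (\<lambda>k. 2 / 3 ^ Suc k :: real)" using ternary_geometric_sums by (rule sums_summable)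
  show "norm (2 * e k / 3 ^ Suc k) \<le> 2 / 3 ^ Suc k" if "0 \<le> k" for k
    using assms[of k] by auto
qed

lemma ternary_code_bounds:
  assumes "\<And>k. e k = 0 \<or> e k = 1"
  shows "0 \<le> ternary_code e" "ternary_code e \<le> 1"
proof -
  have nn: "0 \<le> 2 * e k / 3 ^ Suc k" "2 * e k / 3 ^ Suc k \<le> 2 / 3 ^ Suc k" for k
    using assms[of k] by auto
  show "0 \<le> ternary_code e" unfolding ternary_code_def
    using ternary_code_summable[OF assms] nn by (intro suminf_nonneg) auto
  have "ternary_code e \<le> (\<Sum>k. 2 / 3 ^ Suc k)" unfolding ternary_code_def
    using ternary_code_summable[OF assms] nn sums_summable[OF ternary_geometric_sums]
    by (intro suminf_le) auto
  then show "ternary_code e \<le> 1" using sums_unique[OF ternary_geometric_sums] by simp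
qed

lemma ternary_code_rec:
  assumes "\<And>k. e k = 0 \<or> e k = 1"
  shows "3 * ternary_code e = 2 * e 0 + ternary_code (\<lambda>k. e (Suc k))"
proof -
  have "ternary_code e = (\<Sum>k. 2 * e (Suc k) / 3 ^ Suc (Suc k)) + 2 * e 0 / 3"
    using suminf_split_head[OF ternary_code_summable[of e, OF assms]] by (simp add: ternary_code_def)
  also have "(\<Sum>k. 2 * e (Suc k) / 3 ^ Suc (Suc k)) = (\<Sum>k. (1/3) * (2 * e (Suc k) / 3 ^ Suc k))"
    by (simp add: field_simps)
  also have "\<dots> = (1/3) * ternary_code (\<lambda>k. e (Suc k))"
    unfolding ternary_code_def using assms by (intro suminf_mult ternary_code_summable) auto
  finally show ?thesis by (simp add: field_simps)
qed

text \<open>Each multiplication by 3 moves a digit 0 or 2 in front of the point. What stands in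
  front is therefore even and disappears by the period 2 of the wave.\<close>

lemma ternary_code_shift:
  assumes "\<And>k. e k = 0 \<or> e k = 1"
  shows "\<exists>m::int. 3 ^ n * ternary_code e = 2 * of_int m + ternary_code (\<lambda>k. e (k + n))"
  using assms
proof (induction n arbitrary: e)
  case 0
  show ?case by (intro exI[of _ 0]) simp
next
  case (Suc n)
  obtain m :: int where m: "3 ^ n * ternary_code e = 2 * of_int m + ternary_code (\<lambda>k. e (k + n))"
    using Suc.IH[of e] Suc.prems by blast
  have r: "3 * ternary_code (\<lambda>k. e (k + n)) = 2 * e n + ternary_code (\<lambda>k. e (k + Suc n))"
    using ternary_code_rec[of "\<lambda>k. e (k + n)"] Suc.prems by simp
  have "3 ^ Suc n * ternary_code e = 3 * (3 ^ n * ternary_code e)" by simp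
  also have "\<dots> = 6 * of_int m + 2 * e n + ternary_code (\<lambda>k. e (k + Suc n))"
    unfolding m using r by simp
  finally have *: "3 ^ Suc n * ternary_code e = 6 * of_int m + 2 * e n + ternary_code (\<lambda>k. e (k + Suc n))" .
  show ?case
    using Suc.prems[of n]
  proof
    assume "e n = 0" then show ?thesis using * by (intro exI[of _ "3 * m"]) simp
  next
    assume "e n = 1" then show ?thesis using * by (intro exI[of _ "3 * m + 1"]) simp
  qed
qed

lemma schoenberg_wave_ternary_code:
  assumes "\<And>k. e k = 0 \<or> e k = 1"
  shows "schoenberg_wave (3 ^ n * ternary_code e) = e n"
proof -
  obtain m :: int where m: "3 ^ n * ternary_code e = 2 * of_int m + ternary_code (\<lambda>k. e (k + n))"
    using ternary_code_shift[of e n, OF assms] by blast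
  define r where "r = ternary_code (\<lambda>k. e (Suc k + n)) / 3"
  have "ternary_code (\<lambda>k. e (k + n)) = 2 * e n / 3 + r"
    using ternary_code_rec[of "\<lambda>k. e (k + n)"] assms by (simp add: r_def)
  moreover have "0 \<le> r" "r \<le> 1/3"
    unfolding r_def using ternary_code_bounds[of "\<lambda>k. e (Suc k + n)"] assms by auto
  ultimately show ?thesis
    using schoenberg_wave_digit[OF assms[of n], of r m] m by (simp add: add.assoc)
qed

text \<open>A measurable right inverse \<open>s\<close> is all that is needed: a measure on the
  square is pushed to the line by \<open>s\<close> and returns by \<open>p\<close>, and a continuous
  test function on the square becomes, composed with \<open>p\<close>, a continuous one on the line.
  The square is half open because the floor digits do not represent 1.\<close>

lemma space_filling_curve:
  obtains p :: "real \<Rightarrow> real^2" and s :: "real^2 \<Rightarrow> real"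
  where "continuous_on UNIV p" "s \<in> borel_measurable borel" "\<And>x. s x \<in> {0..1}"
    "\<And>x. (\<And>i. 0 \<le> x $ i \<and> x $ i < 1) \<Longrightarrow> p (s x) = x"
proof -
  define p :: "real \<Rightarrow> real^2" where "p t = vector [schoenberg_coord 0 t, schoenberg_coord 1 t]" for t
  define e :: "real^2 \<Rightarrow> nat \<Rightarrow> real" where
    "e x k = (if even k then binary_digit (x $ 1) (k div 2) else binary_digit (x $ 2) (k div 2))" for x k
  define s where "s x = ternary_code (e x)" for x
  have e01: "e x k = 0 \<or> e x k = 1" for x k
    using binary_digit_cases by (auto simp: e_def)
  have "continuous_on UNIV p"
  proof -
    have "continuous_on UNIV (\<lambda>t. p t $ i)" for i
      using continuous_schoenberg_coord exhaust_2[of i] by (auto simp: p_def)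
    then show ?thesis
      using continuous_on_vec_lambda[of UNIV "\<lambda>i t. p t $ i"] by (simp add: vec_lambda_eta)
  qed
  moreover have "s \<in> borel_measurable borel"
    unfolding s_def ternary_code_def e_def
    by (intro borel_measurable_suminf borel_measurable_divide borel_measurable_times) auto
  moreover have "s x \<in> {0..1}" for x
    using ternary_code_bounds[of "e x"] e01 by (auto simp: s_def)
  moreover have "p (s x) = x" if x: "\<And>i. 0 \<le> x $ i \<and> x $ i < 1" for x
  proof -
    have "schoenberg_coord 0 (s x) = x $ 1"
      using sums_unique[OF binary_digit_sums[of "x $ 1"]] x[of 1]
      unfolding schoenberg_coord_def s_def by (simp add: schoenberg_wave_ternary_code e01) (simp add: e_def)
    moreover have "schoenberg_coord 1 (s x) = x $ 2"
      using sums_unique[OF binary_digit_sums[of "x $ 2"]] x[of 2]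
      unfolding schoenberg_coord_def s_def
      by (simp only: schoenberg_wave_ternary_code e01) (simp add: e_def)
    ultimately show ?thesis by (simp add: p_def vec_eq_iff forall_2)
  qed
  ultimately show ?thesis by (rule that)
qed

section \<open>Weak limits of nonnegative densities\<close>

lemma weak_compactness_nonneg:
  fixes K :: "pt set" and p :: "nat \<Rightarrow> pt \<Rightarrow> real"
  assumes K: "compact K" "convex K" "K \<noteq> {}"
    and nn: "\<And>j x. 0 \<le> p j x" and int: "\<And>j. integrable lborel (p j)"
    and supp: "\<And>j x. p j x \<noteq> 0 \<Longrightarrow> x \<in> K"
    and bound: "\<And>j. integral\<^sup>L lborel (p j) \<le> C"
  obtains r mu where "strict_mono (r :: nat \<Rightarrow> nat)" "finite_measure mu" "sets mu = sets borel"
    "AE x in mu. x \<in> K"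
    "\<And>\<psi>. continuous_on UNIV \<psi> \<Longrightarrow>
      (\<lambda>j. \<integral>x. \<psi> x * p (r j) x \<partial>lborel) \<longlonglongrightarrow> (\<integral>x. \<psi> x \<partial>mu)"
proof -
  obtain p0 :: "real \<Rightarrow> real^2" and s0 :: "real^2 \<Rightarrow> real" where ps:
    "continuous_on UNIV p0" "s0 \<in> borel_measurable borel" "\<And>x. s0 x \<in> {0..1}"
    "\<And>x. (\<And>i. 0 \<le> x $ i \<and> x $ i < 1) \<Longrightarrow> p0 (s0 x) = x"
    using space_filling_curve by metis
  obtain R where R: "0 < R" "\<And>x. x \<in> K \<Longrightarrow> norm x < R"
    using compact_imp_bounded[OF K(1)] unfolding bounded_pos_less by auto
  \<comment> \<open>\<open>P\<close> carries the unit square to the box of side 2 \<open>R\<close>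
    around the origin and \<open>S\<close> goes back. The projection in \<open>q\<close> keeps the
    curve inside \<open>K\<close> even at parameters that code no point of \<open>K\<close>, so the
    limit cannot leave \<open>K\<close>.\<close>
  define P where "P t = (2 * R) *\<^sub>R p0 t - (\<chi> i. R)" for t
  define S where "S x = s0 ((1 / (2 * R)) *\<^sub>R (x + (\<chi> i. R)))" for x
  define q where "q t = closest_point K (P t)" for t
  have PS: "P (S x) = x" if "x \<in> K" for x
  proof -
    have "0 \<le> ((1 / (2 * R)) *\<^sub>R (x + (\<chi> i. R))) $ i \<and> ((1 / (2 * R)) *\<^sub>R (x + (\<chi> i. R))) $ i < 1" for i
      using R(2)[OF that] component_le_norm_cart[of x i] \<open>0 < R\<close> by (simp add: field_simps) linarith
    then have "p0 (S x) = (1 / (2 * R)) *\<^sub>R (x + (\<chi> i. R))"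
      unfolding S_def by (rule ps(4))
    then show ?thesis using \<open>0 < R\<close> by (simp add: P_def)
  qed
  have qS: "q (S x) = x" if "x \<in> K" for x
    using PS[OF that] that by (simp add: q_def closest_point_self)
  have qK: "q t \<in> K" for t
    unfolding q_def using K by (intro closest_point_in_set compact_imp_closed) auto
  have contq: "continuous_on UNIV q"
  proof -
    have "continuous_on UNIV P" unfolding P_def by (intro continuous_intros ps(1))
    then show ?thesis unfolding q_def[abs_def]
      using continuous_on_compose[of UNIV P "closest_point K"]
        continuous_on_closest_point[of K "range P"] K by (auto simp: o_def compact_imp_closed)
  qed
  have [measurable]: "q \<in> borel_measurable borel" by (intro borel_measurable_continuous_onI contq)
  have [measurable]: "S \<in> borel_measurable borel"
    unfolding S_def[abs_def] using ps(2) by (intro measurable_compose[OF _ ps(2)]) simp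
  have S01: "S x \<in> {0..1}" for x unfolding S_def by (rule ps(3))
  have [measurable]: "p j \<in> borel_measurable lborel" for j using int by blast
  have [measurable]: "p j \<in> borel_measurable borel" for j using int by simp
  define m where "m j = integral\<^sup>L lborel (p j)" for j
  have m0: "0 \<le> m j" for j unfolding m_def by (intro Bochner_Integration.integral_nonneg) (simp add: nn)
  define D where "D j = density lborel (\<lambda>x. ennreal (p j x / m j))" for j
  \<comment> \<open>A density of mass zero cannot be normalised; the point mass at 0 is a
    placeholder that is later multiplied by \<open>m j\<close> = 0.\<close>
  define \<nu> where "\<nu> j = (if m j > 0 then distr (D j) borel S else return borel 0)" for j
  have D: "prob_space (D j)" if "m j > 0" for j
  proof
    have "emeasure (D j) (space (D j)) = (\<integral>\<^sup>+x. ennreal (p j x / m j) \<partial>lborel)"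
      unfolding D_def by (subst emeasure_density) (auto simp: space_density)
    also have "\<dots> = ennreal (\<integral>x. p j x / m j \<partial>lborel)"
      using int nn m0 by (intro nn_integral_eq_integral) auto
    also have "\<dots> = 1" using that by (simp add: m_def)
    finally show "emeasure (D j) (space (D j)) = 1" .
  qed
  have distr_nu: "real_distribution (\<nu> j)" for j
  proof (cases "m j > 0")
    case True
    interpret prob_space "D j" by (rule D[OF True])
    have "S \<in> D j \<rightarrow>\<^sub>M borel" unfolding D_def by simp
    then show ?thesis unfolding \<nu>_def using True
      by (auto simp: real_distribution_def real_distribution_axioms_def intro!: prob_space_distr)
  next
    case False
    then show ?thesis unfolding \<nu>_def
      by (auto simp: real_distribution_def real_distribution_axioms_def intro!: prob_space_return)
  qed
  have "tight \<nu>"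
    unfolding tight_def
  proof (intro conjI allI impI distr_nu)
    fix e :: real assume "0 < e"
    have "measure (\<nu> j) {-1<..1} = 1" for j
    proof (cases "m j > 0")
      case True
      interpret prob_space "D j" by (rule D[OF True])
      have "S \<in> D j \<rightarrow>\<^sub>M borel" unfolding D_def by simp
      then have "measure (\<nu> j) {-1<..1} = measure (D j) (S -` {-1<..1} \<inter> space (D j))"
        using True by (simp add: \<nu>_def measure_distr)
      moreover have "S -` {-1<..1} \<inter> space (D j) = space (D j)" using S01 by (force simp: less_le_trans)
      ultimately show ?thesis by (simp add: prob_space)
    next
      case False
      then show ?thesis by (simp add: \<nu>_def measure_return)
    qed
    then show "\<exists>a b. a < b \<and> (\<forall>n. 1 - e < measure (\<nu> n) {a<..b})"
      using \<open>0 < e\<close> by (intro exI[of _ "-1"] exI[of _ 1]) auto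
  qed
  then obtain r1 M where r1: "strict_mono (r1 :: nat \<Rightarrow> nat)" "real_distribution M"
      "weak_conv_m (\<nu> \<circ> id \<circ> r1) M"
    using tight_imp_convergent_subsubsequence[of \<nu> id] by (auto simp: strict_mono_def)
  \<comment> \<open>Weak convergence concerns the normalised laws, so the masses need a further
    subsequence. Their limit \<open>m1\<close> is restored as a constant density, which also covers
    the case that all mass is lost.\<close>
  have "\<forall>n. (m \<circ> r1) n \<in> {0..C}" using m0 bound by (auto simp: m_def)
  then obtain m1 r2 where r2: "m1 \<in> {0..C}" "strict_mono (r2 :: nat \<Rightarrow> nat)" "((m \<circ> r1) \<circ> r2) \<longlonglongrightarrow> m1"
    using compact_Icc[of 0 C] unfolding compact_def by meson
  interpret M: real_distribution M by fact
  define mu where "mu = density (distr M borel q) (\<lambda>_. ennreal m1)"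
  have mq [measurable]: "q \<in> M \<rightarrow>\<^sub>M borel" using measurable_cong_sets[OF M.events_eq_borel refl, of borel] by simp
  show ?thesis
  proof (rule that)
    show "strict_mono (r1 \<circ> r2)" using r1 r2 by (intro strict_mono_o)
    interpret dq: prob_space "distr M borel q" by (rule M.prob_space_distr[OF mq])
    show "finite_measure mu" unfolding mu_def
      by (rule finite_measureI) (auto simp: emeasure_density ennreal_mult_eq_top_iff nn_integral_cmult space_density)
    show "sets mu = sets borel" by (simp add: mu_def)
    have "AE x in distr M borel q. x \<in> K"
      using K by (subst AE_distr_iff[OF mq]) (auto simp: qK compact_imp_closed)
    then show "AE x in mu. x \<in> K" unfolding mu_def by (subst AE_density) auto
    fix \<psi> :: "pt \<Rightarrow> real" assume \<psi>: "continuous_on UNIV \<psi>"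
    have [measurable]: "\<psi> \<in> borel_measurable borel" by (intro borel_measurable_continuous_onI \<psi>)
    have conth: "continuous_on UNIV (\<lambda>t. \<psi> (q t))"
      using continuous_on_compose2[OF \<psi> contq] by auto
    have [measurable]: "(\<lambda>t. \<psi> (q t)) \<in> borel_measurable borel" by measurable
    have "compact (\<psi> ` K)" using \<psi> K by (intro compact_continuous_image) (auto intro: continuous_on_subset)
    then obtain B where B: "\<And>y. y \<in> \<psi> ` K \<Longrightarrow> norm y \<le> B"
      by (meson compact_imp_bounded bounded_iff)
    have eq: "m j * (\<integral>t. \<psi> (q t) \<partial>\<nu> j) = (\<integral>x. \<psi> x * p j x \<partial>lborel)" for j
    proof (cases "m j > 0")
      case True
      have "(\<integral>t. \<psi> (q t) \<partial>\<nu> j) = (\<integral>x. \<psi> (q (S x)) \<partial>D j)"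
        using True by (simp add: \<nu>_def D_def integral_distr)
      also have "\<dots> = (\<integral>x. p j x / m j * \<psi> (q (S x)) \<partial>lborel)"
        unfolding D_def using m0 nn by (subst integral_density) (auto intro!: divide_nonneg_nonneg)
      also have "\<dots> = (\<integral>x. \<psi> x * p j x / m j \<partial>lborel)"
      proof (rule Bochner_Integration.integral_cong)
        show "p j x / m j * \<psi> (q (S x)) = \<psi> x * p j x / m j" for x
          using qS[of x] supp[of j x] by (cases "p j x = 0") auto
      qed simp
      finally show ?thesis using True by simp
    next
      case False
      then have m: "m j = 0" using m0[of j] by simp
      then have "AE x in lborel. p j x = 0"
        using integral_nonneg_eq_0_iff_AE[OF int[of j]] nn by (auto simp: m_def)
      then have "(\<integral>x. \<psi> x * p j x \<partial>lborel) = 0"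
        by (intro integral_eq_zero_AE) auto
      then show ?thesis using m by simp
    qed
    have "(\<lambda>n. \<integral>t. \<psi> (q t) \<partial>(\<nu> \<circ> id \<circ> r1) n) \<longlonglongrightarrow> (\<integral>t. \<psi> (q t) \<partial>M)"
    proof (rule weak_conv_imp_integral_bdd_continuous_conv)
      show "isCont (\<lambda>t. \<psi> (q t)) x" for x using conth by (simp add: continuous_on_eq_continuous_at)
      show "norm (\<psi> (q x)) \<le> B" for x by (intro B imageI qK)
    qed (use r1 distr_nu in \<open>auto simp: o_def\<close>)
    from LIMSEQ_subseq_LIMSEQ[OF this r2(2)]
    have "(\<lambda>n. \<integral>t. \<psi> (q t) \<partial>\<nu> (r1 (r2 n))) \<longlonglongrightarrow> (\<integral>t. \<psi> (q t) \<partial>M)"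
      by (simp add: o_def)
    then have "(\<lambda>n. m (r1 (r2 n)) * (\<integral>t. \<psi> (q t) \<partial>\<nu> (r1 (r2 n)))) \<longlonglongrightarrow> m1 * (\<integral>t. \<psi> (q t) \<partial>M)"
      using r2(3)[unfolded o_def] by (rule tendsto_mult[rotated])
    moreover have "m1 * (\<integral>t. \<psi> (q t) \<partial>M) = (\<integral>x. \<psi> x \<partial>mu)"
    proof -
      have "(\<integral>x. \<psi> x \<partial>mu) = (\<integral>x. m1 *\<^sub>R \<psi> x \<partial>distr M borel q)"
        unfolding mu_def using r2(1) by (intro integral_density) auto
      also have "\<dots> = (\<integral>t. m1 *\<^sub>R \<psi> (q t) \<partial>M)"
        by (intro integral_distr mq) simp
      finally show ?thesis by simp
    qed
    ultimately show "(\<lambda>j. \<integral>x. \<psi> x * p ((r1 \<circ> r2) j) x \<partial>lborel) \<longlonglongrightarrow> (\<integral>x. \<psi> x \<partial>mu)"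
      by (simp add: eq)
  qed
qed

text \<open>Successive extraction: each new sequence refines the subsequence found so far, and this
  preserves the earlier limits.\<close>

lemma weak_compactness_finite_family:
  fixes K :: "pt set" and p :: "nat \<Rightarrow> nat \<Rightarrow> pt \<Rightarrow> real"
  assumes K: "compact K" "convex K" "K \<noteq> {}"
    and nn: "\<And>i j x. 0 \<le> p i j x" and int: "\<And>i j. integrable lborel (p i j)"
    and supp: "\<And>i j x. p i j x \<noteq> 0 \<Longrightarrow> x \<in> K"
    and bound: "\<And>i j. integral\<^sup>L lborel (p i j) \<le> C"
  shows "\<exists>r mu. strict_mono (r :: nat \<Rightarrow> nat) \<and> (\<forall>i<n. finite_measure (mu i) \<and> sets (mu i) = sets borel \<and>
    (AE x in mu i. x \<in> K) \<and>
    (\<forall>\<psi>. continuous_on UNIV \<psi> \<longrightarrow>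
      (\<lambda>j. \<integral>x. \<psi> x * p i (r j) x \<partial>lborel) \<longlonglongrightarrow> (\<integral>x. \<psi> x \<partial>mu i)))"
proof (induction n)
  case 0
  show ?case by (intro exI[of _ id]) (auto simp: strict_mono_def)
next
  case (Suc n)
  then obtain r mu where r: "strict_mono (r :: nat \<Rightarrow> nat)" and mu: "\<And>i. i < n \<Longrightarrow>
      finite_measure (mu i) \<and> sets (mu i) = sets borel \<and> (AE x in mu i. x \<in> K) \<and>
      (\<forall>\<psi>. continuous_on UNIV \<psi> \<longrightarrow>
        (\<lambda>j. \<integral>x. \<psi> x * p i (r j) x \<partial>lborel) \<longlonglongrightarrow> (\<integral>x. \<psi> x \<partial>mu i))"
    by blast
  obtain r' mu' where r': "strict_mono (r' :: nat \<Rightarrow> nat)" "finite_measure mu'" "sets mu' = sets borel"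
      "AE x in mu'. x \<in> K"
      "\<And>\<psi>. continuous_on UNIV \<psi> \<Longrightarrow>
        (\<lambda>j. \<integral>x. \<psi> x * p n (r (r' j)) x \<partial>lborel) \<longlonglongrightarrow> (\<integral>x. \<psi> x \<partial>mu')"
    by (rule weak_compactness_nonneg[of K "\<lambda>j. p n (r j)" C, OF K nn int _ bound]) (erule supp, rule that)
  show ?case
  proof (intro exI conjI allI impI)
    show "strict_mono (r \<circ> r')" using r r'(1) by (rule strict_mono_o)
    fix i assume "i < Suc n"
    have "finite_measure ((mu(n := mu')) i) \<and> sets ((mu(n := mu')) i) = sets borel \<and>
      (AE x in (mu(n := mu')) i. x \<in> K)"
    proof (cases "i = n")
      case True
      then have e: "(mu(n := mu')) i = mu'" by simp
      show ?thesis unfolding e using r'(2-4) by blast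
    next
      case False
      then have e: "(mu(n := mu')) i = mu i" "i < n" using \<open>i < Suc n\<close> by simp_all
      show ?thesis unfolding e(1) using mu[OF e(2)] by blast
    qed
    then show "finite_measure ((mu(n := mu')) i)" "sets ((mu(n := mu')) i) = sets borel"
      "AE x in (mu(n := mu')) i. x \<in> K" by blast+
    fix \<psi> :: "pt \<Rightarrow> real" assume \<psi>: "continuous_on UNIV \<psi>"
    show "(\<lambda>j. \<integral>x. \<psi> x * p i ((r \<circ> r') j) x \<partial>lborel) \<longlonglongrightarrow> (\<integral>x. \<psi> x \<partial>(mu(n := mu')) i)"
    proof (cases "i = n")
      case True
      then show ?thesis using r'(5)[OF \<psi>] by simp
    next
      case False
      then have "(\<lambda>j. \<integral>x. \<psi> x * p i (r j) x \<partial>lborel) \<longlonglongrightarrow> (\<integral>x. \<psi> x \<partial>mu i)"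
        using mu \<psi> \<open>i < Suc n\<close> by auto
      from LIMSEQ_subseq_LIMSEQ[OF this r'(1)] show ?thesis using False by (simp add: o_def)
    qed
  qed
qed

section \<open>Signed densities and a common dominating measure\<close>

text \<open>By inner regularity only compact sets matter, and the indicator of a compact set is the
  pointwise limit of continuous cutoffs of the distance to it.\<close>

lemma measure_le_if_continuous_integral_le:
  fixes M N :: "pt measure"
  assumes fin: "finite_measure M" "finite_measure N" and sets: "sets M = sets borel" "sets N = sets borel"
    and le: "\<And>\<psi>. continuous_on UNIV \<psi> \<Longrightarrow> (\<And>x. 0 \<le> \<psi> x) \<Longrightarrow> (\<And>x. \<psi> x \<le> 1) \<Longrightarrow>
      (\<integral>x. \<psi> x \<partial>M) \<le> (\<integral>x. \<psi> x \<partial>N :: real)"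
    and A: "A \<in> sets borel"
  shows "emeasure M A \<le> emeasure N A"
proof -
  interpret M: finite_measure M by fact
  interpret N: finite_measure N by fact
  have comp: "emeasure M k \<le> emeasure N k" if k: "compact k" for k
  proof (cases "k = {}")
    case False
    define f where "f n x = max 0 (1 - real n * infdist x k)" for n x
    have contf: "continuous_on UNIV (f n)" for n
      unfolding f_def by (intro continuous_intros)
    have lim: "(\<lambda>n. f n x) \<longlonglongrightarrow> indicator k x" for x
    proof (cases "x \<in> k")
      case True then show ?thesis by (simp add: f_def)
    next
      case False
      then have d: "0 < infdist x k"
        using k \<open>k \<noteq> {}\<close> by (metis compact_imp_closed in_closed_iff_infdist_zero infdist_nonneg order_le_less)
      obtain n0 :: nat where n0: "1 / infdist x k < n0" using reals_Archimedean2 by blast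
      have "f n x = 0" if "n0 \<le> n" for n
      proof -
        have "1 / infdist x k < real n" using n0 that by linarith
        then show ?thesis using d by (simp add: f_def field_simps)
      qed
      then have "eventually (\<lambda>n. f n x = 0) sequentially" unfolding eventually_sequentially by blast
      then show ?thesis using False by (simp add: tendsto_eventually)
    qed
    have bd: "0 \<le> f n x" "f n x \<le> 1" for n x by (auto simp: f_def infdist_nonneg)
    have mf: "f n \<in> borel_measurable borel" for n by (intro borel_measurable_continuous_onI contf)
    have L: "(\<lambda>n. \<integral>x. f n x \<partial>Q) \<longlonglongrightarrow> measure Q k" if Q: "finite_measure Q" "sets Q = sets borel" for Q
    proof -
      interpret Q: finite_measure Q by fact
      have "(\<lambda>n. \<integral>x. f n x \<partial>Q) \<longlonglongrightarrow> (\<integral>x. indicator k x \<partial>Q)"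
      proof (rule integral_dominated_convergence[where w = "\<lambda>_. 1"])
        show "f n \<in> borel_measurable Q" for n using mf Q(2) by (simp cong: measurable_cong_sets)
        show "indicator k \<in> borel_measurable Q"
          using Q(2) k by (intro borel_measurable_indicator) (simp add: compact_imp_closed)
      qed (use lim bd in auto)
      then show ?thesis
        using sets_eq_imp_space_eq[OF Q(2)] by simp
    qed
    have "measure M k \<le> measure N k"
      by (rule LIMSEQ_le[OF L[OF fin(1) sets(1)] L[OF fin(2) sets(2)]]) (use le contf bd in auto)
    then show ?thesis by (simp add: M.emeasure_eq_measure N.emeasure_eq_measure)
  qed simp
  have "emeasure M A = (SUP K \<in> {K. K \<subseteq> A \<and> compact K}. emeasure M K)"
    by (rule inner_regular[OF sets(1) _ A]) (simp add: M.emeasure_finite)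
  also have "\<dots> \<le> emeasure N A"
    using A sets comp by (intro SUP_least) (auto intro: order_trans[OF comp] emeasure_mono)
  finally show ?thesis .
qed

text \<open>\<open>mu\<close> is the limit of the sums of absolute values, not the variation of the
  limit. It dominates the limits of all positive and negative parts, so these have densities with
  respect to one measure. It also detects mass that cancels in the limit, which is what controls the
  convergence on half planes later.\<close>

lemma weak_compactness_signed:
  fixes K :: "pt set" and a :: "nat \<Rightarrow> nat \<Rightarrow> pt \<Rightarrow> real"
  assumes K: "compact K" "convex K" "K \<noteq> {}"
    and int: "\<And>i j. integrable lborel (a i j)"
    and supp: "\<And>i j x. a i j x \<noteq> 0 \<Longrightarrow> x \<in> K"
    and bound: "\<And>i j. (\<integral>x. \<bar>a i j x\<bar> \<partial>lborel) \<le> C"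
  obtains r mu g where "strict_mono (r :: nat \<Rightarrow> nat)" "finite_measure mu" "sets mu = sets borel"
    "AE x in mu. x \<in> K" "\<And>i. i < n \<Longrightarrow> integrable mu (g i)"
    "\<And>\<psi> i. continuous_on UNIV \<psi> \<Longrightarrow> i < n \<Longrightarrow>
      (\<lambda>j. \<integral>x. \<psi> x * a i (r j) x \<partial>lborel) \<longlonglongrightarrow> (\<integral>x. \<psi> x * g i x \<partial>mu)"
    "\<And>\<psi>. continuous_on UNIV \<psi> \<Longrightarrow>
      (\<lambda>j. \<integral>x. \<psi> x * (\<Sum>i<n. \<bar>a i (r j) x\<bar>) \<partial>lborel) \<longlonglongrightarrow> (\<integral>x. \<psi> x \<partial>mu)"
proof -
  \<comment> \<open>Index 2i holds the positive part of \<open>a i\<close>, index 2i + 1 the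
    negative part, and every index from 2n on the sum of the absolute values; a family of 2n + 1
    nonnegative sequences thus carries all that is needed.\<close>
  define p where "p k j x = (if k < 2 * n then (if even k then max 0 (a (k div 2) j x)
     else max 0 (- a (k div 2) j x)) else (\<Sum>i<n. \<bar>a i j x\<bar>))" for k j x
  have p_le: "p k j x \<le> (\<Sum>i<n. \<bar>a i j x\<bar>)" if "k < 2 * n" for k j x
  proof -
    have "p k j x \<le> \<bar>a (k div 2) j x\<bar>" using that by (auto simp: p_def)
    also have "\<dots> \<le> (\<Sum>i<n. \<bar>a i j x\<bar>)" using that by (intro member_le_sum) auto
    finally show ?thesis .
  qed
  have pint: "integrable lborel (p k j)" for k j
    unfolding p_def[abs_def] using int by (cases "k < 2 * n"; cases "even k") auto
  have "\<exists>r mu. strict_mono (r :: nat \<Rightarrow> nat) \<and> (\<forall>i<Suc (2 * n). finite_measure (mu i) \<and> sets (mu i) = sets borel \<and>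
    (AE x in mu i. x \<in> K) \<and>
    (\<forall>\<psi>::pt \<Rightarrow> real. continuous_on UNIV \<psi> \<longrightarrow>
      (\<lambda>j. \<integral>x. \<psi> x * p i (r j) x \<partial>lborel) \<longlonglongrightarrow> (\<integral>x. \<psi> x \<partial>mu i)))"
  proof (rule weak_compactness_finite_family[where C = "real n * C + C", OF K])
    show "0 \<le> p i j x" for i j x by (auto simp: p_def intro!: sum_nonneg)
    show "x \<in> K" if "p i j x \<noteq> 0" for i j x
    proof (cases "i < 2 * n")
      case True
      then show ?thesis using that supp by (auto simp: p_def max_def split: if_splits)
    next
      case False
      then have "(\<Sum>i<n. \<bar>a i j x\<bar>) \<noteq> 0" using that by (simp add: p_def)
      then obtain k where "\<bar>a k j x\<bar> \<noteq> 0" by (rule sum.not_neutral_contains_not_neutral)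
      then show ?thesis using supp by auto
    qed
    show "integrable lborel (p i j)" for i j by (rule pint)
    have C0: "0 \<le> C" by (rule order_trans[OF Bochner_Integration.integral_nonneg bound[of 0 0]]) simp
    fix i j
    have "integral\<^sup>L lborel (p i j) \<le> C \<or> integral\<^sup>L lborel (p i j) \<le> real n * C"
    proof (cases "i < 2 * n")
      case True
      have "integral\<^sup>L lborel (p i j) \<le> (\<integral>x. \<bar>a (i div 2) j x\<bar> \<partial>lborel)"
        using pint int True by (intro integral_mono) (auto simp: p_def)
      then show ?thesis using bound order_trans by blast
    next
      case False
      then have "integral\<^sup>L lborel (p i j) = (\<Sum>i<n. \<integral>x. \<bar>a i j x\<bar> \<partial>lborel)"
        unfolding p_def[abs_def] using int by (simp add: Bochner_Integration.integral_sum)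
      also have "\<dots> \<le> real n * C" using sum_bounded_above[of "{..<n}" _ C] bound by auto
      finally show ?thesis by simp
    qed
    moreover have "0 \<le> real n * C" using C0 by simp
    ultimately show "integral\<^sup>L lborel (p i j) \<le> real n * C + C" using C0 by linarith
  qed
  then obtain r \<mu> where r: "strict_mono (r :: nat \<Rightarrow> nat)" and \<mu>: "\<And>i. i < Suc (2 * n) \<Longrightarrow>
      finite_measure (\<mu> i)" "\<And>i. i < Suc (2 * n) \<Longrightarrow> sets (\<mu> i) = sets borel"
     "\<And>i. i < Suc (2 * n) \<Longrightarrow> AE x in \<mu> i. x \<in> K"
     and conv: "\<And>i \<psi>. i < Suc (2 * n) \<Longrightarrow> continuous_on UNIV \<psi> \<Longrightarrow>
      (\<lambda>j. \<integral>x. \<psi> x * p i (r j) x \<partial>lborel) \<longlonglongrightarrow> (\<integral>x. \<psi> x \<partial>\<mu> i)"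
    by blast
  define mu where "mu = \<mu> (2 * n)"
  have fmu: "finite_measure mu" and smu: "sets mu = sets borel" using \<mu> by (auto simp: mu_def)
  have muK: "AE x in mu. x \<in> K" unfolding mu_def by (rule \<mu>(3)) simp
  interpret finite_measure mu by fact
  have le: "emeasure (\<mu> i) A \<le> emeasure mu A" if i: "i < 2 * n" and A: "A \<in> sets borel" for i A
  proof (rule measure_le_if_continuous_integral_le)
    fix \<psi> :: "pt \<Rightarrow> real" assume \<psi>: "continuous_on UNIV \<psi>" "\<And>x. 0 \<le> \<psi> x" "\<And>x. \<psi> x \<le> 1"
    have [measurable]: "\<psi> \<in> borel_measurable borel" by (intro borel_measurable_continuous_onI \<psi>)
    have [measurable]: "p k j \<in> borel_measurable borel" for k j
      using borel_measurable_integrable[OF pint[of k j]] by simp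
    have int\<psi>: "integrable lborel (\<lambda>x. \<psi> x * p k j x)" for k j
      using \<psi> by (intro Bochner_Integration.integrable_bound[OF pint[of k j]])
       (auto simp: abs_mult intro!: mult_left_le_one_le)
    show "(\<integral>x. \<psi> x \<partial>\<mu> i) \<le> (\<integral>x. \<psi> x \<partial>mu)"
      unfolding mu_def
    proof (rule LIMSEQ_le[OF conv conv])
      show "\<exists>N. \<forall>j\<ge>N. (\<integral>x. \<psi> x * p i (r j) x \<partial>lborel) \<le> (\<integral>x. \<psi> x * p (2 * n) (r j) x \<partial>lborel)"
      proof (intro exI allI impI integral_mono int\<psi> mult_left_mono)
        show "p i (r j) x \<le> p (2 * n) (r j) x" for j x
          using p_le[OF i, of "r j" x] by (simp add: p_def)
      qed (rule \<psi>)
    qed (use i \<psi> in auto)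
  qed (use \<mu> i A fmu smu in auto)
  have "\<forall>i\<in>{..<2*n}. \<exists>d. d \<in> borel_measurable borel \<and> (\<forall>x. 0 \<le> d x) \<and> integrable mu d \<and>
      (\<forall>\<psi>::pt \<Rightarrow> real. continuous_on UNIV \<psi> \<longrightarrow> (\<integral>x. \<psi> x \<partial>\<mu> i) = (\<integral>x. \<psi> x * d x \<partial>mu)) \<and> (AE x in mu. d x \<le> 1)"
  proof
    fix i assume "i \<in> {..<2*n}" then have i: "i < 2 * n" by simp
    have "absolutely_continuous mu (\<mu> i)"
      unfolding absolutely_continuous_def
    proof
      fix A assume "A \<in> null_sets mu"
      then show "A \<in> null_sets (\<mu> i)"
        using le[OF i, of A] \<mu>(2)[of i] i smu by (simp add: null_sets_def)
    qed
    moreover have "sets (\<mu> i) = sets mu" using smu \<mu>(2)[of i] i by auto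
    ultimately obtain f where f: "f \<in> borel_measurable mu" "density mu f = \<mu> i"
      using Radon_Nikodym by blast
    have fb [measurable]: "f \<in> borel_measurable borel" using f(1) smu by (simp cong: measurable_cong_sets)
    note measurable_cong_sets[OF smu refl, simp]
    \<comment> \<open>On the set where f > 1 + e, domination gives (1 + e) mu \<le> mu, which for a
      finite measure leaves only a null set.\<close>
    have "AE x in mu. f x \<le> 1"
    proof (rule AE_upper_bound_inf_ennreal)
      fix e :: real assume e: "0 < e"
      let ?A = "{x. f x > 1 + ennreal e}"
      have A: "?A \<in> sets borel" by measurable
      have sp: "space mu = UNIV" using sets_eq_imp_space_eq[OF smu] by simp
      have "(1 + ennreal e) * emeasure mu ?A \<le> emeasure (\<mu> i) ?A"
      proof -
        have "(1 + ennreal e) * emeasure mu ?A = (\<integral>\<^sup>+x. (1 + ennreal e) * indicator ?A x \<partial>mu)"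
          using A smu by (subst nn_integral_cmult_indicator) auto
        also have "\<dots> \<le> (\<integral>\<^sup>+x. f x * indicator ?A x \<partial>mu)"
          by (intro nn_integral_mono) (auto split: split_indicator)
        also have "\<dots> = emeasure (\<mu> i) ?A"
          unfolding f(2)[symmetric] using A smu f(1) by (subst emeasure_density) auto
        finally show ?thesis .
      qed
      also have "\<dots> \<le> emeasure mu ?A" using le[OF i A] .
      finally have "measure mu ?A = 0"
        using e by (simp add: emeasure_eq_measure ennreal_mult'[symmetric] ennreal_1[symmetric] ennreal_plus[symmetric]
            del: ennreal_1 ennreal_plus) (metis add.commute add_le_same_cancel2 distrib_right measure_nonneg mult_1 mult_pos_pos not_le order_le_less)
      then have "emeasure mu ?A = 0" by (simp add: emeasure_eq_measure)
      then have "AE x in mu. x \<notin> ?A" using A smu by (intro AE_not_in) (auto simp: null_sets_def)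
      then show "AE x in mu. f x \<le> 1 + ennreal e" by eventually_elim auto
    qed
    then have ae: "AE x in mu. f x = ennreal (enn2real (f x)) \<and> enn2real (f x) \<le> 1"
    proof eventually_elim
      case (elim x)
      then have "f x < top" using ennreal_one_less_top by (rule le_less_trans)
      then show ?case
        using enn2real_mono[of "f x" 1] elim by simp
    qed
    let ?d = "\<lambda>x. enn2real (f x)"
    have "\<mu> i = density mu ?d"
      unfolding f(2)[symmetric] using f(1) ae by (intro density_cong) (auto elim: eventually_mono)
    then have d1: "(\<integral>x. \<psi> x \<partial>\<mu> i) = (\<integral>x. \<psi> x * ?d x \<partial>mu)" if "continuous_on UNIV \<psi>" for \<psi> :: "pt \<Rightarrow> real"
      using borel_measurable_continuous_onI[OF that] by (simp add: integral_density mult.commute)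
    have d2: "integrable mu ?d"
      using ae by (intro integrable_const_bound[of _ 1]) (auto elim: eventually_mono)
    have d3: "?d \<in> borel_measurable borel" by measurable
    have d4: "AE x in mu. ?d x \<le> 1" using ae by eventually_elim simp
    show "\<exists>d. d \<in> borel_measurable borel \<and> (\<forall>x. 0 \<le> d x) \<and> integrable mu d \<and>
      (\<forall>\<psi>::pt \<Rightarrow> real. continuous_on UNIV \<psi> \<longrightarrow> (\<integral>x. \<psi> x \<partial>\<mu> i) = (\<integral>x. \<psi> x * d x \<partial>mu)) \<and> (AE x in mu. d x \<le> 1)"
      by (intro exI[of _ ?d] conjI allI impI d1 d2 d3 d4) simp
  qed
  from bchoice[OF this] obtain d where D: "\<forall>i\<in>{..<2*n}. d i \<in> borel_measurable borel \<and> (\<forall>x. 0 \<le> d i x) \<and> integrable mu (d i) \<and>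
      (\<forall>\<psi>::pt \<Rightarrow> real. continuous_on UNIV \<psi> \<longrightarrow> (\<integral>x. \<psi> x \<partial>\<mu> i) = (\<integral>x. \<psi> x * d i x \<partial>mu)) \<and> (AE x in mu. d i x \<le> 1)" ..
  have d: "d i \<in> borel_measurable borel" "0 \<le> d i x" "integrable mu (d i)" "AE x in mu. d i x \<le> 1" if "i < 2 * n" for i x
    using D that by simp_all
  have d5: "(\<integral>x. \<psi> x \<partial>\<mu> i) = (\<integral>x. \<psi> x * d i x \<partial>mu)" if "i < 2 * n" "continuous_on UNIV \<psi>" for i and \<psi> :: "pt \<Rightarrow> real"
    using D that by simp
  define g where "g i x = d (2 * i) x - d (2 * i + 1) x" for i x
  show ?thesis
  proof (rule that)
    show "strict_mono r" "finite_measure mu" "sets mu = sets borel" "AE x in mu. x \<in> K"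
      by (fact r fmu smu muK)+
    show "integrable mu (g i)" if "i < n" for i
      unfolding g_def[abs_def] using d(3) that by (intro Bochner_Integration.integrable_diff) auto
    fix \<psi> :: "pt \<Rightarrow> real" assume \<psi>: "continuous_on UNIV \<psi>"
    have [measurable]: "\<psi> \<in> borel_measurable borel" by (intro borel_measurable_continuous_onI \<psi>)
    have "compact (\<psi> ` K)" using \<psi> K by (intro compact_continuous_image) (auto intro: continuous_on_subset)
    from compact_imp_bounded[OF this, unfolded bounded_iff]
    obtain B where "\<forall>y\<in>\<psi> ` K. norm y \<le> B" ..
    then have B: "\<And>x. x \<in> K \<Longrightarrow> norm (\<psi> x) \<le> B" by simp
    have int\<psi>: "integrable lborel (\<lambda>x. \<psi> x * q x)" if q: "integrable lborel q" "\<And>x. q x \<noteq> 0 \<Longrightarrow> x \<in> K" for q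
    proof (rule Bochner_Integration.integrable_bound)
      show "integrable lborel (\<lambda>x. B * q x)" using q(1) by simp
      show "AE x in lborel. norm (\<psi> x * q x) \<le> norm (B * q x)"
      proof (rule AE_I2)
        show "norm (\<psi> x * q x) \<le> norm (B * q x)" for x
        proof (cases "q x = 0")
          case False
          then have "norm (\<psi> x) \<le> B" using B q(2) by blast
          then have "\<bar>\<psi> x\<bar> \<le> \<bar>B\<bar>" by auto
          then show ?thesis by (simp add: abs_mult mult_right_mono)
        qed simp
      qed
    qed (use borel_measurable_integrable[OF q(1)] in simp)
    {
      fix i assume i: "i < n"
      have "(\<lambda>j. (\<integral>x. \<psi> x * p (2 * i) (r j) x \<partial>lborel) - (\<integral>x. \<psi> x * p (2 * i + 1) (r j) x \<partial>lborel))
         \<longlonglongrightarrow> (\<integral>x. \<psi> x \<partial>\<mu> (2 * i)) - (\<integral>x. \<psi> x \<partial>\<mu> (2 * i + 1))"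
        using i \<psi> by (intro tendsto_diff conv) auto
      moreover have "(\<integral>x. \<psi> x * p (2 * i) (r j) x \<partial>lborel) - (\<integral>x. \<psi> x * p (2 * i + 1) (r j) x \<partial>lborel)
         = (\<integral>x. \<psi> x * a i (r j) x \<partial>lborel)" for j
      proof -
        have "x \<in> K" if "p k j x \<noteq> 0" "k < 2 * n" for k j x
          using that supp[of "k div 2" j x] by (auto simp: p_def split: if_splits)
        then have "(\<integral>x. \<psi> x * p (2 * i) (r j) x \<partial>lborel) - (\<integral>x. \<psi> x * p (2 * i + 1) (r j) x \<partial>lborel)
          = (\<integral>x. \<psi> x * p (2 * i) (r j) x - \<psi> x * p (2 * i + 1) (r j) x \<partial>lborel)"
          using i by (intro Bochner_Integration.integral_diff[symmetric] int\<psi> pint) auto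
        also have "\<dots> = (\<integral>x. \<psi> x * a i (r j) x \<partial>lborel)"
          using i by (intro Bochner_Integration.integral_cong) (auto simp: p_def max_def)
        finally show ?thesis .
      qed
      moreover have "(\<integral>x. \<psi> x \<partial>\<mu> (2 * i)) - (\<integral>x. \<psi> x \<partial>\<mu> (2 * i + 1)) = (\<integral>x. \<psi> x * g i x \<partial>mu)"
      proof -
        have psid: "integrable mu (\<lambda>x. \<psi> x * d k x)" if "k < 2 * n" for k
        proof (rule integrable_const_bound[of _ B])
          show "AE x in mu. norm (\<psi> x * d k x) \<le> B"
            using d(4)[OF that] muK
          proof eventually_elim
            case (elim x)
            then have "\<bar>\<psi> x\<bar> * \<bar>d k x\<bar> \<le> B * 1" using B[of x] d(2)[OF that] by (intro mult_mono) auto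
            then show ?case by (simp add: abs_mult)
          qed
          show "(\<lambda>x. \<psi> x * d k x) \<in> borel_measurable mu"
            using d(1)[OF that] smu by (simp cong: measurable_cong_sets)
        qed
        show ?thesis using i d5[of "2 * i" \<psi>] d5[of "2 * i + 1" \<psi>] \<psi> psid
          by (simp add: g_def right_diff_distrib Bochner_Integration.integral_diff)
      qed
      ultimately show "(\<lambda>j. \<integral>x. \<psi> x * a i (r j) x \<partial>lborel) \<longlonglongrightarrow> (\<integral>x. \<psi> x * g i x \<partial>mu)" by simp
    }
    show "(\<lambda>j. \<integral>x. \<psi> x * (\<Sum>i<n. \<bar>a i (r j) x\<bar>) \<partial>lborel) \<longlonglongrightarrow> (\<integral>x. \<psi> x \<partial>mu)"
      using conv[OF _ \<psi>, of "2 * n"] by (simp add: p_def mu_def)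
  qed
qed

section \<open>One-dimensional Hausdorff measure\<close>

definition H1_covers :: "real \<Rightarrow> pt set \<Rightarrow> (nat \<Rightarrow> pt set) set" where
  "H1_covers \<delta> A = {C. A \<subseteq> (\<Union>i. C i) \<and> (\<forall>i. bounded (C i) \<and> diameter (C i) \<le> \<delta>)}"

lemma H1_delta_alt: "H1_delta \<delta> A = (INF C \<in> H1_covers \<delta> A. \<Sum>i. ennreal (diameter (C i)))"
  by (simp add: H1_delta_def H1_covers_def)

lemma H1_delta_mono: "A \<subseteq> B \<Longrightarrow> \<delta>' \<le> \<delta> \<Longrightarrow> H1_delta \<delta> A \<le> H1_delta \<delta>' B"
  unfolding H1_delta_alt
  by (rule INF_superset_mono) (auto simp: H1_covers_def intro: order_trans)

lemma H1_delta_le_H1: "0 < \<delta> \<Longrightarrow> H1_delta \<delta> A \<le> H1 A"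
  unfolding H1_def by (rule SUP_upper) simp

lemma H1_leI: "(\<And>\<delta>. 0 < \<delta> \<Longrightarrow> H1_delta \<delta> A \<le> x) \<Longrightarrow> H1 A \<le> x"
  unfolding H1_def by (rule SUP_least) simp

lemma H1_mono: "A \<subseteq> B \<Longrightarrow> H1 A \<le> H1 B"
  by (rule H1_leI) (meson H1_delta_le_H1 H1_delta_mono order_refl order_trans)

lemma H1_empty [simp]: "H1 {} = 0"
proof -
  have "H1 {} \<le> 0"
  proof (rule H1_leI)
    fix \<delta> :: real assume "0 < \<delta>"
    then have "(\<lambda>_. {}) \<in> H1_covers \<delta> {}" by (auto simp: H1_covers_def)
    then have "H1_delta \<delta> {} \<le> (\<Sum>i::nat. ennreal (diameter ({}::pt set)))"
      unfolding H1_delta_alt by (rule INF_lower)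
    then show "H1_delta \<delta> {} \<le> 0" by simp
  qed
  then show ?thesis by simp
qed

lemma H1_delta_countably_subadditive:
  "H1_delta \<delta> (\<Union>i. A i) \<le> (\<Sum>i. H1_delta \<delta> (A i))"
proof (rule ennreal_le_epsilon)
  fix e :: real assume fin: "(\<Sum>i. H1_delta \<delta> (A i)) < top" and e: "0 < e"
  have "\<exists>C \<in> H1_covers \<delta> (A i). (\<Sum>k. ennreal (diameter (C k))) < H1_delta \<delta> (A i) + ennreal (e * (1/2) ^ Suc i)" for i
    using e ennreal_suminf_lessD[OF fin, of i]
    by (intro INF_approx_ennreal H1_delta_alt) (auto simp: less_top)
  then obtain C where C: "\<And>i. C i \<in> H1_covers \<delta> (A i)"
    "\<And>i. (\<Sum>k. ennreal (diameter (C i k))) < H1_delta \<delta> (A i) + ennreal (e * (1/2) ^ Suc i)" by metis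
  define D where "D n = (case prod_decode n of (i, k) \<Rightarrow> C i k)" for n
  have "D \<in> H1_covers \<delta> (\<Union>i. A i)"
  proof -
    have "x \<in> (\<Union>n. D n)" if "x \<in> A i" for x i
    proof -
      have "x \<in> (\<Union>k. C i k)" using C(1)[of i] that by (auto simp: H1_covers_def)
      then obtain k where "x \<in> C i k" by blast
      then have "x \<in> D (prod_encode (i, k))" by (simp add: D_def)
      then show ?thesis by blast
    qed
    moreover have "bounded (D n) \<and> diameter (D n) \<le> \<delta>" for n
      using C(1) by (auto simp: H1_covers_def D_def split: prod.split)
    ultimately show ?thesis by (auto simp: H1_covers_def)
  qed
  then have "H1_delta \<delta> (\<Union>i. A i) \<le> (\<Sum>n. ennreal (diameter (D n)))"
    unfolding H1_delta_alt by (rule INF_lower)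
  also have "\<dots> = (\<Sum>n. (\<lambda>(i, k). ennreal (diameter (C i k))) (prod_decode n))"
    by (simp add: D_def case_prod_beta)
  also have "\<dots> = (\<Sum>i. \<Sum>k. ennreal (diameter (C i k)))"
    by (rule suminf_ennreal_2dimen) simp
  also have "\<dots> \<le> (\<Sum>i. H1_delta \<delta> (A i) + ennreal (e * (1/2) ^ Suc i))"
    using C(2) by (intro suminf_le) (auto intro: less_imp_le)
  also have "\<dots> = (\<Sum>i. H1_delta \<delta> (A i)) + (\<Sum>i. ennreal (e * (1/2) ^ Suc i))"
    by (rule suminf_add[symmetric]) auto
  also have "(\<Sum>i. ennreal (e * (1/2) ^ Suc i)) = ennreal (e * 1)"
    using e by (intro suminf_ennreal_eq sums_mult power_half_series) auto
  finally show "H1_delta \<delta> (\<Union>i. A i) \<le> (\<Sum>i. H1_delta \<delta> (A i)) + ennreal e" by simp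
qed

lemma H1_countably_subadditive: "H1 (\<Union>i. A i) \<le> (\<Sum>i. H1 (A i))"
proof (rule H1_leI)
  fix \<delta> :: real assume "0 < \<delta>"
  then have "(\<Sum>i. H1_delta \<delta> (A i)) \<le> (\<Sum>i. H1 (A i))"
    by (intro suminf_le H1_delta_le_H1) auto
  then show "H1_delta \<delta> (\<Union>i. A i) \<le> (\<Sum>i. H1 (A i))"
    using H1_delta_countably_subadditive order_trans by blast
qed

lemma H1_subadditive: "H1 (A \<union> B) \<le> H1 A + H1 B"
proof -
  have "H1 (\<Union>i::nat. if i = 0 then A else if i = 1 then B else {})
      \<le> (\<Sum>i::nat. H1 (if i = 0 then A else if i = 1 then B else {}))"
    by (rule H1_countably_subadditive)
  moreover have "(\<Union>i::nat. if i = 0 then A else if i = 1 then B else {}) = A \<union> B"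
    by (auto split: if_splits)
  moreover have "(\<Sum>i::nat. H1 (if i = 0 then A else if i = 1 then B else {})) =
    (\<Sum>i\<in>{0,1::nat}. H1 (if i = 0 then A else if i = 1 then B else {}))"
    by (rule suminf_finite) auto
  moreover have "(\<Sum>i\<in>{0,1::nat}. H1 (if i = 0 then A else if i = 1 then B else {})) = H1 A + H1 B"
    by (subst sum.insert) auto
  ultimately show ?thesis by (simp only:)
qed

text \<open>A cover by sets of diameter below the distance \<open>r\<close> splits, since no piece
  meets both \<open>A\<close> and \<open>B\<close>. Pieces that do not belong to a side are replaced
  by the empty set, so the index set stays the same.\<close>

lemma H1_delta_superadditive:
  assumes d: "\<And>x y. x \<in> A \<Longrightarrow> y \<in> B \<Longrightarrow> r \<le> dist x y" and \<delta>: "0 < \<delta>" "\<delta> < r"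
  shows "H1_delta \<delta> A + H1_delta \<delta> B \<le> H1_delta \<delta> (A \<union> B)"
  unfolding H1_delta_alt[of _ "A \<union> B"]
proof (rule INF_greatest)
  fix C assume C: "C \<in> H1_covers \<delta> (A \<union> B)"
  define CA where "CA i = (if C i \<inter> A = {} then {} else C i)" for i
  define CB where "CB i = (if C i \<inter> B = {} then {} else C i)" for i
  have disj: "C i \<inter> A = {} \<or> C i \<inter> B = {}" for i
  proof (rule ccontr)
    assume "\<not> ?thesis"
    then obtain x y where xy: "x \<in> C i" "x \<in> A" "y \<in> C i" "y \<in> B" by auto
    then have "r \<le> dist x y" using d by blast
    also have "\<dots> \<le> diameter (C i)" using C xy
      by (intro diameter_bounded_bound) (auto simp: H1_covers_def)
    also have "\<dots> \<le> \<delta>" using C by (auto simp: H1_covers_def)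
    finally show False using \<delta> by simp
  qed
  have "CA \<in> H1_covers \<delta> A" "CB \<in> H1_covers \<delta> B"
    using C \<delta> by (fastforce simp: H1_covers_def CA_def CB_def)+
  then have "H1_delta \<delta> A + H1_delta \<delta> B \<le> (\<Sum>i. ennreal (diameter (CA i))) + (\<Sum>i. ennreal (diameter (CB i)))"
    unfolding H1_delta_alt by (intro add_mono INF_lower)
  also have "\<dots> = (\<Sum>i. ennreal (diameter (CA i)) + ennreal (diameter (CB i)))"
    by (rule suminf_add) auto
  also have "\<dots> \<le> (\<Sum>i. ennreal (diameter (C i)))"
    using disj by (intro suminf_le) (auto simp: CA_def CB_def)
  finally show "H1_delta \<delta> A + H1_delta \<delta> B \<le> (\<Sum>i. ennreal (diameter (C i)))" .
qed

lemma H1_eq_SUP_nat: "H1 A = (SUP n. H1_delta (1 / Suc n) A)"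
proof (rule antisym)
  show "H1 A \<le> (SUP n. H1_delta (1 / Suc n) A)"
  proof (rule H1_leI)
    fix \<delta> :: real assume "0 < \<delta>"
    then obtain n where "1 / Suc n < \<delta>" using nat_approx_posE by blast
    then have "H1_delta \<delta> A \<le> H1_delta (1 / Suc n) A" by (intro H1_delta_mono) auto
    then show "H1_delta \<delta> A \<le> (SUP n. H1_delta (1 / Suc n) A)" by (rule SUP_upper2[rotated]) simp
  qed
  show "(SUP n. H1_delta (1 / Suc n) A) \<le> H1 A"
    by (intro SUP_least H1_delta_le_H1) simp
qed

lemma H1_superadditive:
  assumes d: "\<And>x y. x \<in> A \<Longrightarrow> y \<in> B \<Longrightarrow> r \<le> dist x y" and r: "0 < r"
  shows "H1 A + H1 B \<le> H1 (A \<union> B)"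
proof -
  have inc: "incseq (\<lambda>n. H1_delta (1 / Suc n) S)" for S
    by (intro monoI H1_delta_mono) (auto simp: field_simps)
  have "H1 A + H1 B = (SUP n. H1_delta (1 / Suc n) A + H1_delta (1 / Suc n) B)"
    unfolding H1_eq_SUP_nat by (rule ennreal_SUP_add[symmetric, OF inc inc])
  also have "\<dots> \<le> H1 (A \<union> B)"
  proof (rule SUP_least)
    fix n :: nat
    define \<delta> where "\<delta> = min (1 / Suc n) (r / 2)"
    have \<delta>: "0 < \<delta>" "\<delta> < r" "\<delta> \<le> 1 / Suc n" using r by (auto simp: \<delta>_def)
    have "H1_delta (1 / Suc n) A + H1_delta (1 / Suc n) B \<le> H1_delta \<delta> A + H1_delta \<delta> B"
      using \<delta> by (intro add_mono H1_delta_mono) auto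
    also have "\<dots> \<le> H1_delta \<delta> (A \<union> B)" using d \<delta> by (intro H1_delta_superadditive) auto
    also have "\<dots> \<le> H1 (A \<union> B)" by (rule H1_delta_le_H1[OF \<delta>(1)])
    finally show "H1_delta (1 / Suc n) A + H1_delta (1 / Suc n) B \<le> H1 (A \<union> B)" .
  qed
  finally show ?thesis .
qed

text \<open>The separation \<open>r i\<close> depends only on the smaller index and may tend to 0;
  finitely many sets enter each step, so a positive minimum is available.\<close>

lemma H1_separated_sum:
  fixes R :: "nat \<Rightarrow> pt set" and m :: nat
  assumes d: "\<And>i k x y. i < k \<Longrightarrow> x \<in> R i \<Longrightarrow> y \<in> R k \<Longrightarrow> r i \<le> dist x y" and r: "\<And>i. 0 < r i"
  shows "(\<Sum>k<m. H1 (R k)) \<le> H1 (\<Union>k<m. R k)"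
proof (induction m)
  case (Suc m)
  have "(\<Sum>k<Suc m. H1 (R k)) \<le> H1 (\<Union>k<m. R k) + H1 (R m)"
    using Suc by (simp add: add_right_mono)
  also have "\<dots> \<le> H1 ((\<Union>k<m. R k) \<union> R m)"
  proof (cases "m = 0")
    case False
    show ?thesis
    proof (rule H1_superadditive)
      show "0 < Min (r ` {..<m})" using r False by (subst Min_gr_iff) auto
      fix x y assume "x \<in> (\<Union>k<m. R k)" "y \<in> R m"
      then obtain k where k: "k < m" "x \<in> R k" by blast
      then have "r k \<le> dist x y" using d \<open>y \<in> R m\<close> by blast
      moreover have "Min (r ` {..<m}) \<le> r k" using k by simp
      ultimately show "Min (r ` {..<m}) \<le> dist x y" by linarith
    qed
  qed simp
  also have "(\<Union>k<m. R k) \<union> R m = (\<Union>k<Suc m. R k)" by (auto simp: lessThan_Suc)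
  finally show ?case .
qed simp

text \<open>Caratheodory's criterion for metric outer measures: the shells around the closed set
  that are two steps apart are at positive distance, so their measures are summable.\<close>

lemma H1_split_closed:
  assumes F: "closed F"
  shows "H1 (F \<inter> A) + H1 (A - F) = H1 A"
proof (rule antisym)
  have "A = (F \<inter> A) \<union> (A - F)" by blast
  then show "H1 A \<le> H1 (F \<inter> A) + H1 (A - F)" using H1_subadditive[of "F \<inter> A" "A - F"] by simp
  show "H1 (F \<inter> A) + H1 (A - F) \<le> H1 A"
  proof (cases "F = {} \<or> H1 A = top")
    case False
    then have F0: "F \<noteq> {}" and fin: "H1 A < top" by (auto simp: less_top)
    define B where "B n = {x \<in> A - F. 1 / Suc n \<le> infdist x F}" for n :: nat
    define R where "R n = B (Suc n) - B n" for n
    have B_sep: "H1 (F \<inter> A) + H1 (B n) \<le> H1 A" for n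
    proof -
      have "H1 (F \<inter> A) + H1 (B n) \<le> H1 ((F \<inter> A) \<union> B n)"
      proof (rule H1_superadditive)
        fix x y assume "x \<in> F \<inter> A" "y \<in> B n"
        then have "1 / Suc n \<le> infdist y F" "x \<in> F" by (auto simp: B_def)
        then show "1 / Suc n \<le> dist x y" using infdist_le[of x F y] by (simp add: dist_commute)
      qed simp
      also have "\<dots> \<le> H1 A" by (rule H1_mono) (auto simp: B_def)
      finally show ?thesis .
    qed
    have B_mono: "B m \<subseteq> B n" if "m \<le> n" for m n
      using that by (auto simp: B_def intro: order_trans[rotated] simp: frac_le)
    \<comment> \<open>Skipping one shell leaves a gap: points of \<open>R i\<close> have distance at
      least 1/(i+2) from \<open>F\<close>, points of \<open>R k\<close> less than 1/(k+1) \<le>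
      1/(i+3).\<close>
    have R_sep: "1 / Suc (Suc i) - 1 / Suc (Suc (Suc i)) \<le> dist x y"
      if "Suc (Suc i) \<le> k" "x \<in> R i" "y \<in> R k" for i k x y
    proof -
      have x: "1 / Suc (Suc i) \<le> infdist x F" using that by (auto simp: R_def B_def)
      have "y \<notin> B k" "y \<in> A - F" using that by (auto simp: R_def B_def)
      then have "infdist y F < 1 / Suc k" by (auto simp: B_def)
      also have "\<dots> \<le> 1 / Suc (Suc (Suc i))" using that by (intro divide_left_mono) auto
      finally show ?thesis using x infdist_triangle[of x F y] by linarith
    qed
    have R_le: "(\<Sum>k<m. H1 (R (2 * k + c))) \<le> H1 A" for m c
    proof -
      have "(\<Sum>k<m. H1 (R (2 * k + c))) \<le> H1 (\<Union>k<m. R (2 * k + c))"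
      proof (rule H1_separated_sum)
        show "1 / Suc (Suc (2 * i + c)) - 1 / Suc (Suc (Suc (2 * i + c))) \<le> dist x y"
          if "i < k" "x \<in> R (2 * i + c)" "y \<in> R (2 * k + c)" for i k x y
          using that by (intro R_sep) auto
      qed (simp only: diff_gt_0_iff_gt, intro divide_strict_left_mono, auto)
      also have "\<dots> \<le> H1 A" by (rule H1_mono) (auto simp: R_def B_def)
      finally show ?thesis .
    qed
    have "(\<Sum>k. H1 (R k)) \<le> H1 A + H1 A"
    proof (rule suminf_le_const)
      fix n
      have "(\<Sum>k<n. H1 (R k)) \<le> (\<Sum>k<2*n. H1 (R k))" by (intro sum_mono2) auto
      also have "\<dots> = (\<Sum>k<n. H1 (R (2 * k + 0))) + (\<Sum>k<n. H1 (R (2 * k + 1)))"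
        by (induction n) (auto simp: algebra_simps)
      also have "\<dots> \<le> H1 A + H1 A" by (intro add_mono R_le)
      finally show "(\<Sum>k<n. H1 (R k)) \<le> H1 A + H1 A" .
    qed simp
    also have "\<dots> < top" using fin by simp
    finally have sumfin: "(\<Sum>k. H1 (R k)) < top" .
    define \<rho> where "\<rho> k = enn2real (H1 (R k))" for k
    have \<rho>: "H1 (R k) = ennreal (\<rho> k)" "0 \<le> \<rho> k" for k
      using ennreal_suminf_lessD[OF sumfin, of k] by (auto simp: \<rho>_def)
    have summ: "summable \<rho>"
      using sumfin \<rho> by (intro summable_suminf_not_top) auto
    \<comment> \<open>Whatever part of A - F is not yet in \<open>B n\<close> lies in the later
      shells, so the tail of a convergent series measures the error.\<close>
    have key: "H1 (F \<inter> A) + H1 (A - F) \<le> H1 A + ennreal (\<Sum>k. \<rho> (k + n))" for n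
    proof -
      have "A - F \<subseteq> B n \<union> (\<Union>k. R (k + n))"
      proof
        fix x assume x: "x \<in> A - F"
        then have "0 < infdist x F"
          using F F0 by (metis DiffD2 in_closed_iff_infdist_zero infdist_nonneg order_le_less)
        then obtain m where "1 / Suc m < infdist x F" using nat_approx_posE by blast
        then have "x \<in> B m" using x by (auto simp: B_def)
        define l where "l = (LEAST m. x \<in> B m)"
        have l: "x \<in> B l" "\<And>k. k < l \<Longrightarrow> x \<notin> B k"
          unfolding l_def using \<open>x \<in> B m\<close> by (auto intro: LeastI dest: not_less_Least)
        show "x \<in> B n \<union> (\<Union>k. R (k + n))"
        proof (cases "l \<le> n")
          case True then show ?thesis using l(1) B_mono by blast
        next
          case False
          then have "x \<in> R (l - 1)" using l(1) l(2)[of "l - 1"] by (simp add: R_def)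
          moreover have "l - 1 = (l - 1 - n) + n" using False by simp
          ultimately show ?thesis by (metis UN_I UNIV_I UnI2)
        qed
      qed
      then have "H1 (A - F) \<le> H1 (B n) + H1 (\<Union>k. R (k + n))"
        using H1_mono H1_subadditive order_trans by blast
      also have "\<dots> \<le> H1 (B n) + (\<Sum>k. H1 (R (k + n)))"
        by (intro add_left_mono H1_countably_subadditive)
      also have "(\<Sum>k. H1 (R (k + n))) = ennreal (\<Sum>k. \<rho> (k + n))"
        unfolding \<rho>(1) using summ \<rho>(2) by (intro suminf_ennreal2 summable_ignore_initial_segment) auto
      finally have "H1 (F \<inter> A) + H1 (A - F) \<le> (H1 (F \<inter> A) + H1 (B n)) + ennreal (\<Sum>k. \<rho> (k + n))"
        by (metis add.assoc add_left_mono)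
      also have "\<dots> \<le> H1 A + ennreal (\<Sum>k. \<rho> (k + n))" by (intro add_right_mono B_sep)
      finally show ?thesis .
    qed
    show ?thesis
    proof (rule ennreal_le_epsilon)
      fix e :: real assume e: "0 < e"
      obtain n where n: "\<bar>\<Sum>k. \<rho> (k + n)\<bar> < e"
        using suminf_exist_split[OF e summ] by auto
      have "H1 (F \<inter> A) + H1 (A - F) \<le> H1 A + ennreal (\<Sum>k. \<rho> (k + n))" by (rule key)
      also have "\<dots> \<le> H1 A + ennreal e" using n by (intro add_left_mono ennreal_leI) simp
      finally show "H1 (F \<inter> A) + H1 (A - F) \<le> H1 A + ennreal e" .
    qed
  qed auto
qed

text \<open>\<open>measure_of\<close> returns the zero measure unless countable additivity is known
  on the given sets. Caratheodory's theorem provides it here, and only this gives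
  \<open>H1_meas\<close> its intended values.\<close>

lemma measure_space_H1: "measure_space UNIV (sets borel) H1"
proof -
  interpret sigma_algebra "UNIV :: pt set" UNIV using sigma_algebra_Pow[of UNIV] by simp
  have "outer_measure_space UNIV H1"
    unfolding outer_measure_space_def positive_def increasing_def countably_subadditive_def
    using H1_mono H1_countably_subadditive by auto
  then have ms: "measure_space UNIV (lambda_system UNIV UNIV H1) H1"
    by (rule caratheodory_lemma)
  then interpret L: sigma_algebra "UNIV :: pt set" "lambda_system UNIV UNIV H1"
    by (simp add: measure_space_def)
  have "sigma_sets UNIV (Collect closed) \<subseteq> lambda_system UNIV UNIV H1"
    by (intro L.sigma_sets_subset) (auto simp: lambda_system_def H1_split_closed Compl_eq_Diff_UNIV[symmetric] Int_commute Diff_eq[symmetric] simp del: Compl_eq_Diff_UNIV)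
  then have "sets borel \<subseteq> lambda_system UNIV UNIV H1"
    by (simp add: borel_eq_closed)
  then show ?thesis
    using ms sets.sigma_algebra_axioms[of borel] by (intro measure_down[OF ms]) auto
qed

lemma sets_H1_meas [simp, measurable_cong]: "sets H1_meas = sets borel"
  unfolding H1_meas_def by (metis sets.sigma_sets_eq sets_measure_of space_borel subset_UNIV Pow_UNIV)

lemma space_H1_meas [simp]: "space H1_meas = UNIV"
  using sets_eq_imp_space_eq[OF sets_H1_meas] by simp

lemma emeasure_H1_meas: "A \<in> sets borel \<Longrightarrow> emeasure H1_meas A = H1 A"
  using measure_space_H1 sets_H1_meas unfolding measure_space_def H1_meas_def
  by (intro emeasure_measure_of_sigma) auto

section \<open>Lipschitz curves and coordinate projections\<close>

text \<open>Cut the interval into pieces of length \<open>h\<close> with L h \<le> \<delta>: the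
  diameters then add up to at most L (b - a), whatever \<delta> is. This finiteness makes
  \<open>H1\<close> sigma-finite on countably many curves, as Radon--Nikodym requires.\<close>

lemma H1_lipschitz_image:
  fixes f :: "real \<Rightarrow> pt"
  assumes f: "L-lipschitz_on UNIV f" and ab: "a \<le> b"
  shows "H1 (f ` {a..b}) \<le> ennreal (L * (b - a))"
proof (rule H1_leI)
  fix \<delta> :: real assume \<delta>: "0 < \<delta>"
  have L0: "0 \<le> L" using f by (rule lipschitz_on_nonneg)
  obtain n :: nat where n: "L * (b - a) / \<delta> < n" using reals_Archimedean2 by blast
  have n0: "0 < n" using n L0 ab \<delta> by (metis divide_nonneg_pos diff_ge_0_iff_ge gr0I mult_nonneg_nonneg not_less of_nat_0)
  define h where "h = (b - a) / n"
  have h0: "0 \<le> h" using ab by (simp add: h_def)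
  have Lh: "L * h \<le> \<delta>" using n n0 \<delta> by (simp add: h_def field_simps)
  define C where "C i = (if i < n then f ` {a + i * h .. a + (i + 1) * h} else {})" for i :: nat
  have diamC: "bounded (C i) \<and> diameter (C i) \<le> (if i < n then L * h else 0)" for i
  proof (cases "i < n")
    case True
    have "norm (x - y) \<le> L * h" if "x \<in> C i" "y \<in> C i" for x y
    proof -
      obtain s t where st: "x = f s" "y = f t" "s \<in> {a + i * h .. a + (i + 1) * h}" "t \<in> {a + i * h .. a + (i + 1) * h}"
        using \<open>x \<in> C i\<close> \<open>y \<in> C i\<close> True by (auto simp: C_def)
      have "norm (x - y) \<le> L * dist s t" using lipschitz_onD[OF f, of s t] st by (simp add: dist_norm)
      also have "\<dots> \<le> L * h" using st L0 by (intro mult_left_mono) (auto simp: dist_real_def algebra_simps)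
      finally show ?thesis .
    qed
    then have "diameter (C i) \<le> L * h" using L0 h0 by (intro diameter_le) auto
    moreover have "bounded (C i)" unfolding C_def using True f
      by (auto intro!: compact_imp_bounded compact_continuous_image continuous_on_subset[OF lipschitz_on_continuous_on])
    ultimately show ?thesis using True by simp
  qed (simp add: C_def)
  have "C \<in> H1_covers \<delta> (f ` {a..b})"
  proof -
    \<comment> \<open>The right end point is treated apart, because the floor formula would give it
      the index \<open>n\<close>, one past the last piece. That case also absorbs a = b, where
      \<open>h\<close> is 0.\<close>
    have "f t \<in> (\<Union>i. C i)" if t: "t \<in> {a..b}" for t
    proof (cases "t = b")
      case True
      have "real (n - 1) = real n - 1" using n0 by (simp add: of_nat_diff)
      then have "b \<in> {a + (n - 1) * h .. a + ((n - 1) + 1) * h}"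
        using n0 h0 by (auto simp: h_def field_simps)
      then have "f t \<in> C (n - 1)" using n0 True by (auto simp: C_def)
      then show ?thesis by blast
    next
      case False
      then have h: "0 < h" using t n0 by (auto simp: h_def)
      define i where "i = nat \<lfloor>(t - a) / h\<rfloor>"
      have i: "real i \<le> (t - a) / h" "(t - a) / h < real i + 1"
        using t h by (auto simp: i_def)
      have "(t - a) / h < real n" using False t n0 h by (simp add: h_def field_simps)
      then have "i < n" using i by linarith
      moreover have "t \<in> {a + i * h .. a + (i + 1) * h}" using i h by (auto simp: field_simps)
      ultimately have "f t \<in> C i" by (auto simp: C_def)
      then show ?thesis by blast
    qed
    moreover have "diameter (C i) \<le> \<delta>" for i using diamC[of i] Lh \<delta> by (auto split: if_splits)
    ultimately show ?thesis using diamC by (auto simp: H1_covers_def)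
  qed
  then have "H1_delta \<delta> (f ` {a..b}) \<le> (\<Sum>i. ennreal (diameter (C i)))"
    unfolding H1_delta_alt by (rule INF_lower)
  also have "\<dots> = (\<Sum>i<n. ennreal (diameter (C i)))"
    by (rule suminf_finite) (auto simp: C_def)
  also have "\<dots> \<le> (\<Sum>i<n. ennreal (L * h))"
    using diamC by (intro sum_mono ennreal_leI) (metis lessThan_iff)
  also have "\<dots> = ennreal (L * (b - a))"
    using n0 L0 h0 by (simp add: ennreal_of_nat_eq_real_of_nat ennreal_mult'[symmetric] h_def)
  finally show "H1_delta \<delta> (f ` {a..b}) \<le> ennreal (L * (b - a))" .
qed

text \<open>Projection does not increase distances, so the coordinates of a covering set lie within
  its diameter of the coordinate of any one of its points. Covers at scale 1 suffice, since only the
  sum of the diameters has to be small. The set \<open>Z\<close> stands in for the projection, which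
  need not be Borel.\<close>

lemma H1_null_projection:
  assumes A: "H1 A = 0"
  shows "\<exists>Z \<in> null_sets lborel. (\<lambda>x. x $ i) ` A \<subseteq> Z"
proof -
  have "H1_delta 1 A = 0" using H1_delta_le_H1[of 1 A] A by simp
  then have "\<exists>C \<in> H1_covers 1 A. (\<Sum>k. ennreal (diameter (C k))) < 0 + ennreal (1 / Suc n)" for n
    by (intro INF_approx_ennreal) (auto simp: H1_delta_alt)
  then obtain C where C: "\<And>n. C n \<in> H1_covers 1 A"
    "\<And>n. (\<Sum>k. ennreal (diameter (C n k))) < ennreal (1 / Suc n)" by (metis add_0)
  define c where "c n k = (SOME x. x \<in> C n k) $ i" for n k
  define I where "I n k = {c n k - diameter (C n k) .. c n k + diameter (C n k)}" for n k
  define Z where "Z = (\<Inter>n. \<Union>k. I n k)"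
  have em: "emeasure lborel (\<Union>k. I n k) \<le> 2 * ennreal (1 / Suc n)" for n
  proof -
    have "emeasure lborel (\<Union>k. I n k) \<le> (\<Sum>k. emeasure lborel (I n k))"
      by (intro emeasure_subadditive_countably) (auto simp: I_def)
    also have "\<dots> = (\<Sum>k. 2 * ennreal (diameter (C n k)))"
    proof (intro suminf_cong)
      fix k
      have "0 \<le> diameter (C n k)" using C(1)[of n] by (intro diameter_ge_0) (auto simp: H1_covers_def)
      then show "emeasure lborel (I n k) = 2 * ennreal (diameter (C n k))"
        by (simp add: I_def ennreal_mult'[symmetric] ennreal_numeral[symmetric] del: ennreal_numeral)
    qed
    also have "\<dots> = 2 * (\<Sum>k. ennreal (diameter (C n k)))" by simp
    also have "\<dots> \<le> 2 * ennreal (1 / Suc n)" using C(2)[of n] by (intro mult_left_mono) auto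
    finally show ?thesis .
  qed
  have Zs: "Z \<in> sets borel" unfolding Z_def I_def by measurable
  have "emeasure lborel Z \<le> 0"
  proof (rule ennreal_le_epsilon)
    fix e :: real assume "0 < e"
    then obtain n where n: "1 / Suc n < e / 2" using nat_approx_posE[of "e / 2"] by auto
    have "emeasure lborel Z \<le> emeasure lborel (\<Union>k. I n k)"
      by (intro emeasure_mono) (auto simp: Z_def I_def)
    also have "\<dots> \<le> 2 * ennreal (1 / Suc n)" by (rule em)
    also have "\<dots> \<le> ennreal e"
      using n by (simp add: ennreal_mult'[symmetric] ennreal_numeral[symmetric] ennreal_leI del: ennreal_numeral)
    finally show "emeasure lborel Z \<le> 0 + ennreal e" by simp
  qed
  then have "Z \<in> null_sets lborel" using Zs by (auto simp: null_sets_def)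
  moreover have "x $ i \<in> Z" if x: "x \<in> A" for x
    unfolding Z_def
  proof
    fix n
    obtain k where k: "x \<in> C n k" using C(1)[of n] x by (auto simp: H1_covers_def)
    define x0 where "x0 = (SOME x. x \<in> C n k)"
    have "x0 \<in> C n k" unfolding x0_def using k by (rule someI)
    then have "dist x x0 \<le> diameter (C n k)"
      using C(1)[of n] k by (intro diameter_bounded_bound) (auto simp: H1_covers_def)
    then have "\<bar>x $ i - x0 $ i\<bar> \<le> diameter (C n k)"
      using component_le_norm_cart[of "x - x0" i] by (simp add: dist_norm)
    then have "x $ i \<in> I n k" by (auto simp: I_def c_def x0_def[symmetric])
    then show "x $ i \<in> (\<Union>k. I n k)" by blast
  qed
  ultimately show ?thesis by blast
qed

section \<open>One-dimensional phase transitions\<close>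

text \<open>McShane's infimum formula. It serves to fill curves that are known only over the range
  of an increasing function with jumps.\<close>

lemma lipschitz_extension_real:
  fixes f :: "real \<Rightarrow> real"
  assumes L: "0 \<le> L" and f: "\<And>x y. x \<in> S \<Longrightarrow> y \<in> S \<Longrightarrow> \<bar>f x - f y\<bar> \<le> L * \<bar>x - y\<bar>"
  obtains F where "L-lipschitz_on UNIV F" "\<And>x. x \<in> S \<Longrightarrow> F x = f x"
proof (cases "S = {}")
  case True
  show ?thesis by (rule that[of "\<lambda>_. 0"]) (use L True in \<open>auto intro!: lipschitz_onI\<close>)
next
  case False
  then obtain s0 where s0: "s0 \<in> S" by blast
  define F where "F x = (INF s\<in>S. f s + L * \<bar>x - s\<bar>)" for x
  have bdd: "bdd_below ((\<lambda>s. f s + L * \<bar>x - s\<bar>) ` S)" for x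
  proof (rule bdd_belowI2)
    fix s assume s: "s \<in> S"
    have "f s0 - f s \<le> L * \<bar>s0 - s\<bar>" using f[OF s0 s] by linarith
    also have "\<dots> \<le> L * \<bar>x - s\<bar> + L * \<bar>x - s0\<bar>"
      using L by (simp add: distrib_left[symmetric] mult_left_mono)
    finally show "f s0 - L * \<bar>x - s0\<bar> \<le> f s + L * \<bar>x - s\<bar>" by linarith
  qed
  have le: "F x \<le> F y + L * \<bar>x - y\<bar>" for x y
  proof -
    have "F x - L * \<bar>x - y\<bar> \<le> F y"
      unfolding F_def[of y]
    proof (rule cINF_greatest[OF False])
      fix s assume s: "s \<in> S"
      have "F x \<le> f s + L * \<bar>x - s\<bar>" unfolding F_def by (rule cINF_lower[OF bdd s])
      also have "L * \<bar>x - s\<bar> \<le> L * \<bar>y - s\<bar> + L * \<bar>x - y\<bar>"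
        using L by (simp add: distrib_left[symmetric] mult_left_mono)
      finally show "F x - L * \<bar>x - y\<bar> \<le> f s + L * \<bar>y - s\<bar>" by linarith
    qed
    then show ?thesis by simp
  qed
  show ?thesis
  proof (rule that)
    show "L-lipschitz_on UNIV F"
    proof (rule lipschitz_onI[OF _ L])
      fix x y
      show "dist (F x) (F y) \<le> L * dist x y"
        using le[of x y] le[of y x] by (simp add: dist_real_def abs_minus_commute abs_le_iff)
    qed
    fix x assume x: "x \<in> S"
    have "F x \<le> f x + L * \<bar>x - x\<bar>" unfolding F_def by (rule cINF_lower[OF bdd x])
    moreover have "f x \<le> F x" unfolding F_def
      using f x by (intro cINF_greatest[OF False]) (auto simp: abs_le_iff algebra_simps)
    ultimately show "F x = f x" by simp
  qed
qed

text \<open>The positive and the negative part are densities of two finite measures that agree on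
  all rays, hence coincide.\<close>

lemma AE_zero_if_ray_integrals_zero:
  fixes w :: "real \<Rightarrow> real"
  assumes int: "integrable lborel w"
    and zero: "\<And>r. (\<integral>s. indicator {r<..} s * w s \<partial>lborel) = 0"
  shows "AE s in lborel. w s = 0"
proof -
  have [measurable]: "w \<in> borel_measurable borel" using int by simp
  define P where "P = density lborel (\<lambda>s. ennreal (max 0 (w s)))"
  define Q where "Q = density lborel (\<lambda>s. ennreal (max 0 (- w s)))"
  have ip: "integrable lborel (\<lambda>s. indicator {r<..} s * max 0 (c * w s))" for r c
    using int by (intro integrable_mult_indicator[where 'b = real, simplified]) auto
  have em: "emeasure (density lborel (\<lambda>s. ennreal (max 0 (c * w s)))) {r<..}
     = ennreal (\<integral>s. indicator {r<..} s * max 0 (c * w s) \<partial>lborel)" for r c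
  proof -
    have "emeasure (density lborel (\<lambda>s. ennreal (max 0 (c * w s)))) {r<..}
      = (\<integral>\<^sup>+s. ennreal (indicator {r<..} s * max 0 (c * w s)) \<partial>lborel)"
      by (subst emeasure_density) (auto intro!: nn_integral_cong split: split_indicator)
    also have "\<dots> = ennreal (\<integral>s. indicator {r<..} s * max 0 (c * w s) \<partial>lborel)"
      by (rule nn_integral_eq_integral[OF ip]) auto
    finally show ?thesis .
  qed
  have "P = Q"
  proof (rule measure_eqI_lessThan)
    show "sets P = sets borel" "sets Q = sets borel" by (auto simp: P_def Q_def)
    fix r
    show "emeasure P {r<..} < \<infinity>" using em[of 1 r] by (simp add: P_def)
    have "(\<integral>s. indicator {r<..} s * max 0 (w s) \<partial>lborel) - (\<integral>s. indicator {r<..} s * max 0 (- w s) \<partial>lborel)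
       = (\<integral>s. indicator {r<..} s * max 0 (w s) - indicator {r<..} s * max 0 (- w s) \<partial>lborel)"
      using ip[of r 1] ip[of r "-1"] by (intro Bochner_Integration.integral_diff[symmetric]) auto
    also have "\<dots> = (\<integral>s. indicator {r<..} s * w s \<partial>lborel)"
      by (intro Bochner_Integration.integral_cong) (auto simp: max_def split: split_indicator)
    finally show "emeasure P {r<..} = emeasure Q {r<..}"
      using em[of 1 r] em[of "-1" r] zero[of r] by (simp add: P_def Q_def)
  qed
  then have "AE s in lborel. ennreal (max 0 (w s)) = ennreal (max 0 (- w s))"
    unfolding P_def Q_def by (subst (asm) sigma_finite_measure.density_unique_iff[OF lborel.sigma_finite_measure_axioms]) auto
  then show ?thesis
  proof eventually_elim
    case (elim s)
    then have "max 0 (w s) = max 0 (- w s)" by (subst (asm) ennreal_inj) auto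
    then show ?case by (auto simp: max_def split: if_splits)
  qed
qed

section \<open>Counting the dips of a phase field of bounded energy\<close>

text \<open>If \<phi> stayed below 7/8 on the whole window, the potential alone would cost r / (128
  \<epsilon>) > K. So \<phi> takes both values 3/4 and 7/8 inside the window, and the energy density
  dominates the derivative of \<Phi> along \<phi>. The difference of s - s^2/2 at these two values
  is 3/128.\<close>

lemma dip_energy:
  fixes \<phi> d :: "real \<Rightarrow> real"
  assumes der: "\<And>y. (\<phi> has_real_derivative d y) (at y)" and cont: "continuous_on UNIV d"
    and eps: "0 < \<epsilon>" and K: "0 \<le> K"
    and energy: "(\<integral>\<^sup>+y. ennreal (\<epsilon> / 2 * (d y)\<^sup>2 + (1 - \<phi> y)\<^sup>2 / (2 * \<epsilon>)) \<partial>lborel) \<le> ennreal K"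
    and z: "\<phi> z < 3/4" and r: "128 * \<epsilon> * K < r"
  shows "ennreal (3/128) \<le> (\<integral>\<^sup>+y. ennreal (\<epsilon> / 2 * (d y)\<^sup>2 + (1 - \<phi> y)\<^sup>2 / (2 * \<epsilon>)) * indicator {z - r/2..<z + r/2} y \<partial>lborel)"
proof -
  define E where "E y = \<epsilon> / 2 * (d y)\<^sup>2 + (1 - \<phi> y)\<^sup>2 / (2 * \<epsilon>)" for y
  define I where "I = {z - r/2..<z + r/2}"
  have r0: "0 < r" using r eps K by (smt (verit) mult_nonneg_nonneg)
  have contphi: "continuous_on UNIV \<phi>"
    using der by (meson DERIV_isCont continuous_at_imp_continuous_on)
  have [measurable]: "\<phi> \<in> borel_measurable borel" "d \<in> borel_measurable borel"
    by (intro borel_measurable_continuous_onI contphi cont)+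
  have E0: "0 \<le> E y" for y unfolding E_def using eps by simp
  have "\<exists>p\<in>I. 7/8 \<le> \<phi> p"
  proof (rule ccontr)
    assume "\<not> ?thesis"
    then have low: "\<phi> y < 7/8" if "y \<in> I" for y using that by force
    have "ennreal (1 / (128 * \<epsilon>)) * emeasure lborel I = (\<integral>\<^sup>+y. ennreal (1 / (128 * \<epsilon>)) * indicator I y \<partial>lborel)"
      by (simp add: I_def nn_integral_cmult_indicator)
    also have "\<dots> \<le> (\<integral>\<^sup>+y. ennreal (E y) \<partial>lborel)"
    proof (rule nn_integral_mono)
      fix y
      show "ennreal (1 / (128 * \<epsilon>)) * indicator I y \<le> ennreal (E y)"
      proof (cases "y \<in> I")
        case True
        have "(1/8)\<^sup>2 \<le> (1 - \<phi> y)\<^sup>2" using low[OF True] by (intro power_mono) auto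
        then have "1/64 / (2 * \<epsilon>) \<le> (1 - \<phi> y)\<^sup>2 / (2 * \<epsilon>)"
          using eps by (intro divide_right_mono) (auto simp: power2_eq_square)
        then have "1 / (128 * \<epsilon>) \<le> E y" unfolding E_def using eps
          by (simp add: add_increasing)
        then show ?thesis using True by (simp add: ennreal_leI)
      qed simp
    qed
    also have "\<dots> \<le> ennreal K" using energy by (simp add: E_def)
    finally have "ennreal (1 / (128 * \<epsilon>)) * emeasure lborel I \<le> ennreal K" .
    moreover have "ennreal (1 / (128 * \<epsilon>) * r) = ennreal (1 / (128 * \<epsilon>)) * emeasure lborel I"
      using r0 by (subst ennreal_mult'') (auto simp: I_def)
    ultimately have "ennreal (1 / (128 * \<epsilon>) * r) \<le> ennreal K" by (simp only:)
    then have "r \<le> 128 * \<epsilon> * K" using eps K r0 by (simp add: field_simps)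
    then show False using r by simp
  qed
  then obtain p where p: "p \<in> I" "7/8 \<le> \<phi> p" by blast
  have zI: "z \<in> I" using r0 by (simp add: I_def)
  have ex: "\<exists>x. x \<in> closed_segment z p \<and> \<phi> x = c" if "3/4 \<le> c" "c \<le> 7/8" for c
  proof -
    have "\<exists>x\<in>closed_segment z p. \<phi> x = c"
    proof (cases "z \<le> p")
      case True
      have "\<exists>x\<ge>z. x \<le> p \<and> \<phi> x = c"
        using z p that True contphi by (intro IVT') (auto intro: continuous_on_subset)
      then show ?thesis using True by (auto simp: closed_segment_eq_real_ivl)
    next
      case False
      have "\<exists>x\<ge>p. x \<le> z \<and> \<phi> x = c"
        using z p that False contphi by (intro IVT2') (auto intro: continuous_on_subset)
      then show ?thesis using False by (auto simp: closed_segment_eq_real_ivl)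
    qed
    then show ?thesis by blast
  qed
  obtain u v where uv: "u \<in> closed_segment z p" "\<phi> u = 3/4" "v \<in> closed_segment z p" "\<phi> v = 7/8"
    using ex[of "3/4"] ex[of "7/8"] by auto
  have seg: "closed_segment z p \<subseteq> I"
    using zI p(1) by (auto simp: I_def closed_segment_eq_real_ivl split: if_splits)
  \<comment> \<open>The crossings may come in either order, as \<open>p\<close> can lie on either
    side of \<open>z\<close>; only the absolute increment is used.\<close>
  define lo where "lo = min u v"
  define hi where "hi = max u v"
  have sub: "{lo..hi} \<subseteq> I"
    using uv seg zI p(1) by (fastforce simp: lo_def hi_def I_def closed_segment_eq_real_ivl split: if_splits)
  define \<Phi> where "\<Phi> y = \<phi> y - (\<phi> y)\<^sup>2 / 2" for y
  define q where "q y = (1 - \<phi> y) * d y" for y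
  have FTC: "(\<integral>y. indicator {lo..hi} y *\<^sub>R q y \<partial>lborel) = \<Phi> hi - \<Phi> lo"
  proof (rule integral_FTC_Icc)
    show "lo \<le> hi" by (simp add: lo_def hi_def)
    show "(\<Phi> has_vector_derivative q x) (at x within {lo..hi})" for x
      unfolding \<Phi>_def[abs_def] q_def
      by (auto intro!: derivative_eq_intros DERIV_subset[OF der] simp: has_real_derivative_iff_has_vector_derivative[symmetric] algebra_simps)
    show "continuous_on {lo..hi} q" unfolding q_def
      by (intro continuous_intros continuous_on_subset[OF contphi] continuous_on_subset[OF cont]) auto
  qed
  have "\<bar>\<Phi> hi - \<Phi> lo\<bar> = 3/128"
    by (cases "u \<le> v") (simp_all add: lo_def hi_def \<Phi>_def uv(2,4) power2_eq_square)
  moreover have intE: "integrable lborel (\<lambda>y. indicator {lo..hi} y *\<^sub>R E y)"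
    unfolding E_def using eps by (intro borel_integrable_compact[unfolded set_integrable_def] continuous_intros continuous_on_subset[OF contphi] continuous_on_subset[OF cont]) auto
  moreover have intq: "integrable lborel (\<lambda>y. indicator {lo..hi} y *\<^sub>R q y)"
    unfolding q_def by (intro borel_integrable_compact[unfolded set_integrable_def] continuous_intros continuous_on_subset[OF contphi] continuous_on_subset[OF cont]) auto
  \<comment> \<open>The Modica--Mortola inequality, by expanding the square of \<epsilon> |d| - |1 -
    \<phi>|.\<close>
  have qE: "\<bar>q y\<bar> \<le> E y" for y
  proof -
    have "0 \<le> (\<epsilon> * \<bar>d y\<bar> - \<bar>1 - \<phi> y\<bar>)\<^sup>2 / (2 * \<epsilon>)" using eps by simp
    also have "\<dots> = E y - \<bar>q y\<bar>" using eps
      by (simp add: E_def q_def power2_eq_square field_simps abs_mult) (simp add: algebra_simps flip: abs_mult power2_eq_square)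
    finally show ?thesis by simp
  qed
  have "\<bar>\<Phi> hi - \<Phi> lo\<bar> \<le> (\<integral>y. indicator {lo..hi} y *\<^sub>R E y \<partial>lborel)"
    unfolding FTC[symmetric]
    using qE by (intro integral_abs_bound[THEN order_trans] integral_mono intE integrable_abs intq)
      (auto split: split_indicator)
  ultimately have "3/128 \<le> (\<integral>y. indicator {lo..hi} y *\<^sub>R E y \<partial>lborel)" by simp
  then have "ennreal (3/128) \<le> ennreal (\<integral>y. indicator {lo..hi} y *\<^sub>R E y \<partial>lborel)" by (rule ennreal_leI)
  also have "\<dots> = (\<integral>\<^sup>+y. ennreal (indicator {lo..hi} y *\<^sub>R E y) \<partial>lborel)"
    using intE E0 by (intro nn_integral_eq_integral[symmetric]) auto
  also have "\<dots> \<le> (\<integral>\<^sup>+y. ennreal (E y) * indicator I y \<partial>lborel)"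
    using sub by (intro nn_integral_mono) (auto split: split_indicator)
  finally show ?thesis by (simp add: E_def I_def)
qed

text \<open>Half-open windows of length \<open>r\<close> around \<open>r\<close>-separated points
  are disjoint, and each of them costs 3/128.\<close>

lemma few_dips:
  fixes \<phi> d :: "real \<Rightarrow> real"
  assumes der: "\<And>y. (\<phi> has_real_derivative d y) (at y)" and cont: "continuous_on UNIV d"
    and eps: "0 < \<epsilon>" and K: "0 \<le> K"
    and energy: "(\<integral>\<^sup>+y. ennreal (\<epsilon> / 2 * (d y)\<^sup>2 + (1 - \<phi> y)\<^sup>2 / (2 * \<epsilon>)) \<partial>lborel) \<le> ennreal K"
    and r: "128 * \<epsilon> * K < r"
    and Z: "finite Z" "\<And>z. z \<in> Z \<Longrightarrow> \<phi> z < 3/4" "\<And>x y. x \<in> Z \<Longrightarrow> y \<in> Z \<Longrightarrow> x \<noteq> y \<Longrightarrow> r \<le> \<bar>x - y\<bar>"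
  shows "real (card Z) * (3/128) \<le> K"
proof -
  define E where "E y = ennreal (\<epsilon> / 2 * (d y)\<^sup>2 + (1 - \<phi> y)\<^sup>2 / (2 * \<epsilon>))" for y
  have contphi: "continuous_on UNIV \<phi>"
    using der by (meson DERIV_isCont continuous_at_imp_continuous_on)
  have [measurable]: "\<phi> \<in> borel_measurable borel" "d \<in> borel_measurable borel"
    by (intro borel_measurable_continuous_onI contphi cont)+
  have [measurable]: "E \<in> borel_measurable borel" unfolding E_def by measurable
  have "ennreal (real (card Z) * (3/128)) = (\<Sum>z\<in>Z. ennreal (3/128))"
    by (subst ennreal_mult'') (auto simp: ennreal_of_nat_eq_real_of_nat)
  also have "\<dots> \<le> (\<Sum>z\<in>Z. \<integral>\<^sup>+y. E y * indicator {z - r/2..<z + r/2} y \<partial>lborel)"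
    unfolding E_def using Z by (intro sum_mono dip_energy[OF der cont eps K energy _ r]) auto
  also have "\<dots> = (\<integral>\<^sup>+y. (\<Sum>z\<in>Z. E y * indicator {z - r/2..<z + r/2} y) \<partial>lborel)"
    by (rule nn_integral_sum[symmetric]) simp
  also have "\<dots> \<le> (\<integral>\<^sup>+y. E y \<partial>lborel)"
  proof (rule nn_integral_mono)
    fix y
    show "(\<Sum>z\<in>Z. E y * indicator {z - r/2..<z + r/2} y) \<le> E y"
    proof (cases "\<exists>z\<in>Z. y \<in> {z - r/2..<z + r/2}")
      case True
      then obtain z where z: "z \<in> Z" "y \<in> {z - r/2..<z + r/2}" by blast
      have "y \<notin> {z' - r/2..<z' + r/2}" if "z' \<in> Z - {z}" for z'
        using Z(3)[of z z'] z that by (auto simp: abs_if split: if_splits)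
      then have 0: "(\<Sum>z\<in>Z - {z}. E y * indicator {z - r/2..<z + r/2} y) = 0"
        by (intro sum.neutral) auto
      show ?thesis unfolding sum.remove[OF Z(1) z(1)] 0 using z(2) by simp
    next
      case False
      then have "(\<Sum>z\<in>Z. E y * indicator {z - r/2..<z + r/2} y) = 0"
        by (intro sum.neutral) auto
      then show ?thesis by simp
    qed
  qed
  also have "\<dots> \<le> ennreal K" using energy by (simp add: E_def)
  finally show ?thesis using K by simp
qed

text \<open>Separated sets of dips have bounded size, so there is one of maximal size; a dip at
  distance \<open>r\<close> or more from all its points could be added to it.\<close>

lemma dips_cover:
  fixes \<phi> d :: "real \<Rightarrow> real"
  assumes der: "\<And>y. (\<phi> has_real_derivative d y) (at y)" and cont: "continuous_on UNIV d"
    and eps: "0 < \<epsilon>" and K: "0 \<le> K"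
    and energy: "(\<integral>\<^sup>+y. ennreal (\<epsilon> / 2 * (d y)\<^sup>2 + (1 - \<phi> y)\<^sup>2 / (2 * \<epsilon>)) \<partial>lborel) \<le> ennreal K"
    and r: "128 * \<epsilon> * K < r"
  obtains Z where "finite Z" "Z \<subseteq> S" "card Z \<le> nat \<lfloor>128 * K / 3\<rfloor>"
    "\<And>y. y \<in> S \<Longrightarrow> \<phi> y < 3/4 \<Longrightarrow> \<exists>z\<in>Z. \<bar>y - z\<bar> < r"
proof -
  define P where "P Z \<longleftrightarrow> finite Z \<and> Z \<subseteq> {y\<in>S. \<phi> y < 3/4} \<and> (\<forall>x\<in>Z. \<forall>y\<in>Z. x \<noteq> y \<longrightarrow> r \<le> \<bar>x - y\<bar>)" for Z
  have bd: "card Z \<le> nat \<lfloor>128 * K / 3\<rfloor>" if "P Z" for Z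
  proof -
    have "real (card Z) * (3/128) \<le> K"
      using that by (intro few_dips[OF der cont eps K energy r]) (auto simp: P_def)
    then have "real (card Z) \<le> 128 * K / 3" by simp
    then show ?thesis using K by (simp add: le_nat_floor)
  qed
  have "P {}" by (simp add: P_def)
  then have "\<exists>Z. P Z \<and> (\<forall>Z'. P Z' \<longrightarrow> card Z' \<le> card Z)"
    by (rule ex_has_greatest_nat[of P "{}" card "Suc (nat \<lfloor>128 * K / 3\<rfloor>)"]) (auto simp: less_Suc_eq_le bd)
  then obtain Z where Z: "P Z" "\<And>Z'. P Z' \<Longrightarrow> card Z' \<le> card Z" by blast
  show ?thesis
  proof (rule that)
    show "finite Z" "Z \<subseteq> S" using Z by (auto simp: P_def)
    show "card Z \<le> nat \<lfloor>128 * K / 3\<rfloor>" using bd Z by blast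
    fix y assume y: "y \<in> S" "\<phi> y < 3/4"
    show "\<exists>z\<in>Z. \<bar>y - z\<bar> < r"
    proof (rule ccontr)
      assume "\<not> ?thesis"
      then have far: "r \<le> \<bar>y - z\<bar>" if "z \<in> Z" for z using that by force
      have r0: "0 < r" using r eps K by (smt (verit) mult_nonneg_nonneg)
      then have "y \<notin> Z" using far[of y] by auto
      have "P (insert y Z)"
        using Z(1) y far by (auto simp: P_def abs_minus_commute)
      then show False using Z(2)[of "insert y Z"] \<open>y \<notin> Z\<close> Z(1) by (simp add: P_def)
    qed
  qed
qed

text \<open>Induction on the size bound: one point is taken out of every set and made to converge
  along a further subsequence, while the induction hypothesis handles the rest.\<close>

lemma finite_sets_subseq:
  fixes Z :: "nat \<Rightarrow> real set"
  assumes "0 \<le> R" "\<And>j. finite (Z j)" "\<And>j. Z j \<subseteq> {-R..R}" "\<And>j. card (Z j) \<le> k"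
  shows "\<exists>r Y. strict_mono (r :: nat \<Rightarrow> nat) \<and> finite Y \<and> Y \<subseteq> {-R..R} \<and>
    (\<forall>e>0. \<forall>\<^sub>F j in sequentially. \<forall>z\<in>Z (r j). \<exists>y\<in>Y. \<bar>z - y\<bar> < e)"
  using assms
proof (induction k arbitrary: Z)
  case 0
  then have "Z j = {}" for j by (metis card_0_eq le_zero_eq)
  then show ?case by (intro exI[of _ id] exI[of _ "{}"]) (auto simp: strict_mono_def)
next
  case (Suc k)
  \<comment> \<open>An empty set contributes the dummy point 0, which lies in the compact interval
    and whose removal changes nothing.\<close>
  define z where "z j = (if Z j = {} then 0 else SOME x. x \<in> Z j)" for j
  have zin: "z j \<in> Z j" if "Z j \<noteq> {}" for j
    using that by (auto simp: z_def intro: someI_ex)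
  have zR: "z j \<in> {-R..R}" for j
    using zin[of j] Suc.prems(3)[of j] Suc.prems(1) by (cases "Z j = {}") (auto simp: z_def)
  have "card (Z j - {z j}) \<le> k" for j
    using Suc.prems(2)[of j] Suc.prems(4)[of j] zin[of j] by (cases "Z j = {}") auto
  moreover have "finite (Z j - {z j})" "Z j - {z j} \<subseteq> {-R..R}" for j
    using Suc.prems(2,3)[of j] by auto
  ultimately have "\<exists>r Y. strict_mono (r :: nat \<Rightarrow> nat) \<and> finite Y \<and> Y \<subseteq> {-R..R} \<and>
    (\<forall>e>0. \<forall>\<^sub>F j in sequentially. \<forall>x\<in>Z (r j) - {z (r j)}. \<exists>y\<in>Y. \<bar>x - y\<bar> < e)"
    by (intro Suc.IH[of "\<lambda>j. Z j - {z j}"] Suc.prems(1))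
  then obtain r Y where r: "strict_mono (r :: nat \<Rightarrow> nat)" "finite Y" "Y \<subseteq> {-R..R}"
    "\<And>e. 0 < e \<Longrightarrow> \<forall>\<^sub>F j in sequentially. \<forall>x\<in>Z (r j) - {z (r j)}. \<exists>y\<in>Y. \<bar>x - y\<bar> < e" by blast
  have "\<forall>n. (z \<circ> r) n \<in> {-R..R}" using zR by simp
  then obtain y0 r' where r': "y0 \<in> {-R..R}" "strict_mono (r' :: nat \<Rightarrow> nat)" "((z \<circ> r) \<circ> r') \<longlonglongrightarrow> y0"
    using compact_Icc[of "-R" R] unfolding compact_def by meson
  show ?case
  proof (intro exI conjI allI impI)
    show "strict_mono (r \<circ> r')" using r(1) r'(2) by (rule strict_mono_o)
    show "finite (insert y0 Y)" "insert y0 Y \<subseteq> {-R..R}" using r r' by auto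
    fix e :: real assume e: "0 < e"
    have "\<forall>\<^sub>F j in sequentially. \<forall>x\<in>Z (r (r' j)) - {z (r (r' j))}. \<exists>y\<in>Y. \<bar>x - y\<bar> < e"
      using eventually_subseq[OF r'(2) r(4)[OF e]] .
    moreover have "\<forall>\<^sub>F j in sequentially. dist (((z \<circ> r) \<circ> r') j) y0 < e"
      using r'(3) e by (rule tendstoD)
    ultimately show "\<forall>\<^sub>F j in sequentially. \<forall>x\<in>Z ((r \<circ> r') j). \<exists>y\<in>insert y0 Y. \<bar>x - y\<bar> < e"
    proof eventually_elim
      case (elim j)
      show ?case
      proof
        fix x assume x: "x \<in> Z ((r \<circ> r') j)"
        show "\<exists>y\<in>insert y0 Y. \<bar>x - y\<bar> < e"
        proof (cases "x = z (r (r' j))")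
          case True
          then show ?thesis using elim(2) by (auto simp: dist_real_def)
        next
          case False
          then show ?thesis using elim(1) x by auto
        qed
      qed
    qed
  qed
qed

lemma integrable_continuous_mult:
  fixes w f :: "'a :: euclidean_space \<Rightarrow> real"
  assumes w: "integrable M w" and sM: "sets M = sets borel" and supp: "AE x in M. w x \<noteq> 0 \<longrightarrow> x \<in> S" and S: "compact S"
    and f: "continuous_on UNIV f"
  shows "integrable M (\<lambda>x. f x * w x)"
proof -
  have "compact (f ` S)" using f S by (intro compact_continuous_image) (auto intro: continuous_on_subset)
  from compact_imp_bounded[OF this, unfolded bounded_iff]
  obtain B where B: "\<forall>y\<in>f ` S. norm y \<le> B" ..
  show ?thesis
  proof (rule Bochner_Integration.integrable_bound)
    show "integrable M (\<lambda>x. B * w x)" using w by simp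
    have "f \<in> borel_measurable M"
      using borel_measurable_continuous_onI[OF f] sM by (simp cong: measurable_cong_sets)
    then show "(\<lambda>x. f x * w x) \<in> borel_measurable M"
      using borel_measurable_integrable[OF w] by simp
    show "AE x in M. norm (f x * w x) \<le> norm (B * w x)"
      using supp
    proof eventually_elim
      case (elim x)
      show ?case
      proof (cases "w x = 0")
        case False
        then have "norm (f x) \<le> B" using elim B by blast
        then show ?thesis by (simp add: abs_mult mult_right_mono)
      qed simp
    qed
  qed
qed

text \<open>Along a subsequence the dips shrink to the points of \<open>Y\<close>. Elsewhere \<phi>
  \<ge> 3/4, and there \<open>w\<close> disappears in the limit by \<open>small\<close>; so a limit
  pairing feels the test function only on \<open>Y\<close>. Passing to a subsequence is harmless
  because the pairing is assumed to converge along the full sequence.\<close>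

lemma slice_concentration:
  fixes w \<phi> d :: "nat \<Rightarrow> real \<Rightarrow> real"
  assumes der: "\<And>j y. (\<phi> j has_real_derivative d j y) (at y)" and cont: "\<And>j. continuous_on UNIV (d j)"
    and eps: "\<And>j. 0 < \<epsilon> j" "\<epsilon> \<longlonglongrightarrow> 0" and K: "0 \<le> K" and R: "0 \<le> R"
    and energy: "\<And>j. (\<integral>\<^sup>+y. ennreal (\<epsilon> j / 2 * (d j y)\<^sup>2 + (1 - \<phi> j y)\<^sup>2 / (2 * \<epsilon> j)) \<partial>lborel) \<le> ennreal K"
    and w: "\<And>j. integrable lborel (w j)" "\<And>j y. w j y \<noteq> 0 \<Longrightarrow> y \<in> {-R..R}"
    and mass: "\<And>j. (\<integral>y. \<bar>w j y\<bar> \<partial>lborel) \<le> K"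
    and small: "(\<lambda>j. \<integral>y. indicator {y. 3/4 \<le> \<phi> j y} y * \<bar>w j y\<bar> \<partial>lborel) \<longlonglongrightarrow> 0"
  shows "\<exists>Y. finite Y \<and> Y \<subseteq> {-R..R} \<and>
    (\<forall>f l M. continuous_on UNIV f \<longrightarrow> (\<lambda>j. \<integral>y. f y * w j y \<partial>lborel) \<longlonglongrightarrow> l \<longrightarrow>
      0 \<le> M \<longrightarrow> (\<forall>y\<in>Y. \<bar>f y\<bar> \<le> M) \<longrightarrow> \<bar>l\<bar> \<le> K * M)"
proof -
  \<comment> \<open>Just above the width 128 \<epsilon> K demanded by the counting of dips, positive
    also for K = 0, and tending to 0.\<close>
  define r where "r j = \<epsilon> j * (128 * K + 1)" for j
  have "\<exists>Z. finite Z \<and> Z \<subseteq> {-R..R} \<and> card Z \<le> nat \<lfloor>128 * K / 3\<rfloor> \<and>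
    (\<forall>y\<in>{-R..R}. \<phi> j y < 3/4 \<longrightarrow> (\<exists>z\<in>Z. \<bar>y - z\<bar> < r j))" for j
  proof -
    have *: "128 * \<epsilon> j * K < r j" using eps(1)[of j] by (simp add: r_def algebra_simps)
    show ?thesis
      by (rule dips_cover[OF der cont eps(1) K energy *, of "{-R..R}"]) blast
  qed
  from choice[OF allI[OF this]] obtain Z where Z0: "\<forall>j. finite (Z j) \<and> Z j \<subseteq> {-R..R} \<and>
    card (Z j) \<le> nat \<lfloor>128 * K / 3\<rfloor> \<and>
    (\<forall>y\<in>{-R..R}. \<phi> j y < 3/4 \<longrightarrow> (\<exists>z\<in>Z j. \<bar>y - z\<bar> < r j))" ..
  then have Z: "\<And>j. finite (Z j)" "\<And>j. Z j \<subseteq> {-R..R}" "\<And>j. card (Z j) \<le> nat \<lfloor>128 * K / 3\<rfloor>"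
    "\<And>j y. y \<in> {-R..R} \<Longrightarrow> \<phi> j y < 3/4 \<Longrightarrow> \<exists>z\<in>Z j. \<bar>y - z\<bar> < r j" by simp_all
  from finite_sets_subseq[of R Z, OF R Z(1,2,3)]
  obtain s Y where s: "strict_mono (s :: nat \<Rightarrow> nat)" and Y: "finite Y" "Y \<subseteq> {-R..R}"
    "\<And>e. 0 < e \<Longrightarrow> \<forall>\<^sub>F j in sequentially. \<forall>z\<in>Z (s j). \<exists>y\<in>Y. \<bar>z - y\<bar> < e"
    by blast
  have [measurable]: "\<phi> j \<in> borel_measurable borel" for j
    using der by (intro borel_measurable_continuous_onI) (meson DERIV_isCont continuous_at_imp_continuous_on)
  have main: "\<bar>l\<bar> \<le> K * M" if f: "continuous_on UNIV f" and l: "(\<lambda>j. \<integral>y. f y * w j y \<partial>lborel) \<longlonglongrightarrow> l"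
    and M: "0 \<le> M" "\<And>y. y \<in> Y \<Longrightarrow> \<bar>f y\<bar> \<le> M" for f l M
  proof (rule field_le_epsilon)
    fix e :: real assume "0 < e"
    define e1 where "e1 = e / (K + 1)"
    have e1: "0 < e1" "K * e1 \<le> e" using \<open>0 < e\<close> K by (auto simp: e1_def field_simps)
    have "\<exists>\<delta>>0. \<forall>x. \<bar>x - y\<bar> < \<delta> \<longrightarrow> \<bar>f x - f y\<bar> < e1" for y
      using f e1(1) unfolding continuous_on_iff dist_real_def by simp
    from choice[OF allI[OF this]] obtain \<delta> where "\<forall>y. 0 < \<delta> y \<and> (\<forall>x. \<bar>x - y\<bar> < \<delta> y \<longrightarrow> \<bar>f x - f y\<bar> < e1)" ..
    then have \<delta>: "\<And>y. 0 < \<delta> y" "\<And>x y. \<bar>x - y\<bar> < \<delta> y \<Longrightarrow> \<bar>f x - f y\<bar> < e1" by simp_all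
    define \<delta>0 where "\<delta>0 = Min (insert 1 (\<delta> ` Y))"
    have \<delta>0: "0 < \<delta>0" "\<And>y. y \<in> Y \<Longrightarrow> \<delta>0 \<le> \<delta> y"
      using Y(1) \<delta>(1) by (auto simp: \<delta>0_def)
    have "compact (f ` {-R..R})" using f by (intro compact_continuous_image) (auto intro: continuous_on_subset)
    from compact_imp_bounded[OF this, unfolded bounded_iff]
    obtain B where "\<forall>y\<in>f ` {-R..R}. norm y \<le> B" ..
    then have B: "\<And>y. y \<in> {-R..R} \<Longrightarrow> \<bar>f y\<bar> \<le> B" by simp
    have B0: "0 \<le> B" using B[of 0] R by auto
    have "r \<longlonglongrightarrow> 0" unfolding r_def using eps(2) by (intro tendsto_mult_left_zero)
    then have "(\<lambda>j. r (s j)) \<longlonglongrightarrow> 0" using LIMSEQ_subseq_LIMSEQ[OF _ s, of r 0] by (simp add: o_def)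
    then have "\<forall>\<^sub>F j in sequentially. r (s j) < \<delta>0 / 2" using \<delta>0(1) by (intro order_tendstoD) auto
    moreover have "\<forall>\<^sub>F j in sequentially. \<forall>z\<in>Z (s j). \<exists>y\<in>Y. \<bar>z - y\<bar> < \<delta>0 / 2"
      using \<delta>0(1) by (intro Y(3)) simp
    ultimately have ev: "\<forall>\<^sub>F j in sequentially. \<bar>\<integral>y. f y * w (s j) y \<partial>lborel\<bar>
        \<le> (M + e1) * K + B * (\<integral>y. indicator {y. 3/4 \<le> \<phi> (s j) y} y * \<bar>w (s j) y\<bar> \<partial>lborel)"
    proof eventually_elim
      case (elim j)
      have near: "\<bar>f x\<bar> \<le> M + e1" if x: "x \<in> {-R..R}" "\<phi> (s j) x < 3/4" for x
      proof -
        obtain z where z: "z \<in> Z (s j)" "\<bar>x - z\<bar> < r (s j)" using Z(4)[OF x] by blast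
        obtain y where y: "y \<in> Y" "\<bar>z - y\<bar> < \<delta>0 / 2" using elim(2) z(1) by blast
        have "\<bar>x - y\<bar> < \<delta> y" using z(2) y(2) elim(1) \<delta>0(2)[OF y(1)] by linarith
        then have "\<bar>f x - f y\<bar> < e1" by (rule \<delta>(2))
        then show ?thesis using M(2)[OF y(1)] by linarith
      qed
      let ?I = "\<lambda>y. indicator {y. 3/4 \<le> \<phi> (s j) y} y * \<bar>w (s j) y\<bar> :: real"
      have i1: "integrable lborel ?I"
        using w(1)[of "s j"] by (intro integrable_mult_indicator[where 'b = real, simplified]) auto
      have i2: "integrable lborel (\<lambda>y. f y * w (s j) y)"
        using w f by (intro integrable_continuous_mult[of _ _ "{-R..R}"]) auto
      \<comment> \<open>In a dip the point is close to \<open>Y\<close>, so |f| \<le> M + e1;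
        outside the dips only the bound \<open>B\<close> is available, but the mass there tends to
        0.\<close>
      have pt: "\<bar>f y * w (s j) y\<bar> \<le> (M + e1) * \<bar>w (s j) y\<bar> + B * ?I y" for y
      proof (cases "w (s j) y = 0")
        case False
        then have yR: "y \<in> {-R..R}" by (rule w(2))
        show ?thesis
        proof (cases "3/4 \<le> \<phi> (s j) y")
          case True
          have "\<bar>f y\<bar> * \<bar>w (s j) y\<bar> \<le> B * \<bar>w (s j) y\<bar>" using B[OF yR] by (intro mult_right_mono) auto
          moreover have "0 \<le> (M + e1) * \<bar>w (s j) y\<bar>" using M(1) e1(1) by simp
          ultimately show ?thesis using True by (simp add: abs_mult)
        next
          case False
          then have "\<bar>f y\<bar> * \<bar>w (s j) y\<bar> \<le> (M + e1) * \<bar>w (s j) y\<bar>" using near[OF yR] by (intro mult_right_mono) auto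
          then show ?thesis using False by (simp add: abs_mult)
        qed
      qed simp
      have "\<bar>\<integral>y. f y * w (s j) y \<partial>lborel\<bar> \<le> (\<integral>y. \<bar>f y * w (s j) y\<bar> \<partial>lborel)"
        by (rule integral_abs_bound)
      also have "\<dots> \<le> (\<integral>y. (M + e1) * \<bar>w (s j) y\<bar> + B * ?I y \<partial>lborel)"
        using i1 i2 w(1)[of "s j"] pt
        by (intro integral_mono integrable_abs Bochner_Integration.integrable_add integrable_mult_right) auto
      also have "\<dots> = (M + e1) * (\<integral>y. \<bar>w (s j) y\<bar> \<partial>lborel) + B * (\<integral>y. ?I y \<partial>lborel)"
        using i1 w(1)[of "s j"] by (subst Bochner_Integration.integral_add) auto
      also have "\<dots> \<le> (M + e1) * K + B * (\<integral>y. ?I y \<partial>lborel)"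
        using mass M(1) e1(1) by (intro add_right_mono mult_left_mono) auto
      finally show ?case .
    qed
    have lim1: "(\<lambda>j. (M + e1) * K + B * (\<integral>y. indicator {y. 3/4 \<le> \<phi> (s j) y} y * \<bar>w (s j) y\<bar> \<partial>lborel)) \<longlonglongrightarrow> (M + e1) * K + B * 0"
      using LIMSEQ_subseq_LIMSEQ[OF small s] by (intro tendsto_intros) (simp add: o_def)
    have lim2: "(\<lambda>j. \<bar>\<integral>y. f y * w (s j) y \<partial>lborel\<bar>) \<longlonglongrightarrow> \<bar>l\<bar>"
      using LIMSEQ_subseq_LIMSEQ[OF l s] by (intro tendsto_intros) (simp add: o_def)
    have "\<bar>l\<bar> \<le> (M + e1) * K + B * 0"
      by (rule tendsto_le[OF _ lim1 lim2 ev]) simp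
    then show "\<bar>l\<bar> \<le> K * M + e" using e1(2) by (simp add: algebra_simps)
  qed
  show ?thesis
    by (intro exI[of _ Y] conjI allI impI Y(1,2)) (rule main, assumption+, erule (1) bspec)
qed

text \<open>The products are Lagrange polynomials in the application. Expanding one affine factor
  raises the power of y by one, hence the extra factor y ^ k in the induction.\<close>

lemma convergent_integrals_prod_affine:
  fixes w :: "nat \<Rightarrow> real \<Rightarrow> real"
  assumes w: "\<And>j. integrable lborel (w j)" "\<And>j y. w j y \<noteq> 0 \<Longrightarrow> y \<in> {-R..R}"
    and conv: "\<And>k. convergent (\<lambda>j. \<integral>y. y ^ k * w j y \<partial>lborel)"
    and Z: "finite Z"
  shows "convergent (\<lambda>j. \<integral>y. (y ^ k * (\<Prod>z\<in>Z. (y - z) * c z)) * w j y \<partial>lborel)"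
  using Z
proof (induction Z arbitrary: k)
  case empty
  then show ?case using conv by simp
next
  case (insert x Z)
  have int: "integrable lborel (\<lambda>y. (y ^ k * (\<Prod>z\<in>Z. (y - z) * c z)) * w j y)" for k j
    using w by (intro integrable_continuous_mult[of _ _ "{-R..R}"] continuous_intros) auto
  have "(\<integral>y. (y ^ k * (\<Prod>z\<in>insert x Z. (y - z) * c z)) * w j y \<partial>lborel) =
      c x * (\<integral>y. (y ^ Suc k * (\<Prod>z\<in>Z. (y - z) * c z)) * w j y \<partial>lborel)
      - x * c x * (\<integral>y. (y ^ k * (\<Prod>z\<in>Z. (y - z) * c z)) * w j y \<partial>lborel)" for j
  proof -
    have "(\<integral>y. (y ^ k * (\<Prod>z\<in>insert x Z. (y - z) * c z)) * w j y \<partial>lborel) =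
      (\<integral>y. c x * ((y ^ Suc k * (\<Prod>z\<in>Z. (y - z) * c z)) * w j y)
         - x * c x * ((y ^ k * (\<Prod>z\<in>Z. (y - z) * c z)) * w j y) \<partial>lborel)"
      using insert.hyps by (intro Bochner_Integration.integral_cong) (auto simp: algebra_simps)
    also have "\<dots> = c x * (\<integral>y. (y ^ Suc k * (\<Prod>z\<in>Z. (y - z) * c z)) * w j y \<partial>lborel)
      - x * c x * (\<integral>y. (y ^ k * (\<Prod>z\<in>Z. (y - z) * c z)) * w j y \<partial>lborel)"
      by (subst Bochner_Integration.integral_diff)
        (simp_all only: integral_mult_right_zero integrable_mult_right int)
    finally show ?thesis .
  qed
  then show ?case
    using insert.IH[of "Suc k"] insert.IH[of k] by (simp only:) (intro convergent_diff convergent_mult convergent_const)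
qed

text \<open>Lagrange interpolation at the concentration points: a continuous function minus its
  interpolant vanishes on \<open>Y\<close>, so its limit pairing is at most K * 0. Hence the pairing
  is that of the interpolant, a fixed combination of the values on \<open>Y\<close>. Convergence of
  the moments provides the coefficients, so only countably many pairings have to converge.\<close>

lemma slice_atomic:
  fixes w \<phi> d :: "nat \<Rightarrow> real \<Rightarrow> real"
  assumes der: "\<And>j y. (\<phi> j has_real_derivative d j y) (at y)" and cont: "\<And>j. continuous_on UNIV (d j)"
    and eps: "\<And>j. 0 < \<epsilon> j" "\<epsilon> \<longlonglongrightarrow> 0" and K: "0 \<le> K" and R: "0 \<le> R"
    and energy: "\<And>j. (\<integral>\<^sup>+y. ennreal (\<epsilon> j / 2 * (d j y)\<^sup>2 + (1 - \<phi> j y)\<^sup>2 / (2 * \<epsilon> j)) \<partial>lborel) \<le> ennreal K"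
    and w: "\<And>j. integrable lborel (w j)" "\<And>j y. w j y \<noteq> 0 \<Longrightarrow> y \<in> {-R..R}"
    and mass: "\<And>j. (\<integral>y. \<bar>w j y\<bar> \<partial>lborel) \<le> K"
    and small: "(\<lambda>j. \<integral>y. indicator {y. 3/4 \<le> \<phi> j y} y * \<bar>w j y\<bar> \<partial>lborel) \<longlonglongrightarrow> 0"
    and conv: "\<And>k. convergent (\<lambda>j. \<integral>y. y ^ k * w j y \<partial>lborel)"
  shows "\<exists>Y c. finite Y \<and> Y \<subseteq> {-R..R} \<and> (\<forall>y\<in>Y. c y \<noteq> 0) \<and>
    (\<forall>f l. continuous_on UNIV f \<longrightarrow> (\<lambda>j. \<integral>y. f y * w j y \<partial>lborel) \<longlonglongrightarrow> l \<longrightarrow> l = (\<Sum>y\<in>Y. c y * f y)) \<and>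
    (\<forall>v M. 0 \<le> M \<longrightarrow> (\<forall>y\<in>Y. \<bar>v y\<bar> \<le> M) \<longrightarrow> \<bar>\<Sum>y\<in>Y. c y * v y\<bar> \<le> K * M)"
proof -
  have "\<exists>Y. finite Y \<and> Y \<subseteq> {-R..R} \<and>
    (\<forall>f l M. continuous_on UNIV f \<longrightarrow> (\<lambda>j. \<integral>y. f y * w j y \<partial>lborel) \<longlonglongrightarrow> l \<longrightarrow>
      0 \<le> M \<longrightarrow> (\<forall>y\<in>Y. \<bar>f y\<bar> \<le> M) \<longrightarrow> \<bar>l\<bar> \<le> K * M)"
    by (rule slice_concentration[OF der cont eps K R energy w(1) _ mass small]) (rule w(2))
  then obtain Y where Y: "finite Y" "Y \<subseteq> {-R..R}" and le:
     "\<forall>f l M. continuous_on UNIV f \<longrightarrow> (\<lambda>j. \<integral>y. f y * w j y \<partial>lborel) \<longlonglongrightarrow> l \<longrightarrow>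
      0 \<le> M \<longrightarrow> (\<forall>y\<in>Y. \<bar>f y\<bar> \<le> M) \<longrightarrow> \<bar>l\<bar> \<le> K * M"
    by (elim exE conjE) (rule that)
  define p where "p y x = (\<Prod>z\<in>Y - {y}. (x - z) * (1 / (y - z)))" for y x
  have contp: "continuous_on UNIV (p y)" for y unfolding p_def[abs_def] by (intro continuous_intros)
  have p1: "p y y = 1" for y unfolding p_def by (intro prod.neutral) auto
  have p0: "p y x = 0" if "x \<in> Y" "x \<noteq> y" for x y
    unfolding p_def using that Y(1) by (intro prod_zero) auto
  have "convergent (\<lambda>j. \<integral>x. p y x * w j x \<partial>lborel)" for y
    unfolding p_def using Y(1)
    by (intro convergent_integrals_prod_affine[of w R "Y - {y}" 0 "\<lambda>z. 1 / (y - z)", OF w(1) _ conv, unfolded power_0 mult_1]) (rule w(2), assumption, simp)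
  then have "\<exists>c. (\<lambda>j. \<integral>x. p y x * w j x \<partial>lborel) \<longlonglongrightarrow> c" for y by (simp add: convergent_def)
  from choice[OF allI[OF this]] obtain c where "\<forall>y. (\<lambda>j. \<integral>x. p y x * w j x \<partial>lborel) \<longlonglongrightarrow> c y" ..
  then have c: "(\<lambda>j. \<integral>x. p y x * w j x \<partial>lborel) \<longlonglongrightarrow> c y" for y by simp
  have intp: "integrable lborel (\<lambda>x. f x * w j x)" if "continuous_on UNIV f" for f j
    using w that by (intro integrable_continuous_mult[of _ _ "{-R..R}"]) auto
  define I where "I v x = (\<Sum>y\<in>Y. v y * p y x)" for v x
  have contI: "continuous_on UNIV (I v)" for v
    unfolding I_def[abs_def] by (intro continuous_intros contp)
  have IY: "I v y = v y" if "y \<in> Y" for v y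
  proof -
    have "I v y = v y * p y y + (\<Sum>z\<in>Y - {y}. v z * p z y)"
      unfolding I_def using Y(1) that by (rule sum.remove)
    also have "(\<Sum>z\<in>Y - {y}. v z * p z y) = 0" using that by (intro sum.neutral) (auto simp: p0)
    finally show ?thesis by (simp add: p1)
  qed
  have limI: "(\<lambda>j. \<integral>x. I v x * w j x \<partial>lborel) \<longlonglongrightarrow> (\<Sum>y\<in>Y. c y * v y)" for v
  proof -
    have "(\<integral>x. I v x * w j x \<partial>lborel) = (\<Sum>y\<in>Y. v y * (\<integral>x. p y x * w j x \<partial>lborel))" for j
    proof -
      have "(\<integral>x. I v x * w j x \<partial>lborel) = (\<integral>x. (\<Sum>y\<in>Y. v y * (p y x * w j x)) \<partial>lborel)"
        by (intro Bochner_Integration.integral_cong) (auto simp: I_def sum_distrib_right mult.assoc)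
      also have "\<dots> = (\<Sum>y\<in>Y. \<integral>x. v y * (p y x * w j x) \<partial>lborel)"
        by (intro Bochner_Integration.integral_sum integrable_mult_right intp contp)
      finally show ?thesis by simp
    qed
    moreover have "(\<lambda>j. \<Sum>y\<in>Y. v y * (\<integral>x. p y x * w j x \<partial>lborel)) \<longlonglongrightarrow> (\<Sum>y\<in>Y. v y * c y)"
      by (intro tendsto_sum tendsto_mult_left c)
    ultimately show ?thesis by (simp add: mult.commute)
  qed
  have rep: "l = (\<Sum>y\<in>Y. c y * f y)"
    if f: "continuous_on UNIV f" and l: "(\<lambda>j. \<integral>y. f y * w j y \<partial>lborel) \<longlonglongrightarrow> l" for f l
  proof -
    have "(\<lambda>j. \<integral>x. (f x - I f x) * w j x \<partial>lborel) \<longlonglongrightarrow> l - (\<Sum>y\<in>Y. c y * f y)"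
      using tendsto_diff[OF l limI[of f]] intp[OF f] intp[OF contI]
      by (simp add: left_diff_distrib Bochner_Integration.integral_diff)
    moreover have "continuous_on UNIV (\<lambda>x. f x - I f x)" by (intro continuous_intros f contI)
    moreover have "\<forall>y\<in>Y. \<bar>f y - I f y\<bar> \<le> 0" by (simp add: IY)
    ultimately have "\<bar>l - (\<Sum>y\<in>Y. c y * f y)\<bar> \<le> K * 0" using le by blast
    then show ?thesis by simp
  qed
  have bnd: "\<bar>\<Sum>y\<in>Y. c y * v y\<bar> \<le> K * M" if "0 \<le> M" "\<And>y. y \<in> Y \<Longrightarrow> \<bar>v y\<bar> \<le> M" for v M
    using le limI[of v] contI[of v] that by (simp add: IY)
  \<comment> \<open>Points of weight zero are dropped, since an atom can later be located only
    through a nonzero weight.\<close>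
  define Y' where "Y' = {y\<in>Y. c y \<noteq> 0}"
  have Y': "(\<Sum>y\<in>Y'. c y * v y) = (\<Sum>y\<in>Y. c y * v y)" for v
    unfolding Y'_def using Y(1) by (intro sum.mono_neutral_left) auto
  show ?thesis
  proof (intro exI[of _ Y'] exI[of _ c] conjI allI impI ballI)
    show "finite Y'" "Y' \<subseteq> {-R..R}" using Y by (auto simp: Y'_def)
    show "c y \<noteq> 0" if "y \<in> Y'" for y using that by (simp add: Y'_def)
    show "l = (\<Sum>y\<in>Y'. c y * f y)"
      if "continuous_on UNIV f" "(\<lambda>j. \<integral>y. f y * w j y \<partial>lborel) \<longlonglongrightarrow> l" for f l
      using rep[OF that] by (simp add: Y')
    fix v :: "real \<Rightarrow> real" and M :: real assume M: "0 \<le> M" "\<forall>y\<in>Y'. \<bar>v y\<bar> \<le> M"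
    \<comment> \<open>On the dropped points \<open>v\<close> need not be bounded by
      \<open>M\<close>; it is replaced by 0 there.\<close>
    have "\<bar>\<Sum>y\<in>Y. c y * (if y \<in> Y' then v y else 0)\<bar> \<le> K * M"
      using M by (intro bnd) auto
    moreover have "(\<Sum>y\<in>Y. c y * (if y \<in> Y' then v y else 0)) = (\<Sum>y\<in>Y'. c y * v y)"
      unfolding Y'_def using Y(1) by (intro sum.mono_neutral_cong_right) auto
    ultimately show "\<bar>\<Sum>y\<in>Y'. c y * v y\<bar> \<le> K * M" by simp
  qed
qed

section \<open>Slicing\<close>

definition C1_fun :: "(real \<Rightarrow> real) \<Rightarrow> bool" where
  "C1_fun f \<longleftrightarrow> (\<forall>x. (f has_real_derivative deriv f x) (at x)) \<and> continuous_on UNIV (deriv f)"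

lemma C1_funI:
  assumes "\<And>x. (f has_real_derivative f' x) (at x)" "continuous_on UNIV f'"
  shows "C1_fun f" "deriv f = f'"
proof -
  show "deriv f = f'" using assms(1) DERIV_imp_deriv by blast
  then show "C1_fun f" using assms by (simp add: C1_fun_def)
qed

lemma C1_fun_continuous: "C1_fun f \<Longrightarrow> continuous_on UNIV f"
  unfolding C1_fun_def by (meson DERIV_isCont continuous_at_imp_continuous_on)

lemma C1_fun_deriv_continuous: "C1_fun f \<Longrightarrow> continuous_on UNIV (deriv f)"
  by (simp add: C1_fun_def)

lemma C1_fun_measurable [measurable_dest]:
  assumes "C1_fun f" shows "f \<in> borel_measurable borel"
  by (rule borel_measurable_continuous_onI[OF C1_fun_continuous[OF assms]])

lemma C1_fun_bound:
  assumes "C1_fun f"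
  obtains C where "0 \<le> C" "\<And>x. \<bar>x\<bar> \<le> R \<Longrightarrow> \<bar>f x\<bar> \<le> C" "\<And>x. \<bar>x\<bar> \<le> R \<Longrightarrow> \<bar>deriv f x\<bar> \<le> C"
proof -
  have b: "\<exists>B. \<forall>x\<in>{-R..R}. \<bar>g x\<bar> \<le> B" if "continuous_on UNIV g" for g :: "real \<Rightarrow> real"
  proof -
    have "compact (g ` {-R..R})" using that by (intro compact_continuous_image) (auto intro: continuous_on_subset)
    from compact_imp_bounded[OF this, unfolded bounded_iff]
    obtain B where "\<forall>y\<in>g ` {-R..R}. norm y \<le> B" ..
    then show ?thesis by auto
  qed
  obtain B1 where B1: "\<forall>x\<in>{-R..R}. \<bar>f x\<bar> \<le> B1" using b[OF C1_fun_continuous[OF assms]] ..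
  obtain B2 where B2: "\<forall>x\<in>{-R..R}. \<bar>deriv f x\<bar> \<le> B2" using b[OF C1_fun_deriv_continuous[OF assms]] ..
  show ?thesis
  proof (rule that[of "\<bar>B1\<bar> + \<bar>B2\<bar>"])
    fix x :: real assume "\<bar>x\<bar> \<le> R"
    then have x: "x \<in> {-R..R}" by auto
    show "\<bar>f x\<bar> \<le> \<bar>B1\<bar> + \<bar>B2\<bar>" "\<bar>deriv f x\<bar> \<le> \<bar>B1\<bar> + \<bar>B2\<bar>"
      using bspec[OF B1 x] bspec[OF B2 x] by linarith+
  qed simp
qed

text \<open>Squares of positive parts are the building block of all explicit C1 functions used here:
  bumps, regularised rays and cutoffs.\<close>

lemma max0_square_deriv: "((\<lambda>x. (max 0 x)\<^sup>2) has_real_derivative 2 * max 0 x) (at x)" for x :: real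
proof (cases "x = 0")
  case True
  have "((\<lambda>x. (max 0 x)\<^sup>2) has_real_derivative 0) (at (0::real))"
    unfolding has_field_derivative_iff
  proof (rule Lim_null_comparison)
    show "\<forall>\<^sub>F y in at 0. norm (((max 0 y)\<^sup>2 - (max 0 0)\<^sup>2) / (y - 0)) \<le> \<bar>y::real\<bar>"
      by (intro always_eventually allI) (auto simp: max_def power2_eq_square)
    show "((\<lambda>y. \<bar>y::real\<bar>) \<longlongrightarrow> 0) (at 0)" by (rule tendsto_rabs_zero) (rule tendsto_ident_at)
  qed
  then show ?thesis using True by simp
next
  case False
  show ?thesis
  proof (cases "0 < x")
    case True
    have "((\<lambda>x. x\<^sup>2) has_real_derivative 2 * x) (at x)" by (auto intro!: derivative_eq_intros)
    then have "((\<lambda>x. (max 0 x)\<^sup>2) has_real_derivative 2 * x) (at x)"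
      by (rule has_field_derivative_transform_within_open[of _ _ _ "{0<..}"]) (use True in auto)
    then show ?thesis using True by simp
  next
    case F: False
    have "((\<lambda>x. 0) has_real_derivative 0) (at x)" by simp
    then have "((\<lambda>x. (max 0 x)\<^sup>2) has_real_derivative 0) (at x)"
      by (rule has_field_derivative_transform_within_open[of _ _ _ "{..<0}"]) (use F False in auto)
    then show ?thesis using F by simp
  qed
qed

definition bump :: "real \<Rightarrow> real \<Rightarrow> real \<Rightarrow> real" where
  "bump p q x = (max 0 ((x - p) * (q - x)))\<^sup>2"

lemma bump_deriv:
  "(bump p q has_real_derivative 2 * max 0 ((x - p) * (q - x)) * (p + q - 2 * x)) (at x)"
proof -
  have "((\<lambda>x. (x - p) * (q - x)) has_real_derivative (p + q - 2 * x)) (at x)"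
    by (auto intro!: derivative_eq_intros simp: algebra_simps)
  from DERIV_chain2[OF max0_square_deriv this] show ?thesis
    by (simp add: bump_def[abs_def])
qed

lemma C1_bump: "C1_fun (bump p q)"
  by (rule C1_funI[OF bump_deriv]) (intro continuous_intros)

lemma C1_mult_id: assumes "C1_fun f" shows "C1_fun (\<lambda>x. x * f x)"
proof (rule C1_funI)
  show "((\<lambda>x. x * f x) has_real_derivative (f x + x * deriv f x)) (at x)" for x
    using assms unfolding C1_fun_def by (auto intro!: derivative_eq_intros)
  show "continuous_on UNIV (\<lambda>x. f x + x * deriv f x)"
    using assms by (intro continuous_intros C1_fun_continuous C1_fun_deriv_continuous)
qed

lemma C1_power: "C1_fun (\<lambda>x. x ^ k)"
proof (rule C1_funI)
  show "((\<lambda>x. x ^ k) has_real_derivative (real k * x ^ (k - 1))) (at x)" for x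
    by (auto intro!: derivative_eq_intros)
qed (intro continuous_intros)

text \<open>Countable, so that one null set of lines serves all tests. The powers supply the moments
  for the interpolation; a bump and its product with x give the weight and the first moment of an
  atom isolated in a rational interval.\<close>

definition slice_tests :: "(real \<Rightarrow> real) set" where
  "slice_tests = range (\<lambda>k x. x ^ k) \<union> (\<lambda>(p, q). bump p q) ` (\<rat> \<times> \<rat>)
     \<union> (\<lambda>(p, q) x. x * bump p q x) ` (\<rat> \<times> \<rat>)"

lemma countable_slice_tests: "countable slice_tests"
  unfolding slice_tests_def by (intro countable_Un countable_image countable_SIGMA countable_rat) auto

lemma C1_slice_tests: "f \<in> slice_tests \<Longrightarrow> C1_fun f"
  unfolding slice_tests_def using C1_power C1_bump C1_mult_id by auto

section \<open>Fubini and measurability for slices\<close>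

lemma integrable_prod_slices:
  fixes F :: "real \<times> real \<Rightarrow> real"
  assumes F: "integrable lborel F"
  shows "AE t in lborel. integrable lborel (\<lambda>y. F (t, y))"
    and "integrable lborel (\<lambda>t. \<integral>y. F (t, y) \<partial>lborel)"
    and "(\<integral>t. (\<integral>y. F (t, y) \<partial>lborel) \<partial>lborel) = (\<integral>z. F z \<partial>lborel)"
proof -
  have F': "integrable (lborel \<Otimes>\<^sub>M lborel) F" using F by (simp add: lborel_prod)
  show "AE t in lborel. integrable lborel (\<lambda>y. F (t, y))" by (rule lborel_pair.AE_integrable_fst'[OF F'])
  show "integrable lborel (\<lambda>t. \<integral>y. F (t, y) \<partial>lborel)" by (rule lborel_pair.integrable_fst'[OF F'])
  show "(\<integral>t. (\<integral>y. F (t, y) \<partial>lborel) \<partial>lborel) = (\<integral>z. F z \<partial>lborel)"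
    using lborel_pair.integral_fst'[OF F'] by (simp add: lborel_prod)
qed

lemma integrable_bounded_mult:
  fixes f w :: "'a \<Rightarrow> real"
  assumes w: "integrable M w" and f: "f \<in> borel_measurable M" and B: "AE x in M. w x \<noteq> 0 \<longrightarrow> \<bar>f x\<bar> \<le> B"
  shows "integrable M (\<lambda>x. f x * w x)"
proof (rule Bochner_Integration.integrable_bound)
  show "integrable M (\<lambda>x. B * w x)" using w by simp
  show "(\<lambda>x. f x * w x) \<in> borel_measurable M" using f borel_measurable_integrable[OF w] by simp
  show "AE x in M. norm (f x * w x) \<le> norm (B * w x)"
    using B
  proof eventually_elim
    case (elim x)
    show ?case
    proof (cases "w x = 0")
      case False
      then have "\<bar>f x\<bar> \<le> \<bar>B\<bar>" using elim by linarith
      then show ?thesis by (simp add: abs_mult mult_right_mono)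
    qed simp
  qed
qed

lemma fst_snd_borel_real [measurable]:
  "(fst :: real \<times> real \<Rightarrow> real) \<in> borel_measurable borel" "(snd :: real \<times> real \<Rightarrow> real) \<in> borel_measurable borel"
  by (intro borel_measurable_continuous_onI continuous_on_fst continuous_on_snd continuous_on_id)+

lemma measurable_ray_indicator [measurable]:
  "(\<lambda>z :: real \<times> real. if t < fst z then 1 else 0 :: real) \<in> borel_measurable borel"
  by measurable

lemma measurable_ray_pair:
  assumes q: "q \<in> borel_measurable borel" and N: "sets N = sets borel"
  shows "(\<lambda>(t, z :: real \<times> real). (if t < fst z then 1 else 0) * q z :: real) \<in> borel_measurable (borel \<Otimes>\<^sub>M N)"
proof -
  note [measurable] = q
  have [measurable]: "(\<lambda>w :: real \<times> (real \<times> real). fst (snd w)) \<in> borel_measurable (borel \<Otimes>\<^sub>M borel)"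
    by (rule measurable_compose[OF measurable_snd]) measurable
  have "(\<lambda>w :: real \<times> (real \<times> real). (if fst w < fst (snd w) then 1 else 0) * q (snd w)) \<in> borel_measurable (borel \<Otimes>\<^sub>M borel)"
    by measurable
  then show ?thesis
    by (subst measurable_cong_sets[OF sets_pair_measure_cong[OF refl N] refl]) (simp add: case_prod_beta')
qed

text \<open>The product variable is \<open>z = (t, y)\<close>: the fields \<open>(a j, b j)\<close> have divergence \<open>h j\<close>,
  and \<open>(g1, g2)\<close>, \<open>g3\<close> are the densities with respect to \<open>mu\<close> of their weak limits.
  Only slices along lines of constant \<open>t\<close> are considered.\<close>

locale slicing =
  fixes a b h \<phi> d :: "nat \<Rightarrow> real \<times> real \<Rightarrow> real" and \<epsilon> \<delta> :: "nat \<Rightarrow> real" and K R :: real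
    and mu :: "(real \<times> real) measure" and g1 g2 g3 :: "real \<times> real \<Rightarrow> real"
  assumes R: "0 < R" and K: "0 \<le> K"
    and inta: "\<And>j. integrable lborel (a j)" and intb: "\<And>j. integrable lborel (b j)" and inth: "\<And>j. integrable lborel (h j)"
    and suppa: "\<And>j z. a j z \<noteq> 0 \<Longrightarrow> \<bar>fst z\<bar> \<le> R \<and> \<bar>snd z\<bar> \<le> R"
    and suppb: "\<And>j z. b j z \<noteq> 0 \<Longrightarrow> \<bar>fst z\<bar> \<le> R \<and> \<bar>snd z\<bar> \<le> R"
    and supph: "\<And>j z. h j z \<noteq> 0 \<Longrightarrow> \<bar>fst z\<bar> \<le> R \<and> \<bar>snd z\<bar> \<le> R"
    and massbh: "\<And>j. (\<integral>z. \<bar>b j z\<bar> + \<bar>h j z\<bar> \<partial>lborel) \<le> K"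
    and divergence: "\<And>j \<beta> f. C1_fun \<beta> \<Longrightarrow> C1_fun f \<Longrightarrow>
      (\<integral>z. a j z * (deriv \<beta> (fst z) * f (snd z)) + b j z * (\<beta> (fst z) * deriv f (snd z))
         + h j z * (\<beta> (fst z) * f (snd z)) \<partial>lborel) = 0"
    and fmu: "finite_measure mu" and smu: "sets mu = sets borel"
    and suppmu: "AE z in mu. \<bar>fst z\<bar> \<le> R \<and> \<bar>snd z\<bar> \<le> R"
    and intg1: "integrable mu g1" and intg2: "integrable mu g2" and intg3: "integrable mu g3"
    and lima: "\<And>\<psi>. continuous_on UNIV \<psi> \<Longrightarrow> (\<lambda>j. \<integral>z. \<psi> z * a j z \<partial>lborel) \<longlonglongrightarrow> (\<integral>z. \<psi> z * g1 z \<partial>mu)"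
    and limb: "\<And>\<psi>. continuous_on UNIV \<psi> \<Longrightarrow> (\<lambda>j. \<integral>z. \<psi> z * b j z \<partial>lborel) \<longlonglongrightarrow> (\<integral>z. \<psi> z * g2 z \<partial>mu)"
    and limh: "\<And>\<psi>. continuous_on UNIV \<psi> \<Longrightarrow> (\<lambda>j. \<integral>z. \<psi> z * h j z \<partial>lborel) \<longlonglongrightarrow> (\<integral>z. \<psi> z * g3 z \<partial>mu)"
    and limabs: "\<And>\<psi>. continuous_on UNIV \<psi> \<Longrightarrow>
      (\<lambda>j. \<integral>z. \<psi> z * (\<bar>a j z\<bar> + \<bar>b j z\<bar> + \<bar>h j z\<bar>) \<partial>lborel) \<longlonglongrightarrow> (\<integral>z. \<psi> z \<partial>mu)"
    and der: "\<And>j t y. ((\<lambda>y. \<phi> j (t, y)) has_real_derivative d j (t, y)) (at y)"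
    and contd: "\<And>j t. continuous_on UNIV (\<lambda>y. d j (t, y))"
    and mphi: "\<And>j. \<phi> j \<in> borel_measurable borel" and md: "\<And>j. d j \<in> borel_measurable borel"
    and eps: "\<And>j. 0 < \<epsilon> j" "\<epsilon> \<longlonglongrightarrow> 0" and del: "\<And>j. 0 < \<delta> j" "\<delta> \<longlonglongrightarrow> 0"
    and energy: "\<And>j. (\<integral>\<^sup>+z. ennreal (\<epsilon> j / 2 * (d j z)\<^sup>2 + (1 - \<phi> j z)\<^sup>2 / (2 * \<epsilon> j)) \<partial>lborel) \<le> ennreal K"
    and mass: "\<And>j. (\<integral>\<^sup>+z. ennreal \<bar>a j z\<bar> \<partial>lborel) \<le> ennreal K"
    and small: "\<And>j. (\<integral>\<^sup>+z. ennreal (\<bar>a j z\<bar> / \<delta> j) * indicator {z. 3/4 \<le> \<phi> j z} z \<partial>lborel) \<le> ennreal K"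
begin

section \<open>Slices obtained from the divergence identity\<close>

lemma measurable_abh [measurable]:
  "a j \<in> borel_measurable borel" "b j \<in> borel_measurable borel" "h j \<in> borel_measurable borel"
  using borel_measurable_integrable[OF inta[of j]] borel_measurable_integrable[OF intb[of j]]
    borel_measurable_integrable[OF inth[of j]] by simp_all

lemma measurable_g:
  "g1 \<in> borel_measurable borel" "g2 \<in> borel_measurable borel" "g3 \<in> borel_measurable borel"
  using borel_measurable_integrable[OF intg1] borel_measurable_integrable[OF intg2]
    borel_measurable_integrable[OF intg3] by (simp_all cong: measurable_cong_sets add: smu)

lemma measurable_mu: "f \<in> borel_measurable borel \<Longrightarrow> f \<in> borel_measurable mu"
  by (simp cong: measurable_cong_sets add: smu)

text \<open>Testing the divergence identity with \<beta>(t) f(y) shows that the integral of this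
  function over a line of constant \<open>t\<close> is the \<open>t\<close>-derivative of the
  pairing of \<open>a j\<close> with \<open>f\<close> on that line.\<close>

definition flux :: "nat \<Rightarrow> (real \<Rightarrow> real) \<Rightarrow> real \<times> real \<Rightarrow> real" where
  "flux j f z = deriv f (snd z) * b j z + f (snd z) * h j z"

definition flux_lim :: "(real \<Rightarrow> real) \<Rightarrow> real \<times> real \<Rightarrow> real" where
  "flux_lim f z = deriv f (snd z) * g2 z + f (snd z) * g3 z"

text \<open>The pairing of \<open>a j\<close> with \<open>f\<close> on the line at \<open>t\<close>,
  rebuilt by integrating its derivative over the half plane beyond \<open>t\<close>. In this form it
  is defined for every \<open>t\<close>, and it has an analogue for the limit measure, to which line
  integrals do not apply.\<close>

definition slice :: "nat \<Rightarrow> real \<Rightarrow> (real \<Rightarrow> real) \<Rightarrow> real" where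
  "slice j t f = - (\<integral>z. (if t < fst z then 1 else 0) * flux j f z \<partial>lborel)"

definition slice_lim :: "real \<Rightarrow> (real \<Rightarrow> real) \<Rightarrow> real" where
  "slice_lim t f = - (\<integral>z. (if t < fst z then 1 else 0) * flux_lim f z \<partial>mu)"

lemma cont_snd: "continuous_on UNIV f \<Longrightarrow> continuous_on UNIV (\<lambda>z :: real \<times> real. f (snd z) :: real)"
  by (rule continuous_on_compose2[of UNIV f]) (auto intro: continuous_on_snd)

lemma cont_fst: "continuous_on UNIV f \<Longrightarrow> continuous_on UNIV (\<lambda>z :: real \<times> real. f (fst z) :: real)"
  by (rule continuous_on_compose2[of UNIV f]) (auto intro: continuous_on_fst)

lemma compact_box: "compact ({-R..R} \<times> {-R..R})"
  by (intro compact_Times compact_Icc)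

lemma integrable_cont_lborel:
  assumes "continuous_on UNIV \<psi>" "integrable lborel w" "\<And>z. w z \<noteq> 0 \<Longrightarrow> \<bar>fst z\<bar> \<le> R \<and> \<bar>snd z\<bar> \<le> R"
  shows "integrable lborel (\<lambda>z. \<psi> z * w z :: real)"
proof (rule integrable_continuous_mult[OF assms(2) _ _ compact_box assms(1)])
  show "AE z in lborel. w z \<noteq> 0 \<longrightarrow> z \<in> {-R..R} \<times> {-R..R}"
  proof (intro AE_I2 impI)
    fix z assume "w z \<noteq> 0"
    from assms(3)[OF this] show "z \<in> {-R..R} \<times> {-R..R}" by (auto simp: mem_Times_iff)
  qed
qed simp

lemma integrable_cont_mu:
  assumes "continuous_on UNIV \<psi>" "integrable mu w"
  shows "integrable mu (\<lambda>z. \<psi> z * w z :: real)"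
proof (rule integrable_continuous_mult[OF assms(2) smu _ compact_box assms(1)])
  show "AE z in mu. w z \<noteq> 0 \<longrightarrow> z \<in> {-R..R} \<times> {-R..R}"
    using suppmu by eventually_elim (auto simp: mem_Times_iff)
qed

lemma integrable_flux:
  assumes f: "C1_fun f" shows "integrable lborel (flux j f)"
  unfolding flux_def[abs_def]
  by (intro Bochner_Integration.integrable_add integrable_cont_lborel intb inth cont_snd suppb supph
     C1_fun_continuous[OF f] C1_fun_deriv_continuous[OF f])

lemma integrable_flux_lim:
  assumes f: "C1_fun f" shows "integrable mu (flux_lim f)"
  unfolding flux_lim_def[abs_def]
  by (intro Bochner_Integration.integrable_add integrable_cont_mu intg2 intg3 cont_snd
     C1_fun_continuous[OF f] C1_fun_deriv_continuous[OF f])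

lemma flux_supp: "flux j f z \<noteq> 0 \<Longrightarrow> \<bar>fst z\<bar> \<le> R \<and> \<bar>snd z\<bar> \<le> R"
  using suppb[of j z] supph[of j z] unfolding flux_def by (cases "b j z = 0"; cases "h j z = 0") auto

lemma flux_le:
  assumes C: "\<And>x. \<bar>x\<bar> \<le> R \<Longrightarrow> \<bar>f x\<bar> \<le> C" "\<And>x. \<bar>x\<bar> \<le> R \<Longrightarrow> \<bar>deriv f x\<bar> \<le> C" and C0: "0 \<le> C"
  shows "\<bar>flux j f z\<bar> \<le> C * (\<bar>b j z\<bar> + \<bar>h j z\<bar>)"
proof (cases "\<bar>snd z\<bar> \<le> R")
  case True
  have "\<bar>flux j f z\<bar> \<le> \<bar>deriv f (snd z)\<bar> * \<bar>b j z\<bar> + \<bar>f (snd z)\<bar> * \<bar>h j z\<bar>"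
    unfolding flux_def abs_mult[symmetric] by linarith
  also have "\<dots> \<le> C * \<bar>b j z\<bar> + C * \<bar>h j z\<bar>" using C[OF True] by (intro add_mono mult_right_mono) auto
  finally show ?thesis by (simp add: distrib_left)
next
  case False
  then have "flux j f z = 0" using flux_supp by blast
  then show ?thesis using C0 by simp
qed

lemma flux_lim_le:
  assumes C: "\<And>x. \<bar>x\<bar> \<le> R \<Longrightarrow> \<bar>f x\<bar> \<le> C" "\<And>x. \<bar>x\<bar> \<le> R \<Longrightarrow> \<bar>deriv f x\<bar> \<le> C"
  shows "AE z in mu. \<bar>flux_lim f z\<bar> \<le> C * (\<bar>g2 z\<bar> + \<bar>g3 z\<bar>)"
  using suppmu
proof eventually_elim
  case (elim z)
  have "\<bar>flux_lim f z\<bar> \<le> \<bar>deriv f (snd z)\<bar> * \<bar>g2 z\<bar> + \<bar>f (snd z)\<bar> * \<bar>g3 z\<bar>"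
    unfolding flux_lim_def abs_mult[symmetric] by linarith
  also have "\<dots> \<le> C * \<bar>g2 z\<bar> + C * \<bar>g3 z\<bar>" using C[of "snd z"] elim by (intro add_mono mult_right_mono) auto
  finally show ?case by (simp add: distrib_left)
qed

lemma integrable_cut_lborel: "integrable lborel w \<Longrightarrow> integrable lborel (\<lambda>z :: real \<times> real. (if t < fst z then 1 else 0) * w z :: real)"
  by (rule integrable_bounded_mult[where B = 1]) (auto intro!: measurable_ray_indicator)

lemma integrable_cut_mu: "integrable mu w \<Longrightarrow> integrable mu (\<lambda>z. (if t < fst z then 1 else 0) * w z :: real)"
  by (rule integrable_bounded_mult[where B = 1]) (auto intro!: measurable_mu measurable_ray_indicator)

lemma slice_bound:
  assumes f: "C1_fun f" and C: "0 \<le> C" "\<And>x. \<bar>x\<bar> \<le> R \<Longrightarrow> \<bar>f x\<bar> \<le> C" "\<And>x. \<bar>x\<bar> \<le> R \<Longrightarrow> \<bar>deriv f x\<bar> \<le> C"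
  shows "\<bar>slice j t f\<bar> \<le> C * K"
proof -
  have "\<bar>slice j t f\<bar> \<le> (\<integral>z. \<bar>(if t < fst z then 1 else 0) * flux j f z\<bar> \<partial>lborel)"
    unfolding slice_def by (simp only: abs_minus) (rule integral_abs_bound)
  also have "\<dots> \<le> (\<integral>z. C * (\<bar>b j z\<bar> + \<bar>h j z\<bar>) \<partial>lborel)"
  proof (rule integral_mono)
    show "integrable lborel (\<lambda>z. \<bar>(if t < fst z then 1 else 0) * flux j f z\<bar>)"
      by (intro integrable_abs integrable_cut_lborel integrable_flux f)
    show "integrable lborel (\<lambda>z. C * (\<bar>b j z\<bar> + \<bar>h j z\<bar>))"
      by (intro integrable_mult_right Bochner_Integration.integrable_add integrable_abs intb inth)
    show "\<bar>(if t < fst z then 1 else 0) * flux j f z\<bar> \<le> C * (\<bar>b j z\<bar> + \<bar>h j z\<bar>)" for z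
      using flux_le[OF C(2,3,1), of j z] C(1) by auto
  qed
  also have "\<dots> = C * (\<integral>z. \<bar>b j z\<bar> + \<bar>h j z\<bar> \<partial>lborel)" by (rule integral_mult_right_zero)
  also have "\<dots> \<le> C * K" using massbh C(1) by (rule mult_left_mono)
  finally show ?thesis .
qed

text \<open>For t < -R the half plane contains the whole support, and the total flux vanishes by the
  divergence identity with \<beta> = 1. For t > R the half plane misses the support.\<close>

lemma slice_zero_outside:
  assumes f: "C1_fun f" and t: "\<not> (-R \<le> t \<and> t \<le> R)"
  shows "slice j t f = 0"
proof (cases "t < -R")
  case True
  have c: "C1_fun (\<lambda>_. 1)" "deriv (\<lambda>_::real. 1::real) = (\<lambda>_. 0)"
    by (rule C1_funI[where f' = "\<lambda>_. 0"]; simp)+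
  have "(if t < fst z then 1 else 0) * flux j f z
     = a j z * (deriv (\<lambda>_. 1) (fst z) * f (snd z)) + b j z * (1 * deriv f (snd z)) + h j z * (1 * f (snd z))" for z
  proof (cases "flux j f z = 0")
    case True
    then show ?thesis by (simp add: c(2) flux_def algebra_simps)
  next
    case False
    then have "t < fst z" using flux_supp[of j f z] True by auto
    then show ?thesis by (simp add: c(2) flux_def algebra_simps)
  qed
  then show ?thesis unfolding slice_def using divergence[OF c(1) f, of j] by simp
next
  case False
  have "(if t < fst z then 1 else 0) * flux j f z = 0" for z
    using flux_supp[of j f z] False t by (cases "flux j f z = 0") auto
  then have "(\<lambda>z. (if t < fst z then 1 else 0) * flux j f z) = (\<lambda>_. 0)" by (rule ext)
  then show ?thesis unfolding slice_def by (simp only:) simp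
qed

lemma measurable_slice [measurable]:
  assumes f: "C1_fun f" shows "(\<lambda>t. slice j t f) \<in> borel_measurable borel"
proof -
  have [measurable]: "flux j f \<in> borel_measurable borel"
    using borel_measurable_integrable[OF integrable_flux[OF f]] by simp
  show ?thesis unfolding slice_def
    by (intro borel_measurable_uminus lborel.borel_measurable_lebesgue_integral measurable_ray_pair) simp_all
qed

lemma measurable_slice_lim:
  assumes f: "C1_fun f" shows "(\<lambda>t. slice_lim t f) \<in> borel_measurable borel"
proof -
  interpret finite_measure mu by (rule fmu)
  have m [measurable]: "flux_lim f \<in> borel_measurable borel"
    using borel_measurable_integrable[OF integrable_flux_lim[OF f]] by (simp cong: measurable_cong_sets add: smu)
  show ?thesis unfolding slice_lim_def
    by (intro borel_measurable_uminus borel_measurable_lebesgue_integral measurable_ray_pair m smu)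
qed

text \<open>For n > 0 this is \<open>n\<close> times a C1 regularisation of the positive part, whose
  derivative is the ramp rising from 0 to 1 on the interval from 0 to 1/n.\<close>

definition hat :: "real \<Rightarrow> real \<Rightarrow> real" where
  "hat n s = (max 0 (n * s))\<^sup>2 / 2 - (max 0 (n * s - 1))\<^sup>2 / 2"

lemma hat_deriv: "(hat n has_real_derivative n * (max 0 (n * s) - max 0 (n * s - 1))) (at s)"
proof -
  have 1: "((\<lambda>s. n * s) has_real_derivative n) (at s)" by (auto intro!: derivative_eq_intros)
  have 2: "((\<lambda>s. n * s - 1) has_real_derivative n) (at s)" by (auto intro!: derivative_eq_intros)
  have "((\<lambda>s. (max 0 (n * s))\<^sup>2 / 2 - (max 0 (n * s - 1))\<^sup>2 / 2) has_real_derivative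
     (2 * max 0 (n * s) * n) / 2 - (2 * max 0 (n * s - 1) * n) / 2) (at s)"
    by (intro DERIV_diff DERIV_cdivide DERIV_chain2[OF max0_square_deriv 1] DERIV_chain2[OF max0_square_deriv 2])
  then show ?thesis unfolding hat_def[abs_def] by (rule DERIV_cong) (simp add: algebra_simps)
qed

text \<open>Test functions \<open>\<beta>\<close> with \<open>\<beta>'\<close> increasing to the indicator of \<open>{r<..}\<close>.\<close>

lemma flux_ray:
  assumes f: "C1_fun f"
  shows "(\<integral>z. (if r < fst z then 1 else 0) * (f (snd z) * a j z) \<partial>lborel)
     = - (\<integral>z. max 0 (fst z - r) * flux j f z \<partial>lborel)"
proof -
  define \<beta> where "\<beta> n t = hat (Suc n) (t - r) / Suc n" for n :: nat and t
  define \<beta>' where "\<beta>' n t = max 0 (Suc n * (t - r)) - max 0 (Suc n * (t - r) - 1)" for n :: nat and t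
  have d: "(\<beta> n has_real_derivative \<beta>' n t) (at t)" for n t
  proof -
    have "((\<lambda>t. t - r) has_real_derivative 1) (at t)" by (auto intro!: derivative_eq_intros)
    from DERIV_cdivide[OF DERIV_chain2[OF hat_deriv this], of "Suc n" "real (Suc n)"]
    show ?thesis unfolding \<beta>_def[abs_def] by (rule DERIV_cong) (simp add: \<beta>'_def field_simps)
  qed
  have c: "continuous_on UNIV (\<beta>' n)" for n unfolding \<beta>'_def[abs_def] by (intro continuous_intros)
  note C = C1_funI[OF d c]
  have "(\<integral>z. \<beta>' n (fst z) * (f (snd z) * a j z) + \<beta> n (fst z) * flux j f z \<partial>lborel) = 0" for n
  proof -
    have "(\<integral>z. \<beta>' n (fst z) * (f (snd z) * a j z) + \<beta> n (fst z) * flux j f z \<partial>lborel)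
      = (\<integral>z. a j z * (deriv (\<beta> n) (fst z) * f (snd z)) + b j z * (\<beta> n (fst z) * deriv f (snd z))
         + h j z * (\<beta> n (fst z) * f (snd z)) \<partial>lborel)"
      by (intro Bochner_Integration.integral_cong) (auto simp: C(2) flux_def algebra_simps)
    then show ?thesis using divergence[OF C(1) f] by simp
  qed
  moreover have "(\<lambda>n. \<integral>z. \<beta>' n (fst z) * (f (snd z) * a j z) + \<beta> n (fst z) * flux j f z \<partial>lborel) \<longlonglongrightarrow>
     (\<integral>z. (if r < fst z then 1 else 0) * (f (snd z) * a j z) + max 0 (fst z - r) * flux j f z \<partial>lborel)"
  proof (rule integral_dominated_convergence)
    show "integrable lborel (\<lambda>z. \<bar>f (snd z) * a j z\<bar> + \<bar>(\<bar>fst z\<bar> + \<bar>r\<bar> + 1) * flux j f z\<bar>)"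
      by (intro Bochner_Integration.integrable_add integrable_abs integrable_cont_lborel inta cont_snd suppa
          C1_fun_continuous[OF f] integrable_flux f flux_supp cont_fst continuous_intros)
    have [measurable]: "flux j f \<in> borel_measurable borel" "f \<in> borel_measurable borel"
      using borel_measurable_integrable[OF integrable_flux[OF f]] C1_fun_measurable[OF f] by simp_all
    have [measurable]: "\<beta> n \<in> borel_measurable borel" "\<beta>' n \<in> borel_measurable borel" for n
      by (rule borel_measurable_continuous_onI[OF C1_fun_continuous[OF C(1)]]) (rule borel_measurable_continuous_onI[OF c])
    show "(\<lambda>z. \<beta>' n (fst z) * (f (snd z) * a j z) + \<beta> n (fst z) * flux j f z) \<in> borel_measurable lborel" for n
      by measurable
    show "(\<lambda>z. (if r < fst z then 1 else 0) * (f (snd z) * a j z) + max 0 (fst z - r) * flux j f z) \<in> borel_measurable lborel"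
      by measurable
    have b1: "0 \<le> \<beta>' n t" "\<beta>' n t \<le> 1" for n t unfolding \<beta>'_def by (auto simp: max_def)
    have neg: "max 0 (real (Suc n) * (t - r)) = 0" "max 0 (real (Suc n) * (t - r) - 1) = 0" if "t \<le> r" for n t
    proof -
      have "real (Suc n) * (t - r) \<le> 0" using that by (intro mult_nonneg_nonpos) auto
      then show "max 0 (real (Suc n) * (t - r)) = 0" "max 0 (real (Suc n) * (t - r) - 1) = 0" by (auto simp: max_def)
    qed
    have b2: "\<beta> n t = 0" if "t \<le> r" for n t
      unfolding \<beta>_def hat_def neg[OF that] by simp
    have b3: "\<beta> n t = (t - r) - 1 / (2 * Suc n)" if "1 / Suc n \<le> t - r" for n t
    proof -
      have h: "(max 0 u)\<^sup>2 / 2 - (max 0 (u - 1))\<^sup>2 / 2 = u - 1/2" if "1 \<le> u" for u :: real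
        using that by (simp add: max_def power2_eq_square field_simps)
      have "1 \<le> real (Suc n) * (t - r)" using that by (simp add: field_simps)
      from h[OF this] have "hat (Suc n) (t - r) = real (Suc n) * (t - r) - 1/2"
        unfolding hat_def .
      then show ?thesis by (simp add: \<beta>_def diff_divide_distrib del: of_nat_Suc) simp
    qed
    have b4: "\<bar>\<beta> n t\<bar> \<le> \<bar>t\<bar> + \<bar>r\<bar> + 1" for n t
    proof (cases "t \<le> r")
      case True then show ?thesis by (simp add: b2)
    next
      case False
      show ?thesis
      proof (cases "1 / Suc n \<le> t - r")
        case True
        have "1 / (2 * real (Suc n)) \<le> 1" by simp
        moreover have "0 \<le> 1 / (2 * real (Suc n))" by simp
        ultimately show ?thesis using b3[OF True] by linarith
      next
        case F: False
        define u where "u = real (Suc n) * (t - r)"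
        have u: "0 < u" unfolding u_def using False by (intro mult_pos_pos) auto
        have u1: "u < 1" using F by (auto simp: u_def field_simps)
        have "\<beta> n t = u\<^sup>2 / 2 / Suc n" unfolding \<beta>_def hat_def u_def[symmetric] using u u1 by (simp add: max_def)
        moreover have "u\<^sup>2 / 2 / Suc n \<le> 1"
        proof -
          have "u\<^sup>2 \<le> 1" using u u1 by (simp add: power_le_one)
          then show ?thesis by (simp add: field_simps)
        qed
        moreover have "0 \<le> u\<^sup>2 / 2 / Suc n" by simp
        ultimately show ?thesis by linarith
      qed
    qed
    show "AE z in lborel. norm (\<beta>' n (fst z) * (f (snd z) * a j z) + \<beta> n (fst z) * flux j f z)
       \<le> \<bar>f (snd z) * a j z\<bar> + \<bar>(\<bar>fst z\<bar> + \<bar>r\<bar> + 1) * flux j f z\<bar>" for n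
    proof (rule AE_I2)
      fix z :: "real \<times> real"
      have "\<bar>\<beta>' n (fst z) * (f (snd z) * a j z)\<bar> \<le> 1 * \<bar>f (snd z) * a j z\<bar>"
        unfolding abs_mult[of "\<beta>' n (fst z)"] using b1 by (intro mult_right_mono) auto
      moreover have "\<bar>\<beta> n (fst z) * flux j f z\<bar> \<le> \<bar>(\<bar>fst z\<bar> + \<bar>r\<bar> + 1) * flux j f z\<bar>"
        unfolding abs_mult using b4[of n "fst z"] by (intro mult_right_mono) auto
      ultimately show "norm (\<beta>' n (fst z) * (f (snd z) * a j z) + \<beta> n (fst z) * flux j f z)
       \<le> \<bar>f (snd z) * a j z\<bar> + \<bar>(\<bar>fst z\<bar> + \<bar>r\<bar> + 1) * flux j f z\<bar>"
        unfolding real_norm_def using abs_triangle_ineq[of "\<beta>' n (fst z) * (f (snd z) * a j z)" "\<beta> n (fst z) * flux j f z"] by linarith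
    qed
    have l: "(\<lambda>n. \<beta>' n t) \<longlonglongrightarrow> (if r < t then 1 else 0)" "(\<lambda>n. \<beta> n t) \<longlonglongrightarrow> max 0 (t - r)" for t
    proof -
      have "(\<lambda>n. \<beta>' n t) \<longlonglongrightarrow> (if r < t then 1 else 0) \<and> (\<lambda>n. \<beta> n t) \<longlonglongrightarrow> max 0 (t - r)"
      proof (cases "r < t")
        case True
        then obtain n0 where n0: "1 / Suc n0 < t - r" using nat_approx_posE[of "t - r"] by auto
        have big: "1 / Suc n \<le> t - r" if "n0 \<le> n" for n
        proof -
          have "1 / real (Suc n) \<le> 1 / real (Suc n0)" using that by (intro divide_left_mono) auto
          then show ?thesis using n0 by linarith
        qed
        have "\<beta>' n t = 1" if "n0 \<le> n" for n
          using big[OF that] by (simp add: \<beta>'_def field_simps max_def)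
        then have "(\<lambda>n. \<beta>' n t) \<longlonglongrightarrow> 1"
          by (intro tendsto_eventually) (auto simp: eventually_sequentially)
        moreover have "(\<lambda>n. \<beta> n t) \<longlonglongrightarrow> (t - r)"
        proof -
          have "(\<lambda>n. (t - r) - (1/2) * (1 / real (Suc n))) \<longlonglongrightarrow> (t - r) - (1/2) * 0"
            by (intro tendsto_intros LIMSEQ_Suc[OF lim_1_over_n])
          then have "(\<lambda>n. (t - r) - 1 / (2 * real (Suc n))) \<longlonglongrightarrow> (t - r)" by simp
          moreover have "\<forall>\<^sub>F n in sequentially. (t - r) - 1 / (2 * real (Suc n)) = \<beta> n t"
            unfolding eventually_sequentially by (intro exI[of _ n0] allI impI) (simp only: b3[OF big])
          ultimately show ?thesis by (rule Lim_transform_eventually)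
        qed
        ultimately show ?thesis using True by simp
      next
        case False
        then have z: "\<beta>' n t = 0" "\<beta> n t = 0" for n
          using b2 neg by (simp_all add: \<beta>'_def)
        show ?thesis unfolding z using False by simp
      qed
      then show "(\<lambda>n. \<beta>' n t) \<longlonglongrightarrow> (if r < t then 1 else 0)" "(\<lambda>n. \<beta> n t) \<longlonglongrightarrow> max 0 (t - r)" by auto
    qed
    show "AE z in lborel. (\<lambda>n. \<beta>' n (fst z) * (f (snd z) * a j z) + \<beta> n (fst z) * flux j f z) \<longlonglongrightarrow>
      (if r < fst z then 1 else 0) * (f (snd z) * a j z) + max 0 (fst z - r) * flux j f z"
      by (intro AE_I2 tendsto_intros l)
  qed
  ultimately have "(\<lambda>n. 0) \<longlonglongrightarrow> (\<integral>z. (if r < fst z then 1 else 0) * (f (snd z) * a j z) + max 0 (fst z - r) * flux j f z \<partial>lborel)"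
    by (simp only:)
  then have "(\<integral>z. (if r < fst z then 1 else 0) * (f (snd z) * a j z) + max 0 (fst z - r) * flux j f z \<partial>lborel) = 0"
    by (rule LIMSEQ_unique) (rule tendsto_const)
  moreover have "(\<integral>z. (if r < fst z then 1 else 0) * (f (snd z) * a j z) + max 0 (fst z - r) * flux j f z \<partial>lborel)
    = (\<integral>z. (if r < fst z then 1 else 0) * (f (snd z) * a j z) \<partial>lborel) + (\<integral>z. max 0 (fst z - r) * flux j f z \<partial>lborel)"
    by (intro Bochner_Integration.integral_add integrable_cut_lborel integrable_cont_lborel inta cont_snd suppa
          C1_fun_continuous[OF f] integrable_flux f flux_supp cont_fst continuous_intros)
  ultimately show ?thesis by linarith
qed

lemma integrable_slice:
  assumes f: "C1_fun f" shows "integrable lborel (\<lambda>s. slice j s f)"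
proof -
  obtain C where C: "0 \<le> C" "\<And>x. \<bar>x\<bar> \<le> R \<Longrightarrow> \<bar>f x\<bar> \<le> C" "\<And>x. \<bar>x\<bar> \<le> R \<Longrightarrow> \<bar>deriv f x\<bar> \<le> C"
    using C1_fun_bound[OF f] by blast
  show ?thesis
  proof (rule Bochner_Integration.integrable_bound)
    have "integrable lborel (indicator {-R..R} :: real \<Rightarrow> real)"
      using R by (intro integrable_real_indicator) auto
    then show "integrable lborel (\<lambda>s. indicator {-R..R} s * (C * K) :: real)" by (rule integrable_mult_left)
    show "(\<lambda>s. slice j s f) \<in> borel_measurable lborel" using measurable_slice[OF f] by simp
    show "AE s in lborel. norm (slice j s f) \<le> norm (indicator {-R..R} s * (C * K) :: real)"
    proof (rule AE_I2)
      fix s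
      show "norm (slice j s f) \<le> norm (indicator {-R..R} s * (C * K) :: real)"
      proof (cases "-R \<le> s \<and> s \<le> R")
        case True
        have "0 \<le> C * K" using C(1) K by simp
        then show ?thesis using slice_bound[OF f C, of j s] True by simp
      qed (simp add: slice_zero_outside[OF f])
    qed
  qed
qed

text \<open>Fubini: the parameters s with r < s < fst z form a set of length max 0 (fst z - r). The
  right side is also the one in \<open>flux_ray\<close>, so slices and line integrals have equal
  integrals over all rays.\<close>

lemma slice_ray_integral:
  assumes f: "C1_fun f"
  shows "(\<integral>s. indicator {r<..} s * slice j s f \<partial>lborel) = - (\<integral>z. max 0 (fst z - r) * flux j f z \<partial>lborel)"
proof -
  define F where "F z s = (if r < s \<and> s < fst z then 1 else 0) * flux j f z" for z s
  have mf [measurable]: "flux j f \<in> borel_measurable borel"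
    using borel_measurable_integrable[OF integrable_flux[OF f]] by simp
  have inner: "(\<integral>s. (if r < s \<and> s < x then 1 else 0) \<partial>lborel) = max 0 (x - r)" for x :: real
  proof -
    have "(\<integral>s. (if r < s \<and> s < x then 1 else 0) \<partial>lborel) = (\<integral>s. indicator {r<..<x} s \<partial>lborel :: real)"
      by (intro Bochner_Integration.integral_cong) (auto split: split_indicator)
    then show ?thesis by (cases "r \<le> x") (auto simp: max_def)
  qed
  have inti: "integrable lborel (\<lambda>s. (if r < s \<and> s < x then 1 else 0 :: real))" for x :: real
  proof -
    have "(\<lambda>s. (if r < s \<and> s < x then 1 else 0 :: real)) = indicator {r<..<x}"
      by (auto split: split_indicator)
    then show ?thesis by (simp only:) (cases "r \<le> x"; simp)
  qed
  have mF: "case_prod F \<in> borel_measurable (lborel \<Otimes>\<^sub>M lborel)"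
  proof -
    have [measurable]: "(\<lambda>w :: (real \<times> real) \<times> real. fst (fst w)) \<in> borel_measurable (borel \<Otimes>\<^sub>M borel)"
      by (rule measurable_compose[OF measurable_fst]) measurable
    have "(\<lambda>w :: (real \<times> real) \<times> real. (if r < snd w \<and> snd w < fst (fst w) then 1 else 0) * flux j f (fst w)) \<in> borel_measurable (borel \<Otimes>\<^sub>M borel)"
      by measurable
    then show ?thesis
      by (subst measurable_cong_sets[OF sets_pair_measure_cong[OF sets_lborel sets_lborel] refl])
        (simp add: F_def[abs_def] case_prod_beta')
  qed
  have intF: "integrable (lborel \<Otimes>\<^sub>M lborel) (case_prod F)"
  proof (rule lborel_pair.Fubini_integrable[OF mF])
    have "(\<integral>s. norm (case_prod F (z, s)) \<partial>lborel) = max 0 (fst z - r) * \<bar>flux j f z\<bar>" for z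
    proof -
      have "(\<integral>s. norm (case_prod F (z, s)) \<partial>lborel) = (\<integral>s. (if r < s \<and> s < fst z then 1 else 0) * \<bar>flux j f z\<bar> \<partial>lborel)"
        by (intro Bochner_Integration.integral_cong) (auto simp: F_def)
      then show ?thesis by (simp only: integral_mult_left_zero inner)
    qed
    moreover have "integrable lborel (\<lambda>z. max 0 (fst z - r) * \<bar>flux j f z\<bar>)"
      by (intro integrable_cont_lborel integrable_abs integrable_flux f continuous_intros cont_fst)
       (use flux_supp in auto)
    ultimately show "integrable lborel (\<lambda>z. \<integral>s. norm (case_prod F (z, s)) \<partial>lborel)" by (simp only:)
    show "AE z in lborel. integrable lborel (\<lambda>s. case_prod F (z, s))"
      unfolding F_def by (intro AE_I2) (simp only: prod.case, intro integrable_mult_left inti)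
  qed
  have "(\<integral>s. indicator {r<..} s * slice j s f \<partial>lborel) = - (\<integral>s. (\<integral>z. F z s \<partial>lborel) \<partial>lborel)"
  proof -
    have "indicator {r<..} s * slice j s f = - (\<integral>z. F z s \<partial>lborel)" for s
      unfolding slice_def F_def by (cases "r < s") auto
    then show ?thesis by (simp only: Bochner_Integration.integral_minus)
  qed
  also have "(\<integral>s. (\<integral>z. F z s \<partial>lborel) \<partial>lborel) = (\<integral>z. (\<integral>s. F z s \<partial>lborel) \<partial>lborel)"
    by (rule lborel_pair.Fubini_integral[OF intF])
  also have "\<dots> = (\<integral>z. max 0 (fst z - r) * flux j f z \<partial>lborel)"
    unfolding F_def by (simp only: integral_mult_left_zero inner)
  finally show ?thesis .
qed

lemma slice_AE:
  assumes f: "C1_fun f"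
  shows "AE t in lborel. (\<integral>y. f y * a j (t, y) \<partial>lborel) = slice j t f"
proof -
  have intfa: "integrable lborel (\<lambda>z. f (snd z) * a j z)"
    by (intro integrable_cont_lborel inta cont_snd suppa C1_fun_continuous[OF f])
  define w where "w t = (\<integral>y. f y * a j (t, y) \<partial>lborel) - slice j t f" for t
  have intB: "integrable lborel (\<lambda>t. \<integral>y. f y * a j (t, y) \<partial>lborel)"
    using integrable_prod_slices(2)[OF intfa] by simp
  have "AE t in lborel. w t = 0"
  proof (rule AE_zero_if_ray_integrals_zero)
    show "integrable lborel w" unfolding w_def[abs_def]
      by (intro Bochner_Integration.integrable_diff intB integrable_slice f)
    fix r
    have "(\<integral>t. indicator {r<..} t * (\<integral>y. f y * a j (t, y) \<partial>lborel) \<partial>lborel)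
       = (\<integral>t. (\<integral>y. (if r < fst (t, y) then 1 else 0) * (f (snd (t, y)) * a j (t, y)) \<partial>lborel) \<partial>lborel)"
      by (intro Bochner_Integration.integral_cong) (auto split: split_indicator)
    also have "\<dots> = (\<integral>z. (if r < fst z then 1 else 0) * (f (snd z) * a j z) \<partial>lborel)"
      by (rule integrable_prod_slices(3)[OF integrable_cut_lborel[OF intfa]])
    also have "\<dots> = (\<integral>s. indicator {r<..} s * slice j s f \<partial>lborel)"
      unfolding flux_ray[OF f] slice_ray_integral[OF f] ..
    finally have eq: "(\<integral>t. indicator {r<..} t * (\<integral>y. f y * a j (t, y) \<partial>lborel) \<partial>lborel)
      = (\<integral>s. indicator {r<..} s * slice j s f \<partial>lborel)" .
    have "(\<integral>t. indicator {r<..} t * w t \<partial>lborel) = (\<integral>t. indicator {r<..} t * (\<integral>y. f y * a j (t, y) \<partial>lborel) - indicator {r<..} t * slice j t f \<partial>lborel)"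
      by (simp add: w_def right_diff_distrib)
    also have "\<dots> = (\<integral>t. indicator {r<..} t * (\<integral>y. f y * a j (t, y) \<partial>lborel) \<partial>lborel) - (\<integral>s. indicator {r<..} s * slice j s f \<partial>lborel)"
      by (intro Bochner_Integration.integral_diff integrable_mult_indicator[where 'b = real, simplified] intB integrable_slice f) auto
    finally show "(\<integral>t. indicator {r<..} t * w t \<partial>lborel) = 0" using eq by simp
  qed
  then show ?thesis by eventually_elim (simp add: w_def)
qed

text \<open>A portmanteau argument: the indicator of the half plane jumps only across the line,
  which \<open>mu\<close> does not charge. Replacing it by the ramp \<open>c n\<close> costs at most
  a tent \<open>e n\<close> around the line integrated against the absolute values, and
  \<open>limabs\<close> compares that with a small \<open>mu\<close>-integral for all large
  j.\<close>

lemma slice_tendsto: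
  assumes f: "C1_fun f" and t: "emeasure mu {z. fst z = t} = 0"
  shows "(\<lambda>j. slice j t f) \<longlonglongrightarrow> slice_lim t f"
proof -
  interpret finite_measure mu by (rule fmu)
  obtain C where C: "0 \<le> C" "\<And>x. \<bar>x\<bar> \<le> R \<Longrightarrow> \<bar>f x\<bar> \<le> C" "\<And>x. \<bar>x\<bar> \<le> R \<Longrightarrow> \<bar>deriv f x\<bar> \<le> C"
    using C1_fun_bound[OF f] by blast
  define c where "c n s = max 0 (min 1 (real n * (s - t)))" for n s
  \<comment> \<open>Continuous, and at least 1 on the strip of width 1/n in which ramp and half
    plane differ.\<close>
  define e where "e n s = max 0 (2 - real n * \<bar>s - t\<bar>)" for n s
  have contc: "continuous_on UNIV (\<lambda>z. c n (fst z))" and conte: "continuous_on UNIV (\<lambda>z. e n (fst z))" for n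
    unfolding c_def e_def by (intro continuous_intros)+
  define I where "I z = (if t < fst z then 1 else 0 :: real)" for z :: "real \<times> real"
  have Im: "I \<in> borel_measurable borel" unfolding I_def[abs_def] by (rule measurable_ray_indicator)
  have ce: "\<bar>I z - c n (fst z)\<bar> \<le> e n (fst z)" for z :: "real \<times> real" and n
  proof (cases "t < fst z \<and> real n * (fst z - t) < 1")
    case True
    then have "1 \<le> e n (fst z)" by (simp add: e_def)
    moreover have "0 \<le> c n (fst z)" "c n (fst z) \<le> 1" by (auto simp: c_def)
    ultimately show ?thesis using True by (simp add: I_def)
  next
    case False
    have "c n (fst z) = I z"
    proof (cases "t < fst z")
      case True then show ?thesis using False by (simp add: c_def I_def)
    next
      case F: False
      then have "real n * (fst z - t) \<le> 0" by (intro mult_nonneg_nonpos) auto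
      then show ?thesis using F by (simp add: c_def I_def)
    qed
    then show ?thesis by (simp add: e_def)
  qed
  have limc: "(\<lambda>n. c n (fst z)) \<longlonglongrightarrow> I z" for z :: "real \<times> real"
  proof (cases "t < fst z")
    case True
    then obtain n0 :: nat where n0: "1 / (fst z - t) < n0" using reals_Archimedean2 by blast
    have "c n (fst z) = I z" if "n0 \<le> n" for n
    proof -
      have "1 / (fst z - t) < real n" using n0 that by linarith
      then have "1 \<le> real n * (fst z - t)" using True by (simp add: field_simps)
      then show ?thesis using True by (simp add: c_def I_def)
    qed
    then show ?thesis by (intro tendsto_eventually) (auto simp: eventually_sequentially)
  next
    case False
    have "c n (fst z) = 0" for n
    proof -
      have "real n * (fst z - t) \<le> 0" using False by (intro mult_nonneg_nonpos) auto
      then show ?thesis by (simp add: c_def)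
    qed
    then show ?thesis using False by (simp add: I_def)
  qed
  have lime: "(\<lambda>n. e n (fst z)) \<longlonglongrightarrow> 0" if "fst z \<noteq> t" for z :: "real \<times> real"
  proof -
    obtain n0 :: nat where n0: "2 / \<bar>fst z - t\<bar> < n0" using reals_Archimedean2 by blast
    have "e n (fst z) = 0" if "n0 \<le> n" for n
    proof -
      have "2 / \<bar>fst z - t\<bar> < real n" using n0 that by linarith
      then have "2 \<le> real n * \<bar>fst z - t\<bar>" using \<open>fst z \<noteq> t\<close> by (simp add: field_simps)
      then show ?thesis by (simp add: e_def)
    qed
    then show ?thesis by (intro tendsto_eventually) (auto simp: eventually_sequentially)
  qed
  have int_e: "(\<lambda>n. \<integral>z. e n (fst z) \<partial>mu) \<longlonglongrightarrow> (\<integral>z. 0 \<partial>mu)"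
  proof (rule integral_dominated_convergence)
    show "integrable mu (\<lambda>_. 2 :: real)" by simp
    show "(\<lambda>z. e n (fst z)) \<in> borel_measurable mu" for n
      by (intro measurable_mu borel_measurable_continuous_onI conte)
    have "{z. fst z = t} \<in> null_sets mu"
    proof -
      have "{z :: real \<times> real. fst z = t} \<in> sets borel"
        by (intro borel_closed closed_Collect_eq continuous_intros)
      then show ?thesis using t smu by (simp add: null_sets_def)
    qed
    then have "AE z in mu. z \<notin> {z. fst z = t}" by (rule AE_not_in)
    then show "AE z in mu. (\<lambda>n. e n (fst z)) \<longlonglongrightarrow> 0" by eventually_elim (auto intro: lime)
    show "AE z in mu. norm (e n (fst z)) \<le> 2" for n by (intro AE_I2) (auto simp: e_def)
  qed simp
  define q where "q = flux_lim f"
  have intq: "integrable mu q" unfolding q_def by (rule integrable_flux_lim[OF f])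
  have int_c: "(\<lambda>n. \<integral>z. c n (fst z) * q z \<partial>mu) \<longlonglongrightarrow> (\<integral>z. I z * q z \<partial>mu)"
  proof (rule integral_dominated_convergence)
    show "integrable mu (\<lambda>z. \<bar>q z\<bar>)" by (intro integrable_abs intq)
    show "(\<lambda>z. c n (fst z) * q z) \<in> borel_measurable mu" for n
      by (intro borel_measurable_times borel_measurable_integrable[OF intq] measurable_mu borel_measurable_continuous_onI contc)
    show "(\<lambda>z. I z * q z) \<in> borel_measurable mu"
      by (intro borel_measurable_times borel_measurable_integrable[OF intq] measurable_mu Im)
    show "AE z in mu. (\<lambda>n. c n (fst z) * q z) \<longlonglongrightarrow> I z * q z" by (intro AE_I2 tendsto_intros limc)
    show "AE z in mu. norm (c n (fst z) * q z) \<le> \<bar>q z\<bar>" for n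
      by (intro AE_I2) (auto simp: c_def abs_mult intro!: mult_left_le_one_le)
  qed
  have err: "\<bar>slice j t f - - (\<integral>z. c n (fst z) * flux j f z \<partial>lborel)\<bar>
     \<le> C * (\<integral>z. e n (fst z) * (\<bar>a j z\<bar> + \<bar>b j z\<bar> + \<bar>h j z\<bar>) \<partial>lborel)" for j n
  proof -
    have i1: "integrable lborel (\<lambda>z. I z * flux j f z)"
      unfolding I_def by (intro integrable_cut_lborel integrable_flux f)
    have i2: "integrable lborel (\<lambda>z. c n (fst z) * flux j f z)"
      by (intro integrable_cont_lborel contc integrable_flux f flux_supp)
    have i3: "integrable lborel (\<lambda>z. e n (fst z) * (\<bar>a j z\<bar> + \<bar>b j z\<bar> + \<bar>h j z\<bar>))"
    proof (intro integrable_cont_lborel conte Bochner_Integration.integrable_add integrable_abs inta intb inth)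
      fix z assume "\<bar>a j z\<bar> + \<bar>b j z\<bar> + \<bar>h j z\<bar> \<noteq> 0"
      then have "a j z \<noteq> 0 \<or> b j z \<noteq> 0 \<or> h j z \<noteq> 0" by auto
      then show "\<bar>fst z\<bar> \<le> R \<and> \<bar>snd z\<bar> \<le> R" using suppa suppb supph by blast
    qed
    have "\<bar>slice j t f - - (\<integral>z. c n (fst z) * flux j f z \<partial>lborel)\<bar>
      = \<bar>\<integral>z. I z * flux j f z - c n (fst z) * flux j f z \<partial>lborel\<bar>"
      unfolding slice_def I_def[symmetric] Bochner_Integration.integral_diff[OF i1 i2] by linarith
    also have "\<dots> \<le> (\<integral>z. \<bar>I z * flux j f z - c n (fst z) * flux j f z\<bar> \<partial>lborel)"
      by (rule integral_abs_bound)
    also have "\<dots> \<le> (\<integral>z. C * (e n (fst z) * (\<bar>a j z\<bar> + \<bar>b j z\<bar> + \<bar>h j z\<bar>)) \<partial>lborel)"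
    proof (rule integral_mono)
      show "integrable lborel (\<lambda>z. \<bar>I z * flux j f z - c n (fst z) * flux j f z\<bar>)"
        by (intro integrable_abs Bochner_Integration.integrable_diff i1 i2)
      show "integrable lborel (\<lambda>z. C * (e n (fst z) * (\<bar>a j z\<bar> + \<bar>b j z\<bar> + \<bar>h j z\<bar>)))"
        by (intro integrable_mult_right i3)
      fix z :: "real \<times> real"
      have e0: "0 \<le> e n (fst z)" by (simp add: e_def)
      have "\<bar>I z * flux j f z - c n (fst z) * flux j f z\<bar> = \<bar>I z - c n (fst z)\<bar> * \<bar>flux j f z\<bar>"
        by (simp add: left_diff_distrib[symmetric] abs_mult)
      also have "\<dots> \<le> e n (fst z) * (C * (\<bar>b j z\<bar> + \<bar>h j z\<bar>))"
        using ce[of z n] flux_le[OF C(2,3,1), of j z] e0 by (intro mult_mono) auto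
      also have "\<dots> \<le> e n (fst z) * (C * (\<bar>a j z\<bar> + \<bar>b j z\<bar> + \<bar>h j z\<bar>))"
        using C(1) e0 by (intro mult_left_mono) auto
      finally show "\<bar>I z * flux j f z - c n (fst z) * flux j f z\<bar> \<le> C * (e n (fst z) * (\<bar>a j z\<bar> + \<bar>b j z\<bar> + \<bar>h j z\<bar>))"
        by (simp add: mult.left_commute)
    qed
    finally show ?thesis by simp
  qed
  have limq: "(\<lambda>j. \<integral>z. c n (fst z) * flux j f z \<partial>lborel) \<longlonglongrightarrow> (\<integral>z. c n (fst z) * q z \<partial>mu)" for n
  proof -
    let ?p1 = "\<lambda>z. c n (fst z) * deriv f (snd z)" and ?p2 = "\<lambda>z. c n (fst z) * f (snd z)"
    have c1: "continuous_on UNIV ?p1" and c2: "continuous_on UNIV ?p2"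
      by (intro continuous_on_mult contc cont_snd C1_fun_continuous[OF f] C1_fun_deriv_continuous[OF f])+
    have "(\<integral>z. c n (fst z) * flux j f z \<partial>lborel) = (\<integral>z. ?p1 z * b j z \<partial>lborel) + (\<integral>z. ?p2 z * h j z \<partial>lborel)" for j
    proof -
      have "integrable lborel (\<lambda>z. ?p1 z * b j z)" by (intro integrable_cont_lborel c1 intb suppb)
      moreover have "integrable lborel (\<lambda>z. ?p2 z * h j z)" by (intro integrable_cont_lborel c2 inth supph)
      ultimately have "integrable lborel (\<lambda>z. ?p1 z * b j z)" "integrable lborel (\<lambda>z. ?p2 z * h j z)" .
      from Bochner_Integration.integral_add[OF this, symmetric] show ?thesis
        by (simp only:) (intro Bochner_Integration.integral_cong, auto simp: flux_def algebra_simps)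
    qed
    moreover have "(\<integral>z. c n (fst z) * q z \<partial>mu) = (\<integral>z. ?p1 z * g2 z \<partial>mu) + (\<integral>z. ?p2 z * g3 z \<partial>mu)"
    proof -
      have "integrable mu (\<lambda>z. ?p1 z * g2 z)" "integrable mu (\<lambda>z. ?p2 z * g3 z)"
        by (intro integrable_cont_mu c1 c2 intg2 intg3)+
      from Bochner_Integration.integral_add[OF this, symmetric] show ?thesis
        by (simp only:) (intro Bochner_Integration.integral_cong, auto simp: q_def flux_lim_def algebra_simps)
    qed
    ultimately show ?thesis using tendsto_add[OF limb[OF c1] limh[OF c2]] by (simp only:)
  qed
  show ?thesis
  proof (rule LIMSEQ_I)
    fix r :: real assume r: "0 < r"
    \<comment> \<open>The added 1 allows C = 0, and the 4 leaves C * r1 strictly below r/3.\<close>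
    define r1 where "r1 = r / (4 * (C + 1))"
    have r1: "0 < r1" "C * r1 < r / 3"
    proof -
      show "0 < r1" using r C(1) by (simp add: r1_def)
      have "C * r1 \<le> (C + 1) * r1" using \<open>0 < r1\<close> by (intro mult_right_mono) auto
      also have "\<dots> = r / 4" using C(1) by (simp add: r1_def field_simps)
      finally show "C * r1 < r / 3" using r by linarith
    qed
    have "\<forall>\<^sub>F n in sequentially. (\<integral>z. e n (fst z) \<partial>mu) < r1"
      using int_e r1(1) by (intro order_tendstoD(2)) auto
    moreover have "\<forall>\<^sub>F n in sequentially. dist (\<integral>z. c n (fst z) * q z \<partial>mu) (\<integral>z. I z * q z \<partial>mu) < r / 3"
      using r by (intro tendstoD[OF int_c]) simp
    ultimately have "\<forall>\<^sub>F n in sequentially. (\<integral>z. e n (fst z) \<partial>mu) < r1 \<and>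
       dist (\<integral>z. c n (fst z) * q z \<partial>mu) (\<integral>z. I z * q z \<partial>mu) < r / 3" by (rule eventually_conj)
    from eventually_happens[OF this]
    obtain n where n: "(\<integral>z. e n (fst z) \<partial>mu) < r1" "dist (\<integral>z. c n (fst z) * q z \<partial>mu) (\<integral>z. I z * q z \<partial>mu) < r / 3"
      by auto
    have "\<forall>\<^sub>F j in sequentially. (\<integral>z. e n (fst z) * (\<bar>a j z\<bar> + \<bar>b j z\<bar> + \<bar>h j z\<bar>) \<partial>lborel) < r1"
      using limabs[OF conte] n(1) by (rule order_tendstoD(2))
    moreover have "\<forall>\<^sub>F j in sequentially. dist (\<integral>z. c n (fst z) * flux j f z \<partial>lborel) (\<integral>z. c n (fst z) * q z \<partial>mu) < r / 3"
      using r by (intro tendstoD[OF limq]) simp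
    ultimately have "\<forall>\<^sub>F j in sequentially. norm (slice j t f - slice_lim t f) < r"
    proof eventually_elim
      case (elim j)
      have "C * (\<integral>z. e n (fst z) * (\<bar>a j z\<bar> + \<bar>b j z\<bar> + \<bar>h j z\<bar>) \<partial>lborel) \<le> C * r1"
        using elim(1) C(1) by (intro mult_left_mono) auto
      then have "\<bar>slice j t f - - (\<integral>z. c n (fst z) * flux j f z \<partial>lborel)\<bar> < r / 3"
        using err[of j n] r1(2) by linarith
      moreover have "slice_lim t f = - (\<integral>z. I z * q z \<partial>mu)" unfolding slice_lim_def I_def q_def ..
      ultimately show ?case using elim(2) n(2) unfolding dist_real_def real_norm_def by linarith
    qed
    then show "\<exists>no. \<forall>n\<ge>no. norm (slice n t f - slice_lim t f) < r" by (simp add: eventually_sequentially)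
  qed
qed

end

context slicing
begin

section \<open>Regularity of the limit slices and energy on lines\<close>

text \<open>The projection of a finite measure to the \<open>t\<close>-axis has at most countably
  many atoms.\<close>

lemma AE_line_null: "AE t in lborel. emeasure mu {z. fst z = t} = 0"
proof -
  have mf: "fst \<in> mu \<rightarrow>\<^sub>M (borel :: real measure)" by (intro measurable_mu fst_snd_borel_real)
  interpret F: finite_measure "distr mu borel fst"
    by (rule finite_measure.finite_measure_distr[OF fmu mf])
  have "countable {t. measure (distr mu borel fst) {t} \<noteq> 0}" by (rule F.countable_support)
  then have "{t. measure (distr mu borel fst) {t} \<noteq> 0} \<in> null_sets lborel"
    by (rule countable_imp_null_set_lborel)
  then have "AE t in lborel. t \<notin> {t. measure (distr mu borel fst) {t} \<noteq> 0}" by (rule AE_not_in)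
  then show ?thesis
  proof eventually_elim
    case (elim t)
    then have "emeasure (distr mu borel fst) {t} = 0" by (simp add: F.emeasure_eq_measure)
    moreover have "fst -` {t} \<inter> space mu = {z. fst z = t}"
      using sets_eq_imp_space_eq[OF smu] by auto
    ultimately show ?case using emeasure_distr[OF mf, of "{t}"] by simp
  qed
qed

definition total :: real where "total = (\<integral>z. \<bar>g2 z\<bar> + \<bar>g3 z\<bar> \<partial>mu)"

lemma integrable_g23: "integrable mu (\<lambda>z. \<bar>g2 z\<bar> + \<bar>g3 z\<bar>)"
  by (intro Bochner_Integration.integrable_add integrable_abs intg2 intg3)

lemma total_nonneg: "0 \<le> total"
  unfolding total_def by (intro Bochner_Integration.integral_nonneg) simp

text \<open>Up to an additive constant, \<open>t\<close> plus the mass of \<open>g2\<close> and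
  \<open>g3\<close> up to and including the line at \<open>t\<close>. It jumps exactly at the lines
  charged by this mass, and only there can the limit slices jump.\<close>

definition arc :: "real \<Rightarrow> real" where
  "arc t = t - (\<integral>z. (if t < fst z then 1 else 0) * (\<bar>g2 z\<bar> + \<bar>g3 z\<bar>) \<partial>mu)"

lemma arc_diff:
  assumes "s \<le> t"
  shows "arc t - arc s = (t - s) + (\<integral>z. ((if s < fst z then 1 else 0) - (if t < fst z then 1 else 0)) * (\<bar>g2 z\<bar> + \<bar>g3 z\<bar>) \<partial>mu)"
  unfolding arc_def left_diff_distrib
  by (subst Bochner_Integration.integral_diff) (intro integrable_cut_mu integrable_g23, intro integrable_cut_mu integrable_g23, simp)

text \<open>Makes the inverse of \<open>arc\<close> 1-Lipschitz on the range, so that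
  \<open>t\<close> itself is a Lipschitz function of the new parameter.\<close>

lemma arc_expanding: "\<bar>t - s\<bar> \<le> \<bar>arc t - arc s\<bar>"
proof -
  have *: "t - s \<le> arc t - arc s" if "s \<le> t" for s t
  proof -
    have "0 \<le> (\<integral>z. ((if s < fst z then 1 else 0) - (if t < fst z then 1 else 0)) * (\<bar>g2 z\<bar> + \<bar>g3 z\<bar>) \<partial>mu)"
      using that by (intro Bochner_Integration.integral_nonneg) auto
    then show ?thesis using arc_diff[OF that] by linarith
  qed
  show ?thesis using *[of s t] *[of t s] by linarith
qed

lemma slice_lim_bound:
  assumes f: "C1_fun f" and C: "0 \<le> C" "\<And>x. \<bar>x\<bar> \<le> R \<Longrightarrow> \<bar>f x\<bar> \<le> C" "\<And>x. \<bar>x\<bar> \<le> R \<Longrightarrow> \<bar>deriv f x\<bar> \<le> C"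
  shows "\<bar>slice_lim t f\<bar> \<le> C * total"
proof -
  have "\<bar>slice_lim t f\<bar> \<le> (\<integral>z. \<bar>(if t < fst z then 1 else 0) * flux_lim f z\<bar> \<partial>mu)"
    unfolding slice_lim_def by (simp only: abs_minus) (rule integral_abs_bound)
  also have "\<dots> \<le> (\<integral>z. C * (\<bar>g2 z\<bar> + \<bar>g3 z\<bar>) \<partial>mu)"
  proof (rule integral_mono_AE)
    show "integrable mu (\<lambda>z. \<bar>(if t < fst z then 1 else 0) * flux_lim f z\<bar>)"
      by (intro integrable_abs integrable_cut_mu integrable_flux_lim f)
    show "integrable mu (\<lambda>z. C * (\<bar>g2 z\<bar> + \<bar>g3 z\<bar>))" by (intro integrable_mult_right integrable_g23)
    show "AE z in mu. \<bar>(if t < fst z then 1 else 0) * flux_lim f z\<bar> \<le> C * (\<bar>g2 z\<bar> + \<bar>g3 z\<bar>)"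
    proof -
      have "AE z in mu. \<bar>flux_lim f z\<bar> \<le> C * (\<bar>g2 z\<bar> + \<bar>g3 z\<bar>)" by (rule flux_lim_le) (erule C)+
      then show ?thesis by eventually_elim (use C(1) in auto)
    qed
  qed
  also have "\<dots> = C * total" unfolding total_def by (rule integral_mult_right_zero)
  finally show ?thesis .
qed

text \<open>Both differences are integrals over the same strip s < fst z \<le> t, and
  \<open>flux_lim f\<close> is at most \<open>C\<close> times the density that enters
  \<open>arc\<close>.\<close>

lemma slice_lim_lipschitz:
  assumes f: "C1_fun f" and C: "0 \<le> C" "\<And>x. \<bar>x\<bar> \<le> R \<Longrightarrow> \<bar>f x\<bar> \<le> C" "\<And>x. \<bar>x\<bar> \<le> R \<Longrightarrow> \<bar>deriv f x\<bar> \<le> C"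
  shows "\<bar>slice_lim t f - slice_lim s f\<bar> \<le> C * \<bar>arc t - arc s\<bar>"
proof -
  have *: "\<bar>slice_lim t f - slice_lim s f\<bar> \<le> C * (arc t - arc s)" if "s \<le> t" for s t
  proof -
    let ?I = "\<lambda>z :: real \<times> real. (if s < fst z then 1 else 0) - (if t < fst z then 1 else 0) :: real"
    have q: "integrable mu (\<lambda>z. ?I z * flux_lim f z)"
      unfolding left_diff_distrib by (intro Bochner_Integration.integrable_diff integrable_cut_mu integrable_flux_lim f)
    have g: "integrable mu (\<lambda>z. ?I z * (\<bar>g2 z\<bar> + \<bar>g3 z\<bar>))"
      unfolding left_diff_distrib by (intro Bochner_Integration.integrable_diff integrable_cut_mu integrable_g23)
    have "slice_lim t f - slice_lim s f = (\<integral>z. ?I z * flux_lim f z \<partial>mu)"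
      unfolding slice_lim_def left_diff_distrib
      by (subst Bochner_Integration.integral_diff) (intro integrable_cut_mu integrable_flux_lim f, intro integrable_cut_mu integrable_flux_lim f, simp)
    then have "\<bar>slice_lim t f - slice_lim s f\<bar> \<le> (\<integral>z. \<bar>?I z * flux_lim f z\<bar> \<partial>mu)"
      by (simp only: integral_abs_bound)
    also have "\<dots> \<le> (\<integral>z. C * (?I z * (\<bar>g2 z\<bar> + \<bar>g3 z\<bar>)) \<partial>mu)"
    proof (rule integral_mono_AE)
      show "integrable mu (\<lambda>z. \<bar>?I z * flux_lim f z\<bar>)" by (intro integrable_abs q)
      show "integrable mu (\<lambda>z. C * (?I z * (\<bar>g2 z\<bar> + \<bar>g3 z\<bar>)))" by (intro integrable_mult_right g)
      show "AE z in mu. \<bar>?I z * flux_lim f z\<bar> \<le> C * (?I z * (\<bar>g2 z\<bar> + \<bar>g3 z\<bar>))"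
      proof -
        have "AE z in mu. \<bar>flux_lim f z\<bar> \<le> C * (\<bar>g2 z\<bar> + \<bar>g3 z\<bar>)" by (rule flux_lim_le) (erule C)+
        then show ?thesis
        proof eventually_elim
          case (elim z)
          then show ?case using that by auto
        qed
      qed
    qed
    also have "\<dots> = C * (\<integral>z. ?I z * (\<bar>g2 z\<bar> + \<bar>g3 z\<bar>) \<partial>mu)" by (rule integral_mult_right_zero)
    also have "\<dots> \<le> C * (arc t - arc s)"
      unfolding arc_diff[OF that] using that C(1) by (intro mult_left_mono) auto
    finally show ?thesis .
  qed
  have m: "arc s \<le> arc t" if "s \<le> t" for s t
  proof -
    have "0 \<le> (\<integral>z. ((if s < fst z then 1 else 0) - (if t < fst z then 1 else 0)) * (\<bar>g2 z\<bar> + \<bar>g3 z\<bar>) \<partial>mu)"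
      using that by (intro Bochner_Integration.integral_nonneg) auto
    then show ?thesis using arc_diff[OF that] that by linarith
  qed
  show ?thesis
  proof (cases "s \<le> t")
    case True
    then show ?thesis using *[OF True] m[OF True] by simp
  next
    case False
    then have "t \<le> s" by simp
    then show ?thesis using *[of t s] m[of t s] by (simp add: abs_minus_commute)
  qed
qed

text \<open>Disintegration of the component across the lines: Fubini for \<open>a j\<close>, and
  passage to the limit because the slices converge on almost every line and are uniformly bounded.
  The right side is an integral over dt although \<open>mu\<close> itself may charge lines.\<close>

lemma slice_lim_integral:
  assumes f: "C1_fun f" and \<beta>: "continuous_on UNIV \<beta>"
  shows "(\<integral>z. (\<beta> (fst z) * f (snd z)) * g1 z \<partial>mu) = (\<integral>t. indicator {-R..R} t * (\<beta> t * slice_lim t f) \<partial>lborel)"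
    and "integrable lborel (\<lambda>t. indicator {-R..R} t * (\<beta> t * slice_lim t f))"
proof -
  obtain C where C: "0 \<le> C" "\<And>x. \<bar>x\<bar> \<le> R \<Longrightarrow> \<bar>f x\<bar> \<le> C" "\<And>x. \<bar>x\<bar> \<le> R \<Longrightarrow> \<bar>deriv f x\<bar> \<le> C"
    using C1_fun_bound[OF f] by blast
  have "compact (\<beta> ` {-R..R})" using \<beta> by (intro compact_continuous_image) (auto intro: continuous_on_subset)
  from compact_imp_bounded[OF this, unfolded bounded_iff]
  obtain B where "\<forall>y\<in>\<beta> ` {-R..R}. norm y \<le> B" ..
  then have B: "\<bar>\<beta> t\<bar> \<le> B" if "t \<in> {-R..R}" for t using that by simp
  have B0: "0 \<le> B" using B[of 0] R by auto
  have [measurable]: "\<beta> \<in> borel_measurable borel" by (rule borel_measurable_continuous_onI[OF \<beta>])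
  have [measurable]: "(\<lambda>t. slice j t f) \<in> borel_measurable borel" for j by (rule measurable_slice[OF f])
  have [measurable]: "(\<lambda>t. slice_lim t f) \<in> borel_measurable borel" by (rule measurable_slice_lim[OF f])
  have intI: "integrable lborel (indicator {-R..R} :: real \<Rightarrow> real)"
    using R by (intro integrable_real_indicator) auto
  show "integrable lborel (\<lambda>t. indicator {-R..R} t * (\<beta> t * slice_lim t f))"
  proof (rule Bochner_Integration.integrable_bound)
    show "integrable lborel (\<lambda>t. indicator {-R..R} t * (B * (C * total)) :: real)" by (rule integrable_mult_left[OF intI])
    show "AE t in lborel. norm (indicator {-R..R} t * (\<beta> t * slice_lim t f)) \<le> norm (indicator {-R..R} t * (B * (C * total)) :: real)"
    proof (rule AE_I2)
      fix t
      have "\<bar>\<beta> t\<bar> * \<bar>slice_lim t f\<bar> \<le> B * (C * total)" if "t \<in> {-R..R}"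
        using B[OF that] slice_lim_bound[OF f C, of t] B0 by (intro mult_mono) auto
      then show "norm (indicator {-R..R} t * (\<beta> t * slice_lim t f)) \<le> norm (indicator {-R..R} t * (B * (C * total)) :: real)"
        using B0 C(1) total_nonneg by (auto simp: abs_mult split: split_indicator)
    qed
  qed measurable
  have cont: "continuous_on UNIV (\<lambda>z. \<beta> (fst z) * f (snd z))"
    by (intro continuous_on_mult cont_fst cont_snd \<beta> C1_fun_continuous[OF f])
  have X: "(\<integral>z. (\<beta> (fst z) * f (snd z)) * a j z \<partial>lborel) = (\<integral>t. indicator {-R..R} t * (\<beta> t * slice j t f) \<partial>lborel)" for j
  proof -
    have i: "integrable lborel (\<lambda>z. (\<beta> (fst z) * f (snd z)) * a j z)"
      by (intro integrable_cont_lborel cont inta suppa)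
    have i2: "(\<lambda>t. \<integral>y. (\<beta> (fst (t, y)) * f (snd (t, y))) * a j (t, y) \<partial>lborel) \<in> borel_measurable lborel"
      using integrable_prod_slices(2)[OF i] by (rule borel_measurable_integrable)
    have "(\<integral>z. (\<beta> (fst z) * f (snd z)) * a j z \<partial>lborel) = (\<integral>t. (\<integral>y. (\<beta> (fst (t, y)) * f (snd (t, y))) * a j (t, y) \<partial>lborel) \<partial>lborel)"
      using integrable_prod_slices(3)[OF i] by simp
    also have "\<dots> = (\<integral>t. indicator {-R..R} t * (\<beta> t * slice j t f) \<partial>lborel)"
    proof (rule integral_cong_AE[OF i2])
      show "AE t in lborel. (\<integral>y. (\<beta> (fst (t, y)) * f (snd (t, y))) * a j (t, y) \<partial>lborel) = indicator {-R..R} t * (\<beta> t * slice j t f)"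
        using slice_AE[OF f, of j]
      proof eventually_elim
        case (elim t)
        have "(\<integral>y. (\<beta> (fst (t, y)) * f (snd (t, y))) * a j (t, y) \<partial>lborel) = \<beta> t * slice j t f"
          unfolding elim[symmetric] by (simp add: mult.assoc)
        then show ?case using slice_zero_outside[OF f, of t j] by (cases "t \<in> {-R..R}") auto
      qed
    qed measurable
    finally show ?thesis .
  qed
  have "(\<lambda>j. \<integral>t. indicator {-R..R} t * (\<beta> t * slice j t f) \<partial>lborel) \<longlonglongrightarrow> (\<integral>t. indicator {-R..R} t * (\<beta> t * slice_lim t f) \<partial>lborel)"
  proof (rule integral_dominated_convergence)
    show "integrable lborel (\<lambda>t. indicator {-R..R} t * (B * (C * K)) :: real)" by (rule integrable_mult_left[OF intI])
    show "AE t in lborel. (\<lambda>j. indicator {-R..R} t * (\<beta> t * slice j t f)) \<longlonglongrightarrow> indicator {-R..R} t * (\<beta> t * slice_lim t f)"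
      using AE_line_null by eventually_elim (intro tendsto_mult_left slice_tendsto f)
    show "AE t in lborel. norm (indicator {-R..R} t * (\<beta> t * slice j t f)) \<le> indicator {-R..R} t * (B * (C * K))" for j
    proof (rule AE_I2)
      fix t
      have "\<bar>\<beta> t\<bar> * \<bar>slice j t f\<bar> \<le> B * (C * K)" if "t \<in> {-R..R}"
        using B[OF that] slice_bound[OF f C, of j t] B0 by (intro mult_mono) auto
      then show "norm (indicator {-R..R} t * (\<beta> t * slice j t f)) \<le> indicator {-R..R} t * (B * (C * K))"
        by (auto simp: abs_mult split: split_indicator)
    qed
  qed measurable
  then have "(\<lambda>j. \<integral>z. (\<beta> (fst z) * f (snd z)) * a j z \<partial>lborel) \<longlonglongrightarrow> (\<integral>t. indicator {-R..R} t * (\<beta> t * slice_lim t f) \<partial>lborel)"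
    by (simp only: X)
  from LIMSEQ_unique[OF lima[OF cont] this]
  show "(\<integral>z. (\<beta> (fst z) * f (snd z)) * g1 z \<partial>mu) = (\<integral>t. indicator {-R..R} t * (\<beta> t * slice_lim t f) \<partial>lborel)" .
qed

text \<open>The three controlled quantities are added so that on a given line one subsequence
  realising the lower limit bounds all of them. Dividing by \<open>\<delta> j\<close> turns the
  bound on the last one into decay.\<close>

definition slice_energy :: "nat \<Rightarrow> real \<Rightarrow> ennreal" where
  "slice_energy j t = (\<integral>\<^sup>+y. ennreal (\<epsilon> j / 2 * (d j (t, y))\<^sup>2 + (1 - \<phi> j (t, y))\<^sup>2 / (2 * \<epsilon> j))
     + ennreal \<bar>a j (t, y)\<bar> + ennreal (\<bar>a j (t, y)\<bar> / \<delta> j) * indicator {z. 3/4 \<le> \<phi> j z} (t, y) \<partial>lborel)"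

definition slice_energy_lim :: "real \<Rightarrow> ennreal" where
  "slice_energy_lim t = liminf (\<lambda>j. slice_energy j t)"

lemma measurable_phi_d [measurable]: "\<phi> j \<in> borel_measurable borel" "d j \<in> borel_measurable borel"
  by (rule mphi md)+

lemma measurable_energy_density:
  "(\<lambda>z. ennreal (\<epsilon> j / 2 * (d j z)\<^sup>2 + (1 - \<phi> j z)\<^sup>2 / (2 * \<epsilon> j))
     + ennreal \<bar>a j z\<bar> + ennreal (\<bar>a j z\<bar> / \<delta> j) * indicator {z. 3/4 \<le> \<phi> j z} z) \<in> borel_measurable (lborel \<Otimes>\<^sub>M lborel)"
  unfolding lborel_prod by measurable

lemma measurable_slice_energy [measurable]: "slice_energy j \<in> borel_measurable borel"
  using lborel.borel_measurable_nn_integral_fst[OF measurable_energy_density, of j]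
  by (simp add: slice_energy_def[abs_def])

lemma measurable_slice_energy_lim [measurable]: "slice_energy_lim \<in> borel_measurable borel"
  unfolding slice_energy_lim_def[abs_def] by measurable

lemma slice_energy_integral: "(\<integral>\<^sup>+t. slice_energy j t \<partial>lborel) \<le> ennreal (3 * K)"
proof -
  have "(\<integral>\<^sup>+t. slice_energy j t \<partial>lborel) = (\<integral>\<^sup>+z. ennreal (\<epsilon> j / 2 * (d j z)\<^sup>2 + (1 - \<phi> j z)\<^sup>2 / (2 * \<epsilon> j))
     + ennreal \<bar>a j z\<bar> + ennreal (\<bar>a j z\<bar> / \<delta> j) * indicator {z. 3/4 \<le> \<phi> j z} z \<partial>lborel)"
    using lborel.nn_integral_fst[OF measurable_energy_density, of j] unfolding slice_energy_def by (simp add: lborel_prod)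
  also have "\<dots> = (\<integral>\<^sup>+z. ennreal (\<epsilon> j / 2 * (d j z)\<^sup>2 + (1 - \<phi> j z)\<^sup>2 / (2 * \<epsilon> j)) \<partial>lborel)
     + (\<integral>\<^sup>+z. ennreal \<bar>a j z\<bar> \<partial>lborel) + (\<integral>\<^sup>+z. ennreal (\<bar>a j z\<bar> / \<delta> j) * indicator {z. 3/4 \<le> \<phi> j z} z \<partial>lborel)"
    by (subst nn_integral_add; (subst nn_integral_add)?; simp)
  also have "\<dots> \<le> ennreal K + ennreal K + ennreal K" by (intro add_mono energy mass small)
  also have "\<dots> = ennreal (3 * K)" using K by (simp add: ennreal_plus[symmetric] del: ennreal_plus)
  finally show ?thesis .
qed

lemma slice_energy_lim_integral: "(\<integral>\<^sup>+t. slice_energy_lim t \<partial>lborel) \<le> ennreal (3 * K)"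
proof -
  have "(\<integral>\<^sup>+t. slice_energy_lim t \<partial>lborel) \<le> liminf (\<lambda>j. \<integral>\<^sup>+t. slice_energy j t \<partial>lborel)"
    unfolding slice_energy_lim_def by (intro nn_integral_liminf) simp
  also have "\<dots> \<le> liminf (\<lambda>j::nat. ennreal (3 * K))"
    by (intro Liminf_mono always_eventually allI slice_energy_integral)
  also have "\<dots> = ennreal (3 * K)" by (simp add: Liminf_const)
  finally show ?thesis .
qed

text \<open>Line integrals and slices are compared only for the countably many tests in
  \<open>slice_tests\<close>; each comparison holds off a null set of its own.\<close>

definition good :: "real \<Rightarrow> bool" where
  "good t \<longleftrightarrow> slice_energy_lim t < top \<and> (\<forall>j. integrable lborel (\<lambda>y. a j (t, y))) \<and>
     (\<forall>f\<in>slice_tests. \<forall>j. (\<integral>y. f y * a j (t, y) \<partial>lborel) = slice j t f) \<and> emeasure mu {z. fst z = t} = 0"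

lemma AE_good: "AE t in lborel. good t"
proof -
  have "AE t in lborel. slice_energy_lim t \<noteq> \<infinity>"
    using slice_energy_lim_integral by (intro nn_integral_PInf_AE) (auto simp: top_unique)
  moreover have "AE t in lborel. \<forall>j. integrable lborel (\<lambda>y. a j (t, y))"
    unfolding AE_all_countable by (intro allI integrable_prod_slices(1) inta)
  moreover have "AE t in lborel. \<forall>f\<in>slice_tests. \<forall>j. (\<integral>y. f y * a j (t, y) \<partial>lborel) = slice j t f"
    by (subst AE_ball_countable[OF countable_slice_tests], intro ballI, subst AE_all_countable)
       (intro allI slice_AE C1_slice_tests)
  ultimately show ?thesis using AE_line_null
    by eventually_elim (auto simp: good_def less_top)
qed

text \<open>The added 1 makes the bound strict, so that it holds eventually along a subsequence
  realising the lower limit. The resulting function of \<open>t\<close> is integrable over {-R..R},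
  which dominated convergence uses later.\<close>

definition kappa :: "real \<Rightarrow> real" where "kappa t = enn2real (slice_energy_lim t) + 1"

lemma kappa_nonneg: "0 \<le> kappa t" by (simp add: kappa_def)

text \<open>The subsequence depends on \<open>t\<close>, yet on an uncharged line the slices tend to
  \<open>slice_lim t f\<close> along the full sequence. The atoms therefore describe this common
  limit, whichever subsequence produced them.\<close>

lemma good_atomic:
  assumes t: "good t"
  shows "\<exists>Y c. finite Y \<and> Y \<subseteq> {-R..R} \<and> (\<forall>y\<in>Y. c y \<noteq> 0) \<and>
    (\<forall>f\<in>slice_tests. slice_lim t f = (\<Sum>y\<in>Y. c y * f y)) \<and>
    (\<forall>v M. 0 \<le> M \<longrightarrow> (\<forall>y\<in>Y. \<bar>v y\<bar> \<le> M) \<longrightarrow> \<bar>\<Sum>y\<in>Y. c y * v y\<bar> \<le> kappa t * M)"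
proof -
  obtain r0 where r0: "strict_mono r0" "((\<lambda>j. slice_energy j t) \<circ> r0) \<longlonglongrightarrow> slice_energy_lim t"
    using liminf_subseq_lim[of "\<lambda>j. slice_energy j t"] unfolding slice_energy_lim_def by blast
  have "slice_energy_lim t < ennreal (kappa t)"
  proof -
    obtain x where x: "slice_energy_lim t = ennreal x" "0 \<le> x"
      using t unfolding good_def by (cases "slice_energy_lim t") auto
    then show ?thesis by (simp add: kappa_def ennreal_less_iff)
  qed
  with r0(2) have "\<forall>\<^sub>F j in sequentially. ((\<lambda>j. slice_energy j t) \<circ> r0) j < ennreal (kappa t)"
    by (rule order_tendstoD(2))
  then obtain N where N: "\<And>j. N \<le> j \<Longrightarrow> slice_energy (r0 j) t < ennreal (kappa t)"
    by (auto simp: eventually_sequentially)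
  define s where "s j = r0 (j + N)" for j
  have s: "strict_mono s" using r0(1) by (simp add: s_def strict_mono_def)
  have E: "slice_energy (s j) t \<le> ennreal (kappa t)" for j
    using N[of "j + N"] by (simp add: s_def less_imp_le)
  have sec: "Pair t \<in> borel_measurable borel" for t :: real by (intro borel_measurable_continuous_onI continuous_intros)
  have ms: "(\<lambda>y. F (t, y)) \<in> borel_measurable borel" if "F \<in> borel_measurable borel" for F :: "real \<times> real \<Rightarrow> real"
    using measurable_compose[OF sec that] .
  have E1: "(\<integral>\<^sup>+y. ennreal (\<epsilon> (s j) / 2 * (d (s j) (t, y))\<^sup>2 + (1 - \<phi> (s j) (t, y))\<^sup>2 / (2 * \<epsilon> (s j))) \<partial>lborel) \<le> ennreal (kappa t)" for j
  proof (rule order_trans[OF _ E])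
    show "(\<integral>\<^sup>+y. ennreal (\<epsilon> (s j) / 2 * (d (s j) (t, y))\<^sup>2 + (1 - \<phi> (s j) (t, y))\<^sup>2 / (2 * \<epsilon> (s j))) \<partial>lborel) \<le> slice_energy (s j) t"
      unfolding slice_energy_def add.assoc by (intro nn_integral_mono) (auto intro: order_trans[OF _ add_left_mono[OF zero_le]])
  qed
  have E2: "(\<integral>\<^sup>+y. ennreal \<bar>a (s j) (t, y)\<bar> \<partial>lborel) \<le> ennreal (kappa t)" for j
  proof (rule order_trans[OF _ E])
    show "(\<integral>\<^sup>+y. ennreal \<bar>a (s j) (t, y)\<bar> \<partial>lborel) \<le> slice_energy (s j) t"
      unfolding slice_energy_def by (rule nn_integral_mono, rule add_increasing2, rule zero_le, rule add_increasing, rule zero_le, rule order_refl)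
  qed
  have E3: "(\<integral>\<^sup>+y. ennreal (\<bar>a (s j) (t, y)\<bar> / \<delta> (s j)) * indicator {z. 3/4 \<le> \<phi> (s j) z} (t, y) \<partial>lborel) \<le> ennreal (kappa t)" for j
  proof (rule order_trans[OF _ E])
    show "(\<integral>\<^sup>+y. ennreal (\<bar>a (s j) (t, y)\<bar> / \<delta> (s j)) * indicator {z. 3/4 \<le> \<phi> (s j) z} (t, y) \<partial>lborel) \<le> slice_energy (s j) t"
      unfolding slice_energy_def by (rule nn_integral_mono, rule add_increasing, rule zero_le, rule order_refl)
  qed
  have inta': "integrable lborel (\<lambda>y. a (s j) (t, y))" for j using t by (simp add: good_def)
  have lim: "(\<lambda>j. \<integral>y. f y * a (s j) (t, y) \<partial>lborel) \<longlonglongrightarrow> slice_lim t f" if f: "f \<in> slice_tests" for f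
  proof -
    have "(\<lambda>j. slice j t f) \<longlonglongrightarrow> slice_lim t f"
      using t by (intro slice_tendsto C1_slice_tests[OF f]) (simp add: good_def)
    from LIMSEQ_subseq_LIMSEQ[OF this s] have "(\<lambda>j. slice (s j) t f) \<longlonglongrightarrow> slice_lim t f" by (simp add: o_def)
    then show ?thesis using t f by (simp add: good_def)
  qed
  have epslim: "(\<lambda>j. \<epsilon> (s j)) \<longlonglongrightarrow> 0" using LIMSEQ_subseq_LIMSEQ[OF eps(2) s] by (simp add: o_def)
  have "\<exists>Y c. finite Y \<and> Y \<subseteq> {-R..R} \<and> (\<forall>y\<in>Y. c y \<noteq> 0) \<and>
    (\<forall>f l. continuous_on UNIV f \<longrightarrow> (\<lambda>j. \<integral>y. f y * a (s j) (t, y) \<partial>lborel) \<longlonglongrightarrow> l \<longrightarrow> l = (\<Sum>y\<in>Y. c y * f y)) \<and>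
    (\<forall>v M. 0 \<le> M \<longrightarrow> (\<forall>y\<in>Y. \<bar>v y\<bar> \<le> M) \<longrightarrow> \<bar>\<Sum>y\<in>Y. c y * v y\<bar> \<le> kappa t * M)"
  proof (rule slice_atomic[where \<phi> = "\<lambda>j y. \<phi> (s j) (t, y)" and d = "\<lambda>j y. d (s j) (t, y)" and \<epsilon> = "\<lambda>j. \<epsilon> (s j)",
      OF der contd eps(1) epslim kappa_nonneg _ E1 inta'])
    show "0 \<le> R" using R by simp
    show "y \<in> {-R..R}" if "a (s j) (t, y) \<noteq> 0" for j y using suppa[OF that] by auto
    show "(\<integral>y. \<bar>a (s j) (t, y)\<bar> \<partial>lborel) \<le> kappa t" for j
    proof -
      have "ennreal (\<integral>y. \<bar>a (s j) (t, y)\<bar> \<partial>lborel) = (\<integral>\<^sup>+y. ennreal \<bar>a (s j) (t, y)\<bar> \<partial>lborel)"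
        by (intro nn_integral_eq_integral[symmetric] integrable_abs inta') simp
      also have "\<dots> \<le> ennreal (kappa t)" by (rule E2)
      finally show ?thesis using kappa_nonneg by simp
    qed
    show "(\<lambda>j. \<integral>y. indicator {y. 3/4 \<le> \<phi> (s j) (t, y)} y * \<bar>a (s j) (t, y)\<bar> \<partial>lborel) \<longlonglongrightarrow> 0"
    proof (rule tendsto_sandwich)
      show "\<forall>\<^sub>F j in sequentially. 0 \<le> (\<integral>y. indicator {y. 3/4 \<le> \<phi> (s j) (t, y)} y * \<bar>a (s j) (t, y)\<bar> \<partial>lborel)"
        by (intro always_eventually allI Bochner_Integration.integral_nonneg) simp
      have "(\<integral>y. indicator {y. 3/4 \<le> \<phi> (s j) (t, y)} y * \<bar>a (s j) (t, y)\<bar> \<partial>lborel) \<le> \<delta> (s j) * kappa t" for j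
      proof -
        let ?w = "\<lambda>y. indicator {y. 3/4 \<le> \<phi> (s j) (t, y)} y * \<bar>a (s j) (t, y)\<bar> :: real"
        have "{y. 3/4 \<le> \<phi> (s j) (t, y)} \<in> sets lborel"
          using ms[OF mphi[of "s j"]] by measurable
        then have iw: "integrable lborel ?w"
          using integrable_abs[OF inta'] by (intro integrable_mult_indicator[where 'b = real, simplified])
        have "ennreal (\<integral>y. ?w y / \<delta> (s j) \<partial>lborel) = (\<integral>\<^sup>+y. ennreal (?w y / \<delta> (s j)) \<partial>lborel)"
          using iw del(1)[of "s j"] by (intro nn_integral_eq_integral[symmetric]) (auto intro!: divide_nonneg_pos)
        also have "\<dots> = (\<integral>\<^sup>+y. ennreal (\<bar>a (s j) (t, y)\<bar> / \<delta> (s j)) * indicator {z. 3/4 \<le> \<phi> (s j) z} (t, y) \<partial>lborel)"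
          by (intro nn_integral_cong) (auto split: split_indicator)
        also have "\<dots> \<le> ennreal (kappa t)" by (rule E3)
        finally have "(\<integral>y. ?w y / \<delta> (s j) \<partial>lborel) \<le> kappa t" using kappa_nonneg by simp
        then have "(\<integral>y. ?w y \<partial>lborel) / \<delta> (s j) \<le> kappa t" by (simp only: integral_divide_zero)
        then show ?thesis using del(1)[of "s j"] by (simp only: pos_divide_le_eq mult.commute)
      qed
      then show "\<forall>\<^sub>F j in sequentially. (\<integral>y. indicator {y. 3/4 \<le> \<phi> (s j) (t, y)} y * \<bar>a (s j) (t, y)\<bar> \<partial>lborel) \<le> \<delta> (s j) * kappa t"
        by (intro always_eventually allI)
      have "(\<lambda>j. \<delta> (s j)) \<longlonglongrightarrow> 0" using LIMSEQ_subseq_LIMSEQ[OF del(2) s] by (simp add: o_def)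
      then show "(\<lambda>j. \<delta> (s j) * kappa t) \<longlonglongrightarrow> 0" by (rule tendsto_mult_left_zero)
    qed simp
    show "convergent (\<lambda>j. \<integral>y. y ^ k * a (s j) (t, y) \<partial>lborel)" for k
    proof -
      have "(\<lambda>y. y ^ k) \<in> slice_tests" by (auto simp: slice_tests_def)
      from lim[OF this] show ?thesis by (rule convergentI)
    qed
  qed
  then obtain Y c where Yc: "finite Y" "Y \<subseteq> {-R..R}" "\<forall>y\<in>Y. c y \<noteq> 0"
    and rep: "\<forall>f l. continuous_on UNIV f \<longrightarrow> (\<lambda>j. \<integral>y. f y * a (s j) (t, y) \<partial>lborel) \<longlonglongrightarrow> l \<longrightarrow> l = (\<Sum>y\<in>Y. c y * f y)"
    and bd: "\<forall>v M. 0 \<le> M \<longrightarrow> (\<forall>y\<in>Y. \<bar>v y\<bar> \<le> M) \<longrightarrow> \<bar>\<Sum>y\<in>Y. c y * v y\<bar> \<le> kappa t * M"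
    by (elim exE conjE) (rule that)
  have "slice_lim t f = (\<Sum>y\<in>Y. c y * f y)" if "f \<in> slice_tests" for f
    using rep[rule_format, OF C1_fun_continuous[OF C1_slice_tests[OF that]] lim[OF that]] .
  then show ?thesis using Yc bd by (intro exI[of _ Y] exI[of _ c] conjI ballI) simp_all
qed

end

context slicing
begin

section \<open>Atoms on countably many Lipschitz curves\<close>

text \<open>Both slices are bounded and Lipschitz in \<open>arc t\<close>, so their quotient is
  Lipschitz in \<open>arc t\<close> where the denominator stays away from 0. The pair of
  \<open>t\<close> and this quotient becomes a Lipschitz function of the parameter
  \<open>arc t\<close>.\<close>

lemma ratio_curve:
  fixes n :: nat
  shows "\<exists>F :: real \<Rightarrow> real \<times> real. (\<exists>L. L-lipschitz_on UNIV F) \<and>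
    (\<forall>t. 1 / real (Suc n) \<le> \<bar>slice_lim t (bump p q)\<bar> \<longrightarrow>
      (t, slice_lim t (\<lambda>x. x * bump p q x) / slice_lim t (bump p q)) \<in> range F)"
proof -
  define u where "u t = slice_lim t (\<lambda>x. x * bump p q x)" for t
  define v where "v t = slice_lim t (bump p q)" for t
  define N where "N = real (Suc n)"
  have N: "0 < N" by (simp add: N_def)
  have Cu: "C1_fun (\<lambda>x. x * bump p q x)" by (rule C1_mult_id[OF C1_bump])
  obtain C1 where C1: "0 \<le> C1" "\<And>x. \<bar>x\<bar> \<le> R \<Longrightarrow> \<bar>bump p q x\<bar> \<le> C1" "\<And>x. \<bar>x\<bar> \<le> R \<Longrightarrow> \<bar>deriv (bump p q) x\<bar> \<le> C1"
    using C1_fun_bound[OF C1_bump] by blast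
  obtain C2 where C2: "0 \<le> C2" "\<And>x. \<bar>x\<bar> \<le> R \<Longrightarrow> \<bar>x * bump p q x\<bar> \<le> C2" "\<And>x. \<bar>x\<bar> \<le> R \<Longrightarrow> \<bar>deriv (\<lambda>x. x * bump p q x) x\<bar> \<le> C2"
    using C1_fun_bound[OF Cu] by blast
  have ub: "\<bar>u t\<bar> \<le> C2 * total" for t unfolding u_def by (rule slice_lim_bound[OF Cu C2])
  have vb: "\<bar>v t\<bar> \<le> C1 * total" for t unfolding v_def by (rule slice_lim_bound[OF C1_bump C1])
  have ul: "\<bar>u t - u s\<bar> \<le> C2 * \<bar>arc t - arc s\<bar>" for t s unfolding u_def by (rule slice_lim_lipschitz[OF Cu C2])
  have vl: "\<bar>v t - v s\<bar> \<le> C1 * \<bar>arc t - arc s\<bar>" for t s unfolding v_def by (rule slice_lim_lipschitz[OF C1_bump C1])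
  \<comment> \<open>From the quotient rule: each of the two terms of the numerator is at most C1 *
    C2 * total times the increment of \<open>arc\<close>, and N^2 bounds the reciprocal of the
    denominator.\<close>
  define L where "L = (2 * (C1 * C2 * total)) * N\<^sup>2"
  have L0: "0 \<le> L" using C1(1) C2(1) total_nonneg by (simp add: L_def)
  define S where "S = {t. 1 / N \<le> \<bar>v t\<bar>}"
  have rl: "\<bar>u t / v t - u s / v s\<bar> \<le> L * \<bar>arc t - arc s\<bar>" if t: "t \<in> S" and s: "s \<in> S" for t s
  proof -
    have vt: "1 \<le> N * \<bar>v t\<bar>" and vs: "1 \<le> N * \<bar>v s\<bar>" using t s N by (auto simp: S_def field_simps)
    have v0: "v t \<noteq> 0" "v s \<noteq> 0" using vt vs by auto
    have "u t / v t - u s / v s = (u t * (v s - v t) + v t * (u t - u s)) / (v t * v s)"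
      using v0 by (simp add: field_simps)
    then have "\<bar>u t / v t - u s / v s\<bar> = \<bar>u t * (v s - v t) + v t * (u t - u s)\<bar> / (\<bar>v t\<bar> * \<bar>v s\<bar>)"
      by (simp add: abs_mult)
    also have "\<dots> \<le> \<bar>u t * (v s - v t) + v t * (u t - u s)\<bar> * N\<^sup>2"
    proof -
      have "1 * 1 \<le> (N * \<bar>v t\<bar>) * (N * \<bar>v s\<bar>)" using vt vs by (intro mult_mono) auto
      then have "1 / (\<bar>v t\<bar> * \<bar>v s\<bar>) \<le> N\<^sup>2" using v0 by (simp add: divide_le_eq power2_eq_square mult_ac)
      then have "\<bar>u t * (v s - v t) + v t * (u t - u s)\<bar> * (1 / (\<bar>v t\<bar> * \<bar>v s\<bar>)) \<le> \<bar>u t * (v s - v t) + v t * (u t - u s)\<bar> * N\<^sup>2"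
        by (rule mult_left_mono) simp
      then show ?thesis by simp
    qed
    also have "\<dots> \<le> (2 * (C1 * C2 * total) * \<bar>arc t - arc s\<bar>) * N\<^sup>2"
    proof (rule mult_right_mono)
      have "\<bar>u t * (v s - v t)\<bar> \<le> (C2 * total) * (C1 * \<bar>arc t - arc s\<bar>)"
        unfolding abs_mult using ub[of t] vl[of t s] C2(1) total_nonneg by (intro mult_mono) (auto simp: abs_minus_commute)
      moreover have "\<bar>v t * (u t - u s)\<bar> \<le> (C1 * total) * (C2 * \<bar>arc t - arc s\<bar>)"
        unfolding abs_mult using vb[of t] ul[of t s] C1(1) total_nonneg by (intro mult_mono) auto
      ultimately show "\<bar>u t * (v s - v t) + v t * (u t - u s)\<bar> \<le> 2 * (C1 * C2 * total) * \<bar>arc t - arc s\<bar>"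
        using abs_triangle_ineq[of "u t * (v s - v t)" "v t * (u t - u s)"] by (simp add: algebra_simps)
    qed simp
    finally show ?thesis by (simp add: L_def mult_ac)
  qed
  have inj: "inj arc"
  proof (rule injI)
    fix s t assume "arc s = arc t"
    then show "s = t" using arc_expanding[of s t] by simp
  qed
  \<comment> \<open>The curve is determined only on this set of parameters; \<open>F1\<close>
    extends the inverse of \<open>arc\<close> from it, \<open>F2\<close> the quotient.\<close>
  define T where "T = arc ` S"
  obtain F1 where F1: "1-lipschitz_on UNIV F1" "\<And>\<tau>. \<tau> \<in> T \<Longrightarrow> F1 \<tau> = inv arc \<tau>"
  proof (rule lipschitz_extension_real[of 1 T "inv arc"])
    fix x y assume "x \<in> T" "y \<in> T"
    then show "\<bar>inv arc x - inv arc y\<bar> \<le> 1 * \<bar>x - y\<bar>"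
      using arc_expanding by (auto simp: T_def inv_f_f[OF inj])
  qed auto
  obtain F2 where F2: "L-lipschitz_on UNIV F2" "\<And>\<tau>. \<tau> \<in> T \<Longrightarrow> F2 \<tau> = u (inv arc \<tau>) / v (inv arc \<tau>)"
  proof (rule lipschitz_extension_real[of L T "\<lambda>\<tau>. u (inv arc \<tau>) / v (inv arc \<tau>)"])
    fix x y assume "x \<in> T" "y \<in> T"
    then show "\<bar>u (inv arc x) / v (inv arc x) - u (inv arc y) / v (inv arc y)\<bar> \<le> L * \<bar>x - y\<bar>"
      using rl by (auto simp: T_def inv_f_f[OF inj])
  qed (use L0 in auto)
  show ?thesis
  proof (intro exI[of _ "\<lambda>\<tau>. (F1 \<tau>, F2 \<tau>)"] conjI allI impI)
    show "\<exists>L. L-lipschitz_on UNIV (\<lambda>\<tau>. (F1 \<tau>, F2 \<tau>))"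
      using lipschitz_on_Pair[OF F1(1) F2(1)] by blast
    fix t assume "1 / real (Suc n) \<le> \<bar>slice_lim t (bump p q)\<bar>"
    then have t: "t \<in> S" by (simp add: S_def v_def N_def)
    then have "arc t \<in> T" by (simp add: T_def)
    then have "(F1 (arc t), F2 (arc t)) = (t, u t / v t)"
      using F1(2) F2(2) by (simp add: inv_f_f[OF inj])
    then show "(t, slice_lim t (\<lambda>x. x * bump p q x) / slice_lim t (bump p q)) \<in> range (\<lambda>\<tau>. (F1 \<tau>, F2 \<tau>))"
      unfolding u_def v_def by (intro range_eqI[of _ _ "arc t"]) (rule sym)
  qed
qed

text \<open>A bump between two rationals that separate an atom from the others sees only this atom,
  so the quotient of first moment and weight is its position. The curves are indexed by the two
  rationals and a lower bound 1/(n+1) on the weight; they do not depend on the line or on its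
  atoms.\<close>

lemma atoms_on_curves:
  "\<exists>F :: nat \<Rightarrow> real \<Rightarrow> real \<times> real. (\<forall>k. \<exists>L. L-lipschitz_on UNIV (F k)) \<and>
    (\<forall>t Y c. finite Y \<longrightarrow> (\<forall>y\<in>Y. c y \<noteq> 0) \<longrightarrow> (\<forall>f\<in>slice_tests. slice_lim t f = (\<Sum>y\<in>Y. c y * f y)) \<longrightarrow>
      (\<forall>y\<in>Y. (t, y) \<in> (\<Union>k. range (F k))))"
proof -
  have "\<forall>w :: rat \<times> rat \<times> nat. \<exists>F :: real \<Rightarrow> real \<times> real. (\<exists>L. L-lipschitz_on UNIV F) \<and>
    (\<forall>t. 1 / real (Suc (snd (snd w))) \<le> \<bar>slice_lim t (bump (of_rat (fst w)) (of_rat (fst (snd w))))\<bar> \<longrightarrow>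
      (t, slice_lim t (\<lambda>x. x * bump (of_rat (fst w)) (of_rat (fst (snd w))) x)
        / slice_lim t (bump (of_rat (fst w)) (of_rat (fst (snd w))))) \<in> range F)"
    by (intro allI ratio_curve)
  from choice[OF this] obtain G :: "rat \<times> rat \<times> nat \<Rightarrow> real \<Rightarrow> real \<times> real" where G: "\<forall>w :: rat \<times> rat \<times> nat. (\<exists>L. L-lipschitz_on UNIV (G w)) \<and>
    (\<forall>t. 1 / real (Suc (snd (snd w))) \<le> \<bar>slice_lim t (bump (of_rat (fst w)) (of_rat (fst (snd w))))\<bar> \<longrightarrow>
      (t, slice_lim t (\<lambda>x. x * bump (of_rat (fst w)) (of_rat (fst (snd w))) x)
        / slice_lim t (bump (of_rat (fst w)) (of_rat (fst (snd w))))) \<in> range (G w))" ..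
  show ?thesis
  proof (intro exI[of _ "\<lambda>k. G (from_nat k)"] conjI allI impI ballI)
    show "\<exists>L. L-lipschitz_on UNIV (G (from_nat k))" for k using G by blast
    fix t Y c y
    assume Y: "finite Y" "\<forall>y\<in>Y. c y \<noteq> 0" and rep: "\<forall>f\<in>slice_tests. slice_lim t f = (\<Sum>y\<in>Y. c y * f y)" and y: "y \<in> Y"
    \<comment> \<open>At most the distance to the nearest other atom; the inserted 1 keeps the
      minimum meaningful when there is no other atom.\<close>
    define e where "e = Min (insert 1 ((\<lambda>x. \<bar>x - y\<bar>) ` (Y - {y})))"
    have e0: "0 < e" unfolding e_def using Y(1) by (subst Min_gr_iff) auto
    have e: "e \<le> \<bar>x - y\<bar>" if "x \<in> Y" "x \<noteq> y" for x
      unfolding e_def using Y(1) that by (intro Min_le) auto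
    obtain p' where p': "y - e < real_of_rat p'" "real_of_rat p' < y"
      using Rats_dense_in_real[of "y - e" y] e0 by (auto elim: Rats_cases)
    obtain q' where q': "y < real_of_rat q'" "real_of_rat q' < y + e"
      using Rats_dense_in_real[of y "y + e"] e0 by (auto elim: Rats_cases)
    define p q where "p = real_of_rat p'" and "q = real_of_rat q'"
    have py: "0 < bump p q y" using p' q' by (simp add: bump_def p_def q_def)
    have p0: "bump p q x = 0" if "x \<in> Y" "x \<noteq> y" for x
    proof -
      have "x \<le> p \<or> q \<le> x" using e[OF that] p' q' by (auto simp: p_def q_def abs_if split: if_splits)
      then have "(x - p) * (q - x) \<le> 0"
        using p' q' by (auto simp: p_def q_def intro: mult_nonpos_nonneg mult_nonneg_nonpos)
      then show ?thesis by (simp add: bump_def)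
    qed
    have Rt: "p \<in> \<rat>" "q \<in> \<rat>" by (auto simp: p_def q_def)
    have t1: "bump p q \<in> slice_tests" "(\<lambda>x. x * bump p q x) \<in> slice_tests"
      unfolding slice_tests_def using Rt by force+
    have sing: "(\<Sum>x\<in>Y. c x * g x) = c y * g y" if "\<And>x. x \<in> Y \<Longrightarrow> x \<noteq> y \<Longrightarrow> g x = 0" for g
    proof -
      have "(\<Sum>x\<in>Y. c x * g x) = c y * g y + (\<Sum>x\<in>Y - {y}. c x * g x)" using Y(1) y by (rule sum.remove)
      also have "(\<Sum>x\<in>Y - {y}. c x * g x) = 0" using that by (intro sum.neutral) auto
      finally show ?thesis by simp
    qed
    have v: "slice_lim t (bump p q) = c y * bump p q y"
      using rep[rule_format, OF t1(1)] sing[of "bump p q"] p0 by simp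
    have u: "slice_lim t (\<lambda>x. x * bump p q x) = c y * (y * bump p q y)"
      using rep[rule_format, OF t1(2)] sing[of "\<lambda>x. x * bump p q x"] p0 by simp
    have cy: "c y \<noteq> 0" using Y(2) y by blast
    then have "0 < \<bar>c y * bump p q y\<bar>" using py by simp
    then obtain n where n: "1 / Suc n < \<bar>c y * bump p q y\<bar>" using nat_approx_posE by blast
    have "(t, slice_lim t (\<lambda>x. x * bump p q x) / slice_lim t (bump p q)) \<in> range (G (p', q', n))"
    proof -
      have "1 / real (Suc n) \<le> \<bar>slice_lim t (bump p q)\<bar>" using n unfolding v by (rule less_imp_le)
      then show ?thesis
        using G[THEN spec, of "(p', q', n)", THEN conjunct2, THEN spec, of t] unfolding p_def q_def fst_conv snd_conv by blast
    qed
    moreover have "slice_lim t (\<lambda>x. x * bump p q x) / slice_lim t (bump p q) = y"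
      unfolding u v using cy py by simp
    ultimately have "(t, y) \<in> range (G (from_nat (to_nat (p', q', n))))" by simp
    then show "(t, y) \<in> (\<Union>k. range (G (from_nat k)))" by blast
  qed
qed

section \<open>Disintegration into atoms and passage to Borel sets\<close>

text \<open>Powers of the second variable belong to \<open>slice_tests\<close>, and a continuous
  factor in \<open>t\<close> passes through the slicing unchanged. Finite sums of such products form
  an algebra that separates points, so Stone--Weierstrass applies.\<close>

inductive separable :: "(real \<times> real \<Rightarrow> real) \<Rightarrow> bool" where
  base: "continuous_on UNIV \<beta> \<Longrightarrow> separable (\<lambda>z. \<beta> (fst z) * snd z ^ k)"
| plus: "separable p \<Longrightarrow> separable q \<Longrightarrow> separable (\<lambda>z. p z + q z)"

lemma separable_continuous: "separable p \<Longrightarrow> continuous_on UNIV p"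
proof (induction rule: separable.induct)
  case (base \<beta> k)
  then show ?case by (intro continuous_on_mult cont_fst) (auto intro!: continuous_intros)
next
  case (plus p q)
  then show ?case by (intro continuous_on_add)
qed

lemma separable_mult: "separable p \<Longrightarrow> separable q \<Longrightarrow> separable (\<lambda>z. p z * q z)"
proof (induction arbitrary: q rule: separable.induct)
  case (base \<beta> k)
  from base(2) show ?case
  proof (induction rule: separable.induct)
    case (base \<gamma> l)
    have "separable (\<lambda>z. (\<beta> (fst z) * \<gamma> (fst z)) * snd z ^ (k + l))"
      using separable.base[of "\<lambda>t. \<beta> t * \<gamma> t" "k + l"] \<open>continuous_on UNIV \<beta>\<close> base by (auto intro: continuous_on_mult)
    moreover have "(\<lambda>z. (\<beta> (fst z) * \<gamma> (fst z)) * snd z ^ (k + l)) = (\<lambda>z. \<beta> (fst z) * snd z ^ k * (\<gamma> (fst z) * snd z ^ l))"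
      by (simp add: fun_eq_iff power_add mult_ac)
    ultimately show ?case by simp
  next
    case (plus p q)
    then show ?case by (simp only: distrib_left) (rule separable.plus)
  qed
next
  case (plus p1 p2)
  then show ?case by (simp only: distrib_right) (rule separable.plus; blast)
qed

lemma separable_dense:
  fixes \<psi> :: "real \<times> real \<Rightarrow> real"
  assumes \<psi>: "continuous_on UNIV \<psi>" and e: "0 < e"
  shows "\<exists>p. separable p \<and> (\<forall>z\<in>{-R..R} \<times> {-R..R}. \<bar>\<psi> z - p z\<bar> < e)"
proof -
  have c: "separable (\<lambda>z. c)" for c using separable.base[of "\<lambda>_. c" 0] by simp
  have f: "separable fst" using separable.base[of "\<lambda>t. t" 0] by simp
  have s: "separable snd" using separable.base[of "\<lambda>_. 1" 1] by simp
  have "\<exists>g. separable g \<and> (\<forall>x\<in>{-R..R} \<times> {-R..R}. \<bar>\<psi> x - g x\<bar> < e)"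
  proof (rule Stone_Weierstrass_HOL[of "{-R..R} \<times> {-R..R}" separable])
    show "compact ({-R..R} \<times> {-R..R})" by (rule compact_box)
    show "separable (\<lambda>x. c)" for c by (rule c)
    show "continuous_on ({-R..R} \<times> {-R..R}) f" if "separable f" for f
      using separable_continuous[OF that] by (rule continuous_on_subset) simp
    show "separable (\<lambda>x. f x + g x)" if "separable f \<and> separable g" for f g using that separable.plus by blast
    show "separable (\<lambda>x. f x * g x)" if "separable f \<and> separable g" for f g using that separable_mult by blast
    show "\<exists>f. separable f \<and> f x \<noteq> f y"
      if "x \<in> {-R..R} \<times> {-R..R} \<and> y \<in> {-R..R} \<times> {-R..R} \<and> x \<noteq> y" for x y :: "real \<times> real"
      using f s that by (metis prod_eqI)
    show "continuous_on ({-R..R} \<times> {-R..R}) \<psi>" using \<psi> by (rule continuous_on_subset) simp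
    show "0 < e" by (rule e)
  qed
  then show ?thesis .
qed

text \<open>Atoms and weights are chosen line by line, with no measurability in \<open>t\<close>.
  The function \<open>Q\<close> is built from \<open>slice_lim\<close>, hence measurable, and agrees
  with the sum over the atoms on good lines.\<close>

lemma separable_slices:
  assumes Y: "\<And>t f. good t \<Longrightarrow> f \<in> slice_tests \<Longrightarrow> slice_lim t f = (\<Sum>y\<in>Y t. c t y * f y)"
    and p: "separable p"
  shows "\<exists>Q \<in> borel_measurable borel. integrable lborel (\<lambda>t. indicator {-R..R} t * Q t :: real) \<and>
    (\<integral>z. p z * g1 z \<partial>mu) = (\<integral>t. indicator {-R..R} t * Q t \<partial>lborel) \<and>
    (\<forall>t. good t \<longrightarrow> Q t = (\<Sum>y\<in>Y t. c t y * p (t, y)))"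
  using p
proof (induction rule: separable.induct)
  case (base \<beta> k)
  have f: "(\<lambda>y. y ^ k) \<in> slice_tests" by (auto simp: slice_tests_def)
  have [measurable]: "\<beta> \<in> borel_measurable borel" by (rule borel_measurable_continuous_onI[OF base])
  have [measurable]: "(\<lambda>t. slice_lim t (\<lambda>y. y ^ k)) \<in> borel_measurable borel" by (rule measurable_slice_lim[OF C1_power])
  show ?case
  proof (intro bexI[of _ "\<lambda>t. \<beta> t * slice_lim t (\<lambda>y. y ^ k)"] conjI allI impI)
    show "(\<lambda>t. \<beta> t * slice_lim t (\<lambda>y. y ^ k)) \<in> borel_measurable borel" by measurable
    show "\<beta> t * slice_lim t (\<lambda>y. y ^ k) = (\<Sum>y\<in>Y t. c t y * (\<beta> (fst (t, y)) * snd (t, y) ^ k))" if "good t" for t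
      using Y[OF that f] by (simp add: sum_distrib_left mult_ac)
  qed (use slice_lim_integral[OF C1_power base, of k] in simp_all)
next
  case (plus p q)
  obtain Q1 where Q1: "Q1 \<in> borel_measurable borel" "integrable lborel (\<lambda>t. indicator {-R..R} t * Q1 t :: real)"
    "(\<integral>z. p z * g1 z \<partial>mu) = (\<integral>t. indicator {-R..R} t * Q1 t \<partial>lborel)"
    "\<forall>t. good t \<longrightarrow> Q1 t = (\<Sum>y\<in>Y t. c t y * p (t, y))"
    using plus.IH(1) by (elim bexE conjE) (rule that)
  obtain Q2 where Q2: "Q2 \<in> borel_measurable borel" "integrable lborel (\<lambda>t. indicator {-R..R} t * Q2 t :: real)"
    "(\<integral>z. q z * g1 z \<partial>mu) = (\<integral>t. indicator {-R..R} t * Q2 t \<partial>lborel)"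
    "\<forall>t. good t \<longrightarrow> Q2 t = (\<Sum>y\<in>Y t. c t y * q (t, y))"
    using plus.IH(2) by (elim bexE conjE) (rule that)
  have ip: "integrable mu (\<lambda>z. p z * g1 z)" "integrable mu (\<lambda>z. q z * g1 z)"
    by (rule integrable_cont_mu[OF separable_continuous[OF plus.hyps(1)] intg1]
        integrable_cont_mu[OF separable_continuous[OF plus.hyps(2)] intg1])+
  show ?case
  proof (intro bexI[of _ "\<lambda>t. Q1 t + Q2 t"] conjI allI impI)
    show "(\<lambda>t. Q1 t + Q2 t) \<in> borel_measurable borel" using Q1(1) Q2(1) by simp
    show "integrable lborel (\<lambda>t. indicator {-R..R} t * (Q1 t + Q2 t) :: real)"
      unfolding distrib_left by (intro Bochner_Integration.integrable_add Q1(2) Q2(2))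
    show "(\<integral>z. (p z + q z) * g1 z \<partial>mu) = (\<integral>t. indicator {-R..R} t * (Q1 t + Q2 t) \<partial>lborel)"
      unfolding distrib_left distrib_right Bochner_Integration.integral_add[OF ip]
        Bochner_Integration.integral_add[OF Q1(2) Q2(2)] Q1(3) Q2(3) ..
    show "Q1 t + Q2 t = (\<Sum>y\<in>Y t. c t y * (p (t, y) + q (t, y)))" if "good t" for t
      using Q1(4)[rule_format, OF that] Q2(4)[rule_format, OF that] by (simp add: distrib_left sum.distrib)
  qed
qed

text \<open>The indicator of \<open>A\<close> is a bounded limit of separable functions on the box.
  On almost every line the atoms avoid \<open>A\<close>, so the corresponding sums over atoms tend
  to 0, and \<open>kappa\<close> dominates them.\<close>

lemma integral_compact_zero:
  assumes Y: "\<And>t. good t \<Longrightarrow> finite (Y t)" "\<And>t. good t \<Longrightarrow> Y t \<subseteq> {-R..R}"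
    and rep: "\<And>t f. good t \<Longrightarrow> f \<in> slice_tests \<Longrightarrow> slice_lim t f = (\<Sum>y\<in>Y t. c t y * f y)"
    and bd: "\<And>t v M. good t \<Longrightarrow> 0 \<le> M \<Longrightarrow> \<forall>y\<in>Y t. \<bar>v y\<bar> \<le> M \<Longrightarrow> \<bar>\<Sum>y\<in>Y t. c t y * v y\<bar> \<le> kappa t * M"
    and A: "compact A" "AE t in lborel. \<forall>y\<in>Y t. good t \<longrightarrow> (t, y) \<notin> A"
  shows "(\<integral>z. indicator A z * g1 z \<partial>mu) = 0"
proof (cases "A = {}")
  case False
  define \<psi> where "\<psi> n z = max 0 (1 - real n * infdist z A)" for n z
  have cont: "continuous_on UNIV (\<psi> n)" for n unfolding \<psi>_def[abs_def] by (intro continuous_intros)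
  have bpsi: "0 \<le> \<psi> n z" "\<psi> n z \<le> 1" for n z by (auto simp: \<psi>_def infdist_nonneg)
  have limpsi: "(\<lambda>n. \<psi> n z) \<longlonglongrightarrow> indicator A z" for z
  proof (cases "z \<in> A")
    case True then show ?thesis by (simp add: \<psi>_def)
  next
    case F: False
    then have d: "0 < infdist z A"
      using A(1) False by (metis compact_imp_closed in_closed_iff_infdist_zero infdist_nonneg order_le_less)
    obtain n0 :: nat where n0: "1 / infdist z A < n0" using reals_Archimedean2 by blast
    have "\<psi> n z = 0" if "n0 \<le> n" for n
    proof -
      have "1 / infdist z A < real n" using n0 that by linarith
      then show ?thesis using d by (simp add: \<psi>_def field_simps)
    qed
    then have "eventually (\<lambda>n. \<psi> n z = 0) sequentially" unfolding eventually_sequentially by blast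
    then show ?thesis using F by (simp add: tendsto_eventually)
  qed
  have "\<forall>n. \<exists>p. separable p \<and> (\<forall>z\<in>{-R..R} \<times> {-R..R}. \<bar>\<psi> n z - p z\<bar> < 1 / real (Suc n))"
    by (intro allI separable_dense cont) simp
  from choice[OF this] obtain p where p: "\<forall>n. separable (p n) \<and> (\<forall>z\<in>{-R..R} \<times> {-R..R}. \<bar>\<psi> n z - p n z\<bar> < 1 / real (Suc n))" ..
  have close: "\<bar>\<psi> n z - p n z\<bar> \<le> 1 / real (Suc n)" if "z \<in> {-R..R} \<times> {-R..R}" for n z
    using p that by (meson less_imp_le)
  have bp: "\<bar>p n z\<bar> \<le> 2" if "z \<in> {-R..R} \<times> {-R..R}" for n z
  proof -
    have "1 / real (Suc n) \<le> 1" by simp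
    then show ?thesis using close[OF that, of n] bpsi[of n z] by linarith
  qed
  have limp: "(\<lambda>n. p n z) \<longlonglongrightarrow> indicator A z" if z: "z \<in> {-R..R} \<times> {-R..R}" for z
  proof -
    have "(\<lambda>n. \<psi> n z - p n z) \<longlonglongrightarrow> 0"
    proof (rule Lim_null_comparison)
      show "\<forall>\<^sub>F n in sequentially. norm (\<psi> n z - p n z) \<le> 1 / real (Suc n)"
        using close[OF z] by (intro always_eventually allI) simp
      show "(\<lambda>n. 1 / real (Suc n)) \<longlonglongrightarrow> 0" by (rule LIMSEQ_Suc[OF lim_1_over_n])
    qed
    from tendsto_diff[OF limpsi[of z] this] show ?thesis by simp
  qed
  have "\<forall>n. \<exists>Q. Q \<in> borel_measurable borel \<and> integrable lborel (\<lambda>t. indicator {-R..R} t * Q t :: real) \<and>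
    (\<integral>z. p n z * g1 z \<partial>mu) = (\<integral>t. indicator {-R..R} t * Q t \<partial>lborel) \<and>
    (\<forall>t. good t \<longrightarrow> Q t = (\<Sum>y\<in>Y t. c t y * p n (t, y)))"
  proof
    fix n
    have "separable (p n)" using p by blast
    from separable_slices[where Y = Y and c = c, OF rep this]
    show "\<exists>Q. Q \<in> borel_measurable borel \<and> integrable lborel (\<lambda>t. indicator {-R..R} t * Q t :: real) \<and>
    (\<integral>z. p n z * g1 z \<partial>mu) = (\<integral>t. indicator {-R..R} t * Q t \<partial>lborel) \<and>
    (\<forall>t. good t \<longrightarrow> Q t = (\<Sum>y\<in>Y t. c t y * p n (t, y)))" unfolding Bex_def .
  qed
  from choice[OF this] obtain Q where Q: "\<forall>n. Q n \<in> borel_measurable borel \<and> integrable lborel (\<lambda>t. indicator {-R..R} t * Q n t :: real) \<and>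
    (\<integral>z. p n z * g1 z \<partial>mu) = (\<integral>t. indicator {-R..R} t * Q n t \<partial>lborel) \<and>
    (\<forall>t. good t \<longrightarrow> Q n t = (\<Sum>y\<in>Y t. c t y * p n (t, y)))" ..
  have [measurable]: "Q n \<in> borel_measurable borel" for n using Q by blast
  have L1: "(\<lambda>n. \<integral>z. p n z * g1 z \<partial>mu) \<longlonglongrightarrow> (\<integral>z. indicator A z * g1 z \<partial>mu)"
  proof (rule integral_dominated_convergence)
    show "integrable mu (\<lambda>z. 2 * \<bar>g1 z\<bar>)" by (intro integrable_mult_right integrable_abs intg1)
    have "continuous_on UNIV (p n)" for n using p separable_continuous by blast
    then show "(\<lambda>z. p n z * g1 z) \<in> borel_measurable mu" for n
      by (intro borel_measurable_integrable integrable_cont_mu intg1)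
    show "(\<lambda>z. indicator A z * g1 z) \<in> borel_measurable mu"
      using A(1) by (intro borel_measurable_times borel_measurable_integrable[OF intg1] measurable_mu borel_measurable_indicator)
        (simp add: compact_imp_closed)
    show "AE z in mu. (\<lambda>n. p n z * g1 z) \<longlonglongrightarrow> indicator A z * g1 z"
      using suppmu by eventually_elim (intro tendsto_mult_right limp, auto simp: mem_Times_iff)
    show "AE z in mu. norm (p n z * g1 z) \<le> 2 * \<bar>g1 z\<bar>" for n
      using suppmu
    proof eventually_elim
      case (elim z)
      then have "\<bar>p n z\<bar> \<le> 2" by (intro bp) (auto simp: mem_Times_iff)
      then show ?case by (simp add: abs_mult mult_right_mono)
    qed
  qed
  have L2: "(\<lambda>n. \<integral>t. indicator {-R..R} t * Q n t \<partial>lborel) \<longlonglongrightarrow> (\<integral>t. 0 \<partial>(lborel :: real measure))"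
  proof (rule integral_dominated_convergence)
    have "integrable lborel (\<lambda>t. enn2real (slice_energy_lim t))"
    proof (rule integrableI_bounded)
      have "(\<integral>\<^sup>+t. ennreal (norm (enn2real (slice_energy_lim t))) \<partial>lborel) \<le> (\<integral>\<^sup>+t. slice_energy_lim t \<partial>lborel)"
      proof (rule nn_integral_mono)
        fix t show "ennreal (norm (enn2real (slice_energy_lim t))) \<le> slice_energy_lim t"
          by (cases "slice_energy_lim t") auto
      qed
      also have "\<dots> < \<infinity>" using slice_energy_lim_integral by (rule le_less_trans) simp
      finally show "(\<integral>\<^sup>+t. ennreal (norm (enn2real (slice_energy_lim t))) \<partial>lborel) < \<infinity>" .
    qed simp
    moreover have "integrable lborel (indicator {-R..R} :: real \<Rightarrow> real)"
      using R by (intro integrable_real_indicator) auto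
    \<comment> \<open>For t in {-R..R} this is 2 * \<open>kappa t\<close>; the 1 in
      \<open>kappa\<close> is cut off to the interval so that the majorant is integrable on the
      line.\<close>
    ultimately show "integrable lborel (\<lambda>t. 2 * (enn2real (slice_energy_lim t) + indicator {-R..R} t))"
      by (intro integrable_mult_right Bochner_Integration.integrable_add)
    show "(\<lambda>t. indicator {-R..R} t * Q n t) \<in> borel_measurable lborel" for n by measurable
    show "AE t in lborel. (\<lambda>n. indicator {-R..R} t * Q n t) \<longlonglongrightarrow> 0"
      using AE_good A(2)
    proof eventually_elim
      case (elim t)
      show ?case
      proof (cases "t \<in> {-R..R}")
        case True
        have "(\<lambda>n. \<Sum>y\<in>Y t. c t y * p n (t, y)) \<longlonglongrightarrow> (\<Sum>y\<in>Y t. c t y * indicator A (t, y))"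
          using True Y(2)[OF elim(1)] by (intro tendsto_sum tendsto_mult_left limp) auto
        moreover have "(\<Sum>y\<in>Y t. c t y * indicator A (t, y)) = 0"
          using elim by (intro sum.neutral) auto
        moreover have "indicator {-R..R} t * Q n t = (\<Sum>y\<in>Y t. c t y * p n (t, y))" for n
          using Q elim(1) True by simp
        ultimately show ?thesis by (simp only:)
      qed simp
    qed
    show "AE t in lborel. norm (indicator {-R..R} t * Q n t) \<le> 2 * (enn2real (slice_energy_lim t) + indicator {-R..R} t)" for n
      using AE_good
    proof eventually_elim
      case (elim t)
      show ?case
      proof (cases "t \<in> {-R..R}")
        case True
        have "\<bar>\<Sum>y\<in>Y t. c t y * p n (t, y)\<bar> \<le> kappa t * 2"
          using True Y(2)[OF elim] by (intro bd elim ballI bp) auto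
        moreover have "Q n t = (\<Sum>y\<in>Y t. c t y * p n (t, y))" using Q elim by blast
        ultimately show ?thesis using True by (simp add: kappa_def)
      qed simp
    qed
  qed simp
  have eq: "(\<integral>z. p n z * g1 z \<partial>mu) = (\<integral>t. indicator {-R..R} t * Q n t \<partial>lborel)" for n using Q by blast
  from LIMSEQ_unique[OF L1 L2[folded eq]] show ?thesis by simp
qed simp

text \<open>On the part of \<open>A\<close> where \<open>g1\<close> has a fixed sign, the integral
  of \<open>g1\<close> over every compact subset vanishes, as almost every line misses that part
  along the curves and hence at its atoms. Inner regularity then gives zero mass; the sign
  \<open>s\<close> covers both parts.\<close>

theorem concentrated_on_curves:
  "\<exists>F :: nat \<Rightarrow> real \<Rightarrow> real \<times> real. (\<forall>k. \<exists>L. L-lipschitz_on UNIV (F k)) \<and>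
    (\<forall>A \<in> sets borel. (AE t in lborel. \<forall>y. (t, y) \<notin> A \<inter> (\<Union>k. range (F k))) \<longrightarrow>
      (AE z in mu. z \<in> A \<longrightarrow> g1 z = 0))"
proof -
  have "\<forall>t. \<exists>Yc. good t \<longrightarrow> finite (fst Yc) \<and> fst Yc \<subseteq> {-R..R} \<and> (\<forall>y\<in>fst Yc. snd Yc y \<noteq> 0) \<and>
    (\<forall>f\<in>slice_tests. slice_lim t f = (\<Sum>y\<in>fst Yc. snd Yc y * f y)) \<and>
    (\<forall>v M. 0 \<le> M \<longrightarrow> (\<forall>y\<in>fst Yc. \<bar>v y\<bar> \<le> M) \<longrightarrow> \<bar>\<Sum>y\<in>fst Yc. snd Yc y * v y\<bar> \<le> kappa t * M)"
    using good_atomic by (intro allI) (simp add: split_paired_Ex)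
  from choice[OF this] obtain YC where "\<forall>t. good t \<longrightarrow> finite (fst (YC t)) \<and> fst (YC t) \<subseteq> {-R..R} \<and> (\<forall>y\<in>fst (YC t). snd (YC t) y \<noteq> 0) \<and>
    (\<forall>f\<in>slice_tests. slice_lim t f = (\<Sum>y\<in>fst (YC t). snd (YC t) y * f y)) \<and>
    (\<forall>v M. 0 \<le> M \<longrightarrow> (\<forall>y\<in>fst (YC t). \<bar>v y\<bar> \<le> M) \<longrightarrow> \<bar>\<Sum>y\<in>fst (YC t). snd (YC t) y * v y\<bar> \<le> kappa t * M)" ..
  note YC = this[rule_format]
  define Y c where "Y t = fst (YC t)" and "c t = snd (YC t)" for t
  have Y: "finite (Y t)" "Y t \<subseteq> {-R..R}" "\<forall>y\<in>Y t. c t y \<noteq> 0" "\<forall>f\<in>slice_tests. slice_lim t f = (\<Sum>y\<in>Y t. c t y * f y)"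
    "\<forall>v M. 0 \<le> M \<longrightarrow> (\<forall>y\<in>Y t. \<bar>v y\<bar> \<le> M) \<longrightarrow> \<bar>\<Sum>y\<in>Y t. c t y * v y\<bar> \<le> kappa t * M" if "good t" for t
    using YC[OF that] unfolding Y_def c_def by blast+
  obtain F :: "nat \<Rightarrow> real \<Rightarrow> real \<times> real" where F: "\<forall>k. \<exists>L. L-lipschitz_on UNIV (F k)"
    and FY: "\<forall>t Y c. finite Y \<longrightarrow> (\<forall>y\<in>Y. c y \<noteq> 0) \<longrightarrow> (\<forall>f\<in>slice_tests. slice_lim t f = (\<Sum>y\<in>Y. c y * f y)) \<longrightarrow>
      (\<forall>y\<in>Y. (t, y) \<in> (\<Union>k. range (F k)))"
    using atoms_on_curves by (elim exE conjE) (rule that)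
  have YF: "(t, y) \<in> (\<Union>k. range (F k))" if "good t" "y \<in> Y t" for t y
    using FY[rule_format, OF Y(1)[OF that(1)] _ _ that(2), of "c t" t] Y(3,4)[OF that(1)] by blast
  have zero: "AE z in mu. z \<in> A \<longrightarrow> \<not> 0 < s * g1 z"
    if A: "A \<in> sets borel" "AE t in lborel. \<forall>y. (t, y) \<notin> A \<inter> (\<Union>k. range (F k))" and s: "s = 1 \<or> s = -1" for A and s :: real
  proof -
    define B where "B = A \<inter> {z. 0 < s * g1 z}"
    have [measurable]: "g1 \<in> borel_measurable borel" by (rule measurable_g)
    have B: "B \<in> sets borel" unfolding B_def using A(1) by measurable
    define \<nu> where "\<nu> = density mu (\<lambda>z. ennreal (max 0 (s * g1 z)))"
    have m: "(\<lambda>z. ennreal (max 0 (s * g1 z))) \<in> borel_measurable mu"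
      using borel_measurable_integrable[OF intg1] by simp
    have sn: "sets \<nu> = sets borel" by (simp add: \<nu>_def smu)
    have ip: "integrable mu (\<lambda>z. max 0 (s * g1 z))" using intg1 by simp
    have em: "emeasure \<nu> k = ennreal (\<integral>z. indicator k z * max 0 (s * g1 z) \<partial>mu)" if k: "k \<in> sets borel" for k
    proof -
      have "emeasure \<nu> k = (\<integral>\<^sup>+z. ennreal (indicator k z * max 0 (s * g1 z)) \<partial>mu)"
        unfolding \<nu>_def using k smu by (subst emeasure_density[OF m]) (auto intro!: nn_integral_cong split: split_indicator)
      also have "\<dots> = ennreal (\<integral>z. indicator k z * max 0 (s * g1 z) \<partial>mu)"
        using k smu ip by (intro nn_integral_eq_integral integrable_mult_indicator[where 'b = real, simplified]) auto
      finally show ?thesis .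
    qed
    have spn: "space \<nu> = UNIV" using sets_eq_imp_space_eq[OF sn] by simp
    have "emeasure \<nu> B = (SUP k \<in> {k. k \<subseteq> B \<and> compact k}. emeasure \<nu> k)"
      by (rule inner_regular[OF sn _ B]) (simp add: spn em)
    also have "\<dots> \<le> 0"
    proof (rule SUP_least)
      fix k assume "k \<in> {k. k \<subseteq> B \<and> compact k}"
      then have k: "k \<subseteq> B" "compact k" by auto
      have ae: "AE t in lborel. \<forall>y\<in>Y t. good t \<longrightarrow> (t, y) \<notin> k"
        using A(2)
      proof eventually_elim
        case (elim t)
        show ?case
        proof (intro ballI impI notI)
          fix y assume y: "y \<in> Y t" "good t" "(t, y) \<in> k"
          have "(t, y) \<in> A" using k(1) y(3) by (auto simp: B_def)
          then have "(t, y) \<in> A \<inter> (\<Union>k. range (F k))" using YF[OF y(2,1)] by (rule IntI)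
          with elim[THEN spec, of y] show False by (rule notE)
        qed
      qed
      have 0: "(\<integral>z. indicator k z * g1 z \<partial>mu) = 0"
        by (rule integral_compact_zero[where c = c, OF Y(1,2) _ _ k(2) ae]) (assumption, assumption, rule Y(4)[THEN bspec], assumption+, rule Y(5)[rule_format], assumption+, erule (1) bspec)
      have "(\<integral>z. indicator k z * max 0 (s * g1 z) \<partial>mu) = (\<integral>z. s * (indicator k z * g1 z) \<partial>mu)"
        using k(1) by (intro Bochner_Integration.integral_cong) (auto simp: B_def max_def split: split_indicator)
      also have "\<dots> = 0" by (simp only: integral_mult_right_zero 0)
      finally show "emeasure \<nu> k \<le> 0" using k(2) by (simp add: em compact_imp_closed)
    qed
    finally have "emeasure \<nu> B = 0" by simp
    then have "(\<integral>\<^sup>+z. ennreal (max 0 (s * g1 z)) * indicator B z \<partial>mu) = 0"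
      using B smu unfolding \<nu>_def by (subst (asm) emeasure_density[OF m]) auto
    then have "AE z in mu. ennreal (max 0 (s * g1 z)) * indicator B z = 0"
      using m B smu by (subst (asm) nn_integral_0_iff_AE) auto
    then show ?thesis
    proof eventually_elim
      case (elim z)
      then show ?case by (auto simp: B_def indicator_def split: if_splits)
    qed
  qed
  show ?thesis
  proof (intro exI[of _ F] conjI F ballI impI)
    fix A :: "(real \<times> real) set" assume A: "A \<in> sets borel" "AE t in lborel. \<forall>y. (t, y) \<notin> A \<inter> (\<Union>k. range (F k))"
    show "AE z in mu. z \<in> A \<longrightarrow> g1 z = 0"
    proof -
      have "AE z in mu. z \<in> A \<longrightarrow> \<not> 0 < 1 * g1 z" by (rule zero[OF A]) simp
      moreover have "AE z in mu. z \<in> A \<longrightarrow> \<not> 0 < -1 * g1 z" by (rule zero[OF A]) simp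
      ultimately show ?thesis by eventually_elim force
    qed
  qed
qed

end

section \<open>Convolution and divergence\<close>

definition C1_grad :: "(pt \<Rightarrow> real) \<Rightarrow> (pt \<Rightarrow> pt) \<Rightarrow> bool" where
  "C1_grad q G \<longleftrightarrow> (\<forall>x. (q has_derivative (\<lambda>v. G x \<bullet> v)) (at x)) \<and> continuous_on UNIV G"

lemma C1_grad_frechet: "C1_grad q G \<Longrightarrow> frechet_derivative q (at x) = (\<lambda>v. G x \<bullet> v)"
  unfolding C1_grad_def using frechet_derivative_at by metis

lemma C1_grad_grad: assumes "C1_grad q G" shows "grad q = G"
  by (simp add: fun_eq_iff grad_def vec_eq_iff C1_grad_frechet[OF assms] inner_axis)

lemma C1_grad_continuous: "C1_grad q G \<Longrightarrow> continuous_on UNIV q"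
  unfolding C1_grad_def by (meson has_derivative_continuous continuous_at_imp_continuous_on)

lemma smooth_C1_grad:
  assumes "smooth_fn q" shows "C1_grad q (grad q)"
proof -
  have Ck: "Ck n q" for n using assms by (simp add: smooth_fn_def)
  have d: "q differentiable (at x)" for x
    using Ck[of 1] by (simp add: differentiable_on_def)
  have "(q has_derivative (\<lambda>v. grad q x \<bullet> v)) (at x)" for x
  proof -
    have D: "(q has_derivative frechet_derivative q (at x)) (at x)"
      using d frechet_derivative_works by blast
    interpret bounded_linear "frechet_derivative q (at x)" using D by (rule has_derivative_bounded_linear)
    have "frechet_derivative q (at x) v = grad q x \<bullet> v" for v
    proof -
      have "v = (\<Sum>i\<in>UNIV. v $ i *\<^sub>R axis i 1)"
        by (simp add: basis_expansion scalar_mult_eq_scaleR[symmetric])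
      then have "frechet_derivative q (at x) v = (\<Sum>i\<in>UNIV. v $ i * frechet_derivative q (at x) (axis i 1))"
        by (metis (mono_tags, lifting) scaleR real_scaleR_def sum sum.cong)
      then show ?thesis by (simp add: inner_vec_def grad_def mult.commute)
    qed
    then have "frechet_derivative q (at x) = (\<lambda>v. grad q x \<bullet> v)" by (rule ext)
    then show ?thesis using D by (simp only:)
  qed
  moreover have "continuous_on UNIV (grad q)"
  proof -
    have "continuous_on UNIV (\<lambda>x. frechet_derivative q (at x) (axis i 1))" for i
      using Ck[of 1] by simp
    then show ?thesis unfolding grad_def[abs_def] by (rule continuous_on_vec_lambda)
  qed
  ultimately show ?thesis by (simp add: C1_grad_def)
qed

lemma smooth_continuous: "smooth_fn q \<Longrightarrow> continuous_on UNIV q"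
  by (rule C1_grad_continuous[OF smooth_C1_grad])

lemma smooth_partial:
  assumes "smooth_fn q" shows "smooth_fn (\<lambda>x. grad q x $ i)"
proof -
  have "Ck n (\<lambda>x. frechet_derivative q (at x) (axis i 1))" for n
    using assms[unfolded smooth_fn_def, THEN spec, of "Suc n"] by simp
  then show ?thesis unfolding smooth_fn_def grad_def vec_lambda_beta by (rule allI)
qed

text \<open>Avoids computing higher derivatives: \<open>Ck\<close> is descended one order at a time
  inside a class that is closed under partial derivatives.\<close>

lemma smooth_fnI:
  assumes "\<And>q. P q \<Longrightarrow> \<exists>G. C1_grad q G \<and> (\<forall>i. P (\<lambda>x. G x $ i))" and "P q"
  shows "smooth_fn q"
proof -
  have "Ck n q" if "P q" for n q
    using that
  proof (induction n arbitrary: q)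
    case 0
    from assms(1)[OF this] obtain G where "C1_grad q G" by blast
    then show ?case using C1_grad_continuous by simp
  next
    case (Suc n)
    obtain G where G: "C1_grad q G" "\<And>i. P (\<lambda>x. G x $ i)" using assms(1)[OF Suc.prems] by blast
    have "q differentiable_on UNIV"
      using G(1) by (auto simp: C1_grad_def differentiable_on_def differentiable_def)
    moreover have "Ck n (\<lambda>x. frechet_derivative q (at x) (axis i 1))" for i
      using Suc.IH[OF G(2)[of i]] by (simp add: C1_grad_frechet[OF G(1)] inner_axis)
    ultimately show ?case by simp
  qed
  then show ?thesis using assms(2) by (simp add: smooth_fn_def)
qed

text \<open>Serves both ways of writing a convolution. With \<open>q\<close> the mollifier and
  \<open>k\<close> the rough factor, its iteration gives smoothness; with \<open>k\<close> the
  mollifier and \<open>q\<close> the C1 factor it moves the gradient onto that factor. A fixed box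
  containing the support replaces the plane, since the Leibniz rule is applied on boxes.\<close>

lemma C1_grad_param_integral:
  fixes k :: "pt \<Rightarrow> real"
  assumes k: "continuous_on UNIV k" and q: "C1_grad q G"
  shows "C1_grad (\<lambda>x. integral (cbox a b) (\<lambda>y. k y * q (x - y))) (\<lambda>x. integral (cbox a b) (\<lambda>y. k y *\<^sub>R G (x - y)))"
proof -
  have contG: "continuous_on UNIV G" and contq: "continuous_on UNIV q"
    using q C1_grad_continuous by (auto simp: C1_grad_def)
  have cG: "continuous_on S (\<lambda>z. k (snd z) *\<^sub>R G (fst z - snd z))" for S
    by (intro continuous_intros continuous_on_compose2[OF k] continuous_on_compose2[OF contG]) auto
  have "((\<lambda>x. integral (cbox a b) (\<lambda>y. k y * q (x - y))) has_derivative
     (\<lambda>v. integral (cbox a b) (\<lambda>y. k y *\<^sub>R G (x - y)) \<bullet> v)) (at x)" for x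
  proof -
    have "((\<lambda>x. integral (cbox a b) (\<lambda>y. k y * q (x - y))) has_derivative
       blinfun_apply (integral (cbox a b) (\<lambda>y. blinfun_inner_right (k y *\<^sub>R G (x - y))))) (at x within UNIV)"
    proof (rule leibniz_rule)
      fix x t :: pt
      have "((\<lambda>x. q (x - t)) has_derivative (\<lambda>v. G (x - t) \<bullet> v)) (at x)"
      proof -
        have "((\<lambda>x. x - t) has_derivative (\<lambda>v. v)) (at x)" by (auto intro!: derivative_eq_intros)
        then show ?thesis using has_derivative_compose[of "\<lambda>x. x - t" "\<lambda>v. v" x UNIV q] q by (simp add: C1_grad_def)
      qed
      from has_derivative_mult_right[OF this, of "k t"]
      moreover have "blinfun_apply (blinfun_inner_right (k t *\<^sub>R G (x - t))) = (\<lambda>v. k t * (G (x - t) \<bullet> v))"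
        by (simp add: fun_eq_iff)
      ultimately show "((\<lambda>x. k t * q (x - t)) has_derivative blinfun_apply (blinfun_inner_right (k t *\<^sub>R G (x - t)))) (at x within UNIV)"
        by (simp only:)
    next
      fix x :: pt
      show "(\<lambda>y. k y * q (x - y)) integrable_on cbox a b"
        by (intro integrable_continuous continuous_intros continuous_on_subset[OF k] continuous_on_compose2[OF contq]) auto
    next
      show "continuous_on (UNIV \<times> cbox a b) (\<lambda>(x, t). blinfun_inner_right (k t *\<^sub>R G (x - t)))"
        unfolding case_prod_beta'
        by (rule bounded_linear.continuous_on[OF bounded_linear_blinfun_inner_right cG])
    qed auto
    moreover have "integral (cbox a b) (\<lambda>y. blinfun_inner_right (k y *\<^sub>R G (x - y)))
       = blinfun_inner_right (integral (cbox a b) (\<lambda>y. k y *\<^sub>R G (x - y)))"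
    proof -
      have "(\<lambda>y. k y *\<^sub>R G (x - y)) integrable_on cbox a b"
        by (intro integrable_continuous continuous_intros continuous_on_subset[OF k] continuous_on_compose2[OF contG]) auto
      from integral_linear[OF this bounded_linear_blinfun_inner_right] show ?thesis by (simp add: o_def)
    qed
    ultimately show ?thesis by simp
  qed
  moreover have "continuous_on UNIV (\<lambda>x. integral (cbox a b) (\<lambda>y. k y *\<^sub>R G (x - y)))"
    by (intro integral_continuous_on_param) (simp add: case_prod_beta' cG)
  ultimately show ?thesis by (simp add: C1_grad_def)
qed

lemma smooth_param_integral:
  fixes k :: "pt \<Rightarrow> real"
  assumes k: "continuous_on UNIV k" and q: "smooth_fn q"
  shows "smooth_fn (\<lambda>x. integral (cbox a b) (\<lambda>y. k y * q (x - y)))"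
proof (rule smooth_fnI[where P = "\<lambda>F. \<exists>q. smooth_fn q \<and> F = (\<lambda>x. integral (cbox a b) (\<lambda>y. k y * q (x - y)))"])
  fix F assume "\<exists>q. smooth_fn q \<and> F = (\<lambda>x. integral (cbox a b) (\<lambda>y. k y * q (x - y)))"
  then obtain q where q: "smooth_fn q" "F = (\<lambda>x. integral (cbox a b) (\<lambda>y. k y * q (x - y)))" by blast
  let ?G = "\<lambda>x. integral (cbox a b) (\<lambda>y. k y *\<^sub>R grad q (x - y))"
  have contG: "continuous_on UNIV (grad q)" using smooth_C1_grad[OF q(1)] by (simp add: C1_grad_def)
  have "?G x $ i = integral (cbox a b) (\<lambda>y. k y * grad q (x - y) $ i)" for x i
  proof -
    have "(\<lambda>y. k y *\<^sub>R grad q (x - y)) integrable_on cbox a b"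
      by (intro integrable_continuous continuous_intros continuous_on_subset[OF k] continuous_on_compose2[OF contG]) auto
    from integral_linear[OF this bounded_linear_vec_nth[of i]] show ?thesis by (simp add: o_def)
  qed
  then have "\<exists>q'. smooth_fn q' \<and> (\<lambda>x. ?G x $ i) = (\<lambda>x. integral (cbox a b) (\<lambda>y. k y * q' (x - y)))" for i
    using smooth_partial[OF q(1), of i] by (intro exI[of _ "\<lambda>x. grad q x $ i"]) simp
  then show "\<exists>G. C1_grad F G \<and> (\<forall>i. \<exists>q. smooth_fn q \<and> (\<lambda>x. G x $ i) = (\<lambda>x. integral (cbox a b) (\<lambda>y. k y * q (x - y))))"
    using C1_grad_param_integral[OF k smooth_C1_grad[OF q(1)], of a b] q(2) by (intro exI[of _ ?G]) simp
qed (use q in blast)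

lemma smooth_scale:
  assumes "smooth_fn q" shows "smooth_fn (\<lambda>x. s * q (c *\<^sub>R x))"
proof (rule smooth_fnI[where P = "\<lambda>F. \<exists>s q. smooth_fn q \<and> F = (\<lambda>x. s * q (c *\<^sub>R x))"])
  fix F assume "\<exists>s q. smooth_fn q \<and> F = (\<lambda>x. s * q (c *\<^sub>R x))"
  then obtain s q where q: "smooth_fn q" "F = (\<lambda>x. s * q (c *\<^sub>R x))" by blast
  have C: "C1_grad q (grad q)" by (rule smooth_C1_grad[OF q(1)])
  have "C1_grad F (\<lambda>x. (s * c) *\<^sub>R grad q (c *\<^sub>R x))"
    unfolding C1_grad_def
  proof (intro conjI allI)
    fix x :: pt
    have "((\<lambda>x. c *\<^sub>R x) has_derivative (\<lambda>v. c *\<^sub>R v)) (at x)" by (auto intro!: derivative_eq_intros)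
    moreover have "(q has_derivative (\<lambda>v. grad q (c *\<^sub>R x) \<bullet> v)) (at (c *\<^sub>R x))" using C by (simp add: C1_grad_def)
    ultimately have "((\<lambda>x. q (c *\<^sub>R x)) has_derivative (\<lambda>v. grad q (c *\<^sub>R x) \<bullet> (c *\<^sub>R v))) (at x)"
      by (rule has_derivative_compose)
    from has_derivative_mult_right[OF this, of s]
    show "(F has_derivative (\<lambda>v. ((s * c) *\<^sub>R grad q (c *\<^sub>R x)) \<bullet> v)) (at x)" by (simp add: q(2) mult.assoc)
  next
    show "continuous_on UNIV (\<lambda>x. (s * c) *\<^sub>R grad q (c *\<^sub>R x))"
    proof -
      have cg: "continuous_on UNIV (grad q)" using C by (simp add: C1_grad_def)
      have "continuous_on UNIV (\<lambda>x. grad q (c *\<^sub>R x))"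
        by (rule continuous_on_compose2[OF cg]) (auto intro: continuous_on_scaleR continuous_on_const continuous_on_id)
      then show ?thesis by (intro continuous_on_scaleR continuous_on_const)
    qed
  qed
  moreover have "\<exists>s' q'. smooth_fn q' \<and> (\<lambda>x. ((s * c) *\<^sub>R grad q (c *\<^sub>R x)) $ i) = (\<lambda>x. s' * q' (c *\<^sub>R x))" for i
    using smooth_partial[OF q(1), of i] by (intro exI[of _ "s * c"] exI[of _ "\<lambda>x. grad q x $ i"]) simp
  ultimately show "\<exists>G. C1_grad F G \<and> (\<forall>i. \<exists>s q. smooth_fn q \<and> (\<lambda>x. G x $ i) = (\<lambda>x. s * q (c *\<^sub>R x)))"
    by (intro exI[of _ "\<lambda>x. (s * c) *\<^sub>R grad q (c *\<^sub>R x)"] conjI allI)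
next
  show "\<exists>s' q'. smooth_fn q' \<and> (\<lambda>x. s * q (c *\<^sub>R x)) = (\<lambda>x. s' * q' (c *\<^sub>R x))"
    by (intro exI[of _ s] exI[of _ q] conjI assms refl)
qed

section \<open>Mollification and weak divergence\<close>

lemma mollifierD:
  assumes "mollifier \<rho>"
  shows "smooth_fn \<rho>" "0 \<le> \<rho> x" "tsupp \<rho> \<subseteq> ball 0 1" "integral\<^sup>L lborel \<rho> = 1"
  using assms unfolding mollifier_def by blast+

lemma smooth_moll: "mollifier \<rho> \<Longrightarrow> smooth_fn (moll \<rho> \<epsilon>)"
  using smooth_scale[OF mollifierD(1), of \<rho> "1 / \<epsilon>\<^sup>2" "inverse \<epsilon>"] by (simp add: moll_def[abs_def])

lemma continuous_moll: "mollifier \<rho> \<Longrightarrow> continuous_on UNIV (moll \<rho> \<epsilon>)"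
  by (intro smooth_continuous smooth_moll)

lemma measurable_moll: "mollifier \<rho> \<Longrightarrow> moll \<rho> \<epsilon> \<in> borel_measurable borel"
  by (intro borel_measurable_continuous_onI continuous_moll)

lemma moll_nonneg: "mollifier \<rho> \<Longrightarrow> 0 \<le> moll \<rho> \<epsilon> x"
  by (simp add: mollifierD(2) moll_def)

lemma moll_support:
  assumes "mollifier \<rho>" "0 < \<epsilon>" "moll \<rho> \<epsilon> x \<noteq> 0" shows "norm x < \<epsilon>"
proof -
  have "\<rho> (x /\<^sub>R \<epsilon>) \<noteq> 0" using assms(3) by (auto simp: moll_def)
  then have "x /\<^sub>R \<epsilon> \<in> tsupp \<rho>" unfolding tsupp_def by (intro subsetD[OF closure_subset]) simp
  then have "x /\<^sub>R \<epsilon> \<in> ball 0 1" by (rule subsetD[OF mollifierD(3)[OF assms(1)]])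
  then show ?thesis using assms(2) by (simp add: field_simps)
qed

lemma integral_affine_pt:
  fixes f :: "pt \<Rightarrow> 'b::{banach, second_countable_topology}"
  assumes c: "c \<noteq> 0"
  shows "integrable lborel f \<Longrightarrow> integrable lborel (\<lambda>x. f (t + c *\<^sub>R x))"
    and "f \<in> borel_measurable borel \<Longrightarrow> (\<integral>x. f x \<partial>lborel) = c\<^sup>2 *\<^sub>R (\<integral>x. f (t + c *\<^sub>R x) \<partial>lborel)"
proof -
  have L: "(lborel :: pt measure) = density (distr lborel borel (\<lambda>x. t + c *\<^sub>R x)) (\<lambda>_. ennreal (c\<^sup>2))"
    using lborel_affine[OF c, of t] by simp
  show "(\<integral>x. f x \<partial>lborel) = c\<^sup>2 *\<^sub>R (\<integral>x. f (t + c *\<^sub>R x) \<partial>lborel)" if m: "f \<in> borel_measurable borel"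
  proof -
    have "(\<integral>x. f x \<partial>lborel) = (\<integral>x. c\<^sup>2 *\<^sub>R f x \<partial>distr lborel borel (\<lambda>x. t + c *\<^sub>R x))"
      using m by (subst L, subst integral_density) auto
    also have "\<dots> = (\<integral>x. c\<^sup>2 *\<^sub>R f (t + c *\<^sub>R x) \<partial>lborel)"
      using m by (subst integral_distr) auto
    finally show ?thesis using c by simp
  qed
  show "integrable lborel (\<lambda>x. f (t + c *\<^sub>R x))" if i: "integrable lborel f"
  proof -
    have m: "f \<in> borel_measurable borel" using i by auto
    have "integrable (density (distr lborel borel (\<lambda>x. t + c *\<^sub>R x)) (\<lambda>_. ennreal (c\<^sup>2))) f"
      using i L by simp
    then have "integrable (distr lborel borel (\<lambda>x. t + c *\<^sub>R x)) (\<lambda>x. c\<^sup>2 *\<^sub>R f x)"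
      using m by (subst (asm) integrable_density) auto
    then have "integrable lborel (\<lambda>x. c\<^sup>2 *\<^sub>R f (t + c *\<^sub>R x))"
      using m by (subst (asm) integrable_distr_eq) auto
    then have "integrable lborel (\<lambda>x. (1 / c\<^sup>2) *\<^sub>R (c\<^sup>2 *\<^sub>R f (t + c *\<^sub>R x)))" by (rule integrable_scaleR_right)
    then show ?thesis using c by simp
  qed
qed

lemma integrable_compact_support:
  fixes f :: "pt \<Rightarrow> 'b::euclidean_space"
  assumes f: "continuous_on UNIV f" and supp: "\<And>x. f x \<noteq> 0 \<Longrightarrow> x \<in> cbox a b"
  shows "integrable lborel f" "integral (cbox a b) f = (\<integral>x. f x \<partial>lborel)"
proof -
  have i: "set_integrable lborel (cbox a b) f"
    unfolding set_integrable_def using f by (intro borel_integrable_compact) (auto intro: continuous_on_subset)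
  have e: "(\<lambda>x. indicator (cbox a b) x *\<^sub>R f x) = f"
    using supp by (auto simp: fun_eq_iff indicator_def)
  show "integrable lborel f" using i unfolding set_integrable_def e .
  show "integral (cbox a b) f = (\<integral>x. f x \<partial>lborel)"
    using set_borel_integral_eq_integral(2)[OF i] unfolding set_lebesgue_integral_def e by simp
qed

lemma norm_le_cbox: "norm (x :: pt) \<le> A \<Longrightarrow> x \<in> cbox (\<chi> i. - A) (\<chi> i. A)"
  unfolding mem_box_cart
  by (metis abs_le_iff component_le_norm_cart minus_le_iff order_trans vec_lambda_beta)

lemma moll_cbox:
  assumes "mollifier \<rho>" "0 < \<epsilon>" "moll \<rho> \<epsilon> x \<noteq> 0" shows "x \<in> cbox (\<chi> i. - \<epsilon>) (\<chi> i. \<epsilon>)"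
  using moll_support[OF assms] by (intro norm_le_cbox less_imp_le)

lemma integral_moll:
  assumes \<rho>: "mollifier \<rho>" and e: "0 < \<epsilon>"
  shows "integrable lborel (moll \<rho> \<epsilon>)" "(\<integral>x. moll \<rho> \<epsilon> x \<partial>lborel) = 1"
proof -
  show "integrable lborel (moll \<rho> \<epsilon>)"
    by (rule integrable_compact_support[OF continuous_moll[OF \<rho>], where a = "\<chi> i. - \<epsilon>" and b = "\<chi> i. \<epsilon>"])
      (rule moll_cbox[OF \<rho> e])
  have "(\<integral>x. moll \<rho> \<epsilon> x \<partial>lborel) = \<epsilon>\<^sup>2 *\<^sub>R (\<integral>x. moll \<rho> \<epsilon> (0 + \<epsilon> *\<^sub>R x) \<partial>lborel)"
    using e by (intro integral_affine_pt measurable_moll \<rho>) simp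
  also have "\<dots> = (\<integral>x. \<rho> x \<partial>lborel)" using e by (simp add: moll_def)
  finally show "(\<integral>x. moll \<rho> \<epsilon> x \<partial>lborel) = 1" using mollifierD(4)[OF \<rho>] by simp
qed

lemma integrable_moll_mult:
  fixes w :: "pt \<Rightarrow> 'b::euclidean_space"
  assumes \<rho>: "mollifier \<rho>" and e: "0 < \<epsilon>" and w: "continuous_on UNIV w"
  shows "integrable lborel (\<lambda>y. moll \<rho> \<epsilon> y *\<^sub>R w y)"
proof (rule integrable_compact_support)
  show "continuous_on UNIV (\<lambda>y. moll \<rho> \<epsilon> y *\<^sub>R w y)"
    by (intro continuous_on_scaleR continuous_moll[OF \<rho>] w)
  fix y assume "moll \<rho> \<epsilon> y *\<^sub>R w y \<noteq> 0"
  then have "moll \<rho> \<epsilon> y \<noteq> 0" by auto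
  then show "y \<in> cbox (\<chi> i. - \<epsilon>) (\<chi> i. \<epsilon>)" by (rule moll_cbox[OF \<rho> e])
qed

lemma approximate_identity:
  fixes w :: "pt \<Rightarrow> 'b::euclidean_space"
  assumes \<rho>: "mollifier \<rho>" and e: "\<And>n. 0 < e n" "e \<longlonglongrightarrow> 0" and w: "continuous_on UNIV w"
  shows "(\<lambda>n. \<integral>y. moll \<rho> (e n) y *\<^sub>R w y \<partial>lborel) \<longlonglongrightarrow> w 0"
proof (rule LIMSEQ_I)
  fix r :: real assume r: "0 < r"
  obtain d where d: "0 < d" "\<And>y. norm y < d \<Longrightarrow> norm (w y - w 0) < r / 2"
  proof -
    have "\<exists>d>0. \<forall>y. dist y 0 < d \<longrightarrow> dist (w y) (w 0) < r / 2"
      using w r unfolding continuous_on_iff by (metis UNIV_I half_gt_zero)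
    then show ?thesis using that by (auto simp: dist_norm)
  qed
  have "\<forall>\<^sub>F n in sequentially. e n < d" using e(2) d(1) by (rule order_tendstoD(2))
  then have "\<forall>\<^sub>F n in sequentially. norm ((\<integral>y. moll \<rho> (e n) y *\<^sub>R w y \<partial>lborel) - w 0) < r"
  proof eventually_elim
    case (elim n)
    have i1: "integrable lborel (\<lambda>y. moll \<rho> (e n) y *\<^sub>R w y)" by (rule integrable_moll_mult[OF \<rho> e(1) w])
    have i2: "integrable lborel (\<lambda>y. moll \<rho> (e n) y *\<^sub>R w 0)"
      by (intro integrable_scaleR_left integral_moll[OF \<rho> e(1)])
    have "(\<integral>y. moll \<rho> (e n) y *\<^sub>R w 0 \<partial>lborel) = w 0"
      using integral_moll[OF \<rho> e(1)[of n]] by (subst integral_scaleR_left) simp_all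
    then have "(\<integral>y. moll \<rho> (e n) y *\<^sub>R w y \<partial>lborel) - w 0 = (\<integral>y. moll \<rho> (e n) y *\<^sub>R w y - moll \<rho> (e n) y *\<^sub>R w 0 \<partial>lborel)"
      using Bochner_Integration.integral_diff[OF i1 i2] by simp
    also have "norm \<dots> \<le> (\<integral>y. norm (moll \<rho> (e n) y *\<^sub>R w y - moll \<rho> (e n) y *\<^sub>R w 0) \<partial>lborel)"
      by (rule integral_norm_bound)
    also have "\<dots> \<le> (\<integral>y. moll \<rho> (e n) y * (r / 2) \<partial>lborel)"
    proof (rule integral_mono)
      show "integrable lborel (\<lambda>y. norm (moll \<rho> (e n) y *\<^sub>R w y - moll \<rho> (e n) y *\<^sub>R w 0))"
        by (intro integrable_norm Bochner_Integration.integrable_diff i1 i2)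
      show "integrable lborel (\<lambda>y. moll \<rho> (e n) y * (r / 2))"
        by (intro integrable_mult_left integral_moll[OF \<rho> e(1)])
      fix y
      show "norm (moll \<rho> (e n) y *\<^sub>R w y - moll \<rho> (e n) y *\<^sub>R w 0) \<le> moll \<rho> (e n) y * (r / 2)"
      proof (cases "moll \<rho> (e n) y = 0")
        case False
        then have "norm y < d" using moll_support[OF \<rho> e(1)] elim by fastforce
        then have "norm (w y - w 0) \<le> r / 2" using d(2) by (simp add: less_imp_le)
        then have "moll \<rho> (e n) y * norm (w y - w 0) \<le> moll \<rho> (e n) y * (r / 2)"
          by (rule mult_left_mono) (rule moll_nonneg[OF \<rho>])
        then show ?thesis
          using moll_nonneg[OF \<rho>, of "e n" y] unfolding scaleR_diff_right[symmetric] norm_scaleR by simp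
      qed simp
    qed
    also have "\<dots> = r / 2" using integral_moll(2)[OF \<rho> e(1)[of n]] by simp
    finally show ?case using r by linarith
  qed
  then show "\<exists>no. \<forall>n\<ge>no. norm ((\<integral>y. moll \<rho> (e n) y *\<^sub>R w y \<partial>lborel) - w 0) < r"
    by (simp add: eventually_sequentially)
qed

lemma moll_average_bound:
  fixes w :: "pt \<Rightarrow> 'b::euclidean_space"
  assumes \<rho>: "mollifier \<rho>" and e: "0 < \<epsilon>" and w: "continuous_on UNIV w" and B: "\<And>y. norm (w y) \<le> B"
  shows "norm (\<integral>y. moll \<rho> \<epsilon> y *\<^sub>R w y \<partial>lborel) \<le> B"
proof -
  have "norm (\<integral>y. moll \<rho> \<epsilon> y *\<^sub>R w y \<partial>lborel) \<le> (\<integral>y. norm (moll \<rho> \<epsilon> y *\<^sub>R w y) \<partial>lborel)" by (rule integral_norm_bound)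
  also have "\<dots> \<le> (\<integral>y. moll \<rho> \<epsilon> y * B \<partial>lborel)"
    using B moll_nonneg[OF \<rho>, of \<epsilon>]
    by (intro integral_mono integrable_norm integrable_moll_mult[OF \<rho> e w] integrable_mult_left integral_moll[OF \<rho> e])
      (simp add: mult_left_mono)
  also have "\<dots> = B" using integral_moll(2)[OF \<rho> e] by simp
  finally show ?thesis .
qed

lemma C1_grad_support:
  assumes f: "C1_grad f G" and A: "\<And>x. f x \<noteq> 0 \<Longrightarrow> norm x \<le> A" and x: "G x \<noteq> 0"
  shows "norm x \<le> A"
proof (rule ccontr)
  assume "\<not> norm x \<le> A"
  then have xo: "x \<in> - cball 0 A" by simp
  have "((\<lambda>_. 0) has_derivative (\<lambda>v. 0 :: real)) (at x)" by simp
  then have "(f has_derivative (\<lambda>v. 0)) (at x)"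
    by (rule has_derivative_transform_within_open[OF _ _ xo]) (use A in \<open>auto simp: open_Compl\<close>)
  moreover have "(f has_derivative (\<lambda>v. G x \<bullet> v)) (at x)" using f by (simp add: C1_grad_def)
  ultimately have "(\<lambda>v. G x \<bullet> v) = (\<lambda>v. 0)" by (rule has_derivative_unique[rotated])
  then have "G x \<bullet> G x = 0" by meson
  then show False using x by simp
qed

lemma bounded_compact_support:
  fixes f :: "pt \<Rightarrow> 'b::euclidean_space"
  assumes f: "continuous_on UNIV f" and A: "\<And>x. f x \<noteq> 0 \<Longrightarrow> norm x \<le> A"
  obtains B where "\<And>x. norm (f x) \<le> B"
proof -
  have "compact (f ` cball 0 A)" using f by (intro compact_continuous_image) (auto intro: continuous_on_subset)
  from compact_imp_bounded[OF this, unfolded bounded_iff]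
  obtain B where "\<forall>y\<in>f ` cball 0 A. norm y \<le> B" ..
  then have B: "norm (f x) \<le> B" if "norm x \<le> A" for x using that by simp
  show ?thesis
  proof (rule that[of "\<bar>B\<bar>"])
    fix x
    show "norm (f x) \<le> \<bar>B\<bar>" using B[of x] A[of x] by (cases "f x = 0") auto
  qed
qed

text \<open>\<open>F1\<close> and \<open>F2\<close> write the same convolution with the roles of its
  factors exchanged: the first form is smooth because of the mollifier, the second has the mollified
  \<open>G\<close> as its gradient.\<close>

lemma mollification_test_fn:
  assumes \<rho>: "mollifier \<rho>" and e: "0 < \<epsilon>" and f: "C1_grad f G" and A: "\<And>x. f x \<noteq> 0 \<Longrightarrow> norm x \<le> A"
  defines "F \<equiv> \<lambda>x. \<integral>y. moll \<rho> \<epsilon> y *\<^sub>R f (x - y) \<partial>lborel"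
  shows "test_fn UNIV F" "grad F = (\<lambda>x. \<integral>y. moll \<rho> \<epsilon> y *\<^sub>R G (x - y) \<partial>lborel)"
proof -
  have contf: "continuous_on UNIV f" by (rule C1_grad_continuous[OF f])
  have contG: "continuous_on UNIV G" using f by (simp add: C1_grad_def)
  have shift: "continuous_on UNIV (\<lambda>y. u (x - y))" if "continuous_on UNIV u" for u :: "pt \<Rightarrow> 'b::topological_space" and x
    by (rule continuous_on_compose2[OF that]) (auto intro: continuous_intros)
  let ?a = "\<chi> i. - A" and ?b = "\<chi> i. A" and ?c = "\<chi> i. - \<epsilon>" and ?d = "\<chi> i. \<epsilon>"
  have F1: "F x = integral (cbox ?a ?b) (\<lambda>y. f y * moll \<rho> \<epsilon> (x - y))" for x
  proof -
    have m: "(\<lambda>y. moll \<rho> \<epsilon> y *\<^sub>R f (x - y)) \<in> borel_measurable borel"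
      by (intro borel_measurable_continuous_onI continuous_intros continuous_moll[OF \<rho>] shift contf)
    have "F x = (-1)\<^sup>2 *\<^sub>R (\<integral>y. moll \<rho> \<epsilon> (x + (-1) *\<^sub>R y) *\<^sub>R f (x - (x + (-1) *\<^sub>R y)) \<partial>lborel)"
      unfolding F_def by (rule integral_affine_pt(2)[OF _ m]) simp
    also have "\<dots> = (\<integral>y. f y * moll \<rho> \<epsilon> (x - y) \<partial>lborel)" by (simp add: mult.commute)
    also have "\<dots> = integral (cbox ?a ?b) (\<lambda>y. f y * moll \<rho> \<epsilon> (x - y))"
    proof (rule integrable_compact_support(2)[symmetric])
      show "continuous_on UNIV (\<lambda>y. f y * moll \<rho> \<epsilon> (x - y))"
        by (intro continuous_on_mult shift contf continuous_moll[OF \<rho>])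
      fix y assume "f y * moll \<rho> \<epsilon> (x - y) \<noteq> 0"
      then have "f y \<noteq> 0" by auto
      then show "y \<in> cbox ?a ?b" by (intro norm_le_cbox A)
    qed
    finally show ?thesis .
  qed
  have sm: "smooth_fn F"
    using smooth_param_integral[OF contf smooth_moll[OF \<rho>], of ?a ?b] by (simp add: F1[abs_def])
  have supp: "norm x \<le> A + \<epsilon>" if "F x \<noteq> 0" for x
  proof (rule ccontr)
    assume n: "\<not> norm x \<le> A + \<epsilon>"
    have "moll \<rho> \<epsilon> y *\<^sub>R f (x - y) = 0" for y
    proof (rule ccontr)
      assume "moll \<rho> \<epsilon> y *\<^sub>R f (x - y) \<noteq> 0"
      then have "norm y < \<epsilon>" "norm (x - y) \<le> A" using moll_support[OF \<rho> e] A by auto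
      then show False using n norm_triangle_sub[of x y] by linarith
    qed
    then have "(\<lambda>y. moll \<rho> \<epsilon> y *\<^sub>R f (x - y)) = (\<lambda>_. 0)" by (rule ext)
    then have "F x = 0" unfolding F_def by (simp only:) simp
    then show False using that by simp
  qed
  have "tsupp F \<subseteq> cball 0 (A + \<epsilon>)" unfolding tsupp_def by (intro closure_minimal) (use supp in auto)
  then have "compact (tsupp F)" unfolding tsupp_def
    by (meson bounded_cball bounded_subset closed_closure compact_eq_bounded_closed)
  then show "test_fn UNIV F" using sm by (simp add: test_fn_def)
  have F2: "F x = integral (cbox ?c ?d) (\<lambda>y. moll \<rho> \<epsilon> y * f (x - y))" for x
    unfolding F_def real_scaleR_def
  proof (rule integrable_compact_support(2)[symmetric])
    show "continuous_on UNIV (\<lambda>y. moll \<rho> \<epsilon> y * f (x - y))"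
      by (intro continuous_on_mult shift contf continuous_moll[OF \<rho>])
    fix y assume "moll \<rho> \<epsilon> y * f (x - y) \<noteq> 0"
    then have "moll \<rho> \<epsilon> y \<noteq> 0" by auto
    then show "y \<in> cbox ?c ?d" by (rule moll_cbox[OF \<rho> e])
  qed
  have "C1_grad F (\<lambda>x. integral (cbox ?c ?d) (\<lambda>y. moll \<rho> \<epsilon> y *\<^sub>R G (x - y)))"
    using C1_grad_param_integral[OF continuous_moll[OF \<rho>] f, of ?c ?d] by (simp add: F2[abs_def])
  from C1_grad_grad[OF this]
  have "grad F = (\<lambda>x. integral (cbox ?c ?d) (\<lambda>y. moll \<rho> \<epsilon> y *\<^sub>R G (x - y)))" .
  moreover have "integral (cbox ?c ?d) (\<lambda>y. moll \<rho> \<epsilon> y *\<^sub>R G (x - y)) = (\<integral>y. moll \<rho> \<epsilon> y *\<^sub>R G (x - y) \<partial>lborel)" for x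
  proof (rule integrable_compact_support(2))
    show "continuous_on UNIV (\<lambda>y. moll \<rho> \<epsilon> y *\<^sub>R G (x - y))"
      by (intro continuous_on_scaleR shift contG continuous_moll[OF \<rho>])
    fix y assume "moll \<rho> \<epsilon> y *\<^sub>R G (x - y) \<noteq> 0"
    then have "moll \<rho> \<epsilon> y \<noteq> 0" by auto
    then show "y \<in> cbox ?c ?d" by (rule moll_cbox[OF \<rho> e])
  qed
  ultimately show "grad F = (\<lambda>x. \<integral>y. moll \<rho> \<epsilon> y *\<^sub>R G (x - y) \<partial>lborel)" by simp
qed

text \<open>The divergence is tested with smooth functions, whereas the bumps and cutoffs used for
  slicing are only C1. Their mollifications are admissible and converge, together with their
  gradients, pointwise and boundedly.\<close>

lemma divergence_C1:
  fixes s :: "pt \<Rightarrow> pt" and h :: "pt \<Rightarrow> real"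
  assumes \<rho>: "mollifier \<rho>" and s: "integrable lborel s" and h: "integrable lborel h"
    and test: "\<And>\<psi>. test_fn UNIV \<psi> \<Longrightarrow> - (\<integral>x. grad \<psi> x \<bullet> s x \<partial>lborel) = (\<integral>x. h x * \<psi> x \<partial>lborel)"
    and f: "C1_grad f G" and A: "\<And>x. f x \<noteq> 0 \<Longrightarrow> norm x \<le> A"
  shows "- (\<integral>x. G x \<bullet> s x \<partial>lborel) = (\<integral>x. h x * f x \<partial>lborel)"
proof -
  define e where "e n = 1 / real (Suc n)" for n
  have e: "0 < e n" for n by (simp add: e_def)
  have e0: "e \<longlonglongrightarrow> 0" unfolding e_def[abs_def] by (rule LIMSEQ_Suc[OF lim_1_over_n])
  have contf: "continuous_on UNIV f" by (rule C1_grad_continuous[OF f])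
  have contG: "continuous_on UNIV G" using f by (simp add: C1_grad_def)
  have shift: "continuous_on UNIV (\<lambda>y. u (x - y))" if "continuous_on UNIV u" for u :: "pt \<Rightarrow> 'b::topological_space" and x
    by (rule continuous_on_compose2[OF that]) (auto intro: continuous_intros)
  define F where "F n x = (\<integral>y. moll \<rho> (e n) y *\<^sub>R f (x - y) \<partial>lborel)" for n x
  define D where "D n x = (\<integral>y. moll \<rho> (e n) y *\<^sub>R G (x - y) \<partial>lborel)" for n x
  have T: "test_fn UNIV (F n)" "grad (F n) = D n" for n
    using mollification_test_fn[OF \<rho> e f A, of n] unfolding F_def D_def by auto
  have mF: "F n \<in> borel_measurable borel" "D n \<in> borel_measurable borel" for n
  proof -
    have "C1_grad (F n) (D n)" using smooth_C1_grad[of "F n"] T[of n] by (simp add: test_fn_def)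
    then show "F n \<in> borel_measurable borel" "D n \<in> borel_measurable borel"
      using C1_grad_continuous by (auto intro!: borel_measurable_continuous_onI simp: C1_grad_def)
  qed
  obtain B1 where B1: "\<And>x. norm (f x) \<le> B1" by (rule bounded_compact_support[OF contf A]) (assumption, rule that)
  obtain B2 where B2: "\<And>x. norm (G x) \<le> B2"
    by (rule bounded_compact_support[OF contG C1_grad_support[OF f A]]) (assumption, assumption, rule that)
  have [measurable]: "s \<in> borel_measurable borel" "h \<in> borel_measurable borel" using s h by auto
  have [measurable]: "G \<in> borel_measurable borel" "f \<in> borel_measurable borel"
    by (intro borel_measurable_continuous_onI contG contf)+
  have L1: "(\<lambda>n. \<integral>x. D n x \<bullet> s x \<partial>lborel) \<longlonglongrightarrow> (\<integral>x. G x \<bullet> s x \<partial>lborel)"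
  proof (rule integral_dominated_convergence)
    show "integrable lborel (\<lambda>x. B2 * norm (s x))" using s by simp
    show "(\<lambda>x. D n x \<bullet> s x) \<in> borel_measurable lborel" for n using mF[of n] by simp
    show "(\<lambda>x. G x \<bullet> s x) \<in> borel_measurable lborel" by measurable
    have "(\<lambda>n. D n x) \<longlonglongrightarrow> G x" for x
      using approximate_identity[OF \<rho> e e0 shift[OF contG, of x]] by (simp add: D_def)
    then show "AE x in lborel. (\<lambda>n. D n x \<bullet> s x) \<longlonglongrightarrow> G x \<bullet> s x" by (intro AE_I2 tendsto_intros)
    show "AE x in lborel. norm (D n x \<bullet> s x) \<le> B2 * norm (s x)" for n
    proof (rule AE_I2)
      fix x
      have "norm (D n x) \<le> B2" unfolding D_def by (rule moll_average_bound[OF \<rho> e shift[OF contG] B2])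
      then have "norm (D n x) * norm (s x) \<le> B2 * norm (s x)" by (rule mult_right_mono) simp
      then show "norm (D n x \<bullet> s x) \<le> B2 * norm (s x)" using Cauchy_Schwarz_ineq2[of "D n x" "s x"] by simp
    qed
  qed
  have L2: "(\<lambda>n. \<integral>x. h x * F n x \<partial>lborel) \<longlonglongrightarrow> (\<integral>x. h x * f x \<partial>lborel)"
  proof (rule integral_dominated_convergence)
    show "integrable lborel (\<lambda>x. B1 * norm (h x))" using h by simp
    show "(\<lambda>x. h x * F n x) \<in> borel_measurable lborel" for n using mF[of n] by simp
    show "(\<lambda>x. h x * f x) \<in> borel_measurable lborel" by measurable
    have "(\<lambda>n. F n x) \<longlonglongrightarrow> f x" for x
      using approximate_identity[OF \<rho> e e0 shift[OF contf, of x]] by (simp add: F_def)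
    then show "AE x in lborel. (\<lambda>n. h x * F n x) \<longlonglongrightarrow> h x * f x" by (intro AE_I2 tendsto_intros)
    show "AE x in lborel. norm (h x * F n x) \<le> B1 * norm (h x)" for n
    proof (rule AE_I2)
      fix x
      have "norm (F n x) \<le> B1" unfolding F_def by (rule moll_average_bound[OF \<rho> e shift[OF contf] B1])
      then have "norm (h x) * norm (F n x) \<le> norm (h x) * B1" by (rule mult_left_mono) simp
      then show "norm (h x * F n x) \<le> B1 * norm (h x)" by (simp only: norm_mult mult.commute)
    qed
  qed
  have "- (\<integral>x. D n x \<bullet> s x \<partial>lborel) = (\<integral>x. h x * F n x \<partial>lborel)" for n
    using test[OF T(1)[of n]] unfolding T(2) .
  then have "(\<lambda>n. \<integral>x. h x * F n x \<partial>lborel) \<longlonglongrightarrow> - (\<integral>x. G x \<bullet> s x \<partial>lborel)"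
    using tendsto_minus[OF L1] by simp
  from LIMSEQ_unique[OF this L2] show ?thesis .
qed

text \<open>The integral of \<psi>(x - y) over y does not depend on x; differentiating it at 0 under
  the integral gives the claim.\<close>

lemma integral_grad_test_fn:
  assumes "test_fn U \<psi>"
  shows "(\<integral>x. grad \<psi> x \<partial>lborel) = 0" "integrable lborel (grad \<psi>)"
proof -
  have sm: "smooth_fn \<psi>" and cpt: "compact (tsupp \<psi>)" using assms by (auto simp: test_fn_def)
  have C: "C1_grad \<psi> (grad \<psi>)" by (rule smooth_C1_grad[OF sm])
  obtain A0 where A0: "\<And>x. x \<in> tsupp \<psi> \<Longrightarrow> norm x \<le> A0"
  proof -
    from compact_imp_bounded[OF cpt, unfolded bounded_iff] obtain B where "\<forall>x\<in>tsupp \<psi>. norm x \<le> B" ..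
    then show ?thesis by (intro that[of B]) simp
  qed
  define A where "A = \<bar>A0\<bar>"
  have A: "norm x \<le> A" if "\<psi> x \<noteq> 0" for x
  proof -
    have "x \<in> tsupp \<psi>" unfolding tsupp_def using that by (intro subsetD[OF closure_subset]) simp
    then show ?thesis using A0[of x] by (simp add: A_def)
  qed
  have cG: "continuous_on UNIV (grad \<psi>)" using C by (simp add: C1_grad_def)
  show int: "integrable lborel (grad \<psi>)"
    by (rule integrable_compact_support(1)[OF cG norm_le_cbox[OF C1_grad_support[OF C A]]])
  \<comment> \<open>Enlarging the box by 1 makes the truncated integral constant for
    \<open>x\<close> in the unit ball, which is enough to differentiate at 0.\<close>
  let ?a = "(\<chi> i. - (A + 1)) :: pt" and ?b = "(\<chi> i. (A + 1)) :: pt"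
  define F where "F x = integral (cbox ?a ?b) (\<lambda>y. 1 * \<psi> (x - y))" for x
  have F: "C1_grad F (\<lambda>x. integral (cbox ?a ?b) (\<lambda>y. 1 *\<^sub>R grad \<psi> (x - y)))"
    unfolding F_def using C1_grad_param_integral[OF continuous_on_const C, of ?a ?b 1] by simp
  have shift: "continuous_on UNIV (\<lambda>y. u (x - y))" if "continuous_on UNIV u" for u :: "pt \<Rightarrow> 'b::topological_space" and x
    by (rule continuous_on_compose2[OF that]) (auto intro: continuous_intros)
  have m: "\<psi> \<in> borel_measurable borel" by (rule borel_measurable_continuous_onI[OF C1_grad_continuous[OF C]])
  have const: "F x = (\<integral>y. \<psi> y \<partial>lborel)" if x: "x \<in> ball 0 1" for x
  proof -
    have "F x = (\<integral>y. \<psi> (x - y) \<partial>lborel)"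
      unfolding F_def mult_1
    proof (rule integrable_compact_support(2)[OF shift[OF C1_grad_continuous[OF C]]])
      fix y assume "\<psi> (x - y) \<noteq> 0"
      then have "norm (x - y) \<le> A" by (rule A)
      then have "norm y \<le> A + 1" using x norm_triangle_sub[of y x] by (simp add: norm_minus_commute)
      then show "y \<in> cbox ?a ?b" by (rule norm_le_cbox)
    qed
    also have "\<dots> = (\<integral>y. \<psi> y \<partial>lborel)" using integral_affine_pt(2)[of "-1" \<psi> x] m by simp
    finally show ?thesis .
  qed
  have "((\<lambda>_. \<integral>y. \<psi> y \<partial>lborel) has_derivative (\<lambda>v. 0)) (at (0::pt))" by simp
  then have "(F has_derivative (\<lambda>v. 0)) (at 0)"
    by (rule has_derivative_transform_within_open[of _ _ _ _ "ball 0 1"]) (use const in auto)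
  moreover have "(F has_derivative (\<lambda>v. integral (cbox ?a ?b) (\<lambda>y. 1 *\<^sub>R grad \<psi> (0 - y)) \<bullet> v)) (at 0)"
    using F unfolding C1_grad_def by blast
  ultimately have "(\<lambda>v. integral (cbox ?a ?b) (\<lambda>y. 1 *\<^sub>R grad \<psi> (0 - y)) \<bullet> v) = (\<lambda>v. 0)"
    by (rule has_derivative_unique[rotated])
  then have "integral (cbox ?a ?b) (\<lambda>y. 1 *\<^sub>R grad \<psi> (0 - y)) \<bullet> integral (cbox ?a ?b) (\<lambda>y. 1 *\<^sub>R grad \<psi> (0 - y)) = 0"
    by meson
  then have z: "integral (cbox ?a ?b) (\<lambda>y. grad \<psi> (0 - y)) = 0" by simp
  have "integral (cbox ?a ?b) (\<lambda>y. grad \<psi> (0 - y)) = (\<integral>y. grad \<psi> (0 - y) \<partial>lborel)"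
  proof (rule integrable_compact_support(2)[OF shift[OF cG]])
    fix y assume "grad \<psi> (0 - y) \<noteq> 0"
    then have "norm (0 - y) \<le> A" by (intro C1_grad_support[OF C A])
    then show "y \<in> cbox ?a ?b" by (intro norm_le_cbox) simp
  qed
  also have "\<dots> = (\<integral>y. grad \<psi> y \<partial>lborel)"
    using integral_affine_pt(2)[of "-1" "grad \<psi>" 0] borel_measurable_continuous_onI[OF cG] by simp
  finally show "(\<integral>x. grad \<psi> x \<partial>lborel) = 0" using z by simp
qed

text \<open>Turns an identity of signed set functions, such as \<open>vm_density_on\<close>, into
  one of integrals, by approximation from simple functions.\<close>

lemma integral_eq_if_set_integral_eq:
  fixes g w :: "pt \<Rightarrow> real"
  assumes mu: "finite_measure mu" "sets mu = sets borel" and g: "integrable mu g" and w: "integrable lborel w"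
    and eq: "\<And>A. A \<in> sets borel \<Longrightarrow> (\<integral>x. indicator A x * g x \<partial>mu) = (\<integral>x. indicator A x * w x \<partial>lborel)"
    and f: "f \<in> borel_measurable borel" and B: "\<And>x. \<bar>f x\<bar> \<le> B"
  shows "(\<integral>x. f x * g x \<partial>mu) = (\<integral>x. f x * w x \<partial>lborel)"
    and "integrable mu (\<lambda>x. f x * g x)" "integrable lborel (\<lambda>x. f x * w x)"
proof -
  have mm: "u \<in> borel_measurable mu" if "u \<in> borel_measurable borel" for u :: "pt \<Rightarrow> real"
    using that mu(2) by (simp cong: measurable_cong_sets)
  have ig: "integrable N (\<lambda>x. u x * v x)"
    if v: "integrable N v" and u: "u \<in> borel_measurable N" and B: "\<And>x. \<bar>u x\<bar> \<le> B"
    for u v :: "pt \<Rightarrow> real" and B and N :: "pt measure"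
  proof (rule Bochner_Integration.integrable_bound)
    show "integrable N (\<lambda>x. B * v x)" using v by simp
    show "(\<lambda>x. u x * v x) \<in> borel_measurable N" using u borel_measurable_integrable[OF v] by simp
    show "AE x in N. norm (u x * v x) \<le> norm (B * v x)"
    proof (rule AE_I2)
      fix x
      have "\<bar>u x\<bar> \<le> \<bar>B\<bar>" using B[of x] by linarith
      then show "norm (u x * v x) \<le> norm (B * v x)" by (simp add: abs_mult mult_right_mono)
    qed
  qed
  show "integrable mu (\<lambda>x. f x * g x)" by (rule ig[OF g mm[OF f] B])
  show "integrable lborel (\<lambda>x. f x * w x)" by (rule ig[OF w _ B]) (use f in simp)
  \<comment> \<open>Boundedness stands inside the claim, because the induction passes to summands
    and approximants, whose bounds have to be recovered from that of the sum or limit.\<close>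
  have pos: "(\<exists>B. \<forall>x. u x \<le> B) \<longrightarrow> (\<integral>x. u x * g x \<partial>mu) = (\<integral>x. u x * w x \<partial>lborel)"
    if u: "u \<in> borel_measurable borel" "\<And>x. 0 \<le> u x" for u
    using u
  proof (induction rule: borel_measurable_induct_real)
    case (set A)
    then show ?case using eq by simp
  next
    case (mult u c)
    show ?case
    proof (cases "c = 0")
      case False
      then have c: "0 < c" using mult by simp
      show ?thesis
      proof (intro impI)
        assume "\<exists>B. \<forall>x. c * u x \<le> B"
        then obtain B where "\<forall>x. c * u x \<le> B" ..
        then have "\<forall>x. u x \<le> B / c" using c by (simp add: field_simps)
        then have "(\<integral>x. u x * g x \<partial>mu) = (\<integral>x. u x * w x \<partial>lborel)" using mult.IH by blast
        then show "(\<integral>x. c * u x * g x \<partial>mu) = (\<integral>x. c * u x * w x \<partial>lborel)" by (simp add: mult.assoc)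
      qed
    qed simp
  next
    case (add u v)
    show ?case
    proof (intro impI)
      assume "\<exists>B. \<forall>x. v x + u x \<le> B"
      then obtain B where B: "\<forall>x. v x + u x \<le> B" ..
      have ub: "\<forall>x. u x \<le> B" and vb: "\<forall>x. v x \<le> B"
        using B add.hyps(2,4) by (metis add_increasing add_increasing2 order_refl order_trans)+
      have ub': "\<bar>u x\<bar> \<le> B" and vb': "\<bar>v x\<bar> \<le> B" for x using ub vb add.hyps(2,4) by auto
      have "(\<integral>x. v x * g x + u x * g x \<partial>mu) = (\<integral>x. v x * w x + u x * w x \<partial>lborel)"
        using add.IH ub vb ig[OF g mm[OF add.hyps(1)] ub'] ig[OF g mm[OF add.hyps(3)] vb']
          ig[OF w _ ub'] ig[OF w _ vb'] add.hyps(1,3)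
        by (subst (1 2) Bochner_Integration.integral_add) auto
      then show "(\<integral>x. (v x + u x) * g x \<partial>mu) = (\<integral>x. (v x + u x) * w x \<partial>lborel)" by (simp add: distrib_right)
    qed
  next
    case (seq U)
    show ?case
    proof (intro impI)
      assume "\<exists>B. \<forall>x. u x \<le> B"
      then obtain B where B: "\<forall>x. u x \<le> B" ..
      have Ub: "U i x \<le> B" for i x
      proof -
        have "U i x \<le> u x" using seq by (intro incseq_le) (auto simp: incseq_def le_fun_def)
        then show ?thesis using B order_trans by blast
      qed
      have Ub': "\<bar>U i x\<bar> \<le> B" for i x using Ub seq.hyps(2)[of i x] by simp
      have dc: "(\<lambda>i. \<integral>x. U i x * v x \<partial>N) \<longlonglongrightarrow> (\<integral>x. u x * v x \<partial>N)"
        if v: "integrable N v" and sN: "sets N = sets borel" for v and N :: "pt measure"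
      proof (rule integral_dominated_convergence)
        have mN: "q \<in> borel_measurable N" if "q \<in> borel_measurable borel" for q :: "pt \<Rightarrow> real"
          using that sN by (simp cong: measurable_cong_sets)
        show "integrable N (\<lambda>x. B * \<bar>v x\<bar>)" using v by simp
        have mu': "u \<in> borel_measurable borel"
          by (rule borel_measurable_LIMSEQ_real[OF _ seq.hyps(1)]) (use seq.hyps(4) in simp)
        show "(\<lambda>x. u x * v x) \<in> borel_measurable N" using mN[OF mu'] borel_measurable_integrable[OF v] by simp
        show "(\<lambda>x. U i x * v x) \<in> borel_measurable N" for i using mN[OF seq.hyps(1)] borel_measurable_integrable[OF v] by simp
        show "AE x in N. (\<lambda>i. U i x * v x) \<longlonglongrightarrow> u x * v x" using seq.hyps(4) by (intro AE_I2 tendsto_mult_right) simp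
        show "AE x in N. norm (U i x * v x) \<le> B * \<bar>v x\<bar>" for i
          using Ub' by (intro AE_I2) (simp add: abs_mult mult_right_mono)
      qed
      have "(\<integral>x. U i x * g x \<partial>mu) = (\<integral>x. U i x * w x \<partial>lborel)" for i using seq.IH Ub by blast
      then have "(\<lambda>i. \<integral>x. U i x * g x \<partial>mu) \<longlonglongrightarrow> (\<integral>x. u x * w x \<partial>lborel)" using dc[OF w] by simp
      from LIMSEQ_unique[OF dc[OF g mu(2)] this]
      show "(\<integral>x. u x * g x \<partial>mu) = (\<integral>x. u x * w x \<partial>lborel)" .
    qed
  qed
  define fp fm where "fp x = max 0 (f x)" and "fm x = max 0 (- f x)" for x
  have b: "\<bar>fp x\<bar> \<le> B" "\<bar>fm x\<bar> \<le> B" for x using B[of x] by (auto simp: fp_def fm_def)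
  have m: "fp \<in> borel_measurable borel" "fm \<in> borel_measurable borel" using f by (auto simp: fp_def[abs_def] fm_def[abs_def])
  have e: "f x * v = fp x * v - fm x * v" for x v by (simp add: fp_def fm_def max_def)
  have "(\<integral>x. fp x * g x \<partial>mu) = (\<integral>x. fp x * w x \<partial>lborel)"
    using pos[OF m(1)] b(1) by (metis abs_le_D1 fp_def max.cobounded1)
  moreover have "(\<integral>x. fm x * g x \<partial>mu) = (\<integral>x. fm x * w x \<partial>lborel)"
    using pos[OF m(2)] b(2) by (metis abs_le_D1 fm_def max.cobounded1)
  ultimately show "(\<integral>x. f x * g x \<partial>mu) = (\<integral>x. f x * w x \<partial>lborel)"
    unfolding e using ig[OF g mm[OF m(1)] b(1)] ig[OF g mm[OF m(2)] b(2)] ig[OF w _ b(1)] ig[OF w _ b(2)] m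
    by (subst (1 2) Bochner_Integration.integral_diff) auto
qed

section \<open>Coordinates and rectifiability\<close>

definition other :: "2 \<Rightarrow> 2" where "other i = (if i = 1 then 2 else 1)"

lemma other_neq [simp]: "other i \<noteq> i" "i \<noteq> other i"
  using exhaust_2[of i] by (auto simp: other_def)

lemma UNIV_other: "(UNIV :: 2 set) = {i, other i}"
proof -
  have "x = i \<or> x = other i" for x using exhaust_2[of i] exhaust_2[of x] by (auto simp: other_def)
  then show ?thesis by auto
qed

lemma sum_other: "(\<Sum>l\<in>UNIV. f l) = f i + f (other i)" for f :: "2 \<Rightarrow> 'a::comm_monoid_add"
  unfolding UNIV_other[of i] by simp

lemma inner_other: "x \<bullet> y = x $ i * y $ i + x $ other i * y $ other i" for x y :: pt
  by (simp add: inner_vec_def sum_other[of _ i])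

lemma pt_eq_iff_other: "x = y \<longleftrightarrow> x $ i = y $ i \<and> x $ other i = y $ other i" for x y :: pt
proof -
  have "(\<forall>l. x $ l = y $ l) \<longleftrightarrow> (\<forall>l\<in>{i, other i}. x $ l = y $ l)" unfolding UNIV_other[of i, symmetric] by simp
  then show ?thesis by (simp add: vec_eq_iff)
qed

definition to_pt :: "2 \<Rightarrow> real \<times> real \<Rightarrow> pt" where
  "to_pt i z = (\<chi> l. if l = i then fst z else snd z)"

definition of_pt :: "2 \<Rightarrow> pt \<Rightarrow> real \<times> real" where
  "of_pt i x = (x $ i, x $ other i)"

lemma to_pt_nth [simp]: "to_pt i z $ i = fst z" "to_pt i z $ other i = snd z"
  by (simp_all add: to_pt_def)

lemma of_pt_simps [simp]: "fst (of_pt i x) = x $ i" "snd (of_pt i x) = x $ other i"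
  by (simp_all add: of_pt_def)

lemma to_of_pt [simp]: "to_pt i (of_pt i x) = x" "of_pt i (to_pt i z) = z"
  by (simp_all add: pt_eq_iff_other[of _ _ i] of_pt_def)

lemma continuous_to_pt: "continuous_on UNIV (to_pt i)"
  unfolding to_pt_def[abs_def]
proof (rule continuous_on_vec_lambda)
  show "continuous_on UNIV (\<lambda>z :: real \<times> real. if l = i then fst z else snd z)" for l
    by (cases "l = i") (auto intro!: continuous_on_fst continuous_on_snd continuous_on_id)
qed

lemma continuous_of_pt: "continuous_on UNIV (of_pt i)"
  unfolding of_pt_def[abs_def] by (intro continuous_on_Pair continuous_on_component continuous_on_id)

lemma measurable_to_pt [measurable]: "to_pt i \<in> borel_measurable borel"
  by (rule borel_measurable_continuous_onI[OF continuous_to_pt])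

lemma measurable_of_pt [measurable]: "of_pt i \<in> borel_measurable borel"
  by (rule borel_measurable_continuous_onI[OF continuous_of_pt])

lemma norm_to_pt: "norm (to_pt i z - to_pt i w) = norm (z - w)"
proof -
  have "norm (to_pt i z - to_pt i w) = sqrt ((fst z - fst w)\<^sup>2 + (snd z - snd w)\<^sup>2)"
    by (simp add: norm_eq_sqrt_inner inner_other[of _ _ i] power2_eq_square)
  then show ?thesis by (simp add: norm_prod_def)
qed

lemma Basis_pt: "(Basis :: pt set) = {axis i 1, axis (other i) 1}"
proof -
  have "(Basis :: pt set) = (\<lambda>l. axis l 1) ` UNIV" by (auto simp: Basis_vec_def)
  then show ?thesis by (simp add: UNIV_other[of i])
qed

lemma distr_to_pt: "distr lborel borel (to_pt i) = lborel"
proof (rule lborel_eqI[symmetric])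
  fix l u :: pt assume lu: "\<And>b. b \<in> Basis \<Longrightarrow> l \<bullet> b \<le> u \<bullet> b"
  have c: "l $ i \<le> u $ i" "l $ other i \<le> u $ other i"
    using lu[of "axis i 1"] lu[of "axis (other i) 1"] by (simp_all add: inner_axis Basis_pt[of i])
  have "to_pt i -` box l u \<inter> space lborel = box (of_pt i l) (of_pt i u)"
    unfolding box_def Basis_pt[of i] by (auto simp: inner_axis Basis_prod_def of_pt_def)
  then have "emeasure (distr lborel borel (to_pt i)) (box l u) = emeasure lborel (box (of_pt i l) (of_pt i u))"
    by (simp add: emeasure_distr)
  also have "\<dots> = (\<Prod>b\<in>Basis. (of_pt i u - of_pt i l) \<bullet> b)"
    using c by (intro emeasure_lborel_box) (auto simp: Basis_prod_def of_pt_def)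
  also have "(\<Prod>b\<in>Basis. (of_pt i u - of_pt i l) \<bullet> b) = (u $ i - l $ i) * (u $ other i - l $ other i)"
    by (simp add: Basis_prod_def of_pt_def)
  also have "\<dots> = (\<Prod>b\<in>Basis. (u - l) \<bullet> b)"
    unfolding Basis_pt[of i] by (subst prod.insert) (auto simp: inner_axis axis_eq_axis)
  finally show "emeasure (distr lborel borel (to_pt i)) (box l u) = ennreal (\<Prod>b\<in>Basis. (u - l) \<bullet> b)" by simp
qed simp

lemma integral_to_pt:
  fixes f :: "pt \<Rightarrow> 'b::{banach, second_countable_topology}"
  shows "integrable lborel f \<Longrightarrow> integrable lborel (\<lambda>z. f (to_pt i z))"
    and "f \<in> borel_measurable borel \<Longrightarrow> (\<integral>z. f (to_pt i z) \<partial>lborel) = (\<integral>x. f x \<partial>lborel)"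
proof -
  show "integrable lborel (\<lambda>z. f (to_pt i z))" if "integrable lborel f"
  proof -
    have m: "f \<in> borel_measurable borel" using that by auto
    have "integrable (distr lborel borel (to_pt i)) f" using that by (simp only: distr_to_pt)
    then show ?thesis by (subst (asm) integrable_distr_eq) (use m in auto)
  qed
  show "(\<integral>z. f (to_pt i z) \<partial>lborel) = (\<integral>x. f x \<partial>lborel)" if m: "f \<in> borel_measurable borel"
  proof -
    have "(\<integral>x. f x \<partial>distr lborel borel (to_pt i)) = (\<integral>z. f (to_pt i z) \<partial>lborel)"
      using m by (intro integral_distr) auto
    then show ?thesis by (simp only: distr_to_pt)
  qed
qed

lemma nn_integral_to_pt:
  assumes m: "f \<in> borel_measurable borel"
  shows "(\<integral>\<^sup>+z. f (to_pt i z) \<partial>lborel) = (\<integral>\<^sup>+x. f x \<partial>lborel)"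
proof -
  have "(\<integral>\<^sup>+x. f x \<partial>distr lborel borel (to_pt i)) = (\<integral>\<^sup>+z. f (to_pt i z) \<partial>lborel)"
    using m by (intro nn_integral_distr) auto
  then show ?thesis by (simp only: distr_to_pt)
qed

section \<open>Representation by Hausdorff measure on curves\<close>

lemma lipschitz_range_compact_union:
  fixes f :: "real \<Rightarrow> pt"
  shows "range f = (\<Union>n::nat. f ` {- real n..real n})"
proof -
  have "t \<in> (\<Union>n::nat. {- real n..real n})" for t :: real
  proof -
    obtain n :: nat where "\<bar>t\<bar> \<le> n" using real_arch_simple by blast
    then show ?thesis by (auto simp: abs_le_iff intro!: exI[of _ n])
  qed
  then have "(\<Union>n::nat. {- real n..real n}) = UNIV" by blast
  then have "range f = f ` (\<Union>n::nat. {- real n..real n})" by simp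
  then show ?thesis by (simp only: image_UN)
qed

lemma compact_lipschitz_image:
  fixes f :: "real \<Rightarrow> pt"
  assumes "L-lipschitz_on UNIV f" shows "compact (f ` {a..b})"
  by (intro compact_continuous_image continuous_on_subset[OF lipschitz_on_continuous_on[OF assms]]) auto

text \<open>Radon--Nikodym for the measure |g| mu with respect to \<open>H1\<close> restricted to
  the union of the curves: the density is the multiplicity \<theta>, and \<xi> is the direction of
  \<open>g\<close>. The restriction is what makes the reference measure sigma-finite.\<close>

lemma is_U_if_absolutely_continuous:
  fixes f :: "nat \<Rightarrow> real \<Rightarrow> pt" and g :: "pt \<Rightarrow> pt"
  assumes mu: "finite_measure mu" "sets mu = sets borel" and g: "integrable mu g"
    and f: "\<And>k. \<exists>L. L-lipschitz_on UNIV (f k)"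
  defines "M \<equiv> \<Union>k. range (f k)"
  assumes ac: "\<And>A. A \<in> sets borel \<Longrightarrow> H1 (A \<inter> M) = 0 \<Longrightarrow> AE x in mu. x \<in> A \<longrightarrow> g x = 0"
  shows "\<exists>M \<theta> \<xi>. is_U (mu, g) M \<theta> \<xi>"
proof -
  have sp: "space mu = UNIV" using sets_eq_imp_space_eq[OF mu(2)] by simp
  have cpt: "compact (f k ` {- real n..real n})" for k n using f[of k] compact_lipschitz_image by blast
  have M_eq: "M = (\<Union>k. \<Union>n. f k ` {- real n..real n})"
    unfolding M_def using lipschitz_range_compact_union by simp
  have Mb [measurable]: "M \<in> sets borel"
  proof -
    have "(\<Union>n. f k ` {- real n..real n}) \<in> sets borel" for k
      by (rule sets.countable_UN) (auto intro!: borel_compact cpt)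
    then show ?thesis unfolding M_eq by (intro sets.countable_UN) auto
  qed
  have gb [measurable]: "g \<in> borel_measurable borel"
    using borel_measurable_integrable[OF g] mu(2) by (simp cong: measurable_cong_sets)
  define \<nu> where "\<nu> = density mu (\<lambda>x. ennreal (norm (g x)))"
  have mm: "(\<lambda>x. ennreal (norm (g x))) \<in> borel_measurable mu" using borel_measurable_integrable[OF g] by simp
  have s\<nu>: "sets \<nu> = sets borel" by (simp add: \<nu>_def mu(2))
  have fin\<nu>: "emeasure \<nu> (space \<nu>) < \<infinity>"
  proof -
    have "emeasure \<nu> (space \<nu>) = (\<integral>\<^sup>+x. ennreal (norm (g x)) \<partial>mu)"
      unfolding \<nu>_def using mm by (subst emeasure_density) (auto simp: space_density intro!: nn_integral_cong split: split_indicator)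
    also have "\<dots> < \<infinity>" using g by (simp add: integrable_iff_bounded)
    finally show ?thesis .
  qed
  interpret \<nu>: finite_measure \<nu> using fin\<nu> by (intro finite_measureI) auto
  define H where "H = density H1_meas (indicator M)"
  have sH: "sets H = sets borel" by (simp add: H_def)
  have emH: "emeasure H A = H1 (A \<inter> M)" if A: "A \<in> sets borel" for A
  proof -
    have "emeasure H A = (\<integral>\<^sup>+x. indicator M x * indicator A x \<partial>H1_meas)"
      unfolding H_def using A by (subst emeasure_density) auto
    also have "\<dots> = (\<integral>\<^sup>+x. indicator (A \<inter> M) x \<partial>H1_meas)"
      by (intro nn_integral_cong) (auto split: split_indicator)
    also have "\<dots> = H1 (A \<inter> M)" using A by (simp add: emeasure_H1_meas)
    finally show ?thesis .
  qed
  have "sigma_finite_measure H"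
  proof
    \<comment> \<open>The curve pieces over {-n..n} have finite length, and the complement of
      \<open>M\<close> is null for \<open>H\<close>.\<close>
    let ?A = "insert (- M) (\<Union>k. range (\<lambda>n. f k ` {- real n..real n}))"
    show "\<exists>A. countable A \<and> A \<subseteq> sets H \<and> \<Union>A = space H \<and> (\<forall>a\<in>A. emeasure H a \<noteq> \<infinity>)"
    proof (intro exI[of _ ?A] conjI ballI)
      show "countable ?A" by auto
      show "?A \<subseteq> sets H" unfolding sH using cpt by (auto intro!: borel_compact)
      show "\<Union>?A = space H" using sets_eq_imp_space_eq[OF sH] by (auto simp: M_eq)
      fix a assume "a \<in> ?A"
      then consider "a = - M" | k n where "a = f k ` {- real n..real n}" by blast
      then show "emeasure H a \<noteq> \<infinity>"
      proof cases
        case 1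
        have "- M \<inter> M = {}" by blast
        then show ?thesis using 1 emH[of "- M"] by simp
      next
        case 2
        obtain L where L: "L-lipschitz_on UNIV (f k)" using f by blast
        have "emeasure H a \<le> H1 a" using 2 cpt by (subst emH) (auto intro!: borel_compact H1_mono)
        also have "\<dots> \<le> ennreal (L * (real n - - real n))" unfolding 2 by (rule H1_lipschitz_image[OF L]) simp
        finally show ?thesis by (auto simp: top_unique)
      qed
    qed
  qed
  then interpret H: sigma_finite_measure H .
  have "absolutely_continuous H \<nu>"
    unfolding absolutely_continuous_def
  proof
    fix A assume "A \<in> null_sets H"
    then have A: "A \<in> sets borel" "H1 (A \<inter> M) = 0" using emH by (auto simp: null_sets_def sH)
    have "emeasure \<nu> A = (\<integral>\<^sup>+x. ennreal (norm (g x)) * indicator A x \<partial>mu)"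
      unfolding \<nu>_def using A(1) mm mu(2) by (subst emeasure_density) auto
    also have "\<dots> = (\<integral>\<^sup>+x. 0 \<partial>mu)"
    proof (rule nn_integral_cong_AE)
      show "AE x in mu. ennreal (norm (g x)) * indicator A x = 0"
        using ac[OF A] by eventually_elim (auto split: split_indicator)
    qed
    finally show "A \<in> null_sets \<nu>" using A(1) s\<nu> by (simp add: null_sets_def)
  qed
  then obtain F where F: "F \<in> borel_measurable H" "density H F = \<nu>"
    using H.Radon_Nikodym[of \<nu>] s\<nu> sH by auto
  have Fb [measurable]: "F \<in> borel_measurable borel" using F(1) sH by (simp cong: measurable_cong_sets)
  have "AE x in H. F x \<noteq> \<infinity>"
  proof (rule nn_integral_PInf_AE[OF F(1)])
    have "(\<integral>\<^sup>+x. F x \<partial>H) = emeasure (density H F) (space H)"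
      using F(1) by (subst emeasure_density) (auto intro!: nn_integral_cong)
    also have "\<dots> < \<infinity>" using fin\<nu> F(2) by (metis space_density)
    finally show "(\<integral>\<^sup>+x. F x \<partial>H) \<noteq> \<infinity>" by simp
  qed
  then have aeF: "AE x in H. F x = ennreal (enn2real (F x))"
    by eventually_elim (simp add: less_top)
  define \<theta> where "\<theta> x = enn2real (F x)" for x
  \<comment> \<open>\<open>is_U\<close> asks for unit vectors at every point of \<open>M\<close>, so
    an arbitrary one is used where \<open>g\<close> vanishes; the measure |g| mu gives that set no
    mass.\<close>
  define \<xi> where "\<xi> x = (if g x = 0 then axis 1 1 else (1 / norm (g x)) *\<^sub>R g x)" for x
  have th [measurable]: "\<theta> \<in> borel_measurable borel" unfolding \<theta>_def[abs_def] by measurable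
  have xi [measurable]: "\<xi> \<in> borel_measurable borel" unfolding \<xi>_def[abs_def] by measurable
  have nxi: "norm (\<xi> x) = 1" for x by (simp add: \<xi>_def)
  have gxi: "g x = norm (g x) *\<^sub>R \<xi> x" for x by (simp add: \<xi>_def)
  have \<nu>2: "\<nu> = density H (\<lambda>x. ennreal (\<theta> x))"
    unfolding F(2)[symmetric] \<theta>_def
    by (rule density_cong[OF F(1) _ aeF]) (use sH in \<open>simp cong: measurable_cong_sets\<close>)
  have th0: "0 \<le> \<theta> x" for x by (simp add: \<theta>_def)
  have mH: "u \<in> borel_measurable H" if "u \<in> borel_measurable borel" for u :: "pt \<Rightarrow> 'z::topological_space"
    using that sH by (simp cong: measurable_cong_sets)
  have mH1: "u \<in> borel_measurable H1_meas" if "u \<in> borel_measurable borel" for u :: "pt \<Rightarrow> 'z::topological_space"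
    using that by (simp cong: measurable_cong_sets)
  have Hd: "H = density H1_meas (\<lambda>x. ennreal (indicator M x))" unfolding H_def by (simp add: ennreal_indicator)
  have key: "integrable H1_meas (\<lambda>x. indicator (A \<inter> M) x *\<^sub>R (\<theta> x *\<^sub>R \<xi> x)) \<and>
    (\<integral>x. indicator A x *\<^sub>R g x \<partial>mu) = (\<integral>x. indicator (A \<inter> M) x *\<^sub>R (\<theta> x *\<^sub>R \<xi> x) \<partial>H1_meas)"
    if A: "A \<in> sets borel" for A
  proof -
    have u: "(\<lambda>x. indicator A x *\<^sub>R \<xi> x) \<in> borel_measurable borel" using A by measurable
    have uth: "(\<lambda>x. \<theta> x *\<^sub>R (indicator A x *\<^sub>R \<xi> x)) \<in> borel_measurable borel" using A by measurable
    have uth': "(\<lambda>x. (\<theta> x * indicat_real A x) *\<^sub>R \<xi> x) \<in> borel_measurable borel" using A by measurable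
    have "integrable \<nu> (\<lambda>x. indicator A x *\<^sub>R \<xi> x)"
      by (rule \<nu>.integrable_const_bound[of _ 1]) (use u s\<nu> nxi in \<open>auto simp: indicator_def cong: measurable_cong_sets\<close>)
    then have "integrable H (\<lambda>x. \<theta> x *\<^sub>R (indicator A x *\<^sub>R \<xi> x))"
      unfolding \<nu>2 by (subst (asm) integrable_density) (auto intro!: mH u th th0)
    then have i: "integrable H1_meas (\<lambda>x. indicator M x *\<^sub>R (\<theta> x *\<^sub>R (indicator A x *\<^sub>R \<xi> x)))"
      unfolding Hd by (subst (asm) integrable_density) (auto intro!: mH1 uth uth')
    have e: "indicator M x *\<^sub>R (\<theta> x *\<^sub>R (indicator A x *\<^sub>R \<xi> x)) = indicator (A \<inter> M) x *\<^sub>R (\<theta> x *\<^sub>R \<xi> x)" for x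
      by (auto split: split_indicator)
    have "(\<integral>x. indicator A x *\<^sub>R g x \<partial>mu) = (\<integral>x. norm (g x) *\<^sub>R (indicator A x *\<^sub>R \<xi> x) \<partial>mu)"
    proof (rule Bochner_Integration.integral_cong[OF refl])
      show "indicator A x *\<^sub>R g x = norm (g x) *\<^sub>R (indicator A x *\<^sub>R \<xi> x)" for x
        using gxi[of x] by (auto split: split_indicator)
    qed
    also have "\<dots> = (\<integral>x. indicator A x *\<^sub>R \<xi> x \<partial>\<nu>)"
      unfolding \<nu>_def using u mu(2) borel_measurable_integrable[OF g]
      by (intro integral_density[symmetric]) (auto cong: measurable_cong_sets)
    also have "\<dots> = (\<integral>x. \<theta> x *\<^sub>R (indicator A x *\<^sub>R \<xi> x) \<partial>H)"
      unfolding \<nu>2 by (rule integral_density) (auto intro!: mH u th th0)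
    also have "\<dots> = (\<integral>x. indicator M x *\<^sub>R (\<theta> x *\<^sub>R (indicator A x *\<^sub>R \<xi> x)) \<partial>H1_meas)"
      unfolding Hd by (rule integral_density) (auto intro!: mH1 uth uth')
    finally show ?thesis using i unfolding e by blast
  qed
  have "is_U (mu, g) M \<theta> \<xi>"
    unfolding is_U_def
  proof (intro conjI ballI)
    show "rectifiable1 M"
      unfolding rectifiable1_def using f by (intro exI[of _ "{}"] exI[of _ f]) (auto simp: M_def)
    show "M \<in> sets borel" by (rule Mb)
    show "\<theta> \<in> borel_measurable borel" "\<xi> \<in> borel_measurable borel" by (rule th xi)+
    show "0 \<le> \<theta> x" "norm (\<xi> x) = 1" for x by (rule th0 nxi)+
    show "set_integrable H1_meas M (\<lambda>x. \<theta> x *\<^sub>R \<xi> x)"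
      using key[of UNIV] by (simp add: set_integrable_def)
    show "vm_val (mu, g) A = set_lebesgue_integral H1_meas (A \<inter> M) (\<lambda>x. \<theta> x *\<^sub>R \<xi> x)" if "A \<in> sets borel" for A
      using key[OF that] by (simp add: vm_val_def set_lebesgue_integral_def)
  qed
  then show ?thesis by blast
qed

section \<open>Energy estimates\<close>

lemma test_fn_outside:
  assumes "test_fn U \<psi>" "x \<notin> U" shows "\<psi> x = 0" "grad \<psi> x = 0"
proof -
  have sub: "tsupp \<psi> \<subseteq> U" using assms(1) by (simp add: test_fn_def)
  have x: "x \<in> - tsupp \<psi>" using sub assms(2) by blast
  have z: "\<psi> y = 0" if "y \<in> - tsupp \<psi>" for y
  proof (rule ccontr)
    assume "\<psi> y \<noteq> 0"
    then have "y \<in> tsupp \<psi>" unfolding tsupp_def by (intro subsetD[OF closure_subset]) simp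
    then show False using that by simp
  qed
  show "\<psi> x = 0" by (rule z[OF x])
  have "((\<lambda>_. 0) has_derivative (\<lambda>v. 0 :: real)) (at x)" by simp
  then have "(\<psi> has_derivative (\<lambda>v. 0)) (at x)"
  proof (rule has_derivative_transform_within_open[OF _ _ x])
    show "open (- tsupp \<psi>)" unfolding tsupp_def by (intro open_Compl closed_closure)
    show "0 = \<psi> y" if "y \<in> - tsupp \<psi>" for y using z[OF that] by simp
  qed
  from frechet_derivative_at[OF this] have "frechet_derivative \<psi> (at x) = (\<lambda>v. 0)" by simp
  then show "grad \<psi> x = 0" by (simp add: grad_def vec_eq_iff)
qed

lemma test_fn_grad_continuous: "test_fn U \<psi> \<Longrightarrow> continuous_on UNIV (grad \<psi>)"
  using smooth_C1_grad[of \<psi>] by (simp add: test_fn_def C1_grad_def)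

lemma test_fn_grad_bounded:
  assumes "test_fn U \<psi>" shows "\<exists>B. \<forall>x. norm (grad \<psi> x) \<le> B"
proof -
  have "compact (tsupp \<psi>)" using assms by (simp add: test_fn_def)
  then have "compact (grad \<psi> ` tsupp \<psi>)"
    by (intro compact_continuous_image continuous_on_subset[OF test_fn_grad_continuous[OF assms]]) simp_all
  from compact_imp_bounded[OF this, unfolded bounded_iff]
  obtain B where B: "\<forall>y\<in>grad \<psi> ` tsupp \<psi>. norm y \<le> B" ..
  have "test_fn (tsupp \<psi>) \<psi>" using assms by (simp add: test_fn_def)
  note out = test_fn_outside(2)[OF this]
  have "norm (grad \<psi> x) \<le> \<bar>B\<bar>" for x
    using B out[of x] by (cases "x \<in> tsupp \<psi>") auto
  then show ?thesis by blast
qed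

text \<open>Young's inequality, with \<tau> left free: 1 for integrability of L2 fields, \<epsilon>
  where \<phi> is small, 1 / sqrt \<epsilon> where \<phi> is large or when \<phi> is compared with
  1.\<close>

lemma linear_le_quadratic: "0 < \<tau> \<Longrightarrow> x \<le> \<tau> * x\<^sup>2 / 2 + 1 / (2 * \<tau>)" for x \<tau> :: real
proof -
  assume t: "0 < \<tau>"
  have "0 \<le> (\<tau> * x - 1)\<^sup>2 / (2 * \<tau>)" using t by simp
  also have "\<dots> = \<tau> * x\<^sup>2 / 2 + 1 / (2 * \<tau>) - x" using t by (simp add: power2_eq_square field_simps)
  finally show ?thesis by simp
qed

lemma L2_on_integrable:
  fixes s :: "pt \<Rightarrow> 'b::euclidean_space"
  assumes "L2_on U s" and U: "U \<in> sets borel" "emeasure lborel U < \<infinity>"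
  shows "integrable lborel (\<lambda>x. indicator U x *\<^sub>R s x)"
proof (rule integrableI_bounded)
  have m: "(\<lambda>x. indicator U x *\<^sub>R s x) \<in> borel_measurable lborel"
    using assms(1) by (simp add: L2_on_def set_borel_measurable_def)
  then show "(\<lambda>x. indicator U x *\<^sub>R s x) \<in> borel_measurable lborel" .
  have "(\<integral>\<^sup>+x. ennreal (norm (indicator U x *\<^sub>R s x)) \<partial>lborel) \<le>
    (\<integral>\<^sup>+x. indicator U x * ennreal ((norm (s x))\<^sup>2) + indicator U x \<partial>lborel)"
  proof (rule nn_integral_mono)
    fix x
    have "norm (s x) \<le> (norm (s x))\<^sup>2 + 1"
      using linear_le_quadratic[of 1 "norm (s x)"] zero_le_power2[of "norm (s x)"] by linarith
    then have "ennreal (norm (s x)) \<le> ennreal ((norm (s x))\<^sup>2) + 1"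
      by (metis ennreal_1 ennreal_leI ennreal_plus zero_le_one zero_le_power2)
    then show "ennreal (norm (indicator U x *\<^sub>R s x)) \<le> indicator U x * ennreal ((norm (s x))\<^sup>2) + indicator U x"
      by (auto split: split_indicator)
  qed
  also have "\<dots> = (\<integral>\<^sup>+x. indicator U x * ennreal ((norm (s x))\<^sup>2) \<partial>lborel) + emeasure lborel U"
  proof -
    have "(\<lambda>x. indicator U x * ennreal ((norm (s x))\<^sup>2)) = (\<lambda>x. ennreal ((norm (indicator U x *\<^sub>R s x))\<^sup>2))"
      by (auto simp: fun_eq_iff split: split_indicator)
    moreover have "(\<lambda>x. ennreal ((norm (indicator U x *\<^sub>R s x))\<^sup>2)) \<in> borel_measurable lborel"
      by (intro measurable_compose[OF m]) measurable
    ultimately have "(\<lambda>x. indicator U x * ennreal ((norm (s x))\<^sup>2)) \<in> borel_measurable lborel" by (simp only:)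
    then show ?thesis using U(1) by (subst nn_integral_add) auto
  qed
  also have "\<dots> < \<infinity>" using assms(1) U(2) by (simp add: L2_on_def)
  finally show "(\<integral>\<^sup>+x. ennreal (norm (indicator U x *\<^sub>R s x)) \<partial>lborel) < \<infinity>" .
qed

text \<open>A constant contributes nothing because gradients of test functions have integral zero.
  The finite measure of \<open>U\<close> makes the remaining products integrable.\<close>

lemma weak_grad_minus_const:
  assumes U: "open U" "emeasure lborel U < \<infinity>" and u: "L2_on U u"
  shows "weak_grad U (\<lambda>x. u x - c) G \<longleftrightarrow> weak_grad U u G"
proof -
  have Ub: "U \<in> sets borel" using U(1) by simp
  have "set_lebesgue_integral lborel U (\<lambda>x. (u x - c) * (grad \<psi> x $ i))
      = set_lebesgue_integral lborel U (\<lambda>x. u x * (grad \<psi> x $ i))" if \<psi>: "test_fn U \<psi>" for \<psi> i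
  proof -
    note g = integral_grad_test_fn[OF \<psi>]
    have gi: "integrable lborel (\<lambda>x. grad \<psi> x $ i)"
      using integrable_inner_left[of "axis i 1" lborel "grad \<psi>"] g(2) by (simp add: inner_axis)
    have gi0: "(\<integral>x. grad \<psi> x $ i \<partial>lborel) = 0"
      using integral_inner_left[of "axis i 1" lborel "grad \<psi>"] g by (simp add: inner_axis)
    have iu: "integrable lborel (\<lambda>x. indicator U x *\<^sub>R u x)" by (rule L2_on_integrable[OF u Ub U(2)])
    obtain B where B: "\<And>x. norm (grad \<psi> x) \<le> B" using test_fn_grad_bounded[OF \<psi>] by blast
    have ip: "integrable lborel (\<lambda>x. indicator U x *\<^sub>R (u x * (grad \<psi> x $ i)))"
    proof (rule Bochner_Integration.integrable_bound)
      show "integrable lborel (\<lambda>x. B * norm (indicator U x *\<^sub>R u x))" using iu by (intro integrable_mult_right integrable_norm)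
      have "(\<lambda>x. (indicator U x *\<^sub>R u x) * (grad \<psi> x $ i)) \<in> borel_measurable lborel"
        by (intro borel_measurable_times borel_measurable_integrable[OF iu] borel_measurable_integrable[OF gi])
      then show "(\<lambda>x. indicator U x *\<^sub>R (u x * (grad \<psi> x $ i))) \<in> borel_measurable lborel" by (simp add: mult.assoc)
      show "AE x in lborel. norm (indicator U x *\<^sub>R (u x * (grad \<psi> x $ i))) \<le> norm (B * norm (indicator U x *\<^sub>R u x))"
      proof (rule AE_I2)
        fix x
        have "\<bar>grad \<psi> x $ i\<bar> \<le> \<bar>B\<bar>" using component_le_norm_cart[of "grad \<psi> x" i] B[of x] by linarith
        then have "\<bar>u x\<bar> * \<bar>grad \<psi> x $ i\<bar> \<le> \<bar>u x\<bar> * \<bar>B\<bar>" by (rule mult_left_mono) simp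
        then show "norm (indicator U x *\<^sub>R (u x * (grad \<psi> x $ i))) \<le> norm (B * norm (indicator U x *\<^sub>R u x))"
          by (auto simp: abs_mult mult.commute split: split_indicator)
      qed
    qed
    have ic: "integrable lborel (\<lambda>x. c * (grad \<psi> x $ i))" using gi by simp
    have "indicator U x *\<^sub>R ((u x - c) * (grad \<psi> x $ i)) = indicator U x *\<^sub>R (u x * (grad \<psi> x $ i)) - c * (grad \<psi> x $ i)" for x
      using test_fn_outside(2)[OF \<psi>, of x] by (cases "x \<in> U") (auto simp: algebra_simps)
    then show ?thesis
      unfolding set_lebesgue_integral_def using Bochner_Integration.integral_diff[OF ip ic] gi0 by simp
  qed
  then show ?thesis unfolding weak_grad_def by simp
qed

text \<open>\<open>wgrad\<close> is a choice, so almost everywhere uniqueness of weak gradients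
  would not give equality of functions; the choices coincide because their defining predicates
  do.\<close>

lemma wgrad_minus_const:
  assumes "open U" "emeasure lborel U < \<infinity>" "L2_on U u"
  shows "wgrad U (\<lambda>x. u x - c) = wgrad U u"
  unfolding wgrad_def using weak_grad_minus_const[OF assms] by simp

lemma wgrad_L2: "H1_on U u \<Longrightarrow> L2_on U (wgrad U u)"
  unfolding H1_on_def wgrad_def by (metis (mono_tags, lifting) someI_ex)

section \<open>Pointwise bounds by the energy density\<close>

locale energy_bound =
  fixes \<Omega> :: "pt set" and \<eta> \<epsilon> a C :: real and s :: "pt \<Rightarrow> pt" and \<phi> :: "pt \<Rightarrow> real"
  assumes \<Omega>: "open \<Omega>" "bounded \<Omega>" and eps: "0 < \<epsilon>" "\<epsilon> \<le> 1" and a: "0 < a" "a * \<epsilon> \<le> \<eta>" and C: "0 \<le> C"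
    and W: "in_W \<Omega> \<eta> \<phi>" and s: "L2_on \<Omega> s"
    and energy: "(\<integral>\<^sup>+ x. indicator \<Omega> x * ennreal ((\<phi> x)\<^sup>2 * (norm (s x))\<^sup>2 / (2 * \<epsilon>)
         + \<epsilon> / 2 * (norm (wgrad \<Omega> \<phi> x))\<^sup>2 + (1 - \<phi> x)\<^sup>2 / (2 * \<epsilon>)) \<partial>lborel) \<le> ennreal C"
begin

text \<open>Extension by zero turns measurability on \<Omega> into Borel measurability on the plane;
  the same holds for \<open>phi0\<close> and \<open>w0\<close>.\<close>

definition s0 :: "pt \<Rightarrow> pt" where "s0 x = indicator \<Omega> x *\<^sub>R s x"
definition phi0 :: "pt \<Rightarrow> real" where "phi0 x = indicator \<Omega> x *\<^sub>R \<phi> x"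
definition w0 :: "pt \<Rightarrow> pt" where "w0 x = indicator \<Omega> x *\<^sub>R wgrad \<Omega> \<phi> x"
definition ed :: "pt \<Rightarrow> real" where
  "ed x = indicator \<Omega> x * ((phi0 x)\<^sup>2 * (norm (s0 x))\<^sup>2 / (2 * \<epsilon>) + \<epsilon> / 2 * (norm (w0 x))\<^sup>2 + (1 - phi0 x)\<^sup>2 / (2 * \<epsilon>))"
definition vol :: real where "vol = measure lborel \<Omega>"

lemma Omega_borel [measurable]: "\<Omega> \<in> sets borel" using \<Omega>(1) by simp

lemma Omega_finite: "emeasure lborel \<Omega> < \<infinity>"
  using \<Omega>(2) by (rule emeasure_bounded_finite)

lemma emeasure_Omega: "emeasure lborel \<Omega> = ennreal vol"
  unfolding vol_def using Omega_finite by (intro emeasure_eq_ennreal_measure) auto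

lemma vol_nonneg: "0 \<le> vol" by (simp add: vol_def)

lemma phi_L2: "L2_on \<Omega> \<phi>" and phi_H1: "H1_on \<Omega> \<phi>"
  using W by (simp_all add: in_W_def H1_on_def)

lemma s0_measurable [measurable]: "s0 \<in> borel_measurable borel"
  using s unfolding L2_on_def set_borel_measurable_def s0_def[abs_def] by simp

lemma phi0_measurable [measurable]: "phi0 \<in> borel_measurable borel"
  using phi_L2 unfolding L2_on_def set_borel_measurable_def phi0_def[abs_def] by simp

lemma w0_measurable [measurable]: "w0 \<in> borel_measurable borel"
  using wgrad_L2[OF phi_H1] unfolding L2_on_def set_borel_measurable_def w0_def[abs_def] by simp

lemma ed_measurable [measurable]: "ed \<in> borel_measurable borel"
  unfolding ed_def[abs_def] by measurable

lemma ed_nonneg: "0 \<le> ed x" unfolding ed_def using eps by simp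

lemma ed_integral: "(\<integral>\<^sup>+x. ennreal (ed x) \<partial>lborel) \<le> ennreal C"
proof -
  have "ennreal (ed x) = indicator \<Omega> x * ennreal ((\<phi> x)\<^sup>2 * (norm (s x))\<^sup>2 / (2 * \<epsilon>)
         + \<epsilon> / 2 * (norm (wgrad \<Omega> \<phi> x))\<^sup>2 + (1 - \<phi> x)\<^sup>2 / (2 * \<epsilon>))" for x
    by (cases "x \<in> \<Omega>") (simp_all add: ed_def phi0_def s0_def w0_def)
  then show ?thesis using energy by simp
qed

lemma nn_integral_le_energy:
  assumes "AE x in lborel. f x \<le> m * ed x + c * indicator \<Omega> x" "0 \<le> m" "0 \<le> c"
  shows "(\<integral>\<^sup>+x. ennreal (f x) \<partial>lborel) \<le> ennreal (m * C + c * vol)"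
proof -
  have "(\<integral>\<^sup>+x. ennreal (f x) \<partial>lborel) \<le> (\<integral>\<^sup>+x. ennreal m * ennreal (ed x) + ennreal c * indicator \<Omega> x \<partial>lborel)"
  proof (rule nn_integral_mono_AE)
    show "AE x in lborel. ennreal (f x) \<le> ennreal m * ennreal (ed x) + ennreal c * indicator \<Omega> x"
      using assms(1)
    proof eventually_elim
      case (elim x)
      have "ennreal (f x) \<le> ennreal (m * ed x + c * indicator \<Omega> x)" using elim by (rule ennreal_leI)
      also have "\<dots> = ennreal m * ennreal (ed x) + ennreal c * indicator \<Omega> x"
        using assms(2,3) ed_nonneg[of x] by (simp add: ennreal_plus ennreal_mult ennreal_indicator)
      finally show ?case .
    qed
  qed
  also have "\<dots> = ennreal m * (\<integral>\<^sup>+x. ennreal (ed x) \<partial>lborel) + ennreal c * emeasure lborel \<Omega>"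
    by (subst nn_integral_add) (auto simp: nn_integral_cmult nn_integral_cmult_indicator)
  also have "\<dots> \<le> ennreal m * ennreal C + ennreal c * ennreal vol"
    unfolding emeasure_Omega by (intro add_right_mono mult_left_mono ed_integral) simp
  also have "\<dots> = ennreal (m * C + c * vol)"
    using assms(2,3) C vol_nonneg by (simp add: ennreal_plus ennreal_mult)
  finally show ?thesis .
qed

lemma phi0_bounds: "AE x in lborel. x \<in> \<Omega> \<longrightarrow> a * \<epsilon> \<le> phi0 x \<and> phi0 x \<le> 1"
proof -
  have "AE x in lborel. x \<in> \<Omega> \<longrightarrow> \<eta> \<le> \<phi> x \<and> \<phi> x \<le> 1" using W by (simp add: in_W_def)
  then show ?thesis by eventually_elim (use a(2) in \<open>auto simp: phi0_def\<close>)
qed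

text \<open>For \<phi> \<ge> 1/2 the weight of |s|^2 in the energy is at least 1 / (8 \<epsilon>),
  so |s|^2 \<le> 8 \<epsilon> * \<open>ed\<close>. Young's inequality with parameter 1 / sqrt
  \<epsilon> makes this a linear bound with the small factor sqrt \<epsilon>.\<close>

lemma high_phase:
  assumes x: "x \<in> \<Omega>" and p: "1/2 \<le> phi0 x"
  shows "norm (s0 x) \<le> 4 * sqrt \<epsilon> * ed x + sqrt \<epsilon>"
proof -
  define S where "S = norm (s0 x)"
  have "(1/2)\<^sup>2 \<le> (phi0 x)\<^sup>2" using p by (intro power_mono) auto
  then have "1/4 * S\<^sup>2 \<le> (phi0 x)\<^sup>2 * S\<^sup>2" by (intro mult_right_mono) (auto simp: power2_eq_square)
  then have "1/4 * S\<^sup>2 / (2 * \<epsilon>) \<le> (phi0 x)\<^sup>2 * S\<^sup>2 / (2 * \<epsilon>)" using eps by (intro divide_right_mono) auto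
  also have "\<dots> \<le> ed x" unfolding ed_def S_def using x eps by simp
  finally have S2: "S\<^sup>2 \<le> 8 * \<epsilon> * ed x" using eps by (simp add: field_simps)
  define r where "r = sqrt \<epsilon>"
  have r: "0 < r" "r * r = \<epsilon>" using eps by (auto simp: r_def)
  have "S \<le> (1 / r) * S\<^sup>2 / 2 + 1 / (2 * (1 / r))" using r by (intro linear_le_quadratic) simp
  also have "(1 / r) * S\<^sup>2 / 2 \<le> (1 / r) * (8 * \<epsilon> * ed x) / 2" using S2 r by (intro divide_right_mono mult_left_mono) auto
  also have "(1 / r) * (8 * \<epsilon> * ed x) / 2 = 4 * r * ed x" unfolding r(2)[symmetric] using r(1) by simp
  finally have "S \<le> 4 * r * ed x + r / 2" by simp
  then have "S \<le> 4 * r * ed x + r" using r(1) by linarith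
  then show ?thesis by (simp only: S_def r_def)
qed

text \<open>Where \<phi> < 1/2, the lower bound \<phi> \<ge> a \<epsilon> gives \<epsilon> |s|^2 / 2
  \<le> A / a^2 and the well gives 1 / (2 \<epsilon>) \<le> 4 D; Young's inequality with parameter
  \<epsilon> adds the two. No small factor appears here, which is why mass may survive in the
  limit.\<close>

lemma mass_density_bound:
  "AE x in lborel. norm (s0 x) \<le> (1 / a\<^sup>2 + 4) * ed x + 1 * indicator \<Omega> x"
  using phi0_bounds
proof eventually_elim
  case (elim x)
  show ?case
  proof (cases "x \<in> \<Omega>")
    case x: True
    show ?thesis
    proof (cases "1/2 \<le> phi0 x")
      case True
      have "sqrt \<epsilon> \<le> 1" using eps by simp
      moreover have "4 * sqrt \<epsilon> * ed x \<le> 4 * 1 * ed x" using eps ed_nonneg[of x] by (intro mult_right_mono mult_left_mono) auto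
      moreover have "0 \<le> 1 / a\<^sup>2 * ed x" using ed_nonneg[of x] by simp
      moreover have "(1 / a\<^sup>2 + 4) * ed x = 1 / a\<^sup>2 * ed x + 4 * 1 * ed x" by (simp add: distrib_right)
      moreover have "1 * indicator \<Omega> x = (1 :: real)" using x by simp
      ultimately show ?thesis using high_phase[OF x True] by linarith
    next
      case False
      define S where "S = norm (s0 x)"
      define A where "A = (phi0 x)\<^sup>2 * S\<^sup>2 / (2 * \<epsilon>)"
      define D where "D = (1 - phi0 x)\<^sup>2 / (2 * \<epsilon>)"
      have A0: "0 \<le> A" and D0: "0 \<le> D" using eps by (auto simp: A_def D_def)
      have AD: "A + D \<le> ed x" using x eps by (simp add: ed_def A_def D_def S_def)
      have ae: "0 < a * \<epsilon>" using a eps by simp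
      have "(a * \<epsilon>)\<^sup>2 \<le> (phi0 x)\<^sup>2" using elim x ae by (intro power_mono) auto
      then have "(a * \<epsilon>)\<^sup>2 * S\<^sup>2 / (2 * \<epsilon>) \<le> A" unfolding A_def using eps by (intro divide_right_mono mult_right_mono) auto
      then have "\<epsilon> * S\<^sup>2 / 2 \<le> A / a\<^sup>2" using eps a by (simp add: field_simps power2_eq_square)
      moreover have "1 / (2 * \<epsilon>) \<le> 4 * D"
      proof -
        have "(1/2)\<^sup>2 \<le> (1 - phi0 x)\<^sup>2" using False by (intro power_mono) auto
        then have "(1/4) / (2 * \<epsilon>) \<le> D" unfolding D_def using eps by (intro divide_right_mono) (auto simp: power2_eq_square)
        then show ?thesis by simp
      qed
      moreover have "S \<le> \<epsilon> * S\<^sup>2 / 2 + 1 / (2 * \<epsilon>)" using eps(1) by (rule linear_le_quadratic)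
      ultimately have "S \<le> A / a\<^sup>2 + 4 * D" by linarith
      also have "\<dots> \<le> (1 / a\<^sup>2 + 4) * (A + D)"
      proof -
        have "0 \<le> 1 / a\<^sup>2 * D" using D0 by simp
        moreover have "(1 / a\<^sup>2 + 4) * (A + D) = A / a\<^sup>2 + 1 / a\<^sup>2 * D + 4 * A + 4 * D" by (simp add: algebra_simps add_divide_distrib)
        ultimately show ?thesis using A0 by linarith
      qed
      also have "\<dots> \<le> (1 / a\<^sup>2 + 4) * ed x" using AD by (intro mult_left_mono) (auto intro: add_nonneg_nonneg)
      finally show ?thesis using x by (simp add: S_def)
    qed
  next
    case False
    then have "s0 x = 0" by (simp add: s0_def)
    moreover have "0 \<le> (1 / a\<^sup>2 + 4) * ed x" using ed_nonneg[of x] by (intro mult_nonneg_nonneg) (auto intro: add_nonneg_nonneg)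
    ultimately show ?thesis by simp
  qed
qed

lemma mass_bound: "(\<integral>\<^sup>+x. ennreal (norm (s0 x)) \<partial>lborel) \<le> ennreal ((1 / a\<^sup>2 + 4) * C + vol)"
  using nn_integral_le_energy[OF mass_density_bound] by (simp add: add_nonneg_nonneg)

text \<open>The potential controls the square of \<phi> - 1 with the factor 1 / (2 \<epsilon>);
  Young's inequality with parameter 1 / sqrt \<epsilon> balances it against the area of
  \<Omega>.\<close>

lemma phase_to_one: "(\<integral>\<^sup>+x. ennreal (indicator \<Omega> x * \<bar>\<phi> x - 1\<bar>) \<partial>lborel) \<le> ennreal (sqrt \<epsilon> * (C + vol))"
proof -
  have "AE x in lborel. indicator \<Omega> x * \<bar>\<phi> x - 1\<bar> \<le> sqrt \<epsilon> * ed x + sqrt \<epsilon> * indicator \<Omega> x"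
  proof (rule AE_I2)
    fix x
    show "indicator \<Omega> x * \<bar>\<phi> x - 1\<bar> \<le> sqrt \<epsilon> * ed x + sqrt \<epsilon> * indicator \<Omega> x"
    proof (cases "x \<in> \<Omega>")
      case True
      define r where "r = sqrt \<epsilon>"
      have r: "0 < r" "r * r = \<epsilon>" using eps by (auto simp: r_def)
      define y where "y = \<bar>\<phi> x - 1\<bar>"
      have "y\<^sup>2 / (2 * \<epsilon>) \<le> ed x" using True eps by (simp add: ed_def y_def phi0_def power2_commute)
      then have "r * (y\<^sup>2 / (2 * (r * r))) \<le> r * ed x" using r by (intro mult_left_mono) auto
      moreover have "y \<le> (1 / r) * y\<^sup>2 / 2 + 1 / (2 * (1 / r))" using r by (intro linear_le_quadratic) simp
      moreover have "r * (y\<^sup>2 / (2 * (r * r))) = (1 / r) * y\<^sup>2 / 2" using r(1) by simp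
      moreover have "1 / (2 * (1 / r)) \<le> r" using r by simp
      ultimately have "y \<le> r * ed x + r" by linarith
      then show ?thesis using True by (simp add: y_def r_def)
    next
      case False
      then show ?thesis using ed_nonneg[of x] eps by simp
    qed
  qed
  from nn_integral_le_energy[OF this] show ?thesis using eps by (simp add: distrib_left)
qed

text \<open>The accuracy of the approximation of \<phi> - 1 by \<psi> is chosen after
  \<open>s\<close>, because the energy gives no bound on the L2 norm of \<open>s\<close> that is
  uniform in \<epsilon>. Where 1 + \<psi> \<ge> 3/4 although \<phi> < 1/2, the error is at least
  1/4, and its smallness in L2 pays for \<open>s\<close> through Young's inequality.\<close>

lemma smooth_approximant:
  obtains \<psi> where "test_fn \<Omega> \<psi>"
    "(\<integral>\<^sup>+x. ennreal (\<epsilon> / 2 * (norm (grad \<psi> x))\<^sup>2 + (\<psi> x)\<^sup>2 / (2 * \<epsilon>)) \<partial>lborel) \<le> ennreal (2 * C + 2)"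
    "(\<integral>\<^sup>+x. ennreal (norm (s0 x)) * indicator {x. 3/4 \<le> 1 + \<psi> x} x \<partial>lborel) \<le> ennreal (sqrt \<epsilon> * (4 * C + vol + 9))"
proof -
  define S2 where "S2 = enn2real (\<integral>\<^sup>+x. ennreal ((norm (s0 x))\<^sup>2) \<partial>lborel)"
  have S2fin: "(\<integral>\<^sup>+x. ennreal ((norm (s0 x))\<^sup>2) \<partial>lborel) = ennreal S2"
  proof -
    have "(\<integral>\<^sup>+x. ennreal ((norm (s0 x))\<^sup>2) \<partial>lborel) = (\<integral>\<^sup>+x. indicator \<Omega> x * ennreal ((norm (s x))\<^sup>2) \<partial>lborel)"
      by (intro nn_integral_cong) (auto simp: s0_def split: split_indicator)
    also have "\<dots> < \<infinity>" using s by (simp add: L2_on_def)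
    finally show ?thesis unfolding S2_def by simp
  qed
  have S20: "0 \<le> S2" by (simp add: S2_def)
  define r where "r = sqrt \<epsilon>"
  have r: "0 < r" "r * r = \<epsilon>" using eps by (auto simp: r_def)
  \<comment> \<open>Makes \<tau> times the squared L2 norm of \<open>s0\<close> at most sqrt
    \<epsilon>; the added 1 admits norm zero.\<close>
  define \<tau> where "\<tau> = r / (S2 + 1)"
  have \<tau>: "0 < \<tau>" using r S20 by (simp add: \<tau>_def)
  have \<tau>S: "\<tau> * S2 \<le> r" using r S20 by (simp add: \<tau>_def field_simps)
  \<comment> \<open>The two entries serve the two estimates: t0 \<le> \<epsilon> gives (\<epsilon> +
    1/\<epsilon>) * t0 \<le> 2, and t0 \<le> \<tau> * r gives 8 * t0 / \<tau> \<le> 8 * r.\<close>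
  define t0 where "t0 = min \<epsilon> (\<tau> * r)"
  have t0: "0 < t0" "t0 \<le> \<epsilon>" "t0 \<le> \<tau> * r" using eps \<tau> r by (auto simp: t0_def)
  have wg: "wgrad \<Omega> (\<lambda>x. \<phi> x - 1) = wgrad \<Omega> \<phi>"
    by (rule wgrad_minus_const[OF \<Omega>(1) Omega_finite phi_L2])
  have "H10_on \<Omega> (\<lambda>x. \<phi> x - 1)" using W by (simp add: in_W_def)
  then obtain \<psi>s where \<psi>s: "\<forall>n. test_fn \<Omega> (\<psi>s n)"
    "(\<lambda>n. \<integral>\<^sup>+ x. indicator \<Omega> x * ennreal ((\<psi>s n x - (\<phi> x - 1))\<^sup>2 + (norm (grad (\<psi>s n) x - wgrad \<Omega> \<phi> x))\<^sup>2) \<partial>lborel) \<longlonglongrightarrow> 0"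
    unfolding H10_on_def wg by blast
  have "\<forall>\<^sub>F n in sequentially. (\<integral>\<^sup>+ x. indicator \<Omega> x * ennreal ((\<psi>s n x - (\<phi> x - 1))\<^sup>2 + (norm (grad (\<psi>s n) x - wgrad \<Omega> \<phi> x))\<^sup>2) \<partial>lborel) < ennreal t0"
    using \<psi>s(2) by (rule order_tendstoD(2)) (use t0 in simp)
  from eventually_happens[OF this] obtain n where
    n: "(\<integral>\<^sup>+ x. indicator \<Omega> x * ennreal ((\<psi>s n x - (\<phi> x - 1))\<^sup>2 + (norm (grad (\<psi>s n) x - wgrad \<Omega> \<phi> x))\<^sup>2) \<partial>lborel) < ennreal t0"
    by auto
  define \<psi> where "\<psi> = \<psi>s n"
  have test: "test_fn \<Omega> \<psi>" using \<psi>s(1) by (simp add: \<psi>_def)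
  have C1: "C1_grad \<psi> (grad \<psi>)" using smooth_C1_grad test by (simp add: test_fn_def)
  have [measurable]: "\<psi> \<in> borel_measurable borel" "grad \<psi> \<in> borel_measurable borel"
    using C1 C1_grad_continuous[OF C1] by (auto intro!: borel_measurable_continuous_onI simp: C1_grad_def)
  define q where "q x = indicator \<Omega> x * ((\<psi> x - (phi0 x - 1))\<^sup>2 + (norm (grad \<psi> x - w0 x))\<^sup>2)" for x
  have [measurable]: "q \<in> borel_measurable borel" unfolding q_def[abs_def] by measurable
  have q0: "0 \<le> q x" for x by (simp add: q_def)
  have qint: "(\<integral>\<^sup>+x. ennreal (q x) \<partial>lborel) \<le> ennreal t0"
  proof -
    have "ennreal (q x) = indicator \<Omega> x * ennreal ((\<psi>s n x - (\<phi> x - 1))\<^sup>2 + (norm (grad (\<psi>s n) x - wgrad \<Omega> \<phi> x))\<^sup>2)" for x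
      by (cases "x \<in> \<Omega>") (simp_all add: q_def \<psi>_def phi0_def w0_def)
    then show ?thesis using n by simp
  qed
  have sq: "(u + v)\<^sup>2 \<le> 2 * u\<^sup>2 + 2 * v\<^sup>2" for u v :: real
    using zero_le_power2[of "u - v"] by (simp add: power2_eq_square algebra_simps)
  have E: "\<epsilon> / 2 * (norm (grad \<psi> x))\<^sup>2 + (\<psi> x)\<^sup>2 / (2 * \<epsilon>) \<le> 2 * ed x + (\<epsilon> + 1 / \<epsilon>) * q x" for x
  proof (cases "x \<in> \<Omega>")
    case True
    have "(norm (grad \<psi> x))\<^sup>2 \<le> (norm (w0 x) + norm (grad \<psi> x - w0 x))\<^sup>2"
      by (intro power_mono norm_triangle_sub) simp
    also have "\<dots> \<le> 2 * (norm (w0 x))\<^sup>2 + 2 * (norm (grad \<psi> x - w0 x))\<^sup>2" by (rule sq)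
    finally have "\<epsilon> / 2 * (norm (grad \<psi> x))\<^sup>2 \<le> \<epsilon> / 2 * (2 * (norm (w0 x))\<^sup>2 + 2 * (norm (grad \<psi> x - w0 x))\<^sup>2)"
      using eps by (intro mult_left_mono) auto
    then have e1: "\<epsilon> / 2 * (norm (grad \<psi> x))\<^sup>2 \<le> 2 * (\<epsilon> / 2 * (norm (w0 x))\<^sup>2) + \<epsilon> * (norm (grad \<psi> x - w0 x))\<^sup>2"
      by (simp add: algebra_simps)
    have "(\<psi> x)\<^sup>2 \<le> 2 * (1 - phi0 x)\<^sup>2 + 2 * (\<psi> x - (phi0 x - 1))\<^sup>2"
      using sq[of "phi0 x - 1" "\<psi> x - (phi0 x - 1)"] by (simp add: power2_commute)
    then have "(\<psi> x)\<^sup>2 / (2 * \<epsilon>) \<le> (2 * (1 - phi0 x)\<^sup>2 + 2 * (\<psi> x - (phi0 x - 1))\<^sup>2) / (2 * \<epsilon>)"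
      using eps by (intro divide_right_mono) auto
    then have e2: "(\<psi> x)\<^sup>2 / (2 * \<epsilon>) \<le> 2 * ((1 - phi0 x)\<^sup>2 / (2 * \<epsilon>)) + 1 / \<epsilon> * (\<psi> x - (phi0 x - 1))\<^sup>2"
      by (simp add: add_divide_distrib)
    have A0: "0 \<le> (phi0 x)\<^sup>2 * (norm (s0 x))\<^sup>2 / (2 * \<epsilon>)" using eps by simp
    have ed: "ed x = (phi0 x)\<^sup>2 * (norm (s0 x))\<^sup>2 / (2 * \<epsilon>) + \<epsilon> / 2 * (norm (w0 x))\<^sup>2 + (1 - phi0 x)\<^sup>2 / (2 * \<epsilon>)"
      using True by (simp add: ed_def)
    have q: "(\<epsilon> + 1 / \<epsilon>) * q x = \<epsilon> * (norm (grad \<psi> x - w0 x))\<^sup>2 + 1 / \<epsilon> * (\<psi> x - (phi0 x - 1))\<^sup>2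
       + (\<epsilon> * (\<psi> x - (phi0 x - 1))\<^sup>2 + 1 / \<epsilon> * (norm (grad \<psi> x - w0 x))\<^sup>2)"
      using True by (simp add: q_def algebra_simps)
    have "0 \<le> \<epsilon> * (\<psi> x - (phi0 x - 1))\<^sup>2 + 1 / \<epsilon> * (norm (grad \<psi> x - w0 x))\<^sup>2" using eps by simp
    moreover have "X + Y \<le> 2 * (A + B + D) + (P + Q + T)"
      if "X \<le> 2 * B + P" "Y \<le> 2 * D + Q" "0 \<le> A" "0 \<le> T" for X Y A B D P Q T :: real
      using that by argo
    ultimately show ?thesis using e1 e2 A0 unfolding ed q by iprover
  next
    case False
    have "0 \<le> 2 * ed x + (\<epsilon> + 1 / \<epsilon>) * q x" using ed_nonneg[of x] q0[of x] eps by simp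
    then show ?thesis using test_fn_outside[OF test False] by simp
  qed
  show ?thesis
  proof (rule that[OF test])
    have "(\<integral>\<^sup>+x. ennreal (\<epsilon> / 2 * (norm (grad \<psi> x))\<^sup>2 + (\<psi> x)\<^sup>2 / (2 * \<epsilon>)) \<partial>lborel)
      \<le> (\<integral>\<^sup>+x. ennreal 2 * ennreal (ed x) + ennreal (\<epsilon> + 1 / \<epsilon>) * ennreal (q x) \<partial>lborel)"
    proof (rule nn_integral_mono)
      fix x
      have "ennreal (\<epsilon> / 2 * (norm (grad \<psi> x))\<^sup>2 + (\<psi> x)\<^sup>2 / (2 * \<epsilon>)) \<le> ennreal (2 * ed x + (\<epsilon> + 1 / \<epsilon>) * q x)"
        by (rule ennreal_leI[OF E])
      also have "\<dots> = ennreal (2 * ed x) + ennreal ((\<epsilon> + 1 / \<epsilon>) * q x)"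
        using ed_nonneg[of x] q0[of x] eps by (intro ennreal_plus) auto
      also have "\<dots> = ennreal 2 * ennreal (ed x) + ennreal (\<epsilon> + 1 / \<epsilon>) * ennreal (q x)"
        using ed_nonneg[of x] q0[of x] by (simp only: ennreal_mult'')
      finally show "ennreal (\<epsilon> / 2 * (norm (grad \<psi> x))\<^sup>2 + (\<psi> x)\<^sup>2 / (2 * \<epsilon>)) \<le> ennreal 2 * ennreal (ed x) + ennreal (\<epsilon> + 1 / \<epsilon>) * ennreal (q x)" .
    qed
    also have "\<dots> = ennreal 2 * (\<integral>\<^sup>+x. ennreal (ed x) \<partial>lborel) + ennreal (\<epsilon> + 1 / \<epsilon>) * (\<integral>\<^sup>+x. ennreal (q x) \<partial>lborel)"
      by (subst nn_integral_add) (auto simp: nn_integral_cmult)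
    also have "\<dots> \<le> ennreal 2 * ennreal C + ennreal (\<epsilon> + 1 / \<epsilon>) * ennreal t0"
      by (intro add_mono mult_left_mono ed_integral qint) auto
    also have "\<dots> = ennreal (2 * C + (\<epsilon> + 1 / \<epsilon>) * t0)"
      using C t0(1) eps by (simp only: ennreal_mult''[symmetric] less_imp_le) (intro ennreal_plus[symmetric], auto)
    also have "\<dots> \<le> ennreal (2 * C + 2)"
    proof (rule ennreal_leI)
      have "(\<epsilon> + 1 / \<epsilon>) * t0 \<le> (\<epsilon> + 1 / \<epsilon>) * \<epsilon>" using t0(2) eps by (intro mult_left_mono) auto
      also have "\<dots> = \<epsilon> * \<epsilon> + 1" using eps by (simp add: field_simps)
      also have "\<epsilon> * \<epsilon> \<le> 1 * 1" using eps by (intro mult_mono) auto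
      finally show "2 * C + (\<epsilon> + 1 / \<epsilon>) * t0 \<le> 2 * C + 2" by simp
    qed
    finally show "(\<integral>\<^sup>+x. ennreal (\<epsilon> / 2 * (norm (grad \<psi> x))\<^sup>2 + (\<psi> x)\<^sup>2 / (2 * \<epsilon>)) \<partial>lborel) \<le> ennreal (2 * C + 2)" .
    have P: "norm (s0 x) * indicator {x. 3/4 \<le> 1 + \<psi> x} x \<le> (4 * r) * ed x + r * indicator \<Omega> x + (\<tau> / 2) * (norm (s0 x))\<^sup>2 + (8 / \<tau>) * q x" for x
    proof (cases "x \<in> \<Omega> \<and> 3/4 \<le> 1 + \<psi> x")
      case True
      have n1: "0 \<le> (\<tau> / 2) * (norm (s0 x))\<^sup>2" "0 \<le> (8 / \<tau>) * q x" "0 \<le> 4 * r * ed x"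
        using \<tau> q0[of x] r ed_nonneg[of x] by auto
      show ?thesis
      proof (cases "1/2 \<le> phi0 x")
        case h: True
        have "norm (s0 x) \<le> 4 * r * ed x + r" unfolding r_def using True by (intro high_phase h) simp
        moreover have "norm (s0 x) * indicator {x. 3/4 \<le> 1 + \<psi> x} x = norm (s0 x)" "r * indicator \<Omega> x = r"
          using True by auto
        ultimately show ?thesis using n1 by linarith
      next
        case False
        \<comment> \<open>The squared error is at least 1/16, so 8 * q / \<tau> covers the constant
          1 / (2 \<tau>) of Young's inequality.\<close>
        have "1/4 \<le> \<psi> x - (phi0 x - 1)" using True False by simp
        then have "(1/4)\<^sup>2 \<le> (\<psi> x - (phi0 x - 1))\<^sup>2" by (intro power_mono) auto
        also have "\<dots> \<le> q x" using True by (simp add: q_def)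
        finally have "1/16 \<le> q x" by (simp add: power2_eq_square)
        then have "8 / \<tau> * (1/16) \<le> 8 / \<tau> * q x" using \<tau> by (intro mult_left_mono) auto
        moreover have "8 / \<tau> * (1/16) = 1 / (2 * \<tau>)" by simp
        moreover have "norm (s0 x) \<le> \<tau> * (norm (s0 x))\<^sup>2 / 2 + 1 / (2 * \<tau>)" by (rule linear_le_quadratic[OF \<tau>])
        moreover have "norm (s0 x) * indicator {x. 3/4 \<le> 1 + \<psi> x} x = norm (s0 x)" "r * indicator \<Omega> x = r"
          using True by auto
        moreover have "\<tau> * (norm (s0 x))\<^sup>2 / 2 = \<tau> / 2 * (norm (s0 x))\<^sup>2" by simp
        moreover have "A' \<le> X + r' + Y + Q"
          if "B' \<le> Q" "B' = T" "A' \<le> Z + T" "Z = Y" "0 \<le> X" "0 < r'" for A' B' Q T Z Y X r' :: real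
          using that by argo
        ultimately show ?thesis using n1 r(1) by metis
      qed
    next
      case False
      then have z: "norm (s0 x) * indicator {x. 3/4 \<le> 1 + \<psi> x} x = 0" by (auto simp: s0_def)
      have "0 \<le> (4 * r) * ed x + r * indicator \<Omega> x + (\<tau> / 2) * (norm (s0 x))\<^sup>2 + (8 / \<tau>) * q x"
        using \<tau> q0[of x] r ed_nonneg[of x] by (intro add_nonneg_nonneg mult_nonneg_nonneg) auto
      then show ?thesis unfolding z .
    qed
    have "(\<integral>\<^sup>+x. ennreal (norm (s0 x)) * indicator {x. 3/4 \<le> 1 + \<psi> x} x \<partial>lborel)
      \<le> (\<integral>\<^sup>+x. ennreal (4 * r) * ennreal (ed x) + ennreal r * indicator \<Omega> x + ennreal (\<tau> / 2) * ennreal ((norm (s0 x))\<^sup>2) + ennreal (8 / \<tau>) * ennreal (q x) \<partial>lborel)"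
    proof (rule nn_integral_mono)
      fix x
      have "ennreal (norm (s0 x)) * indicator {x. 3/4 \<le> 1 + \<psi> x} x = ennreal (norm (s0 x) * indicator {x. 3/4 \<le> 1 + \<psi> x} x)"
        by (auto split: split_indicator)
      also have "\<dots> \<le> ennreal ((4 * r) * ed x + r * indicator \<Omega> x + (\<tau> / 2) * (norm (s0 x))\<^sup>2 + (8 / \<tau>) * q x)"
        by (rule ennreal_leI[OF P])
      also have "\<dots> = ennreal ((4 * r) * ed x) + ennreal (r * indicator \<Omega> x) + ennreal ((\<tau> / 2) * (norm (s0 x))\<^sup>2) + ennreal ((8 / \<tau>) * q x)"
      proof -
        have nn: "0 \<le> (4 * r) * ed x" "0 \<le> r * indicator \<Omega> x" "0 \<le> (\<tau> / 2) * (norm (s0 x))\<^sup>2" "0 \<le> (8 / \<tau>) * q x"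
          using \<tau> q0[of x] r ed_nonneg[of x] by auto
        then show ?thesis by (simp only: ennreal_plus add_nonneg_nonneg)
      qed
      also have "\<dots> = ennreal (4 * r) * ennreal (ed x) + ennreal r * indicator \<Omega> x + ennreal (\<tau> / 2) * ennreal ((norm (s0 x))\<^sup>2) + ennreal (8 / \<tau>) * ennreal (q x)"
        using ed_nonneg[of x] q0[of x] by (simp only: ennreal_mult'' zero_le_power2 indicator_pos_le ennreal_indicator)
      finally show "ennreal (norm (s0 x)) * indicator {x. 3/4 \<le> 1 + \<psi> x} x \<le> \<dots>" .
    qed
    also have "\<dots> = ennreal (4 * r) * (\<integral>\<^sup>+x. ennreal (ed x) \<partial>lborel) + ennreal r * emeasure lborel \<Omega>
       + ennreal (\<tau> / 2) * (\<integral>\<^sup>+x. ennreal ((norm (s0 x))\<^sup>2) \<partial>lborel) + ennreal (8 / \<tau>) * (\<integral>\<^sup>+x. ennreal (q x) \<partial>lborel)"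
      by (simp add: nn_integral_add nn_integral_cmult nn_integral_cmult_indicator)
    also have "\<dots> \<le> ennreal (4 * r) * ennreal C + ennreal r * ennreal vol + ennreal (\<tau> / 2) * ennreal S2 + ennreal (8 / \<tau>) * ennreal t0"
      unfolding S2fin emeasure_Omega by (intro add_mono mult_left_mono ed_integral qint order_refl) auto
    also have "\<dots> = ennreal (4 * r * C + r * vol + \<tau> / 2 * S2 + 8 / \<tau> * t0)"
    proof -
      have nn: "0 \<le> 4 * r * C" "0 \<le> r * vol" "0 \<le> \<tau> / 2 * S2" "0 \<le> 8 / \<tau> * t0" "0 \<le> t0"
        using \<tau> r C vol_nonneg S20 t0 by auto
      show ?thesis using nn C vol_nonneg S20 by (simp only: ennreal_plus add_nonneg_nonneg ennreal_mult'')
    qed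
    also have "\<dots> \<le> ennreal (r * (4 * C + vol + 9))"
    proof (rule ennreal_leI)
      \<comment> \<open>The 9 in the final constant consists of 8 from this term and room for the
        term with \<open>S2\<close>, which is at most r/2.\<close>
      have "8 / \<tau> * t0 \<le> 8 / \<tau> * (\<tau> * r)" using t0(3) \<tau> by (intro mult_left_mono) auto
      also have "\<dots> = 8 * r" using \<tau> by simp
      finally show "4 * r * C + r * vol + \<tau> / 2 * S2 + 8 / \<tau> * t0 \<le> r * (4 * C + vol + 9)"
        using \<tau>S r(1) by (simp add: algebra_simps)
    qed
    finally show "(\<integral>\<^sup>+x. ennreal (norm (s0 x)) * indicator {x. 3/4 \<le> 1 + \<psi> x} x \<partial>lborel) \<le> ennreal (sqrt \<epsilon> * (4 * C + vol + 9))"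
      by (simp add: r_def)
  qed
qed

end

section \<open>Mollified sources, pairings and product test functions\<close>

lemma moll_translate:
  fixes w :: "pt \<Rightarrow> real"
  assumes \<rho>: "mollifier \<rho>" and e: "0 < \<epsilon>" and w: "continuous_on UNIV w"
  shows "integrable lborel (\<lambda>y. moll \<rho> \<epsilon> (y - p) * w y)"
    and "(\<integral>y. moll \<rho> \<epsilon> (y - p) * w y \<partial>lborel) = (\<integral>y. moll \<rho> \<epsilon> y * w (p + y) \<partial>lborel)"
proof -
  define f where "f y = moll \<rho> \<epsilon> y * w (p + y)" for y
  have c: "continuous_on UNIV (\<lambda>y. w (p + y))"
    by (rule continuous_on_compose2[OF w]) (auto intro: continuous_intros)
  have i: "integrable lborel f" using integrable_moll_mult[OF \<rho> e c] by (simp add: f_def[abs_def])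
  have eq: "f (- p + 1 *\<^sub>R y) = moll \<rho> \<epsilon> (y - p) * w y" for y by (simp add: f_def)
  show "integrable lborel (\<lambda>y. moll \<rho> \<epsilon> (y - p) * w y)"
    using integral_affine_pt(1)[OF _ i, of 1 "- p"] by (simp only: eq)
  have "(\<integral>x. f x \<partial>lborel) = 1\<^sup>2 *\<^sub>R (\<integral>x. f (- p + 1 *\<^sub>R x) \<partial>lborel)"
    using borel_measurable_integrable[OF i] by (intro integral_affine_pt(2)) simp_all
  then show "(\<integral>y. moll \<rho> \<epsilon> (y - p) * w y \<partial>lborel) = (\<integral>y. moll \<rho> \<epsilon> y * w (p + y) \<partial>lborel)"
    by (simp only: eq) (simp add: f_def)
qed

lemma src_support:
  assumes \<rho>: "mollifier \<rho>" and e: "0 < \<epsilon>" and x: "src \<rho> N xs \<epsilon> x \<noteq> 0"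
  shows "\<exists>i\<le>N. norm (x - xs i) < \<epsilon>"
proof (rule ccontr)
  assume n: "\<not> ?thesis"
  have "moll \<rho> \<epsilon> (x - xs i) = 0" if "i \<le> N" for i
  proof (rule ccontr)
    assume "moll \<rho> \<epsilon> (x - xs i) \<noteq> 0"
    from moll_support[OF \<rho> e this] n that show False by simp
  qed
  then have "src \<rho> N xs \<epsilon> x = 0" by (simp add: src_def)
  then show False using x by simp
qed

lemma continuous_src:
  assumes \<rho>: "mollifier \<rho>" shows "continuous_on UNIV (src \<rho> N xs \<epsilon>)"
proof -
  have "continuous_on UNIV (\<lambda>y. moll \<rho> \<epsilon> (y - p))" for p
    by (rule continuous_on_compose2[OF continuous_moll[OF \<rho>]]) (auto intro: continuous_intros)
  then show ?thesis unfolding src_def[abs_def] by (intro continuous_intros)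
qed

lemma integral_src:
  fixes w :: "pt \<Rightarrow> real"
  assumes \<rho>: "mollifier \<rho>" and e: "0 < \<epsilon>" and w: "continuous_on UNIV w"
  shows "(\<integral>y. w y * src \<rho> N xs \<epsilon> y \<partial>lborel) =
    real N * (\<integral>y. moll \<rho> \<epsilon> y * w (xs 0 + y) \<partial>lborel) - (\<Sum>j\<in>{1..N}. \<integral>y. moll \<rho> \<epsilon> y * w (xs j + y) \<partial>lborel)"
proof -
  note i = moll_translate(1)[OF \<rho> e w] and t = moll_translate(2)[OF \<rho> e w]
  have "(\<integral>y. w y * src \<rho> N xs \<epsilon> y \<partial>lborel) =
    (\<integral>y. real N * (moll \<rho> \<epsilon> (y - xs 0) * w y) - (\<Sum>j\<in>{1..N}. moll \<rho> \<epsilon> (y - xs j) * w y) \<partial>lborel)"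
    by (intro Bochner_Integration.integral_cong refl) (simp add: src_def algebra_simps sum_distrib_left)
  also have "\<dots> = (\<integral>y. real N * (moll \<rho> \<epsilon> (y - xs 0) * w y) \<partial>lborel) - (\<integral>y. (\<Sum>j\<in>{1..N}. moll \<rho> \<epsilon> (y - xs j) * w y) \<partial>lborel)"
    by (intro Bochner_Integration.integral_diff Bochner_Integration.integrable_sum integrable_mult_right i)
  also have "\<dots> = real N * (\<integral>y. moll \<rho> \<epsilon> (y - xs 0) * w y \<partial>lborel) - (\<Sum>j\<in>{1..N}. \<integral>y. moll \<rho> \<epsilon> (y - xs j) * w y \<partial>lborel)"
    using i by (subst Bochner_Integration.integral_sum) simp_all
  finally show ?thesis unfolding t .
qed

lemma src_mass:
  assumes \<rho>: "mollifier \<rho>" and e: "0 < \<epsilon>"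
  shows "integrable lborel (src \<rho> N xs \<epsilon>)" "(\<integral>y. \<bar>src \<rho> N xs \<epsilon> y\<bar> \<partial>lborel) \<le> 2 * real N"
proof -
  have i: "integrable lborel (\<lambda>y. moll \<rho> \<epsilon> (y - p))" for p
    using moll_translate(1)[OF \<rho> e continuous_on_const, of p 1] by simp
  have t: "(\<integral>y. moll \<rho> \<epsilon> (y - p) \<partial>lborel) = 1" for p
    using moll_translate(2)[OF \<rho> e continuous_on_const, of p 1] integral_moll(2)[OF \<rho> e] by simp
  show s: "integrable lborel (src \<rho> N xs \<epsilon>)"
    unfolding src_def[abs_def] by (intro Bochner_Integration.integrable_diff Bochner_Integration.integrable_sum integrable_mult_right i)
  have j: "integrable lborel (\<lambda>y. real N * moll \<rho> \<epsilon> (y - xs 0) + (\<Sum>j\<in>{1..N}. moll \<rho> \<epsilon> (y - xs j)))"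
    by (intro Bochner_Integration.integrable_add Bochner_Integration.integrable_sum integrable_mult_right i)
  have "(\<integral>y. \<bar>src \<rho> N xs \<epsilon> y\<bar> \<partial>lborel) \<le> (\<integral>y. real N * moll \<rho> \<epsilon> (y - xs 0) + (\<Sum>j\<in>{1..N}. moll \<rho> \<epsilon> (y - xs j)) \<partial>lborel)"
  proof (rule integral_mono[OF integrable_abs[OF s] j])
    fix y
    have "0 \<le> real N * moll \<rho> \<epsilon> (y - xs 0)" "0 \<le> (\<Sum>j\<in>{1..N}. moll \<rho> \<epsilon> (y - xs j))"
      using moll_nonneg[OF \<rho>] by (auto intro: sum_nonneg)
    then show "\<bar>src \<rho> N xs \<epsilon> y\<bar> \<le> real N * moll \<rho> \<epsilon> (y - xs 0) + (\<Sum>j\<in>{1..N}. moll \<rho> \<epsilon> (y - xs j))"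
      unfolding src_def by linarith
  qed
  also have "\<dots> = (\<integral>y. real N * moll \<rho> \<epsilon> (y - xs 0) \<partial>lborel) + (\<integral>y. (\<Sum>j\<in>{1..N}. moll \<rho> \<epsilon> (y - xs j)) \<partial>lborel)"
    by (intro Bochner_Integration.integral_add Bochner_Integration.integrable_sum integrable_mult_right i)
  also have "\<dots> = 2 * real N" by (subst Bochner_Integration.integral_sum) (simp_all add: i t)
  finally show "(\<integral>y. \<bar>src \<rho> N xs \<epsilon> y\<bar> \<partial>lborel) \<le> 2 * real N" .
qed

lemma src_tendsto:
  fixes w :: "pt \<Rightarrow> real"
  assumes \<rho>: "mollifier \<rho>" and e: "\<And>n. 0 < e n" "e \<longlonglongrightarrow> 0" and w: "continuous_on UNIV w"
  shows "(\<lambda>n. \<integral>y. w y * src \<rho> N xs (e n) y \<partial>lborel) \<longlonglongrightarrow> real N * w (xs 0) - (\<Sum>j\<in>{1..N}. w (xs j))"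
proof -
  have "(\<lambda>n. \<integral>y. moll \<rho> (e n) y * w (p + y) \<partial>lborel) \<longlonglongrightarrow> w p" for p
  proof -
    have c: "continuous_on UNIV (\<lambda>y. w (p + y))"
      by (rule continuous_on_compose2[OF w]) (auto intro: continuous_intros)
    show ?thesis using approximate_identity[OF \<rho> e c] by simp
  qed
  then show ?thesis unfolding integral_src[OF \<rho> e(1) w] by (intro tendsto_diff tendsto_mult tendsto_const tendsto_sum)
qed

lemma integral_vec_component:
  fixes f :: "'a \<Rightarrow> real^'n"
  assumes "integrable M f"
  shows "integrable M (\<lambda>x. f x $ i)" "(\<integral>x. f x $ i \<partial>M) = (\<integral>x. f x \<partial>M) $ i"
  using integrable_inner_left[of "axis i 1" M f] integral_inner_left[of "axis i 1" M f] assms by (simp_all add: inner_axis)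

text \<open>The density is given through values on Borel sets, so the pairing is computed
  componentwise from them. \<open>f\<close> is cut off to \<open>A\<close> because it is bounded
  only there.\<close>

lemma vm_int_density:
  assumes \<sigma>: "is_vmeasure \<sigma>" and d: "vm_density_on \<sigma> U s" and s: "integrable lborel (\<lambda>x. indicator U x *\<^sub>R s x)"
    and A: "A \<in> sets borel" and f: "f \<in> borel_measurable borel" and B: "\<And>x. x \<in> A \<Longrightarrow> norm (f x) \<le> B"
  shows "vm_int \<sigma> A f = (\<integral>x. indicator A x * (f x \<bullet> (indicator U x *\<^sub>R s x)) \<partial>lborel)"
proof -
  obtain mu g where \<sigma>eq: "\<sigma> = (mu, g)" by (cases \<sigma>)
  have mu: "finite_measure mu" "sets mu = sets borel" and g: "integrable mu g"
    using \<sigma> by (simp_all add: is_vmeasure_def \<sigma>eq)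
  define F where "F x = indicator A x *\<^sub>R f x" for x
  define u where "u x = indicator U x *\<^sub>R s x" for x
  have [measurable]: "f \<in> borel_measurable borel" "A \<in> sets borel" by fact+
  have Fm: "(\<lambda>x. F x $ i) \<in> borel_measurable borel" for i
  proof -
    have "(\<lambda>x. F x \<bullet> axis i 1) \<in> borel_measurable borel" unfolding F_def[abs_def] by measurable
    then show ?thesis by (simp add: inner_axis)
  qed
  have FB: "\<bar>F x $ i\<bar> \<le> \<bar>B\<bar>" for x i
  proof -
    have "\<bar>F x $ i\<bar> \<le> norm (F x)" by (rule component_le_norm_cart)
    also have "\<dots> \<le> \<bar>B\<bar>" using B[of x] by (auto simp: F_def split: split_indicator)
    finally show ?thesis .
  qed
  have ui: "integrable lborel u" unfolding u_def[abs_def] by (rule s)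
  have eq: "(\<integral>x. indicator D x * (g x $ i) \<partial>mu) = (\<integral>x. indicator D x * (u x $ i) \<partial>lborel)" if D: "D \<in> sets borel" for D i
  proof -
    have [measurable]: "D \<in> sets borel" "D \<in> sets mu" using D mu(2) by simp_all
    have "(\<integral>x. indicator D x * (g x $ i) \<partial>mu) = (\<integral>x. (indicator D x *\<^sub>R g x) $ i \<partial>mu)" by simp
    also have "\<dots> = vm_val \<sigma> D $ i"
      unfolding vm_val_def set_lebesgue_integral_def \<sigma>eq fst_conv snd_conv
      by (intro integral_vec_component integrable_mult_indicator g) fact
    also have "vm_val \<sigma> D = (\<integral>x. indicator (D \<inter> U) x *\<^sub>R s x \<partial>lborel)"
      using d D by (simp add: vm_density_on_def set_lebesgue_integral_def)
    also have "\<dots> = (\<integral>x. indicator D x *\<^sub>R u x \<partial>lborel)" by (simp add: u_def indicator_inter_arith)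
    also have "\<dots> $ i = (\<integral>x. (indicator D x *\<^sub>R u x) $ i \<partial>lborel)"
      by (intro integral_vec_component(2)[symmetric] integrable_mult_indicator ui) simp
    finally show ?thesis by simp
  qed
  note E = integral_eq_if_set_integral_eq[OF mu integral_vec_component(1)[OF g] integral_vec_component(1)[OF ui] eq Fm FB]
  have "vm_int \<sigma> A f = (\<integral>x. F x $ 1 * g x $ 1 + F x $ 2 * g x $ 2 \<partial>mu)"
    unfolding vm_int_def set_lebesgue_integral_def \<sigma>eq fst_conv snd_conv
    by (intro Bochner_Integration.integral_cong refl) (simp add: F_def inner_vec_def sum_2 algebra_simps)
  also have "\<dots> = (\<integral>x. F x $ 1 * g x $ 1 \<partial>mu) + (\<integral>x. F x $ 2 * g x $ 2 \<partial>mu)"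
    by (intro Bochner_Integration.integral_add E(2))
  also have "\<dots> = (\<integral>x. F x $ 1 * u x $ 1 \<partial>lborel) + (\<integral>x. F x $ 2 * u x $ 2 \<partial>lborel)"
    by (intro arg_cong2[where f = "(+)"] E(1))
  also have "\<dots> = (\<integral>x. F x $ 1 * u x $ 1 + F x $ 2 * u x $ 2 \<partial>lborel)"
    by (intro Bochner_Integration.integral_add[symmetric] E(3))
  also have "\<dots> = (\<integral>x. indicator A x * (f x \<bullet> u x) \<partial>lborel)"
    by (intro Bochner_Integration.integral_cong refl) (simp add: F_def inner_vec_def sum_2 algebra_simps)
  finally show ?thesis by (simp add: u_def)
qed

lemma C1_fun_mult:
  assumes "C1_fun f" "C1_fun g"
  shows "C1_fun (\<lambda>x. f x * g x)" "deriv (\<lambda>x. f x * g x) = (\<lambda>x. deriv f x * g x + f x * deriv g x)"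
proof -
  have d: "((\<lambda>x. f x * g x) has_real_derivative (deriv f x * g x + f x * deriv g x)) (at x)" for x
    using assms unfolding C1_fun_def by (auto intro!: derivative_eq_intros)
  have c: "continuous_on UNIV (\<lambda>x. deriv f x * g x + f x * deriv g x)"
    using assms by (intro continuous_intros C1_fun_continuous C1_fun_deriv_continuous)
  show "C1_fun (\<lambda>x. f x * g x)" "deriv (\<lambda>x. f x * g x) = (\<lambda>x. deriv f x * g x + f x * deriv g x)"
    using C1_funI[OF d c] by simp_all
qed

text \<open>Quadratic splines: \<open>p\<close> rises from 0 to 1 on the unit interval, its
  derivative \<open>q\<close> being a tent of height 2. The product of two reflected copies is
  locally flat wherever both arguments are at least 1.\<close>

lemma C1_cutoff:
  "\<exists>c. C1_fun c \<and> (\<forall>t. \<bar>t\<bar> \<le> R \<longrightarrow> c t = 1 \<and> deriv c t = 0) \<and> (\<forall>t. c t \<noteq> 0 \<longrightarrow> \<bar>t\<bar> \<le> R + 1)"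
proof -
  define p where "p x = 2 * ((max 0 x)\<^sup>2 - 2 * (max 0 (x - 1/2))\<^sup>2 + (max 0 (x - 1))\<^sup>2)" for x :: real
  define q where "q x = 4 * (max 0 x - 2 * max 0 (x - 1/2) + max 0 (x - 1))" for x :: real
  have p1: "p x = 1" if "1 \<le> x" for x using that by (simp add: p_def power2_eq_square algebra_simps)
  have p0: "p x = 0" if "x \<le> 0" for x using that by (simp add: p_def)
  have q1: "q x = 0" if "1 \<le> x" for x using that by (simp add: q_def)
  have dp: "(p has_real_derivative q x) (at x)" for x
  proof -
    have s: "((\<lambda>x. (max 0 (x - k))\<^sup>2) has_real_derivative 2 * max 0 (x - k)) (at x)" for k :: real
    proof -
      have "((\<lambda>x. x - k) has_real_derivative 1) (at x)" by (auto intro!: derivative_eq_intros)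
      from DERIV_chain2[OF max0_square_deriv this] show ?thesis by simp
    qed
    have "(p has_real_derivative 2 * (2 * max 0 x - 2 * (2 * max 0 (x - 1/2)) + 2 * max 0 (x - 1))) (at x)"
      unfolding p_def[abs_def] by (intro DERIV_cmult DERIV_add DERIV_diff s max0_square_deriv)
    then show ?thesis by (simp add: q_def algebra_simps)
  qed
  have cq: "continuous_on UNIV q" unfolding q_def[abs_def] by (intro continuous_intros)
  have l: "C1_fun (\<lambda>t. p (R + 1 - t))" "deriv (\<lambda>t. p (R + 1 - t)) = (\<lambda>t. - q (R + 1 - t))"
  proof -
    have d: "((\<lambda>t. p (R + 1 - t)) has_real_derivative - q (R + 1 - t)) (at t)" for t
    proof -
      have "((\<lambda>t. R + 1 - t) has_real_derivative - 1) (at t)" by (auto intro!: derivative_eq_intros)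
      from DERIV_chain2[OF dp this] show ?thesis by simp
    qed
    have c: "continuous_on UNIV (\<lambda>t. - q (R + 1 - t))"
      by (intro continuous_on_minus continuous_on_compose2[OF cq]) (auto intro!: continuous_intros)
    show "C1_fun (\<lambda>t. p (R + 1 - t))" "deriv (\<lambda>t. p (R + 1 - t)) = (\<lambda>t. - q (R + 1 - t))"
      using C1_funI[OF d c] by simp_all
  qed
  have r: "C1_fun (\<lambda>t. p (R + 1 + t))" "deriv (\<lambda>t. p (R + 1 + t)) = (\<lambda>t. q (R + 1 + t))"
  proof -
    have d: "((\<lambda>t. p (R + 1 + t)) has_real_derivative q (R + 1 + t)) (at t)" for t
    proof -
      have "((\<lambda>t. R + 1 + t) has_real_derivative 1) (at t)" by (auto intro!: derivative_eq_intros)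
      from DERIV_chain2[OF dp this] show ?thesis by simp
    qed
    have c: "continuous_on UNIV (\<lambda>t. q (R + 1 + t))"
      by (intro continuous_on_compose2[OF cq]) (auto intro!: continuous_intros)
    show "C1_fun (\<lambda>t. p (R + 1 + t))" "deriv (\<lambda>t. p (R + 1 + t)) = (\<lambda>t. q (R + 1 + t))"
      using C1_funI[OF d c] by simp_all
  qed
  show ?thesis
  proof (intro exI[of _ "\<lambda>t. p (R + 1 - t) * p (R + 1 + t)"] conjI allI impI C1_fun_mult(1)[OF l(1) r(1)])
    fix t assume t: "\<bar>t\<bar> \<le> R"
    show "p (R + 1 - t) * p (R + 1 + t) = 1" using t by (simp add: p1 abs_le_iff)
    show "deriv (\<lambda>t. p (R + 1 - t) * p (R + 1 + t)) t = 0"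
      unfolding C1_fun_mult(2)[OF l(1) r(1)] l(2) r(2) using t by (simp add: q1 abs_le_iff)
  next
    fix t assume t: "p (R + 1 - t) * p (R + 1 + t) \<noteq> 0"
    show "\<bar>t\<bar> \<le> R + 1"
    proof (rule ccontr)
      assume "\<not> \<bar>t\<bar> \<le> R + 1"
      then have "R + 1 - t \<le> 0 \<or> R + 1 + t \<le> 0" by linarith
      then show False using t p0 by auto
    qed
  qed
qed

lemma C1_grad_product:
  assumes \<beta>: "C1_fun \<beta>" and f: "C1_fun f"
  shows "C1_grad (\<lambda>x. \<beta> (x $ i) * f (x $ other i)) (\<lambda>x. to_pt i (deriv \<beta> (x $ i) * f (x $ other i), \<beta> (x $ i) * deriv f (x $ other i)))"
  unfolding C1_grad_def
proof (intro conjI allI)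
  fix x :: pt
  have comp: "((\<lambda>x :: pt. x $ l) has_derivative (\<lambda>v. v $ l)) (at x)" for l
    by (rule bounded_linear_imp_has_derivative[OF bounded_linear_vec_nth])
  have D: "((\<lambda>x. h (x $ l)) has_derivative (\<lambda>v. deriv h (x $ l) * v $ l)) (at x)" if h: "C1_fun h" for h l
  proof -
    have "(h has_derivative (\<lambda>v. deriv h (x $ l) * v)) (at (x $ l))"
      using h unfolding C1_fun_def has_field_derivative_def by blast
    from has_derivative_compose[OF comp this] show ?thesis .
  qed
  have "((\<lambda>x. \<beta> (x $ i) * f (x $ other i)) has_derivative
    (\<lambda>v. \<beta> (x $ i) * (deriv f (x $ other i) * v $ other i) + deriv \<beta> (x $ i) * v $ i * f (x $ other i))) (at x)"
    by (rule has_derivative_mult[OF D[OF \<beta>] D[OF f]])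
  then show "((\<lambda>x. \<beta> (x $ i) * f (x $ other i)) has_derivative
    (\<lambda>v. to_pt i (deriv \<beta> (x $ i) * f (x $ other i), \<beta> (x $ i) * deriv f (x $ other i)) \<bullet> v)) (at x)"
    by (simp add: inner_other[of _ _ i] algebra_simps)
next
  have c: "continuous_on UNIV (\<lambda>x :: pt. h (x $ l))" if "continuous_on UNIV h" for h :: "real \<Rightarrow> real" and l
    by (rule continuous_on_compose2[OF that]) (auto intro!: continuous_intros)
  show "continuous_on UNIV (\<lambda>x. to_pt i (deriv \<beta> (x $ i) * f (x $ other i), \<beta> (x $ i) * deriv f (x $ other i)))"
    by (rule continuous_on_compose2[OF continuous_to_pt])
      (auto intro!: continuous_on_Pair continuous_on_mult c C1_fun_continuous C1_fun_deriv_continuous \<beta> f)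
qed

text \<open>A product \<beta> f need not have compact support. A cutoff equal to 1 with zero
  derivative up to \<open>R\<close> makes it admissible and changes nothing in the integrals, since
  \<open>s\<close> and \<open>h\<close> vanish where the norm exceeds \<open>R\<close>.\<close>

lemma divergence_product:
  fixes s :: "pt \<Rightarrow> pt" and h :: "pt \<Rightarrow> real"
  assumes \<rho>: "mollifier \<rho>" and s: "integrable lborel s" and h: "integrable lborel h"
    and test: "\<And>\<psi>. test_fn UNIV \<psi> \<Longrightarrow> - (\<integral>x. grad \<psi> x \<bullet> s x \<partial>lborel) = (\<integral>x. h x * \<psi> x \<partial>lborel)"
    and supps: "\<And>x. s x \<noteq> 0 \<Longrightarrow> norm x \<le> R" and supph: "\<And>x. h x \<noteq> 0 \<Longrightarrow> norm x \<le> R"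
    and \<beta>: "C1_fun \<beta>" and f: "C1_fun f"
  shows "(\<integral>z. s (to_pt i z) $ i * (deriv \<beta> (fst z) * f (snd z)) + s (to_pt i z) $ other i * (\<beta> (fst z) * deriv f (snd z))
         + h (to_pt i z) * (\<beta> (fst z) * f (snd z)) \<partial>lborel) = 0"
proof -
  obtain c where c: "C1_fun c" "\<And>t. \<bar>t\<bar> \<le> R \<Longrightarrow> c t = 1" "\<And>t. \<bar>t\<bar> \<le> R \<Longrightarrow> deriv c t = 0" "\<And>t. c t \<noteq> 0 \<Longrightarrow> \<bar>t\<bar> \<le> R + 1"
    using C1_cutoff[of R] by metis
  note B = C1_fun_mult[OF \<beta> c(1)] and F = C1_fun_mult[OF f c(1)]
  define \<psi> where "\<psi> x = (\<beta> (x $ i) * c (x $ i)) * (f (x $ other i) * c (x $ other i))" for x :: pt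
  define G where "G x = to_pt i (deriv (\<lambda>t. \<beta> t * c t) (x $ i) * (f (x $ other i) * c (x $ other i)), (\<beta> (x $ i) * c (x $ i)) * deriv (\<lambda>t. f t * c t) (x $ other i))" for x :: pt
  have C1: "C1_grad \<psi> G" unfolding \<psi>_def[abs_def] G_def[abs_def] by (rule C1_grad_product[OF B(1) F(1)])
  have supp: "norm x \<le> 2 * (R + 1)" if "\<psi> x \<noteq> 0" for x
  proof -
    have "c (x $ i) \<noteq> 0" "c (x $ other i) \<noteq> 0" using that by (auto simp: \<psi>_def)
    then have "\<bar>x $ i\<bar> \<le> R + 1" "\<bar>x $ other i\<bar> \<le> R + 1" using c(4) by blast+
    moreover have "norm x \<le> \<bar>x $ i\<bar> + \<bar>x $ other i\<bar>" using norm_le_l1_cart[of x] by (simp add: sum_other[of _ i])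
    ultimately show ?thesis by argo
  qed
  have div: "- (\<integral>x. G x \<bullet> s x \<partial>lborel) = (\<integral>x. h x * \<psi> x \<partial>lborel)"
    by (rule divergence_C1[OF \<rho> s h test C1 supp])
  have contG: "continuous_on UNIV G" using C1 by (simp add: C1_grad_def)
  have cont\<psi>: "continuous_on UNIV \<psi>" by (rule C1_grad_continuous[OF C1])
  obtain BG where BG: "\<And>x. norm (G x) \<le> BG"
    by (rule bounded_compact_support[OF contG, of "2 * (R + 1)"]) (erule C1_grad_support[OF C1 supp, rotated], assumption, rule that)
  obtain B\<psi> where B\<psi>: "\<And>x. norm (\<psi> x) \<le> B\<psi>"
    by (rule bounded_compact_support[OF cont\<psi> supp]) (assumption, rule that)
  have [measurable]: "G \<in> borel_measurable borel" "\<psi> \<in> borel_measurable borel" "s \<in> borel_measurable borel" "h \<in> borel_measurable borel"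
    using borel_measurable_integrable[OF s] borel_measurable_integrable[OF h]
    by (simp_all add: borel_measurable_continuous_onI contG cont\<psi>)
  have i1: "integrable lborel (\<lambda>x. G x \<bullet> s x)"
  proof (rule Bochner_Integration.integrable_bound)
    show "integrable lborel (\<lambda>x. BG * norm (s x))" using s by simp
    show "AE x in lborel. norm (G x \<bullet> s x) \<le> norm (BG * norm (s x))"
    proof (rule AE_I2)
      fix x
      have "\<bar>G x \<bullet> s x\<bar> \<le> norm (G x) * norm (s x)" by (rule Cauchy_Schwarz_ineq2)
      also have "\<dots> \<le> BG * norm (s x)" using BG by (intro mult_right_mono) auto
      finally show "norm (G x \<bullet> s x) \<le> norm (BG * norm (s x))" by simp
    qed
  qed simp
  have i2: "integrable lborel (\<lambda>x. h x * \<psi> x)"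
  proof (rule Bochner_Integration.integrable_bound)
    show "integrable lborel (\<lambda>x. B\<psi> * h x)" using h by simp
    show "AE x in lborel. norm (h x * \<psi> x) \<le> norm (B\<psi> * h x)"
    proof (rule AE_I2)
      fix x
      have "\<bar>\<psi> x\<bar> * \<bar>h x\<bar> \<le> \<bar>B\<psi>\<bar> * \<bar>h x\<bar>" using B\<psi>[of x] by (intro mult_right_mono) auto
      then show "norm (h x * \<psi> x) \<le> norm (B\<psi> * h x)" by (simp add: abs_mult mult.commute)
    qed
  qed simp
  define P where "P x = s x $ i * (deriv \<beta> (x $ i) * f (x $ other i)) + s x $ other i * (\<beta> (x $ i) * deriv f (x $ other i))
         + h x * (\<beta> (x $ i) * f (x $ other i))" for x
  have PG: "P x = G x \<bullet> s x + h x * \<psi> x" for x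
  proof (cases "norm x \<le> R")
    case True
    then have "\<bar>x $ i\<bar> \<le> R" "\<bar>x $ other i\<bar> \<le> R" using component_le_norm_cart order_trans by blast+
    then show ?thesis unfolding P_def G_def \<psi>_def B(2) F(2) by (simp add: inner_other[of _ _ i] c(2,3) algebra_simps)
  next
    case False
    then have "s x = 0" "h x = 0" using supps supph by blast+
    then show ?thesis by (simp add: P_def)
  qed
  have "(\<integral>x. P x \<partial>lborel) = 0"
    using Bochner_Integration.integral_add[OF i1 i2] div by (simp add: PG)
  moreover have "P \<in> borel_measurable borel" unfolding PG[abs_def] by measurable
  ultimately have "(\<integral>z. P (to_pt i z) \<partial>lborel) = 0" using integral_to_pt(2)[of P i] by simp
  then show ?thesis by (simp add: P_def)
qed

section \<open>The limit field\<close>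

text \<open>\<open>1 + \<psi> j\<close> plays the part of the phase field. \<open>g\<close> and
  \<open>gh\<close> are the densities of the limit field and of the limit source with respect to
  \<open>mu\<close>, the weak limit of the summed absolute values of both components and the source.
  A single \<open>K\<close> serves all bounds.\<close>

locale field_limit =
  fixes \<Omega> :: "pt set" and \<rho> :: "pt \<Rightarrow> real" and N :: nat and xs :: "nat \<Rightarrow> pt" and e :: "nat \<Rightarrow> real"
    and s :: "nat \<Rightarrow> pt \<Rightarrow> pt" and \<psi> :: "nat \<Rightarrow> pt \<Rightarrow> real" and K R :: real
    and mu :: "pt measure" and g :: "pt \<Rightarrow> pt" and gh :: "pt \<Rightarrow> real"
  assumes \<rho>: "mollifier \<rho>" and e: "\<And>j. 0 < e j" "e \<longlonglongrightarrow> 0" and R: "0 < R" and K: "0 \<le> K"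
    and s: "\<And>j. integrable lborel (s j)"
    and supps: "\<And>j x. s j x \<noteq> 0 \<Longrightarrow> norm x \<le> R" and supph: "\<And>j x. src \<rho> N xs (e j) x \<noteq> 0 \<Longrightarrow> norm x \<le> R"
    and mass: "\<And>j. (\<integral>\<^sup>+x. ennreal (norm (s j x)) \<partial>lborel) \<le> ennreal K"
    and div: "\<And>j f. test_fn UNIV f \<Longrightarrow> - (\<integral>x. grad f x \<bullet> s j x \<partial>lborel) = (\<integral>x. src \<rho> N xs (e j) x * f x \<partial>lborel)"
    and test: "\<And>j. test_fn \<Omega> (\<psi> j)"
    and energy: "\<And>j. (\<integral>\<^sup>+x. ennreal (e j / 2 * (norm (grad (\<psi> j) x))\<^sup>2 + (\<psi> j x)\<^sup>2 / (2 * e j)) \<partial>lborel) \<le> ennreal K"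
    and small: "\<And>j. (\<integral>\<^sup>+x. ennreal (norm (s j x)) * indicator {x. 3/4 \<le> 1 + \<psi> j x} x \<partial>lborel) \<le> ennreal (sqrt (e j) * K)"
    and fmu: "finite_measure mu" and smu: "sets mu = sets borel" and suppmu: "AE x in mu. norm x \<le> R"
    and g: "integrable mu g" and gh: "integrable mu gh"
    and lims: "\<And>f l. continuous_on UNIV f \<Longrightarrow> (\<lambda>j. \<integral>x. f x * s j x $ l \<partial>lborel) \<longlonglongrightarrow> (\<integral>x. f x * g x $ l \<partial>mu)"
    and limh: "\<And>f. continuous_on UNIV f \<Longrightarrow> (\<lambda>j. \<integral>x. f x * src \<rho> N xs (e j) x \<partial>lborel) \<longlonglongrightarrow> (\<integral>x. f x * gh x \<partial>mu)"
    and limabs: "\<And>f. continuous_on UNIV f \<Longrightarrow>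
      (\<lambda>j. \<integral>x. f x * (\<bar>s j x $ 1\<bar> + \<bar>s j x $ 2\<bar> + \<bar>src \<rho> N xs (e j) x\<bar>) \<partial>lborel) \<longlonglongrightarrow> (\<integral>x. f x \<partial>mu)"
begin

lemma s_comp: "integrable lborel (\<lambda>x. s j x $ l)" and g_comp: "integrable mu (\<lambda>x. g x $ l)"
  by (rule integral_vec_component(1)[OF s], rule integral_vec_component(1)[OF g])

lemma s_comp_borel [measurable]: "(\<lambda>x. s j x $ l) \<in> borel_measurable borel"
  using borel_measurable_integrable[OF s_comp] by simp

lemma s_borel [measurable]: "s j \<in> borel_measurable borel"
  using borel_measurable_integrable[OF s] by simp

lemma src_borel [measurable]: "src \<rho> N xs \<epsilon> \<in> borel_measurable borel"
  by (rule borel_measurable_continuous_onI[OF continuous_src[OF \<rho>]])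

lemma g_comp_borel [measurable]: "(\<lambda>x. g x $ l) \<in> borel_measurable borel"
  using borel_measurable_integrable[OF g_comp] smu by (simp cong: measurable_cong_sets)

lemma gh_borel [measurable]: "gh \<in> borel_measurable borel"
  using borel_measurable_integrable[OF gh] smu by (simp cong: measurable_cong_sets)

lemma psi_C1: "C1_grad (\<psi> j) (grad (\<psi> j))"
  using smooth_C1_grad test[of j] by (simp add: test_fn_def)

lemma psi_borel [measurable]: "\<psi> j \<in> borel_measurable borel"
  by (rule borel_measurable_continuous_onI[OF C1_grad_continuous[OF psi_C1]])

lemma grad_psi_borel [measurable]: "(\<lambda>x. grad (\<psi> j) x $ l) \<in> borel_measurable borel"
  by (rule borel_measurable_continuous_onI[OF continuous_on_component[OF test_fn_grad_continuous[OF test]]])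

lemma inner_limit:
  assumes w: "continuous_on UNIV w"
  shows "(\<lambda>j. \<integral>x. w x \<bullet> s j x \<partial>lborel) \<longlonglongrightarrow> (\<integral>x. w x \<bullet> g x \<partial>mu)"
proof -
  have cw: "continuous_on UNIV (\<lambda>x. w x $ l)" for l using w by (rule continuous_on_component)
  have wb: "(\<lambda>x. w x $ l) \<in> borel_measurable borel" for l by (rule borel_measurable_continuous_onI[OF cw])
  have "compact (w ` cball 0 R)" by (intro compact_continuous_image continuous_on_subset[OF w]) auto
  from compact_imp_bounded[OF this, unfolded bounded_iff]
  obtain B where "\<forall>y\<in>w ` cball 0 R. norm y \<le> B" ..
  then have B: "\<bar>w x $ l\<bar> \<le> B" if "norm x \<le> R" for x l
    using that component_le_norm_cart[of "w x" l] by (simp add: order_trans)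
  have ils: "integrable lborel (\<lambda>x. w x $ l * s j x $ l)" for j l
  proof (rule integrable_bounded_mult[OF s_comp])
    show "(\<lambda>x. w x $ l) \<in> borel_measurable lborel" using wb by simp
    show "AE x in lborel. s j x $ l \<noteq> 0 \<longrightarrow> \<bar>w x $ l\<bar> \<le> B"
    proof (intro AE_I2 impI)
      fix x assume "s j x $ l \<noteq> 0"
      then have "s j x \<noteq> 0" by auto
      then show "\<bar>w x $ l\<bar> \<le> B" by (intro B supps)
    qed
  qed
  have ig: "integrable mu (\<lambda>x. w x $ l * g x $ l)" for l
  proof (rule integrable_bounded_mult[OF g_comp])
    show "(\<lambda>x. w x $ l) \<in> borel_measurable mu" using wb smu by (simp cong: measurable_cong_sets)
    show "AE x in mu. g x $ l \<noteq> 0 \<longrightarrow> \<bar>w x $ l\<bar> \<le> B"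
      using suppmu by eventually_elim (simp add: B)
  qed
  have "(\<integral>x. w x \<bullet> s j x \<partial>lborel) = (\<integral>x. w x $ 1 * s j x $ 1 \<partial>lborel) + (\<integral>x. w x $ 2 * s j x $ 2 \<partial>lborel)" for j
    using Bochner_Integration.integral_add[OF ils[of 1 j] ils[of 2 j]] by (simp add: inner_vec_def sum_2)
  moreover have "(\<integral>x. w x \<bullet> g x \<partial>mu) = (\<integral>x. w x $ 1 * g x $ 1 \<partial>mu) + (\<integral>x. w x $ 2 * g x $ 2 \<partial>mu)"
    using Bochner_Integration.integral_add[OF ig[of 1] ig[of 2]] by (simp add: inner_vec_def sum_2)
  ultimately show ?thesis by (simp only:) (intro tendsto_add lims cw)
qed

lemma limit_divergence:
  assumes f: "test_fn UNIV f"
  shows "- (\<integral>x. grad f x \<bullet> g x \<partial>mu) = real N * f (xs 0) - (\<Sum>i\<in>{1..N}. f (xs i))"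
proof (rule LIMSEQ_unique)
  have cf: "continuous_on UNIV f" using f smooth_continuous by (simp add: test_fn_def)
  show "(\<lambda>j. - (\<integral>x. grad f x \<bullet> s j x \<partial>lborel)) \<longlonglongrightarrow> - (\<integral>x. grad f x \<bullet> g x \<partial>mu)"
    by (intro tendsto_minus inner_limit test_fn_grad_continuous[OF f])
  show "(\<lambda>j. - (\<integral>x. grad f x \<bullet> s j x \<partial>lborel)) \<longlonglongrightarrow> real N * f (xs 0) - (\<Sum>i\<in>{1..N}. f (xs i))"
    using src_tendsto[OF \<rho> e cf] unfolding div[OF f] by (simp only: mult.commute)
qed

lemma norm_s_integral: "(\<integral>x. norm (s j x) \<partial>lborel) \<le> K"
proof -
  have "ennreal (\<integral>x. norm (s j x) \<partial>lborel) = (\<integral>\<^sup>+x. ennreal (norm (s j x)) \<partial>lborel)"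
    by (rule nn_integral_eq_integral[symmetric]) (use s in auto)
  also have "\<dots> \<le> ennreal K" by (rule mass)
  finally show ?thesis by (simp only: ennreal_le_iff[OF K])
qed

lemma measurable_mu: "f \<in> measurable borel M \<Longrightarrow> f \<in> measurable mu M"
  using smu by (simp cong: measurable_cong_sets)

lemma of_pt_mu: "of_pt i \<in> measurable mu borel"
  by (rule measurable_mu[OF measurable_of_pt])

lemma abs_sum_other: "\<bar>v $ i\<bar> + \<bar>v $ other i\<bar> = \<bar>v $ 1\<bar> + \<bar>v $ 2\<bar>" for v :: pt
  using exhaust_2[of i] by (auto simp: other_def)

text \<open>The coordinate \<open>i\<close> takes the role of \<open>t\<close>. The square root of
  \<open>e j\<close> in \<open>small\<close> becomes the decay rate, and 2 N is added to
  \<open>K\<close> to include the mass of the source.\<close>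

lemma slicing_direction:
  "slicing (\<lambda>j z. s j (to_pt i z) $ i) (\<lambda>j z. s j (to_pt i z) $ other i) (\<lambda>j z. src \<rho> N xs (e j) (to_pt i z))
    (\<lambda>j z. 1 + \<psi> j (to_pt i z)) (\<lambda>j z. grad (\<psi> j) (to_pt i z) $ other i) e (\<lambda>j. sqrt (e j)) (K + 2 * real N) R
    (distr mu borel (of_pt i)) (\<lambda>z. g (to_pt i z) $ i) (\<lambda>z. g (to_pt i z) $ other i) (\<lambda>z. gh (to_pt i z))"
proof (rule slicing.intro)
  have norm_comp: "\<bar>fst z\<bar> \<le> R \<and> \<bar>snd z\<bar> \<le> R" if "norm (to_pt i z) \<le> R" for z
    using component_le_norm_cart[of "to_pt i z" i] component_le_norm_cart[of "to_pt i z" "other i"] that by simp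
  have cont: "continuous_on UNIV (\<lambda>x. f (of_pt i x))" if "continuous_on UNIV f" for f :: "real \<times> real \<Rightarrow> real"
    by (rule continuous_on_compose2[OF that continuous_of_pt]) simp
  have transport: "(\<integral>z. f z * q (to_pt i z) \<partial>lborel) = (\<integral>x. f (of_pt i x) * q x \<partial>lborel)"
    if f: "continuous_on UNIV f" and q: "q \<in> borel_measurable borel" for f and q :: "pt \<Rightarrow> real"
  proof -
    have [measurable]: "(\<lambda>x. f (of_pt i x)) \<in> borel_measurable borel" "q \<in> borel_measurable borel"
      by (rule borel_measurable_continuous_onI[OF cont[OF f]], rule q)
    have "(\<lambda>x. f (of_pt i x) * q x) \<in> borel_measurable borel" by measurable
    from integral_to_pt(2)[OF this, of i] show ?thesis by simp
  qed
  have transport_mu: "(\<integral>z. f z * q (to_pt i z) \<partial>distr mu borel (of_pt i)) = (\<integral>x. f (of_pt i x) * q x \<partial>mu)"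
    if f: "continuous_on UNIV f" and q: "q \<in> borel_measurable borel" for f and q :: "pt \<Rightarrow> real"
  proof -
    have [measurable]: "f \<in> borel_measurable borel" "q \<in> borel_measurable borel"
      by (rule borel_measurable_continuous_onI[OF f], rule q)
    have "(\<lambda>z. f z * q (to_pt i z)) \<in> borel_measurable borel" by measurable
    from integral_distr[OF of_pt_mu this] show ?thesis by simp
  qed
  have int_mu: "integrable (distr mu borel (of_pt i)) (\<lambda>z. q (to_pt i z))"
    if q: "q \<in> borel_measurable borel" "integrable mu q" for q :: "pt \<Rightarrow> real"
  proof -
    have "(\<lambda>z. q (to_pt i z)) \<in> borel_measurable borel" by (rule measurable_compose[OF measurable_to_pt q(1)])
    from integrable_distr_eq[OF of_pt_mu this] show ?thesis using q(2) by simp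
  qed
  interpret fm: finite_measure mu by (rule fmu)
  fix j
  show "0 < R" by (rule R)
  show "0 \<le> K + 2 * real N" using K by simp
  show "integrable lborel (\<lambda>z. s j (to_pt i z) $ i)" "integrable lborel (\<lambda>z. s j (to_pt i z) $ other i)"
    "integrable lborel (\<lambda>z. src \<rho> N xs (e j) (to_pt i z))"
    by (rule integral_to_pt(1)[OF s_comp], rule integral_to_pt(1)[OF s_comp], rule integral_to_pt(1)[OF src_mass(1)[OF \<rho> e(1)]])
  show "\<bar>fst z\<bar> \<le> R \<and> \<bar>snd z\<bar> \<le> R" if "s j (to_pt i z) $ i \<noteq> 0" for z
    by (rule norm_comp, rule supps[of j]) (use that in auto)
  show "\<bar>fst z\<bar> \<le> R \<and> \<bar>snd z\<bar> \<le> R" if "s j (to_pt i z) $ other i \<noteq> 0" for z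
    by (rule norm_comp, rule supps[of j]) (use that in auto)
  show "\<bar>fst z\<bar> \<le> R \<and> \<bar>snd z\<bar> \<le> R" if "src \<rho> N xs (e j) (to_pt i z) \<noteq> 0" for z
    by (rule norm_comp, rule supph[OF that])
  show "(\<integral>z. \<bar>s j (to_pt i z) $ other i\<bar> + \<bar>src \<rho> N xs (e j) (to_pt i z)\<bar> \<partial>lborel) \<le> K + 2 * real N"
  proof -
    have "(\<integral>z. \<bar>s j (to_pt i z) $ other i\<bar> + \<bar>src \<rho> N xs (e j) (to_pt i z)\<bar> \<partial>lborel) = (\<integral>x. \<bar>s j x $ other i\<bar> + \<bar>src \<rho> N xs (e j) x\<bar> \<partial>lborel)"
      by (rule integral_to_pt(2)[of "\<lambda>x. \<bar>s j x $ other i\<bar> + \<bar>src \<rho> N xs (e j) x\<bar>"]) measurable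
    also have "\<dots> = (\<integral>x. \<bar>s j x $ other i\<bar> \<partial>lborel) + (\<integral>x. \<bar>src \<rho> N xs (e j) x\<bar> \<partial>lborel)"
      by (intro Bochner_Integration.integral_add integrable_abs s_comp src_mass \<rho> e)
    also have "(\<integral>x. \<bar>s j x $ other i\<bar> \<partial>lborel) \<le> (\<integral>x. norm (s j x) \<partial>lborel)"
      by (intro integral_mono integrable_abs s_comp integrable_norm s component_le_norm_cart)
    also have "\<dots> \<le> K" by (rule norm_s_integral)
    finally show ?thesis using src_mass(2)[OF \<rho> e(1)[of j], of N xs] by simp
  qed
  show "(\<integral>z. s j (to_pt i z) $ i * (deriv \<beta> (fst z) * f (snd z)) + s j (to_pt i z) $ other i * (\<beta> (fst z) * deriv f (snd z))
         + src \<rho> N xs (e j) (to_pt i z) * (\<beta> (fst z) * f (snd z)) \<partial>lborel) = 0" if "C1_fun \<beta>" "C1_fun f" for \<beta> f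
    by (rule divergence_product[OF \<rho> s src_mass(1)[OF \<rho> e(1)] div supps supph that])
  show "finite_measure (distr mu borel (of_pt i))" by (rule fm.finite_measure_distr[OF of_pt_mu])
  show "sets (distr mu borel (of_pt i)) = sets borel" by simp
  show "AE z in distr mu borel (of_pt i). \<bar>fst z\<bar> \<le> R \<and> \<bar>snd z\<bar> \<le> R"
  proof (subst AE_distr_iff[OF of_pt_mu])
    show "{z \<in> space borel. \<bar>fst z\<bar> \<le> R \<and> \<bar>snd z\<bar> \<le> R} \<in> sets borel" by measurable
    show "AE x in mu. \<bar>fst (of_pt i x)\<bar> \<le> R \<and> \<bar>snd (of_pt i x)\<bar> \<le> R"
      using suppmu by eventually_elim (rule norm_comp, simp)
  qed
  show "integrable (distr mu borel (of_pt i)) (\<lambda>z. g (to_pt i z) $ i)"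
    "integrable (distr mu borel (of_pt i)) (\<lambda>z. g (to_pt i z) $ other i)"
    "integrable (distr mu borel (of_pt i)) (\<lambda>z. gh (to_pt i z))"
    by (rule int_mu[OF g_comp_borel g_comp], rule int_mu[OF g_comp_borel g_comp], rule int_mu[OF gh_borel gh])
  fix f :: "real \<times> real \<Rightarrow> real" assume f: "continuous_on UNIV f"
  show "(\<lambda>j. \<integral>z. f z * s j (to_pt i z) $ i \<partial>lborel) \<longlonglongrightarrow> (\<integral>z. f z * g (to_pt i z) $ i \<partial>distr mu borel (of_pt i))"
    unfolding transport[OF f s_comp_borel] transport_mu[OF f g_comp_borel] by (rule lims[OF cont[OF f]])
  show "(\<lambda>j. \<integral>z. f z * s j (to_pt i z) $ other i \<partial>lborel) \<longlonglongrightarrow> (\<integral>z. f z * g (to_pt i z) $ other i \<partial>distr mu borel (of_pt i))"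
    unfolding transport[OF f s_comp_borel] transport_mu[OF f g_comp_borel] by (rule lims[OF cont[OF f]])
  show "(\<lambda>j. \<integral>z. f z * src \<rho> N xs (e j) (to_pt i z) \<partial>lborel) \<longlonglongrightarrow> (\<integral>z. f z * gh (to_pt i z) \<partial>distr mu borel (of_pt i))"
    unfolding transport[OF f src_borel] transport_mu[OF f gh_borel] by (rule limh[OF cont[OF f]])
  show "(\<lambda>j. \<integral>z. f z * (\<bar>s j (to_pt i z) $ i\<bar> + \<bar>s j (to_pt i z) $ other i\<bar> + \<bar>src \<rho> N xs (e j) (to_pt i z)\<bar>) \<partial>lborel)
    \<longlonglongrightarrow> (\<integral>z. f z \<partial>distr mu borel (of_pt i))"
  proof -
    have m: "(\<lambda>x. \<bar>s j x $ 1\<bar> + \<bar>s j x $ 2\<bar> + \<bar>src \<rho> N xs (e j) x\<bar>) \<in> borel_measurable borel" for j by measurable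
    have "(\<integral>z. f z \<partial>distr mu borel (of_pt i)) = (\<integral>x. f (of_pt i x) \<partial>mu)"
      by (rule integral_distr[OF of_pt_mu borel_measurable_continuous_onI[OF f]])
    then show ?thesis
      unfolding abs_sum_other transport[OF f m] by (simp only:) (rule limabs[OF cont[OF f]])
  qed
next
  fix j
  define p where "p t = to_pt i (t, 0)" for t
  have line: "to_pt i (t, y) = p t + y *\<^sub>R axis (other i) 1" for t y
    by (simp add: pt_eq_iff_other[of _ _ i] axis_def p_def)
  show "((\<lambda>y. 1 + \<psi> j (to_pt i (t, y))) has_real_derivative grad (\<psi> j) (to_pt i (t, y)) $ other i) (at y)" for t y
  proof -
    have "((\<lambda>y. to_pt i (t, y)) has_derivative (\<lambda>v. v *\<^sub>R axis (other i) 1)) (at y)"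
      unfolding line[of t] by (auto intro!: derivative_eq_intros)
    moreover have "(\<psi> j has_derivative (\<lambda>v. grad (\<psi> j) (to_pt i (t, y)) \<bullet> v)) (at (to_pt i (t, y)))"
      using psi_C1[of j] by (simp add: C1_grad_def)
    ultimately have "((\<lambda>y. \<psi> j (to_pt i (t, y))) has_derivative (\<lambda>v. grad (\<psi> j) (to_pt i (t, y)) \<bullet> (v *\<^sub>R axis (other i) 1))) (at y)"
      by (rule has_derivative_compose)
    moreover have "(\<lambda>v. grad (\<psi> j) (to_pt i (t, y)) \<bullet> (v *\<^sub>R axis (other i) 1)) = (\<lambda>v. (grad (\<psi> j) (to_pt i (t, y)) $ other i) * v)"
      by (simp add: fun_eq_iff inner_axis)
    ultimately have "((\<lambda>y. \<psi> j (to_pt i (t, y))) has_real_derivative grad (\<psi> j) (to_pt i (t, y)) $ other i) (at y)"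
      by (simp add: has_field_derivative_def)
    from DERIV_add[OF DERIV_const this] show ?thesis by simp
  qed
  show "continuous_on UNIV (\<lambda>y. grad (\<psi> j) (to_pt i (t, y)) $ other i)" for t
  proof (rule continuous_on_component, rule continuous_on_compose2[OF test_fn_grad_continuous[OF test]])
    show "continuous_on UNIV (\<lambda>y. to_pt i (t, y))" unfolding line[of t] by (intro continuous_intros)
  qed simp
  show "(\<lambda>z. 1 + \<psi> j (to_pt i z)) \<in> borel_measurable borel"
    using measurable_compose[OF measurable_to_pt psi_borel] by measurable
  show "(\<lambda>z. grad (\<psi> j) (to_pt i z) $ other i) \<in> borel_measurable borel"
    by (rule measurable_compose[OF measurable_to_pt grad_psi_borel])
  show "0 < e j" "e \<longlonglongrightarrow> 0" "0 < sqrt (e j)" using e by simp_all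
  show "(\<lambda>j. sqrt (e j)) \<longlonglongrightarrow> 0" using tendsto_real_sqrt[OF e(2)] by simp
  have K': "ennreal K \<le> ennreal (K + 2 * real N)" by (rule ennreal_leI) simp
  show "(\<integral>\<^sup>+z. ennreal (e j / 2 * (grad (\<psi> j) (to_pt i z) $ other i)\<^sup>2 + (1 - (1 + \<psi> j (to_pt i z)))\<^sup>2 / (2 * e j)) \<partial>lborel) \<le> ennreal (K + 2 * real N)"
  proof -
    have "(\<integral>\<^sup>+z. ennreal (e j / 2 * (grad (\<psi> j) (to_pt i z) $ other i)\<^sup>2 + (1 - (1 + \<psi> j (to_pt i z)))\<^sup>2 / (2 * e j)) \<partial>lborel)
      = (\<integral>\<^sup>+x. ennreal (e j / 2 * (grad (\<psi> j) x $ other i)\<^sup>2 + (1 - (1 + \<psi> j x))\<^sup>2 / (2 * e j)) \<partial>lborel)"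
      by (rule nn_integral_to_pt[of "\<lambda>x. ennreal (e j / 2 * (grad (\<psi> j) x $ other i)\<^sup>2 + (1 - (1 + \<psi> j x))\<^sup>2 / (2 * e j))"]) measurable
    also have "\<dots> \<le> (\<integral>\<^sup>+x. ennreal (e j / 2 * (norm (grad (\<psi> j) x))\<^sup>2 + (\<psi> j x)\<^sup>2 / (2 * e j)) \<partial>lborel)"
    proof (intro nn_integral_mono ennreal_leI add_mono mult_left_mono)
      fix x
      show "(grad (\<psi> j) x $ other i)\<^sup>2 \<le> (norm (grad (\<psi> j) x))\<^sup>2"
        using component_le_norm_cart[of "grad (\<psi> j) x" "other i"] by (rule abs_le_square_iff[THEN iffD1, OF order_trans]) simp
      show "0 \<le> e j / 2" using e(1)[of j] by simp
    qed simp
    finally show ?thesis using energy[of j] K' by (meson order_trans)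
  qed
  have comp: "ennreal \<bar>s j x $ i\<bar> \<le> ennreal (norm (s j x))" for x by (intro ennreal_leI component_le_norm_cart)
  show "(\<integral>\<^sup>+z. ennreal \<bar>s j (to_pt i z) $ i\<bar> \<partial>lborel) \<le> ennreal (K + 2 * real N)"
  proof -
    have "(\<integral>\<^sup>+z. ennreal \<bar>s j (to_pt i z) $ i\<bar> \<partial>lborel) = (\<integral>\<^sup>+x. ennreal \<bar>s j x $ i\<bar> \<partial>lborel)"
      by (rule nn_integral_to_pt[of "\<lambda>x. ennreal \<bar>s j x $ i\<bar>"]) measurable
    also have "\<dots> \<le> (\<integral>\<^sup>+x. ennreal (norm (s j x)) \<partial>lborel)" by (intro nn_integral_mono comp)
    finally show ?thesis using mass[of j] K' by (meson order_trans)
  qed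
  show "(\<integral>\<^sup>+z. ennreal (\<bar>s j (to_pt i z) $ i\<bar> / sqrt (e j)) * indicator {z. 3/4 \<le> 1 + \<psi> j (to_pt i z)} z \<partial>lborel) \<le> ennreal (K + 2 * real N)"
  proof -
    define r where "r = sqrt (e j)"
    have r: "0 < r" using e(1)[of j] by (simp add: r_def)
    have "(\<integral>\<^sup>+z. ennreal (\<bar>s j (to_pt i z) $ i\<bar> / r) * indicator {z. 3/4 \<le> 1 + \<psi> j (to_pt i z)} z \<partial>lborel)
      = (\<integral>\<^sup>+z. (\<lambda>x. ennreal (\<bar>s j x $ i\<bar> / r) * indicator {x. 3/4 \<le> 1 + \<psi> j x} x) (to_pt i z) \<partial>lborel)"
      by (intro nn_integral_cong) (simp split: split_indicator)
    also have "\<dots> = (\<integral>\<^sup>+x. ennreal (\<bar>s j x $ i\<bar> / r) * indicator {x. 3/4 \<le> 1 + \<psi> j x} x \<partial>lborel)"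
      by (rule nn_integral_to_pt) measurable
    also have "\<dots> \<le> (\<integral>\<^sup>+x. ennreal (1 / r) * (ennreal (norm (s j x)) * indicator {x. 3/4 \<le> 1 + \<psi> j x} x) \<partial>lborel)"
    proof (rule nn_integral_mono)
      fix x
      have "ennreal (\<bar>s j x $ i\<bar> / r) = ennreal (1 / r) * ennreal \<bar>s j x $ i\<bar>" using r by (simp flip: ennreal_mult)
      also have "\<dots> \<le> ennreal (1 / r) * ennreal (norm (s j x))" by (intro mult_left_mono comp) simp
      finally show "ennreal (\<bar>s j x $ i\<bar> / r) * indicator {x. 3/4 \<le> 1 + \<psi> j x} x \<le> ennreal (1 / r) * (ennreal (norm (s j x)) * indicator {x. 3/4 \<le> 1 + \<psi> j x} x)"
        by (auto split: split_indicator)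
    qed
    also have "\<dots> = ennreal (1 / r) * (\<integral>\<^sup>+x. ennreal (norm (s j x)) * indicator {x. 3/4 \<le> 1 + \<psi> j x} x \<partial>lborel)"
      by (rule nn_integral_cmult) measurable
    also have "\<dots> \<le> ennreal (1 / r) * ennreal (r * K)" unfolding r_def by (intro mult_left_mono small) simp
    also have "\<dots> = ennreal K" using r K by (simp flip: ennreal_mult)
    finally show ?thesis using K' unfolding r_def by (meson order_trans)
  qed
qed

text \<open>An \<open>H1\<close>-null set has a null projection to coordinate \<open>i\<close>, so
  almost every line misses the part of \<open>A\<close> on the curves, which is the form in which
  slicing needs the hypothesis.\<close>

lemma concentration_component:
  "\<exists>F :: nat \<Rightarrow> real \<Rightarrow> pt. (\<forall>k. \<exists>L. L-lipschitz_on UNIV (F k)) \<and>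
    (\<forall>A\<in>sets borel. H1 (A \<inter> (\<Union>k. range (F k))) = 0 \<longrightarrow> (AE x in mu. x \<in> A \<longrightarrow> g x $ i = 0))"
proof -
  from slicing.concentrated_on_curves[OF slicing_direction[of i]]
  obtain F :: "nat \<Rightarrow> real \<Rightarrow> real \<times> real" where
    FL: "\<forall>k. \<exists>L. L-lipschitz_on UNIV (F k)" and
    F: "\<forall>A\<in>sets borel. (AE t in lborel. \<forall>y. (t, y) \<notin> A \<inter> (\<Union>k. range (F k))) \<longrightarrow>
      (AE z in distr mu borel (of_pt i). z \<in> A \<longrightarrow> g (to_pt i z) $ i = 0)"
    by (elim exE conjE) (rule that)
  show ?thesis
  proof (intro exI[of _ "\<lambda>k t. to_pt i (F k t)"] conjI allI ballI impI)
    fix k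
    obtain L where "L-lipschitz_on UNIV (F k)" using spec[OF FL, of k] ..
    then have "L-lipschitz_on UNIV (\<lambda>t. to_pt i (F k t))"
      by (simp add: lipschitz_on_def dist_norm norm_to_pt)
    then show "\<exists>L. L-lipschitz_on UNIV (\<lambda>t. to_pt i (F k t))" ..
  next
    fix A assume A: "A \<in> sets borel" and null: "H1 (A \<inter> (\<Union>k. range (\<lambda>t. to_pt i (F k t)))) = 0"
    define A' where "A' = to_pt i -` A"
    have A': "A' \<in> sets borel" using measurable_sets[OF measurable_to_pt A, of i] by (simp add: A'_def)
    obtain Z where Z: "Z \<in> null_sets lborel" "(\<lambda>x. x $ i) ` (A \<inter> (\<Union>k. range (\<lambda>t. to_pt i (F k t)))) \<subseteq> Z"
      using H1_null_projection[OF null] by blast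
    have "AE t in lborel. \<forall>y. (t, y) \<notin> A' \<inter> (\<Union>k. range (F k))"
    proof (rule AE_I'[OF Z(1)], rule subsetI, rule ccontr)
      fix t assume t: "t \<in> {t \<in> space lborel. \<not> (\<forall>y. (t, y) \<notin> A' \<inter> (\<Union>k. range (F k)))}" and n: "t \<notin> Z"
      from t obtain y k u where y: "(t, y) \<in> A'" "(t, y) = F k u" by blast
      have "to_pt i (t, y) \<in> A \<inter> (\<Union>k. range (\<lambda>t. to_pt i (F k t)))" using y by (auto simp: A'_def)
      then have "to_pt i (t, y) $ i \<in> Z" by (intro subsetD[OF Z(2)] imageI)
      then show False using n by simp
    qed
    from bspec[OF F A', rule_format, OF this] have "AE z in distr mu borel (of_pt i). z \<in> A' \<longrightarrow> g (to_pt i z) $ i = 0" .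
    from AE_distrD[OF of_pt_mu this] show "AE x in mu. x \<in> A \<longrightarrow> g x $ i = 0" by (simp add: A'_def)
  qed
qed

text \<open>The curves of the two directions are interleaved into one sequence; a set that meets
  their union in an \<open>H1\<close>-null set does so with each family, and both components vanish
  on it.\<close>

lemma rectifiable_limit: "\<exists>M \<theta> \<xi>. is_U (mu, g) M \<theta> \<xi>"
proof -
  from concentration_component[of 1] obtain F :: "nat \<Rightarrow> real \<Rightarrow> pt" where FL: "\<forall>k. \<exists>L. L-lipschitz_on UNIV (F k)"
    and F: "\<forall>A\<in>sets borel. H1 (A \<inter> (\<Union>k. range (F k))) = 0 \<longrightarrow> (AE x in mu. x \<in> A \<longrightarrow> g x $ 1 = 0)"
    by (elim exE conjE) (rule that)
  from concentration_component[of 2] obtain G :: "nat \<Rightarrow> real \<Rightarrow> pt" where GL: "\<forall>k. \<exists>L. L-lipschitz_on UNIV (G k)"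
    and G: "\<forall>A\<in>sets borel. H1 (A \<inter> (\<Union>k. range (G k))) = 0 \<longrightarrow> (AE x in mu. x \<in> A \<longrightarrow> g x $ 2 = 0)"
    by (elim exE conjE) (rule that)
  define f where "f k = (if even k then F (k div 2) else G (k div 2))" for k :: nat
  show ?thesis
  proof (rule is_U_if_absolutely_continuous[OF fmu smu g, of f])
    show "\<exists>L. L-lipschitz_on UNIV (f k)" for k using FL GL by (simp add: f_def)
    fix A assume A: "A \<in> sets borel" and null: "H1 (A \<inter> (\<Union>k. range (f k))) = 0"
    have "range (F k) \<subseteq> range (f (2 * k))" for k by (simp add: f_def)
    then have "(\<Union>k. range (F k)) \<subseteq> (\<Union>k. range (f k))" by blast
    then have "H1 (A \<inter> (\<Union>k. range (F k))) \<le> 0" unfolding null[symmetric] by (intro H1_mono) blast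
    then have 1: "AE x in mu. x \<in> A \<longrightarrow> g x $ 1 = 0" using bspec[OF F A] by simp
    have "range (G k) \<subseteq> range (f (2 * k + 1))" for k by (simp add: f_def)
    then have "(\<Union>k. range (G k)) \<subseteq> (\<Union>k. range (f k))" by blast
    then have "H1 (A \<inter> (\<Union>k. range (G k))) \<le> 0" unfolding null[symmetric] by (intro H1_mono) blast
    then have 2: "AE x in mu. x \<in> A \<longrightarrow> g x $ 2 = 0" using bspec[OF G A] by simp
    show "AE x in mu. x \<in> A \<longrightarrow> g x = 0"
      using 1 2 by eventually_elim (simp add: vec_eq_iff forall_2)
  qed
qed

end

section \<open>From bounded energy to convergent densities\<close>

text \<open>One predicate collects everything the energy yields at a single \<epsilon>, so that the
  field and its smooth companion can be chosen at once for the whole sequence.\<close>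

definition reduced_fields :: "pt set \<Rightarrow> (pt \<Rightarrow> real) \<Rightarrow> nat \<Rightarrow> (nat \<Rightarrow> pt) \<Rightarrow> real \<Rightarrow> real \<Rightarrow> real \<Rightarrow>
    vmeas \<Rightarrow> (pt \<Rightarrow> real) \<Rightarrow> (pt \<Rightarrow> pt) \<Rightarrow> (pt \<Rightarrow> real) \<Rightarrow> bool" where
  "reduced_fields \<Omega> \<rho> N xs a C \<epsilon> \<sigma> \<phi> s \<psi> \<longleftrightarrow> integrable lborel s \<and> (\<forall>x. s x \<noteq> 0 \<longrightarrow> x \<in> \<Omega>) \<and>
    (\<integral>\<^sup>+x. ennreal (norm (s x)) \<partial>lborel) \<le> ennreal ((1 / a\<^sup>2 + 4) * C + measure lborel \<Omega>) \<and>
    test_fn \<Omega> \<psi> \<and>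
    (\<integral>\<^sup>+x. ennreal (\<epsilon> / 2 * (norm (grad \<psi> x))\<^sup>2 + (\<psi> x)\<^sup>2 / (2 * \<epsilon>)) \<partial>lborel) \<le> ennreal (2 * C + 2) \<and>
    (\<integral>\<^sup>+x. ennreal (norm (s x)) * indicator {x. 3/4 \<le> 1 + \<psi> x} x \<partial>lborel) \<le> ennreal (sqrt \<epsilon> * (4 * C + measure lborel \<Omega> + 9)) \<and>
    (\<forall>f. test_fn UNIV f \<longrightarrow> - (\<integral>x. grad f x \<bullet> s x \<partial>lborel) = (\<integral>x. src \<rho> N xs \<epsilon> x * f x \<partial>lborel)) \<and>
    (\<forall>A f B. A \<in> sets borel \<longrightarrow> f \<in> borel_measurable borel \<longrightarrow> (\<forall>x\<in>A. norm (f x) \<le> B) \<longrightarrow>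
      vm_int \<sigma> A f = (\<integral>x. indicator A x * (f x \<bullet> s x) \<partial>lborel)) \<and>
    \<bar>set_lebesgue_integral lborel \<Omega> (\<lambda>x. \<bar>\<phi> x - 1\<bar>)\<bar> \<le> sqrt \<epsilon> * (C + measure lborel \<Omega>)"

lemma energy_fields:
  assumes \<Omega>: "open \<Omega>" "bounded \<Omega>" and eps: "0 < \<epsilon>" "\<epsilon> \<le> 1" and a: "0 < a" "a * \<epsilon> \<le> \<eta>" and C: "0 \<le> C"
    and F: "Feps \<rho> N xs \<Omega> \<eta> \<epsilon> \<sigma> \<phi> \<le> ennreal C"
  shows "\<exists>s \<psi>. reduced_fields \<Omega> \<rho> N xs a C \<epsilon> \<sigma> \<phi> s \<psi>"
proof -
  have VW: "in_V \<rho> N xs \<Omega> \<epsilon> \<sigma>" "in_W \<Omega> \<eta> \<phi>"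
    using F by (auto simp: Feps_def top_unique split: if_splits)
  have vm: "is_vmeasure \<sigma>" and ex: "\<exists>s. L2_on \<Omega> s \<and> vm_density_on \<sigma> \<Omega> s"
    and divV: "\<And>f. test_fn UNIV f \<Longrightarrow> - vm_int \<sigma> UNIV (grad f) = (\<integral>y. src \<rho> N xs \<epsilon> y * f y \<partial>lborel)"
    using VW(1) by (simp_all add: in_V_def)
  have D: "L2_on \<Omega> (dens \<sigma> \<Omega>)" "vm_density_on \<sigma> \<Omega> (dens \<sigma> \<Omega>)"
    using someI_ex[OF ex] by (simp_all add: dens_def)
  interpret E: energy_bound \<Omega> \<eta> \<epsilon> a C "dens \<sigma> \<Omega>" \<phi>
    by (rule energy_bound.intro[OF \<Omega> eps a C VW(2) D(1)]) (use F VW in \<open>simp add: Feps_def\<close>)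
  obtain \<psi> where \<psi>: "test_fn \<Omega> \<psi>"
    "(\<integral>\<^sup>+x. ennreal (\<epsilon> / 2 * (norm (grad \<psi> x))\<^sup>2 + (\<psi> x)\<^sup>2 / (2 * \<epsilon>)) \<partial>lborel) \<le> ennreal (2 * C + 2)"
    "(\<integral>\<^sup>+x. ennreal (norm (E.s0 x)) * indicator {x. 3/4 \<le> 1 + \<psi> x} x \<partial>lborel) \<le> ennreal (sqrt \<epsilon> * (4 * C + E.vol + 9))"
    by (rule E.smooth_approximant) (rule that)
  have s: "integrable lborel (\<lambda>x. indicator \<Omega> x *\<^sub>R dens \<sigma> \<Omega> x)"
    by (rule L2_on_integrable[OF D(1) E.Omega_borel E.Omega_finite])
  have V: "vm_int \<sigma> A f = (\<integral>x. indicator A x * (f x \<bullet> E.s0 x) \<partial>lborel)"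
    if "A \<in> sets borel" "f \<in> borel_measurable borel" "\<And>x. x \<in> A \<Longrightarrow> norm (f x) \<le> B" for A f B
    unfolding E.s0_def by (rule vm_int_density[OF vm D(2) s that])
  show ?thesis
    unfolding reduced_fields_def
  proof (rule exI[of _ E.s0], rule exI[of _ \<psi>], intro conjI allI impI)
    show "integrable lborel E.s0" using s by (simp add: E.s0_def[abs_def])
    show "x \<in> \<Omega>" if "E.s0 x \<noteq> 0" for x using that by (auto simp: E.s0_def split: split_indicator_asm)
    show "(\<integral>\<^sup>+x. ennreal (norm (E.s0 x)) \<partial>lborel) \<le> ennreal ((1 / a\<^sup>2 + 4) * C + measure lborel \<Omega>)"
      using E.mass_bound by (simp only: E.vol_def)
    show "(\<integral>\<^sup>+x. ennreal (norm (E.s0 x)) * indicator {x. 3/4 \<le> 1 + \<psi> x} x \<partial>lborel) \<le> ennreal (sqrt \<epsilon> * (4 * C + measure lborel \<Omega> + 9))"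
      using \<psi>(3) by (simp only: E.vol_def)
    fix f assume f: "test_fn UNIV f"
    obtain B where B: "\<forall>x. norm (grad f x) \<le> B" using test_fn_grad_bounded[OF f] ..
    have "vm_int \<sigma> UNIV (grad f) = (\<integral>x. indicator UNIV x * (grad f x \<bullet> E.s0 x) \<partial>lborel)"
      by (rule V[of _ _ B]) (use B in \<open>auto intro!: borel_measurable_continuous_onI test_fn_grad_continuous[OF f]\<close>)
    then show "- (\<integral>x. grad f x \<bullet> E.s0 x \<partial>lborel) = (\<integral>x. src \<rho> N xs \<epsilon> x * f x \<partial>lborel)"
      using divV[OF f] by simp
  next
    show "vm_int \<sigma> A f = (\<integral>x. indicator A x * (f x \<bullet> E.s0 x) \<partial>lborel)"
      if "A \<in> sets borel" "f \<in> borel_measurable borel" "\<forall>x\<in>A. norm (f x) \<le> B" for A f B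
      by (rule V[OF that(1,2)]) (rule bspec[OF that(3)])
    have m: "(\<lambda>x. indicator \<Omega> x * \<bar>\<phi> x - 1\<bar>) \<in> borel_measurable lborel"
    proof -
      have "(\<lambda>x. indicator \<Omega> x * \<bar>\<phi> x - 1\<bar>) = (\<lambda>x. \<bar>E.phi0 x - indicator \<Omega> x\<bar>)"
        by (auto simp: fun_eq_iff E.phi0_def split: split_indicator)
      then show ?thesis by simp
    qed
    have i: "set_lebesgue_integral lborel \<Omega> (\<lambda>x. \<bar>\<phi> x - 1\<bar>) = enn2real (\<integral>\<^sup>+x. ennreal (indicator \<Omega> x * \<bar>\<phi> x - 1\<bar>) \<partial>lborel)"
      unfolding set_lebesgue_integral_def real_scaleR_def by (rule integral_eq_nn_integral[OF m]) simp
    have "0 \<le> sqrt \<epsilon> * (C + E.vol)" using eps C E.vol_nonneg by simp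
    from enn2real_leI[OF this E.phase_to_one]
    show "\<bar>set_lebesgue_integral lborel \<Omega> (\<lambda>x. \<bar>\<phi> x - 1\<bar>)\<bar> \<le> sqrt \<epsilon> * (C + measure lborel \<Omega>)"
      unfolding i E.vol_def by simp
  qed (use \<psi> in auto)
qed

theorem theorem1p3:
  fixes \<Omega> :: "pt set" and N :: nat and xs :: "nat \<Rightarrow> pt" and \<rho> :: "pt \<Rightarrow> real"
    and \<eta> :: "real \<Rightarrow> real" and \<alpha> :: real
    and \<sigma> :: "real \<Rightarrow> vmeas" and \<phi> :: "real \<Rightarrow> pt \<Rightarrow> real"
  assumes "open \<Omega>" and "bounded \<Omega>" and "convex \<Omega>"
    and "N \<ge> 1" and "\<forall>i\<le>N. xs i \<in> \<Omega>" and "inj_on xs {0..N}"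
    and "mollifier \<rho>"
    and "\<forall>\<epsilon>\<in>{0<..1}. \<eta> \<epsilon> > 0"
    and "((\<lambda>\<epsilon>. \<eta> \<epsilon> / \<epsilon>) \<longlongrightarrow> \<alpha>) (at_right 0)" and "\<alpha> > 0"
    and "\<forall>\<epsilon>\<in>{0<..1}. is_vmeasure (\<sigma> \<epsilon>)"
    and "\<forall>\<epsilon>\<in>{0<..1}. set_integrable lborel \<Omega> (\<phi> \<epsilon>)"
    and "\<exists>C < \<infinity>. \<forall>\<epsilon>\<in>{0<..1}. Feps \<rho> N xs \<Omega> (\<eta> \<epsilon>) \<epsilon> (\<sigma> \<epsilon>) (\<phi> \<epsilon>) \<le> C"
  shows "\<exists>(e :: nat \<Rightarrow> real) \<sigma>0. (\<forall>j. e j \<in> {0<..1} \<and> e (Suc j) < e j) \<and> e \<longlonglongrightarrow> 0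
     \<and> in_MS \<Omega> N xs \<sigma>0
     \<and> weak_star_conv \<Omega> (\<lambda>j. \<sigma> (e j)) \<sigma>0
     \<and> (\<lambda>j. set_lebesgue_integral lborel \<Omega> (\<lambda>x. \<bar>\<phi> (e j) x - 1\<bar>)) \<longlonglongrightarrow> 0
     \<and> (\<exists>M \<theta> \<xi>. is_U \<sigma>0 M \<theta> \<xi>)"
proof -
  note \<Omega> = assms(1,2) and \<rho> = assms(7)
  obtain C where C: "0 \<le> C" "\<And>\<epsilon>. \<epsilon> \<in> {0<..1} \<Longrightarrow> Feps \<rho> N xs \<Omega> (\<eta> \<epsilon>) \<epsilon> (\<sigma> \<epsilon>) (\<phi> \<epsilon>) \<le> ennreal C"
  proof -
    obtain C' where C': "C' < \<infinity>" "\<forall>\<epsilon>\<in>{0<..1}. Feps \<rho> N xs \<Omega> (\<eta> \<epsilon>) \<epsilon> (\<sigma> \<epsilon>) (\<phi> \<epsilon>) \<le> C'" using assms(13) by blast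
    have "C' = ennreal (enn2real C')" using C'(1) by simp
    then show ?thesis using that[of "enn2real C'"] bspec[OF C'(2)] by simp
  qed
  \<comment> \<open>Any constant strictly between 0 and \<alpha> would do; the limit of
    \<eta>/\<epsilon> then gives \<eta> \<ge> a * \<epsilon> for all small \<epsilon>.\<close>
  define a where "a = \<alpha> / 2"
  have a0: "0 < a" "a < \<alpha>" using assms(10) by (simp_all add: a_def)
  obtain b where b: "0 < b" "\<And>\<epsilon>. 0 < \<epsilon> \<Longrightarrow> \<epsilon> < b \<Longrightarrow> a * \<epsilon> \<le> \<eta> \<epsilon>"
  proof -
    have "\<forall>\<^sub>F \<epsilon> in at_right 0. a < \<eta> \<epsilon> / \<epsilon>" using assms(9) a0(2) by (rule order_tendstoD(1))
    then obtain b where b: "0 < b" "\<forall>\<epsilon>>0. \<epsilon> < b \<longrightarrow> a < \<eta> \<epsilon> / \<epsilon>"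
      unfolding eventually_at_right[of 0 "1 :: real", OF zero_less_one] by blast
    have "a * \<epsilon> \<le> \<eta> \<epsilon>" if "0 < \<epsilon>" "\<epsilon> < b" for \<epsilon>
      using b(2)[rule_format, OF that] that(1) by (simp add: pos_less_divide_eq)
    then show ?thesis using that b(1) by blast
  qed
  \<comment> \<open>For \<epsilon> < d the mollified sources keep their support in \<Omega>, so that
    they fit into the compact set on which weak limits are taken.\<close>
  obtain d where d: "0 < d" "(\<Union>x\<in>xs ` {..N}. ball x d) \<subseteq> \<Omega>"
  proof (rule compact_subset_open_imp_ball_epsilon_subset[of "xs ` {..N}" \<Omega>])
    show "compact (xs ` {..N})" by (intro finite_imp_compact) simp
    show "xs ` {..N} \<subseteq> \<Omega>" using assms(5) by auto
  qed (rule \<Omega>(1), rule that)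
  obtain n0 :: nat where n0: "1 / real (Suc n0) < min b d"
    using nat_approx_posE[of "min b d"] b(1) d(1) by auto
  define e0 where "e0 n = 1 / real (Suc (n + n0))" for n
  have e0: "0 < e0 n" "e0 n \<le> 1" for n by (simp_all add: e0_def)
  have e0bd: "e0 n < b" "e0 n < d" for n
  proof -
    have "e0 n \<le> 1 / real (Suc n0)" unfolding e0_def by (intro divide_left_mono) simp_all
    then show "e0 n < b" "e0 n < d" using n0 by simp_all
  qed
  have e0_mem: "e0 n \<in> {0<..1}" for n using e0[of n] by simp
  have e0_dec: "e0 n < e0 m" if "m < n" for m n
    unfolding e0_def using that by (intro divide_strict_left_mono) simp_all
  have e0_lim: "e0 \<longlonglongrightarrow> 0"
    unfolding e0_def[abs_def] using LIMSEQ_ignore_initial_segment[OF LIMSEQ_Suc[OF lim_1_over_n], of n0] by simp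
  have ex: "\<exists>s\<psi>. reduced_fields \<Omega> \<rho> N xs a C (e0 n) (\<sigma> (e0 n)) (\<phi> (e0 n)) (fst s\<psi>) (snd s\<psi>)" for n
    using energy_fields[OF \<Omega> e0(1) e0(2) a0(1) b(2)[OF e0(1) e0bd(1)] C(1) C(2)[OF e0_mem], of n]
    unfolding split_paired_Ex fst_conv snd_conv .
  obtain SP where SP: "\<forall>n. reduced_fields \<Omega> \<rho> N xs a C (e0 n) (\<sigma> (e0 n)) (\<phi> (e0 n)) (fst (SP n)) (snd (SP n))"
    using choice[OF allI, OF ex] ..
  define S where "S n = fst (SP n)" for n
  define \<Psi> where "\<Psi> n = snd (SP n)" for n
  note P = SP[rule_format, unfolded reduced_fields_def, folded S_def \<Psi>_def]
  define vol where "vol = measure lborel \<Omega>"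
  have vol: "0 \<le> vol" by (simp add: vol_def)
  \<comment> \<open>The sum of three nonnegative bounds, so that it dominates each of them.\<close>
  define K where "K = (1 / a\<^sup>2 + 4) * C + vol + (2 * C + 2) + (4 * C + vol + 9)"
  have am: "0 \<le> (1 / a\<^sup>2 + 4) * C" using C(1) by simp
  have K: "0 \<le> K" using am vol C(1) by (simp add: K_def)
  have K3: "(1 / a\<^sup>2 + 4) * C + vol \<le> K" "2 * C + 2 \<le> K" "4 * C + vol + 9 \<le> K"
    unfolding K_def using am vol C(1) by argo+
  have S_int: "integrable lborel (S n)" and S_supp: "S n x \<noteq> 0 \<Longrightarrow> x \<in> \<Omega>" for n x using P[of n] by blast+
  have mass: "(\<integral>\<^sup>+x. ennreal (norm (S n x)) \<partial>lborel) \<le> ennreal K" for n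
    using P[of n] K3(1) unfolding vol_def by (meson ennreal_leI order_trans)
  have test: "test_fn \<Omega> (\<Psi> n)" for n using P[of n] by blast
  have energy: "(\<integral>\<^sup>+x. ennreal (e0 n / 2 * (norm (grad (\<Psi> n) x))\<^sup>2 + (\<Psi> n x)\<^sup>2 / (2 * e0 n)) \<partial>lborel) \<le> ennreal K" for n
    using P[of n] K3(2) by (meson ennreal_leI order_trans)
  have small: "(\<integral>\<^sup>+x. ennreal (norm (S n x)) * indicator {x. 3/4 \<le> 1 + \<Psi> n x} x \<partial>lborel) \<le> ennreal (sqrt (e0 n) * K)" for n
  proof -
    have "sqrt (e0 n) * (4 * C + vol + 9) \<le> sqrt (e0 n) * K" using K3(3) e0(1)[of n] by (intro mult_left_mono) simp_all
    then show ?thesis using P[of n] unfolding vol_def by (meson ennreal_leI order_trans)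
  qed
  have div: "- (\<integral>x. grad f x \<bullet> S n x \<partial>lborel) = (\<integral>x. src \<rho> N xs (e0 n) x * f x \<partial>lborel)" if "test_fn UNIV f" for f n
    using P[of n] that by blast
  have V: "vm_int (\<sigma> (e0 n)) A f = (\<integral>x. indicator A x * (f x \<bullet> S n x) \<partial>lborel)"
    if "A \<in> sets borel" "f \<in> borel_measurable borel" "\<forall>x\<in>A. norm (f x) \<le> B" for A f B n
    using P[of n] that by blast
  have L1: "\<bar>set_lebesgue_integral lborel \<Omega> (\<lambda>x. \<bar>\<phi> (e0 n) x - 1\<bar>)\<bar> \<le> sqrt (e0 n) * (C + vol)" for n
    unfolding vol_def using P[of n] by blast
  define H where "H n = src \<rho> N xs (e0 n)" for n
  have H_int: "integrable lborel (H n)" "(\<integral>x. \<bar>H n x\<bar> \<partial>lborel) \<le> 2 * real N" for n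
    unfolding H_def by (rule src_mass[OF \<rho> e0(1)])+
  have H_supp: "x \<in> \<Omega>" if nz: "H n x \<noteq> 0" for n x
  proof -
    obtain i where i: "i \<le> N" "norm (x - xs i) < e0 n"
      using src_support[OF \<rho> e0(1) nz[unfolded H_def]] by blast
    then have "x \<in> ball (xs i) d" using e0bd(2)[of n] by (simp add: dist_norm norm_minus_commute)
    then have "x \<in> (\<Union>x\<in>xs ` {..N}. ball x d)" using i(1) by blast
    then show ?thesis by (rule subsetD[OF d(2)])
  qed
  \<comment> \<open>Making the source a third scalar sequence gives all limits along one subsequence
    with one measure \<open>mu\<close>. Every index from 2 on repeats the source; only 0, 1 and 2
    are used.\<close>
  define A where "A i n x = (if i = 0 then S n x $ 1 else if i = 1 then S n x $ 2 else H n x)" for i n :: nat and x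
  have \<Omega>ne: "\<Omega> \<noteq> {}" using assms(5) by auto
  have sub: "\<Omega> \<subseteq> closure \<Omega>" by (rule closure_subset)
  have comp: "compact (closure \<Omega>)" using \<Omega>(2) by simp
  have conv: "convex (closure \<Omega>)" using assms(3) by (rule convex_closure)
  have A_int: "integrable lborel (A i n)" for i n
    unfolding A_def[abs_def] using integral_vec_component(1)[OF S_int] H_int(1)[of n] by (cases "i = 0"; cases "i = 1") simp_all
  have A_supp: "x \<in> closure \<Omega>" if "A i n x \<noteq> 0" for i n x
  proof (rule subsetD[OF sub])
    have "S n x \<noteq> 0 \<or> H n x \<noteq> 0" using that by (auto simp: A_def split: if_splits)
    then show "x \<in> \<Omega>" using S_supp H_supp by blast
  qed
  have S_mass: "(\<integral>x. norm (S n x) \<partial>lborel) \<le> K" for n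
  proof -
    have "ennreal (\<integral>x. norm (S n x) \<partial>lborel) = (\<integral>\<^sup>+x. ennreal (norm (S n x)) \<partial>lborel)"
      by (rule nn_integral_eq_integral[symmetric]) (use S_int in auto)
    also have "\<dots> \<le> ennreal K" by (rule mass)
    finally show ?thesis by (simp only: ennreal_le_iff[OF K])
  qed
  have A_bound: "(\<integral>x. \<bar>A i n x\<bar> \<partial>lborel) \<le> K + 2 * real N" for i n
  proof -
    have c: "(\<integral>x. \<bar>S n x $ l\<bar> \<partial>lborel) \<le> K + 2 * real N" for l
    proof -
      have "(\<integral>x. \<bar>S n x $ l\<bar> \<partial>lborel) \<le> (\<integral>x. norm (S n x) \<partial>lborel)"
        by (intro integral_mono integrable_abs integral_vec_component(1) integrable_norm S_int component_le_norm_cart)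
      then show ?thesis using S_mass[of n] by simp
    qed
    show ?thesis unfolding A_def using c H_int(2)[of n] K by (cases "i = 0"; cases "i = 1") simp_all
  qed
  obtain r mu g where r: "strict_mono (r :: nat \<Rightarrow> nat)" and fmu: "finite_measure mu" and smu: "sets mu = sets borel"
    and suppmu: "AE x in mu. x \<in> closure \<Omega>" and g_int: "\<And>i. i < 3 \<Longrightarrow> integrable mu (g i)"
    and lim: "\<And>f i. continuous_on UNIV f \<Longrightarrow> i < 3 \<Longrightarrow>
      (\<lambda>j. \<integral>x. f x * A i (r j) x \<partial>lborel) \<longlonglongrightarrow> (\<integral>x. f x * g i x \<partial>mu)"
    and limabs: "\<And>f. continuous_on UNIV f \<Longrightarrow>
      (\<lambda>j. \<integral>x. f x * (\<Sum>i<3. \<bar>A i (r j) x\<bar>) \<partial>lborel) \<longlonglongrightarrow> (\<integral>x. f x \<partial>mu)"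
  proof (rule weak_compactness_signed[of "closure \<Omega>" A "K + 2 * real N" 3, OF comp conv _ A_int A_supp A_bound])
    show "closure \<Omega> \<noteq> {}" using \<Omega>ne by simp
  qed (assumption, rule that)
  define gv :: "pt \<Rightarrow> pt" where "gv x = g 0 x *\<^sub>R axis 1 1 + g 1 x *\<^sub>R axis 2 1" for x
  have gv1: "gv x $ 1 = g 0 x" and gv2: "gv x $ 2 = g 1 x" for x by (simp_all add: gv_def axis_def)
  have gv_int: "integrable mu gv"
    unfolding gv_def[abs_def] by (intro Bochner_Integration.integrable_add integrable_scaleR_left g_int) simp_all
  define e where "e j = e0 (r j)" for j
  have e: "0 < e j" for j by (simp add: e_def e0)
  have e_lim: "e \<longlonglongrightarrow> 0" using LIMSEQ_subseq_LIMSEQ[OF e0_lim r] by (simp add: e_def[abs_def] o_def)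
  obtain R where R: "0 < R" "\<And>x. x \<in> closure \<Omega> \<Longrightarrow> norm x \<le> R"
    using compact_imp_bounded[OF comp] unfolding bounded_pos by blast
  interpret L: field_limit \<Omega> \<rho> N xs e "\<lambda>j. S (r j)" "\<lambda>j. \<Psi> (r j)" K R mu gv "g 2"
  proof (rule field_limit.intro)
    show "norm x \<le> R" if "S (r j) x \<noteq> 0" for j x by (intro R(2) subsetD[OF sub] S_supp[OF that])
    show "norm x \<le> R" if "src \<rho> N xs (e j) x \<noteq> 0" for j x
      by (intro R(2) subsetD[OF sub] H_supp[of "r j"]) (use that in \<open>simp add: H_def e_def\<close>)
    show "(\<lambda>j. \<integral>x. f x * S (r j) x $ l \<partial>lborel) \<longlonglongrightarrow> (\<integral>x. f x * gv x $ l \<partial>mu)" if "continuous_on UNIV f" for f l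
      using lim[OF that, of 0] lim[OF that, of 1] exhaust_2[of l] by (auto simp: A_def gv1 gv2)
    show "(\<lambda>j. \<integral>x. f x * src \<rho> N xs (e j) x \<partial>lborel) \<longlonglongrightarrow> (\<integral>x. f x * g 2 x \<partial>mu)" if "continuous_on UNIV f" for f
      using lim[OF that, of 2] by (simp add: A_def H_def e_def)
    show "(\<lambda>j. \<integral>x. f x * (\<bar>S (r j) x $ 1\<bar> + \<bar>S (r j) x $ 2\<bar> + \<bar>src \<rho> N xs (e j) x\<bar>) \<partial>lborel) \<longlonglongrightarrow> (\<integral>x. f x \<partial>mu)"
      if "continuous_on UNIV f" for f
      using limabs[OF that] by (simp add: A_def H_def e_def eval_nat_numeral)
    show "AE x in mu. norm x \<le> R" using suppmu by eventually_elim (rule R(2))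
    show "integrable mu (g 2)" by (rule g_int) simp
    show "- (\<integral>x. grad f x \<bullet> S (r j) x \<partial>lborel) = (\<integral>x. src \<rho> N xs (e j) x * f x \<partial>lborel)" if "test_fn UNIV f" for f j
      unfolding e_def by (rule div[OF that])
  qed (unfold e_def, (rule \<rho> e0(1) e_lim[unfolded e_def] R(1) K S_int mass test energy small fmu smu gv_int)+)
  have vm: "is_vmeasure (mu, gv)" using fmu smu gv_int by (simp add: is_vmeasure_def)
  have MS: "in_MS \<Omega> N xs (mu, gv)"
    unfolding in_MS_def
  proof (intro conjI allI impI)
    show "is_vmeasure (mu, gv)" by (rule vm)
    show "vm_supported_in (mu, gv) (closure \<Omega>)"
      unfolding vm_supported_in_def
    proof (intro ballI impI)
      fix D assume D: "D \<in> sets borel" "D \<inter> closure \<Omega> = {}"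
      have "AE x in mu. indicator D x *\<^sub>R gv x = 0"
        using suppmu by eventually_elim (use D(2) in \<open>auto split: split_indicator\<close>)
      then show "vm_val (mu, gv) D = 0"
        unfolding vm_val_def set_lebesgue_integral_def fst_conv snd_conv by (rule integral_eq_zero_AE)
    qed
    fix f assume "test_fn UNIV f"
    from L.limit_divergence[OF this]
    show "- vm_int (mu, gv) UNIV (grad f) = real N * f (xs 0) - (\<Sum>i\<in>{1..N}. f (xs i))"
      by (simp add: vm_int_def set_lebesgue_integral_def)
  qed
  have W: "weak_star_conv \<Omega> (\<lambda>j. \<sigma> (e j)) (mu, gv)"
    unfolding weak_star_conv_def
  proof (intro allI impI)
    fix f :: "pt \<Rightarrow> pt" assume f: "continuous_on (closure \<Omega>) f"
    \<comment> \<open>Admissible tests are continuous on the closure of \<Omega> only, whereas the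
      limits are known for functions continuous on the plane. The nearest point projection,
      continuous by convexity, extends them.\<close>
    define w where "w x = f (closest_point (closure \<Omega>) x)" for x
    have clne: "closed (closure \<Omega>)" "closure \<Omega> \<noteq> {}" using \<Omega>ne by simp_all
    have w: "continuous_on UNIV w"
      unfolding w_def by (rule continuous_on_compose2[OF f continuous_on_closest_point[OF conv clne]]) (use closest_point_in_set[OF clne] in auto)
    have wf: "w x = f x" if "x \<in> closure \<Omega>" for x using closest_point_self[OF that] by (simp add: w_def)
    have same: "vm_int \<tau> (closure \<Omega>) f = vm_int \<tau> (closure \<Omega>) w" for \<tau>
      unfolding vm_int_def set_lebesgue_integral_def
      by (intro Bochner_Integration.integral_cong refl) (auto simp: wf split: split_indicator)
    from compact_imp_bounded[OF compact_continuous_image[OF f comp], unfolded bounded_iff]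
    obtain B where "\<forall>y\<in>f ` closure \<Omega>. norm y \<le> B" ..
    then have B: "\<forall>x\<in>closure \<Omega>. norm (w x) \<le> B" by (simp add: wf)
    have "vm_int (\<sigma> (e j)) (closure \<Omega>) f = (\<integral>x. indicator (closure \<Omega>) x * (w x \<bullet> S (r j) x) \<partial>lborel)" for j
      unfolding same e_def by (rule V[OF _ borel_measurable_continuous_onI[OF w] B]) simp
    also have "\<dots> j = (\<integral>x. w x \<bullet> S (r j) x \<partial>lborel)" for j
    proof (intro Bochner_Integration.integral_cong refl)
      fix x
      show "indicator (closure \<Omega>) x * (w x \<bullet> S (r j) x) = w x \<bullet> S (r j) x"
        using S_supp[of "r j" x] subsetD[OF sub, of x] by (cases "S (r j) x = 0") simp_all
    qed
    finally have 1: "vm_int (\<sigma> (e j)) (closure \<Omega>) f = (\<integral>x. w x \<bullet> S (r j) x \<partial>lborel)" for j .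
    have 2: "vm_int (mu, gv) (closure \<Omega>) f = (\<integral>x. w x \<bullet> gv x \<partial>mu)"
      unfolding same unfolding vm_int_def set_lebesgue_integral_def fst_conv snd_conv
    proof (rule integral_cong_AE)
      have wm: "w \<in> borel_measurable mu" by (rule L.measurable_mu[OF borel_measurable_continuous_onI[OF w]])
      have gm: "gv \<in> borel_measurable mu" using gv_int by auto
      show "(\<lambda>x. w x \<bullet> gv x) \<in> borel_measurable mu" using wm gm by measurable
      then show "(\<lambda>x. indicator (closure \<Omega>) x *\<^sub>R (w x \<bullet> gv x)) \<in> borel_measurable mu"
        using smu by (intro borel_measurable_scaleR borel_measurable_indicator) simp_all
      show "AE x in mu. indicator (closure \<Omega>) x *\<^sub>R (w x \<bullet> gv x) = w x \<bullet> gv x"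
        using suppmu by eventually_elim simp
    qed
    show "(\<lambda>j. vm_int (\<sigma> (e j)) (closure \<Omega>) f) \<longlonglongrightarrow> vm_int (mu, gv) (closure \<Omega>) f"
      unfolding 1 2 by (rule L.inner_limit[OF w])
  qed
  have L1lim: "(\<lambda>j. set_lebesgue_integral lborel \<Omega> (\<lambda>x. \<bar>\<phi> (e j) x - 1\<bar>)) \<longlonglongrightarrow> 0"
  proof (rule Lim_null_comparison)
    show "\<forall>\<^sub>F j in sequentially. norm (set_lebesgue_integral lborel \<Omega> (\<lambda>x. \<bar>\<phi> (e j) x - 1\<bar>)) \<le> sqrt (e j) * (C + vol)"
      unfolding e_def real_norm_def by (intro always_eventually allI L1)
    show "(\<lambda>j. sqrt (e j) * (C + vol)) \<longlonglongrightarrow> 0"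
      using tendsto_mult_left_zero[OF tendsto_real_sqrt[OF e_lim, unfolded real_sqrt_zero]] .
  qed
  have dec: "\<forall>j. e j \<in> {0<..1} \<and> e (Suc j) < e j"
    using e0_mem e0_dec[OF strict_monoD[OF r lessI]] by (simp add: e_def)
  show ?thesis
    by (rule exI[of _ e], rule exI[of _ "(mu, gv)"]) (intro conjI dec e_lim MS W L1lim L.rectifiable_limit)
qed

end
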